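(* Let $N\geq 2$, let $p=4+\frac{4}{N}$, and let $g:\mathbb{R}\to\mathbb{R}$ satisfy: (g1) $g\in C(\mathbb{R},\mathbb{R})$; (g2) $\lim_{s\to 0} g(s)/s=0$; (g3) $\lim_{|s|\to\infty}|g(s)|/|s|^{p-1}=0$; (g4) there exists $s_0>0$ with $G(s_0)>0$; (g5) $g(-s)=-g(s)$ for all $s$; (g7) $g(s)s\geq 0$ for all $s\in\mathbb{R}$. Then: (1) For every $m>m_1$, $e(m)$ has a minimizer, i.e. there is $u\in S(m)$ with $E(u)=e(m)$. (2) If in addition (g6) holds, namely $\liminf_{s\to 0}\frac{g(s)}{|s|^{q-2}s}=+\infty$ with $q=2+\frac4N$, then $e(m)$ has a minimizer for every $m>0$.
   Context: $G(s)=\int_0^s g(t)dt$. $S(m)=\{u\in H^1(\mathbb{R}^N):\int_{\mathbb{R}^N}u^2|\nabla u|^2dx<\infty,\ \int_{\mathbb{R}^N}|u|^2dx=m\}$, $E(u)=\frac12\int_{\mathbb{R}^N}(1+2u^2)|\nabla u|^2dx-\int_{\mathbb{R}^N}G(u)dx$, and $e(m)=\inf_{u\in S(m)}E(u)$. The number $m_1$ is defined as follows. Let $f\in C^\infty(\mathbb{R})$ be the odd function with $f(0)=0$ and $f'(t)=(1+2f(t)^2)^{-1/2}$. Let $H_r^1(\mathbb{R}^N)$ be the radial functions in $H^1(\mathbb{R}^N)$. For $\lambda\in\mathbb{R}$ let $J_\lambda(v)=\frac12\|\nabla v\|_2^2+\frac{e^\lambda}{2}\|f(v)\|_2^2-\int_{\mathbb{R}^N}G(f(v))dx$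 on $H_r^1(\mathbb{R}^N)$. Let $\lambda_0=\ln\big(2\sup_{s\neq0}G(s)/s^2\big)$ if this supremum is finite and $\lambda_0=+\infty$ otherwise. For $\lambda<\lambda_0$ let $\Gamma_1(\lambda)=\{\gamma\in C([0,1],H_r^1(\mathbb{R}^N)):\gamma(0)=0,\ J_\lambda(\gamma(1))<0\}$ and $a_1(\lambda)=\inf_{\gamma\in\Gamma_1(\lambda)}\max_{\xi\in[0,1]}J_\lambda(\gamma(\xi))$. Then $m_1=2\inf_{\lambda\in(-\infty,\lambda_0)}a_1(\lambda)/e^\lambda$. *)

theory Defs
  imports "HOL-Analysis.Analysis"
begin

definition Gp :: "(real \<Rightarrow> real) \<Rightarrow> real \<Rightarrow> real" where
  "Gp g s = (LBINT t=0..s. g t)"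

definition partial_deriv :: "((real^'n) \<Rightarrow> real) \<Rightarrow> 'n \<Rightarrow> (real^'n) \<Rightarrow> real" where
  "partial_deriv \<phi> i x = frechet_derivative \<phi> (at x) (axis i 1)"

coinductive smooth_fun :: "((real^'n) \<Rightarrow> real) \<Rightarrow> bool" where
  "(\<forall>x. \<phi> differentiable (at x)) \<Longrightarrow> (\<forall>i. smooth_fun (partial_deriv \<phi> i)) \<Longrightarrow> smooth_fun \<phi>"

definition test_fun :: "((real^'n) \<Rightarrow> real) \<Rightarrow> bool" where
  "test_fun \<phi> \<longleftrightarrow> smooth_fun \<phi> \<and> (\<exists>R. \<forall>x. norm x > R \<longrightarrow> \<phi> x = 0)"

definition weak_grad :: "((real^'n) \<Rightarrow> real) \<Rightarrow> ((real^'n) \<Rightarrow> real^'n) \<Rightarrow> bool" where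
  "weak_grad u w \<longleftrightarrow>
     (\<forall>i \<phi>. test_fun \<phi> \<longrightarrow>
        integrable lebesgue (\<lambda>x. u x * partial_deriv \<phi> i x) \<and>
        integrable lebesgue (\<lambda>x. w x $ i * \<phi> x) \<and>
        (LINT x|lebesgue. u x * partial_deriv \<phi> i x) = - (LINT x|lebesgue. w x $ i * \<phi> x))"

definition L2_grad :: "((real^'n) \<Rightarrow> real) \<Rightarrow> ((real^'n) \<Rightarrow> real^'n) \<Rightarrow> bool" where
  "L2_grad u w \<longleftrightarrow> weak_grad u w \<and> w \<in> borel_measurable lebesgue \<and>
      integrable lebesgue (\<lambda>x. (norm (w x))\<^sup>2)"

definition H1 :: "((real^'n) \<Rightarrow> real) set" where
  "H1 = {u. u \<in> borel_measurable lebesgue \<and> integrable lebesgue (\<lambda>x. (u x)\<^sup>2) \<and> (\<exists>w. L2_grad u w)}"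

text \<open>The (a.e. unique) weak gradient.\<close>
definition grad :: "((real^'n) \<Rightarrow> real) \<Rightarrow> (real^'n) \<Rightarrow> real^'n" where
  "grad u = (SOME w. L2_grad u w)"

definition H1_norm :: "((real^'n) \<Rightarrow> real) \<Rightarrow> real" where
  "H1_norm u = sqrt ((LINT x|lebesgue. (u x)\<^sup>2) + (LINT x|lebesgue. (norm (grad u x))\<^sup>2))"

definition radial :: "((real^'n) \<Rightarrow> real) \<Rightarrow> bool" where
  "radial u \<longleftrightarrow> (\<exists>\<rho>. \<forall>x. u x = \<rho> (norm x))"

definition H1r :: "((real^'n) \<Rightarrow> real) set" where
  "H1r = {u \<in> H1. radial u}"

definition Sm :: "real \<Rightarrow> ((real^'n) \<Rightarrow> real) set" where
  "Sm m = {u \<in> H1. integrable lebesgue (\<lambda>x. (u x)\<^sup>2 * (norm (grad u x))\<^sup>2) \<and>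
                   (LINT x|lebesgue. (u x)\<^sup>2) = m}"

definition Efun :: "(real \<Rightarrow> real) \<Rightarrow> ((real^'n) \<Rightarrow> real) \<Rightarrow> real" where
  "Efun g u = (1/2) * (LINT x|lebesgue. (1 + 2 * (u x)\<^sup>2) * (norm (grad u x))\<^sup>2)
              - (LINT x|lebesgue. Gp g (u x))"

definition e_level :: "(real \<Rightarrow> real) \<Rightarrow> 'n::finite itself \<Rightarrow> real \<Rightarrow> real" where
  "e_level g _ m = Inf (Efun g ` (Sm m :: ((real^'n) \<Rightarrow> real) set))"

definition is_minimizer :: "(real \<Rightarrow> real) \<Rightarrow> real \<Rightarrow> ((real^'n) \<Rightarrow> real) \<Rightarrow> bool" where
  "is_minimizer g m u \<longleftrightarrow> u \<in> Sm m \<and> (\<forall>v\<in>(Sm m :: ((real^'n) \<Rightarrow> real) set). Efun g u \<le> Efun g v)"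

text \<open>f: the solution of f(0)=0, f'=(1+2f^2)^(-1/2) (unique, odd, smooth).\<close>
definition fchange :: "real \<Rightarrow> real" where
  "fchange = (THE f. f 0 = 0 \<and> (\<forall>t. (f has_real_derivative (1 / sqrt (1 + 2 * (f t)\<^sup>2))) (at t)))"

definition Jfun :: "(real \<Rightarrow> real) \<Rightarrow> real \<Rightarrow> ((real^'n) \<Rightarrow> real) \<Rightarrow> real" where
  "Jfun g lam v = (1/2) * (LINT x|lebesgue. (norm (grad v x))\<^sup>2)
               + (exp lam / 2) * (LINT x|lebesgue. (fchange (v x))\<^sup>2)
               - (LINT x|lebesgue. Gp g (fchange (v x)))"

definition lambda0 :: "(real \<Rightarrow> real) \<Rightarrow> ereal" where
  "lambda0 g = (let S = (SUP s\<in>-{0}. ereal (Gp g s / s\<^sup>2)) in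
                if S = \<infinity> then \<infinity> else ereal (ln (2 * real_of_ereal S)))"

definition Gamma1 :: "(real \<Rightarrow> real) \<Rightarrow> real \<Rightarrow> (real \<Rightarrow> (real^'n) \<Rightarrow> real) set" where
  "Gamma1 g lam = {\<gamma>. (\<forall>\<xi>\<in>{0..1}. \<gamma> \<xi> \<in> H1r) \<and>
      (\<forall>\<xi>\<in>{0..1}. \<forall>\<epsilon>>0. \<exists>\<delta>>0. \<forall>\<eta>\<in>{0..1}. \<bar>\<eta> - \<xi>\<bar> < \<delta> \<longrightarrow> H1_norm (\<lambda>x. \<gamma> \<eta> x - \<gamma> \<xi> x) < \<epsilon>) \<and>
      \<gamma> 0 = (\<lambda>x. 0) \<and> Jfun g lam (\<gamma> 1) < 0}"

definition a1 :: "(real \<Rightarrow> real) \<Rightarrow> 'n::finite itself \<Rightarrow> real \<Rightarrow> real" where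
  "a1 g _ lam = Inf ((\<lambda>\<gamma>. Sup ((\<lambda>\<xi>. Jfun g lam (\<gamma> \<xi>)) ` {0..1})) ` (Gamma1 g lam :: (real \<Rightarrow> (real^'n) \<Rightarrow> real) set))"

definition m1 :: "(real \<Rightarrow> real) \<Rightarrow> 'n::finite itself \<Rightarrow> real" where
  "m1 g T = 2 * Inf {a1 g T lam / exp lam | lam. ereal lam < lambda0 g}"

end

theory Submission imports Defs "HOL-Complex_Analysis.Great_Picard"
begin

text \<open>In the dual variable \<open>v\<close>, \<open>u = f(v)\<close>, the functional \<open>E\<close> becomes the semilinear
  \<open>I(v) = \<parallel>\<nabla>v\<parallel>\<^sup>2/2 - \<integral>G(f(v))\<close>, constrained by \<open>\<integral>f(v)\<^sup>2 = m\<close>. The Gagliardo--Nirenberg inequality at the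
  critical power \<open>4 + 4/N\<close> makes \<open>I\<close> coercive. If \<open>I\<close> is negative somewhere on \<open>\<integral>f(v)\<^sup>2 \<le> m\<close>, dilation gives
  \<open>e(m) < 0\<close>, a minimizing sequence does not vanish, and after translation it has a nonzero limit \<open>v\<close> in
  \<open>L\<^sup>2\<^sub>l\<^sub>o\<^sub>c\<close>, of mass \<open>\<mu> \<in> (0, m]\<close> say. Cutting the sequence at a large radius gives \<open>I(v) \<le> (\<mu>/m) e(m)\<close>; dilating \<open>v\<close>
  by \<open>t \<ge> 1\<close> up to mass \<open>m\<close> cannot lose in this comparison, so the dilated function is a minimizer.

  Negative energy comes from the mountain pass: on a path along which \<open>J\<^sub>\<lambda> < e\<^sup>\<lambda> m/2\<close>, either the mass
  reaches \<open>m\<close>, where the bound says \<open>I < 0\<close>, or it stays below \<open>m\<close> up to the endpoint, where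
  \<open>J\<^sub>\<lambda> < 0\<close>. Under (g6) it comes from spreading a fixed profile.\<close>

section \<open>Square-integrable functions\<close>

text \<open>The linear bound \<open>energy_ge\<close> takes the place of strict subadditivity. It
  comes from the dilation by r >= 1, which multiplies mass and nonlinear integral by r^N but the
  Dirichlet integral only by r^(N-2). Because the bound is linear, loss of mass in the limit need
  not be excluded: what escapes has at least its share of the minimal level, so the limit has at
  most its own, whatever mass remains.

  The dual variable turns the weighted Dirichlet integral into the plain quadratic
  \<open>n2 w\<close>, as the parallelogram identity and the cutoff estimate require. The exponent p
  is critical because |u|^p is the power 2 + 2/N of u^2, while u^2 |grad u|^2 is a quarter of |grad
  (u^2)|^2. By (g3), G is small against |u|^p at infinity; hence coercivity for every m.

  All compactness rests on one estimate: translation by h moves v in L2 by at most |h| times the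
  norm of its gradient (\<open>sob_increment\<close>). It gives the level-set bound behind the
  critical inequality, the nonvanishing, and the local compactness.\<close>

definition L2 :: "('a::euclidean_space \<Rightarrow> 'b::euclidean_space) \<Rightarrow> bool" where
  "L2 f \<longleftrightarrow> f \<in> borel_measurable borel \<and> integrable lborel (\<lambda>x. (norm (f x))\<^sup>2)"

text \<open>A squared norm, kept without the root because most estimates are additive in it. The
  integral defaults to 0 off \<open>L2\<close>, so a bound on \<open>n2\<close> is informative only
  together with \<open>L2\<close>.\<close>

definition n2 :: "('a::euclidean_space \<Rightarrow> 'b::euclidean_space) \<Rightarrow> real" where
  "n2 f = (LINT x|lborel. (norm (f x))\<^sup>2)"

lemma L2_measurable [measurable_dest]: "L2 f \<Longrightarrow> f \<in> borel_measurable borel"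
  by (simp add: L2_def)

lemma L2_integrable: "L2 f \<Longrightarrow> integrable lborel (\<lambda>x. (norm (f x))\<^sup>2)"
  by (simp add: L2_def)

lemma n2_nonneg [simp]: "0 \<le> n2 f"
  by (simp add: n2_def)

lemma L2_nn_integral: "L2 f \<Longrightarrow> (\<integral>\<^sup>+x. ennreal ((norm (f x))\<^sup>2) \<partial>lborel) = ennreal (n2 f)"
  unfolding n2_def by (intro nn_integral_eq_integral L2_integrable) auto

text \<open>The form in which Fatou and Tonelli arguments deliver integrability and the bound at
  once.\<close>

lemma L2I_nn_integral:
  assumes [measurable]: "f \<in> borel_measurable borel"
    and "(\<integral>\<^sup>+x. ennreal ((norm (f x))\<^sup>2) \<partial>lborel) \<le> ennreal c" "0 \<le> c"
  shows "L2 f" "n2 f \<le> c"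
proof -
  have "(\<integral>\<^sup>+x. ennreal ((norm (f x))\<^sup>2) \<partial>lborel) < \<infinity>"
    using assms(2) by (simp add: order_le_less_trans ennreal_less_top)
  then have "integrable lborel (\<lambda>x. (norm (f x))\<^sup>2)"
    by (intro integrableI_bounded) auto
  then show *: "L2 f"
    by (simp add: L2_def)
  show "n2 f \<le> c"
    using assms(2,3) L2_nn_integral[OF *] by simp
qed

lemma L2_bounded:
  fixes f :: "'a::euclidean_space \<Rightarrow> 'b::euclidean_space" and h :: "'a \<Rightarrow> 'c::euclidean_space"
  assumes "L2 h" "f \<in> borel_measurable borel" "\<And>x. norm (f x) \<le> C * norm (h x)"
  shows "L2 f" "n2 f \<le> C\<^sup>2 * n2 h"
proof -
  have *: "(norm (f x))\<^sup>2 \<le> C\<^sup>2 * (norm (h x))\<^sup>2" for x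
    using power_mono[OF assms(3)[of x], of 2] by (simp add: power_mult_distrib)
  have i: "integrable lborel (\<lambda>x. C\<^sup>2 * (norm (h x))\<^sup>2)"
    using assms(1) by (intro integrable_mult_right L2_integrable)
  have "integrable lborel (\<lambda>x. (norm (f x))\<^sup>2)"
    by (rule Bochner_Integration.integrable_bound[OF i]) (use assms(2) * in auto)
  then show "L2 f" using assms(2) by (simp add: L2_def)
  show "n2 f \<le> C\<^sup>2 * n2 h"
    unfolding n2_def integral_mult_right_zero[symmetric]
    by (rule integral_mono) (use * i \<open>integrable lborel (\<lambda>x. (norm (f x))\<^sup>2)\<close> in auto)
qed

lemma L2_scaleR: "L2 f \<Longrightarrow> L2 (\<lambda>x. c *\<^sub>R f x)"
  by (rule L2_bounded(1)[where h=f and C="\<bar>c\<bar>"]) (auto simp: L2_def)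

lemma n2_scaleR: "n2 (\<lambda>x. c *\<^sub>R f x) = c\<^sup>2 * n2 f"
  by (simp add: n2_def power_mult_distrib)

lemma L2_cmult: "L2 f \<Longrightarrow> L2 (\<lambda>x. c * f x)" for f :: "'a::euclidean_space \<Rightarrow> real"
  using L2_scaleR[of f c] by simp

lemma L2_zero [simp]: "L2 (\<lambda>x. 0)"
  by (simp add: L2_def)

lemma L2_minus: "L2 f \<Longrightarrow> L2 (\<lambda>x. - f x)"
  using L2_scaleR[of f "-1"] by simp

lemma norm_add_square_le: "(norm (a + b))\<^sup>2 \<le> 2 * (norm a)\<^sup>2 + 2 * (norm b)\<^sup>2"
  for a b :: "'a::real_inner"
proof -
  have "(norm (a + b))\<^sup>2 + (norm (a - b))\<^sup>2 = 2 * (norm a)\<^sup>2 + 2 * (norm b)\<^sup>2"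
    by (simp add: power2_norm_eq_inner inner_simps inner_commute)
  then show ?thesis by (smt (verit) zero_le_power2)
qed

lemma L2_add:
  assumes f: "L2 f" and g: "L2 g"
  shows "L2 (\<lambda>x. f x + g x)"
proof -
  have m [measurable]: "f \<in> borel_measurable borel" "g \<in> borel_measurable borel"
    using f g by (auto simp: L2_def)
  have "integrable lborel (\<lambda>x. 2 * (norm (f x))\<^sup>2 + 2 * (norm (g x))\<^sup>2)"
    using f g by (intro Bochner_Integration.integrable_add integrable_mult_right L2_integrable)
  then have "integrable lborel (\<lambda>x. (norm (f x + g x))\<^sup>2)"
    by (rule Bochner_Integration.integrable_bound) (use norm_add_square_le in auto)
  then show ?thesis by (simp add: L2_def)
qed

lemma L2_diff: "L2 f \<Longrightarrow> L2 g \<Longrightarrow> L2 (\<lambda>x. f x - g x)"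
  using L2_add[OF _ L2_minus, of f g] by simp

lemma L2_sum: "(\<And>i. i \<in> I \<Longrightarrow> L2 (f i)) \<Longrightarrow> L2 (\<lambda>x. \<Sum>i\<in>I. f i x)"
  by (induction I rule: infinite_finite_induct) (auto intro: L2_add)

lemma L2_inner_integrable:
  assumes f: "L2 f" and g: "L2 g"
  shows "integrable lborel (\<lambda>x. f x \<bullet> g x)" "integrable lborel (\<lambda>x. norm (f x) * norm (g x))"
proof -
  have m [measurable]: "f \<in> borel_measurable borel" "g \<in> borel_measurable borel"
    using f g by (auto simp: L2_def)
  have i: "integrable lborel (\<lambda>x. (norm (f x))\<^sup>2 + (norm (g x))\<^sup>2)"
    using f g by (intro Bochner_Integration.integrable_add L2_integrable)
  have 1: "norm (f x) * norm (g x) \<le> (norm (f x))\<^sup>2 + (norm (g x))\<^sup>2" for x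
    using sum_squares_bound[of "norm (f x)" "norm (g x)"]
      mult_nonneg_nonneg[OF norm_ge_zero[of "f x"] norm_ge_zero[of "g x"]] by linarith
  show "integrable lborel (\<lambda>x. f x \<bullet> g x)"
    by (rule Bochner_Integration.integrable_bound[OF i])
      (use 1 Cauchy_Schwarz_ineq2 order_trans in \<open>auto intro!: AE_I2\<close>, fastforce)
  show "integrable lborel (\<lambda>x. norm (f x) * norm (g x))"
    by (rule Bochner_Integration.integrable_bound[OF i]) (use 1 in auto)
qed

lemma L2_mult_integrable:
  fixes f g :: "'a::euclidean_space \<Rightarrow> real"
  shows "L2 f \<Longrightarrow> L2 g \<Longrightarrow> integrable lborel (\<lambda>x. f x * g x)"
  using L2_inner_integrable(1)[of f g] by simp

lemma n2_add:
  assumes f: "L2 f" and g: "L2 g"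
  shows "n2 (\<lambda>x. f x + g x) = n2 f + 2 * (LINT x|lborel. f x \<bullet> g x) + n2 g"
proof -
  have "n2 (\<lambda>x. f x + g x) = (LINT x|lborel. ((norm (f x))\<^sup>2 + 2 * (f x \<bullet> g x)) + (norm (g x))\<^sup>2)"
    unfolding n2_def
    by (intro Bochner_Integration.integral_cong) (auto simp: power2_norm_eq_inner inner_simps inner_commute)
  also have "\<dots> = n2 f + 2 * (LINT x|lborel. f x \<bullet> g x) + n2 g"
    unfolding n2_def
    using f g by (subst Bochner_Integration.integral_add Bochner_Integration.integral_add;
        (intro Bochner_Integration.integrable_add L2_integrable integrable_mult_right L2_inner_integrable)?; simp)+
  finally show ?thesis .
qed

lemma n2_minus [simp]: "n2 (\<lambda>x. - f x) = n2 f"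
  by (simp add: n2_def)

lemma n2_commute: "n2 (\<lambda>x. f x - g x) = n2 (\<lambda>x. g x - f x)"
  by (simp add: n2_def norm_minus_commute)

lemma n2_parallelogram:
  assumes f: "L2 f" and g: "L2 g"
  shows "n2 (\<lambda>x. f x - g x) = 2 * n2 f + 2 * n2 g - n2 (\<lambda>x. f x + g x)"
  using n2_add[OF f g] n2_add[OF f L2_minus[OF g]] by simp

lemma n2_add_le: "L2 f \<Longrightarrow> L2 g \<Longrightarrow> n2 (\<lambda>x. f x + g x) \<le> 2 * n2 f + 2 * n2 g"
  using n2_parallelogram[of f g] n2_nonneg[of "\<lambda>x. f x - g x"] by linarith

lemma n2_diff_le: "L2 f \<Longrightarrow> L2 g \<Longrightarrow> n2 (\<lambda>x. f x - g x) \<le> 2 * n2 f + 2 * n2 g"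
  using n2_parallelogram[of f g] n2_nonneg[of "\<lambda>x. f x + g x"] by linarith

lemma n2_mono: "L2 g \<Longrightarrow> f \<in> borel_measurable borel \<Longrightarrow> (\<And>x. norm (f x) \<le> norm (g x)) \<Longrightarrow> n2 f \<le> n2 g"
  using L2_bounded(2)[of g f 1] by simp

lemma n2_eq_0_AE:
  assumes "L2 f" "n2 f = 0"
  shows "AE x in lborel. f x = 0"
  using assms integral_nonneg_eq_0_iff_AE[OF L2_integrable[OF assms(1)]]
  by (auto simp: n2_def)

lemma L2_cong_AE:
  assumes "L2 f" "g \<in> borel_measurable borel" "AE x in lborel. f x = g x"
  shows "L2 g" "n2 g = n2 f"
proof -
  have m [measurable]: "f \<in> borel_measurable borel" "g \<in> borel_measurable borel"
    using assms by (auto simp: L2_def)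
  have "integrable lborel (\<lambda>x. (norm (f x))\<^sup>2) \<longleftrightarrow> integrable lborel (\<lambda>x. (norm (g x))\<^sup>2)"
    by (intro integrable_cong_AE) (use assms(3) in auto)
  then show "L2 g" using assms by (simp add: L2_def)
  show "n2 g = n2 f"
    unfolding n2_def by (intro integral_cong_AE) (use assms(3) in auto)
qed

text \<open>The quadratic polynomial \<open>n2 (f + t g)\<close> in t is nonnegative; its value at
  the minimising t = - I / \<open>n2 g\<close> is the inequality. If \<open>n2 g\<close> = 0 then g
  vanishes almost everywhere.\<close>

lemma L2_Cauchy_Schwarz:
  assumes f: "L2 f" and g: "L2 g"
  shows "\<bar>LINT x|lborel. f x \<bullet> g x\<bar> \<le> sqrt (n2 f) * sqrt (n2 g)"
proof -
  let ?I = "LINT x|lborel. f x \<bullet> g x"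
  have q: "0 \<le> n2 f + 2 * t * ?I + t\<^sup>2 * n2 g" for t
  proof -
    have "n2 (\<lambda>x. f x + t *\<^sub>R g x) = n2 f + 2 * (t * ?I) + t\<^sup>2 * n2 g"
      by (subst n2_add[OF f L2_scaleR[OF g]]) (simp add: n2_scaleR)
    then show ?thesis
      using n2_nonneg[of "\<lambda>x. f x + t *\<^sub>R g x"] by simp
  qed
  have "?I\<^sup>2 \<le> n2 f * n2 g"
  proof (cases "n2 g = 0")
    case True
    then have "?I = 0"
      using n2_eq_0_AE[OF g] f g by (intro integral_eq_zero_AE) auto
    then show ?thesis by simp
  next
    case False
    then have "0 < n2 g" using n2_nonneg[of g] by linarith
    have "0 \<le> (n2 f + 2 * (- ?I / n2 g) * ?I + (- ?I / n2 g)\<^sup>2 * n2 g) * n2 g"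
      using q[of "- ?I / n2 g"] \<open>0 < n2 g\<close> by (intro mult_nonneg_nonneg) auto
    also have "\<dots> = n2 f * n2 g - ?I\<^sup>2"
      using False by (simp add: field_simps power2_eq_square)
    finally show ?thesis by simp
  qed
  then have "sqrt (?I\<^sup>2) \<le> sqrt (n2 f * n2 g)" by (rule real_sqrt_le_mono)
  then show ?thesis by (simp add: real_sqrt_mult)
qed

lemma L2_Minkowski:
  assumes f: "L2 f" and g: "L2 g"
  shows "sqrt (n2 (\<lambda>x. f x + g x)) \<le> sqrt (n2 f) + sqrt (n2 g)"
proof -
  have "n2 (\<lambda>x. f x + g x) \<le> (sqrt (n2 f) + sqrt (n2 g))\<^sup>2"
    unfolding n2_add[OF f g] using L2_Cauchy_Schwarz[OF f g] by (simp add: power2_sum)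
  then show ?thesis by (simp add: real_le_lsqrt)
qed

lemma L2_Minkowski_diff:
  assumes f: "L2 f" and g: "L2 g"
  shows "\<bar>sqrt (n2 f) - sqrt (n2 g)\<bar> \<le> sqrt (n2 (\<lambda>x. f x - g x))"
  using L2_Minkowski[OF L2_diff[OF f g] g] L2_Minkowski[OF L2_diff[OF g f] f] n2_commute[of f g]
  by simp

section \<open>Limits and completeness in \<open>L2\<close>\<close>

lemma L2_limit_n2:
  assumes "\<And>n. L2 (f n)" "L2 g" "(\<lambda>n. n2 (\<lambda>x. f n x - g x)) \<longlonglongrightarrow> 0"
  shows "(\<lambda>n. n2 (f n)) \<longlonglongrightarrow> n2 g"
proof -
  have "(\<lambda>n. sqrt (n2 (\<lambda>x. f n x - g x))) \<longlonglongrightarrow> 0"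
    using tendsto_real_sqrt[OF assms(3)] by simp
  then have "(\<lambda>n. sqrt (n2 (f n)) - sqrt (n2 g)) \<longlonglongrightarrow> 0"
    by (rule Lim_null_comparison[rotated]) (use L2_Minkowski_diff[OF assms(1,2)] in auto)
  then have "(\<lambda>n. sqrt (n2 (f n))) \<longlonglongrightarrow> sqrt (n2 g)"
    by (simp add: LIM_zero_iff)
  then have "(\<lambda>n. (sqrt (n2 (f n)))\<^sup>2) \<longlonglongrightarrow> (sqrt (n2 g))\<^sup>2"
    by (intro tendsto_power)
  then show ?thesis by (simp add: real_sqrt_pow2)
qed

lemma L2_limit_inner:
  assumes f: "\<And>n. L2 (f n)" and g: "L2 g" and lim: "(\<lambda>n. n2 (\<lambda>x. f n x - g x)) \<longlonglongrightarrow> 0" and h: "L2 h"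
  shows "(\<lambda>n. LINT x|lborel. f n x \<bullet> h x) \<longlonglongrightarrow> (LINT x|lborel. g x \<bullet> h x)"
proof -
  have "(\<lambda>n. sqrt (n2 (\<lambda>x. f n x - g x)) * sqrt (n2 h)) \<longlonglongrightarrow> 0"
    using tendsto_mult_right[OF tendsto_real_sqrt[OF lim], of "sqrt (n2 h)"] by simp
  then have "(\<lambda>n. (LINT x|lborel. f n x \<bullet> h x) - (LINT x|lborel. g x \<bullet> h x)) \<longlonglongrightarrow> 0"
  proof (rule Lim_null_comparison[rotated], intro always_eventually allI)
    fix n
    have "(LINT x|lborel. f n x \<bullet> h x) - (LINT x|lborel. g x \<bullet> h x) = (LINT x|lborel. (f n x - g x) \<bullet> h x)"
      unfolding inner_diff_left
      by (rule Bochner_Integration.integral_diff[symmetric]) (intro L2_inner_integrable f g h)+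
    then show "norm ((LINT x|lborel. f n x \<bullet> h x) - (LINT x|lborel. g x \<bullet> h x))
        \<le> sqrt (n2 (\<lambda>x. f n x - g x)) * sqrt (n2 h)"
      using L2_Cauchy_Schwarz[OF L2_diff[OF f g] h] by simp
  qed
  then show ?thesis by (simp add: LIM_zero_iff)
qed

lemma L2_dominated_convergence:
  assumes f: "\<And>n. f n \<in> borel_measurable borel" and g: "g \<in> borel_measurable borel" and h: "L2 h"
    and lim: "AE x in lborel. (\<lambda>n. f n x) \<longlonglongrightarrow> g x"
    and dom: "\<And>n. AE x in lborel. norm (f n x - g x) \<le> norm (h x)"
  shows "(\<lambda>n. n2 (\<lambda>x. f n x - g x)) \<longlonglongrightarrow> 0"
proof -
  have "(\<lambda>n. LINT x|lborel. (norm (f n x - g x))\<^sup>2) \<longlonglongrightarrow> (LINT x|(lborel::'a measure). 0)"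
  proof (rule integral_dominated_convergence[where w="\<lambda>x. (norm (h x))\<^sup>2"])
    show "AE x in lborel. (\<lambda>n. (norm (f n x - g x))\<^sup>2) \<longlonglongrightarrow> 0"
      using lim
    proof eventually_elim
      case (elim x)
      then have "(\<lambda>n. (norm (f n x - g x))\<^sup>2) \<longlonglongrightarrow> (norm (g x - g x))\<^sup>2" by (intro tendsto_intros)
      then show ?case by simp
    qed
    show "AE x in lborel. norm ((norm (f n x - g x))\<^sup>2) \<le> (norm (h x))\<^sup>2" for n
      using dom[of n] by eventually_elim (simp add: power_mono)
  qed (use f g h L2_integrable in auto)
  then show ?thesis by (simp add: n2_def)
qed

lemma L2_Fatou:
  assumes f: "\<And>n. L2 (f n)" and g [measurable]: "g \<in> borel_measurable borel"
    and lim: "AE x in lborel. (\<lambda>n. f n x) \<longlonglongrightarrow> g x"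
    and c: "eventually (\<lambda>n. n2 (f n) \<le> c) sequentially" and "0 \<le> c"
  shows "L2 g" "n2 g \<le> c"
proof -
  have [measurable]: "f n \<in> borel_measurable borel" for n using f by (simp add: L2_def)
  have "(\<integral>\<^sup>+x. ennreal ((norm (g x))\<^sup>2) \<partial>lborel) \<le> (\<integral>\<^sup>+x. liminf (\<lambda>n. ennreal ((norm (f n x))\<^sup>2)) \<partial>lborel)"
  proof (rule nn_integral_mono_AE)
    show "AE x in lborel. ennreal ((norm (g x))\<^sup>2) \<le> liminf (\<lambda>n. ennreal ((norm (f n x))\<^sup>2))"
      using lim
    proof eventually_elim
      case (elim x)
      then have "(\<lambda>n. ennreal ((norm (f n x))\<^sup>2)) \<longlonglongrightarrow> ennreal ((norm (g x))\<^sup>2)"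
        by (intro tendsto_intros)
      then have "liminf (\<lambda>n. ennreal ((norm (f n x))\<^sup>2)) = ennreal ((norm (g x))\<^sup>2)"
        by (rule lim_imp_Liminf[OF sequentially_bot])
      then show ?case by simp
    qed
  qed
  also have "\<dots> \<le> liminf (\<lambda>n. \<integral>\<^sup>+x. ennreal ((norm (f n x))\<^sup>2) \<partial>lborel)"
    by (rule nn_integral_liminf) auto
  also have "\<dots> \<le> ennreal c"
  proof -
    have "liminf (\<lambda>n. ennreal (n2 (f n))) \<le> limsup (\<lambda>n. ennreal (n2 (f n)))"
      by (rule Liminf_le_Limsup) simp
    also have "\<dots> \<le> ennreal c"
      by (rule Limsup_bounded) (use c in \<open>auto elim!: eventually_mono intro: ennreal_leI\<close>)
    finally show ?thesis using f by (simp add: L2_nn_integral)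
  qed
  finally show "L2 g" "n2 g \<le> c"
    using L2I_nn_integral[OF g] \<open>0 \<le> c\<close> by auto
qed

text \<open>Along a subsequence whose increments have squared norm at most 4^-j on
  \<open>B j\<close>, the sum of 2^j times the squared increments is integrable, hence finite almost
  everywhere. The increments at such a point are then dominated by a geometric series of ratio sqrt
  (1/2). Working on increasing sets serves both completeness of \<open>L2\<close> and the local
  compactness lemma.\<close>

lemma L2_local_complete:
  fixes z :: "nat \<Rightarrow> 'a::euclidean_space \<Rightarrow> 'b::euclidean_space" and B :: "nat \<Rightarrow> 'a set"
  assumes z [measurable]: "\<And>n. z n \<in> borel_measurable borel" and B [measurable]: "\<And>j. B j \<in> sets borel"
    and inc: "incseq B"
    and Cauchy: "\<And>j e. 0 < e \<Longrightarrow> \<exists>N. \<forall>m\<ge>N. \<forall>n\<ge>N.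
       (\<integral>\<^sup>+x. ennreal ((norm (z m x - z n x))\<^sup>2 * indicator (B j) x) \<partial>lborel) \<le> ennreal e"
  obtains r y where "strict_mono (r::nat\<Rightarrow>nat)" "y \<in> borel_measurable borel"
    "AE x in lborel. x \<in> (\<Union>j. B j) \<longrightarrow> (\<lambda>n. z (r n) x) \<longlonglongrightarrow> y x"
proof -
  have "\<forall>j. \<exists>N. \<forall>m\<ge>N. \<forall>n\<ge>N.
       (\<integral>\<^sup>+x. ennreal ((norm (z m x - z n x))\<^sup>2 * indicator (B j) x) \<partial>lborel) \<le> ennreal ((1/4)^j)"
    by (intro allI Cauchy) auto
  then obtain N where N: "\<And>j m n. m \<ge> N j \<Longrightarrow> n \<ge> N j \<Longrightarrow>
       (\<integral>\<^sup>+x. ennreal ((norm (z m x - z n x))\<^sup>2 * indicator (B j) x) \<partial>lborel) \<le> ennreal ((1/4)^j)"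
    by metis
  \<comment> \<open>Summing all earlier thresholds makes \<open>r\<close> strictly increasing while
    keeping \<open>N j \<le> r j\<close>.\<close>
  define r where "r j = (\<Sum>i\<le>j. N i) + j" for j
  have r: "strict_mono r" by (rule strict_monoI_Suc) (simp add: r_def)
  have rN: "N j \<le> r j" for j
    using member_le_sum[of j "{..j}" N] by (simp add: r_def)
  define d where "d j x = (norm (z (r (Suc j)) x - z (r j) x))\<^sup>2 * indicator (B j) x" for j x
  have [measurable]: "d j \<in> borel_measurable borel" for j
    unfolding d_def by measurable
  have "(\<integral>\<^sup>+x. (\<Sum>j. ennreal (2^j * d j x)) \<partial>lborel) = (\<Sum>j. \<integral>\<^sup>+x. ennreal (2^j * d j x) \<partial>lborel)"
    by (rule nn_integral_suminf) auto
  also have "\<dots> \<le> (\<Sum>j. ennreal ((1/2)^j))"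
  proof (rule suminf_le)
    fix j
    have "(\<integral>\<^sup>+x. ennreal (2^j * d j x) \<partial>lborel) = ennreal (2^j) * (\<integral>\<^sup>+x. ennreal (d j x) \<partial>lborel)"
      by (subst nn_integral_cmult[symmetric]) (auto simp: ennreal_mult' d_def)
    also have "\<dots> \<le> ennreal (2^j) * ennreal ((1/4)^j)"
      unfolding d_def using rN[of j] rN[of "Suc j"] strict_monoD[OF r, of j "Suc j"]
      by (intro mult_left_mono N) auto
    also have "\<dots> = ennreal ((1/2)^j)"
      by (subst ennreal_mult[symmetric]) (auto simp: power_mult_distrib[symmetric])
    finally show "(\<integral>\<^sup>+x. ennreal (2^j * d j x) \<partial>lborel) \<le> ennreal ((1/2)^j)" .
  qed auto
  also have "\<dots> < \<infinity>"
    by (subst suminf_ennreal2) (auto simp: ennreal_less_top)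
  finally have "AE x in lborel. (\<Sum>j. ennreal (2^j * d j x)) \<noteq> \<infinity>"
    by (intro nn_integral_PInf_AE) auto
  then have AE: "AE x in lborel. x \<in> (\<Union>j. B j) \<longrightarrow> convergent (\<lambda>n. z (r n) x)"
  proof eventually_elim
    case (elim x)
    show ?case
    proof
      assume "x \<in> (\<Union>j. B j)"
      then obtain j0 where "x \<in> B j0" by blast
      then have inB: "x \<in> B j" if "j \<ge> j0" for j using incseqD[OF inc that] by blast
      define c where "c = enn2real (\<Sum>j. ennreal (2^j * d j x))"
      have le: "2^j * d j x \<le> c" for j
      proof -
        have "ennreal (2^j * d j x) \<le> (\<Sum>j. ennreal (2^j * d j x))"
          using sum_le_suminf[of "\<lambda>j. ennreal (2^j * d j x)" "{j}"] by simp
        then show ?thesis unfolding c_def using elim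
          by (metis enn2real_mono enn2real_ennreal d_def zero_le_mult_iff zero_le_numeral
              zero_le_power zero_le_power2 indicator_pos_le infinity_ennreal_def less_top)
      qed
      define q where "q = sqrt (1/2::real)"
      have q: "0 < q" "q < 1" by (auto simp: q_def real_less_lsqrt real_less_rsqrt)
      have "summable (\<lambda>j. z (r (Suc j)) x - z (r j) x)"
      proof (rule summable_comparison_test)
        show "\<exists>N. \<forall>j\<ge>N. norm (z (r (Suc j)) x - z (r j) x) \<le> sqrt c * q ^ j"
        proof (intro exI allI impI)
          fix j assume "j0 \<le> j"
          then have "2^j * (norm (z (r (Suc j)) x - z (r j) x))\<^sup>2 \<le> c"
            using le[of j] inB by (simp add: d_def)
          then have "(norm (z (r (Suc j)) x - z (r j) x))\<^sup>2 \<le> c * (1/2)^j"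
            by (simp add: field_simps)
          then have "norm (z (r (Suc j)) x - z (r j) x) \<le> sqrt (c * (1/2)^j)"
            by (rule real_le_rsqrt)
          then show "norm (z (r (Suc j)) x - z (r j) x) \<le> sqrt c * q ^ j"
            by (simp add: real_sqrt_mult q_def real_sqrt_power)
        qed
        show "summable (\<lambda>j. sqrt c * q ^ j)"
          using q by (intro summable_mult summable_geometric) auto
      qed
      then have "(\<lambda>n. \<Sum>j<n. z (r (Suc j)) x - z (r j) x) \<longlonglongrightarrow> (\<Sum>j. z (r (Suc j)) x - z (r j) x)"
        by (rule summable_LIMSEQ)
      then have "(\<lambda>n. z (r n) x - z (r 0) x) \<longlonglongrightarrow> (\<Sum>j. z (r (Suc j)) x - z (r j) x)"
        using sum_lessThan_telescope[of "\<lambda>n. z (r n) x"] by simp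
      then have "(\<lambda>n. (z (r n) x - z (r 0) x) + z (r 0) x) \<longlonglongrightarrow> (\<Sum>j. z (r (Suc j)) x - z (r j) x) + z (r 0) x"
        by (intro tendsto_intros)
      then show "convergent (\<lambda>n. z (r n) x)" by (auto simp: convergent_def)
    qed
  qed
  show thesis
  proof (rule that[OF r])
    show "(\<lambda>x. lim (\<lambda>n. z (r n) x)) \<in> borel_measurable borel"
      by measurable
    show "AE x in lborel. x \<in> (\<Union>j. B j) \<longrightarrow> (\<lambda>n. z (r n) x) \<longlonglongrightarrow> lim (\<lambda>n. z (r n) x)"
      using AE by eventually_elim (simp add: convergent_LIMSEQ_iff)
  qed
qed

text \<open>The almost everywhere limit along a fast subsequence is shown to be the limit of the
  whole sequence by applying Fatou to \<open>f n - f (r k)\<close> as k grows.\<close>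

lemma L2_complete:
  assumes f: "\<And>n. L2 (f n)"
    and Cauchy: "\<And>e. 0 < e \<Longrightarrow> \<exists>N. \<forall>m\<ge>N. \<forall>n\<ge>N. n2 (\<lambda>x. f m x - f n x) \<le> e"
  obtains g where "L2 g" "(\<lambda>n. n2 (\<lambda>x. f n x - g x)) \<longlonglongrightarrow> 0"
proof -
  have m [measurable]: "f n \<in> borel_measurable borel" for n using f by (simp add: L2_def)
  obtain r g where r: "strict_mono (r::nat\<Rightarrow>nat)" and g [measurable]: "g \<in> borel_measurable borel"
    and lim: "AE x in lborel. x \<in> (\<Union>j::nat. UNIV) \<longrightarrow> (\<lambda>n. f (r n) x) \<longlonglongrightarrow> g x"
  proof (rule L2_local_complete[of f "\<lambda>_. UNIV"])
    fix e :: real assume "0 < e"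
    then show "\<exists>N. \<forall>m\<ge>N. \<forall>n\<ge>N.
       (\<integral>\<^sup>+x. ennreal ((norm (f m x - f n x))\<^sup>2 * indicator UNIV x) \<partial>lborel) \<le> ennreal e"
      using Cauchy[of e] by (simp add: L2_nn_integral[OF L2_diff[OF f f]])
  qed (auto simp: incseq_def)
  have lim: "AE x in lborel. (\<lambda>n. f (r n) x) \<longlonglongrightarrow> g x" using lim by simp
  have *: "\<exists>N. \<forall>n\<ge>N. L2 (\<lambda>x. f n x - g x) \<and> n2 (\<lambda>x. f n x - g x) \<le> e" if "0 < e" for e
  proof -
    obtain N where N: "\<And>m n. m \<ge> N \<Longrightarrow> n \<ge> N \<Longrightarrow> n2 (\<lambda>x. f m x - f n x) \<le> e"
      using Cauchy[OF \<open>0 < e\<close>] by blast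
    have "L2 (\<lambda>x. f n x - g x) \<and> n2 (\<lambda>x. f n x - g x) \<le> e" if n: "n \<ge> N" for n
    proof (intro conjI; rule L2_Fatou[where f="\<lambda>k x. f n x - f (r k) x" and c=e])
      show "AE x in lborel. (\<lambda>k. f n x - f (r k) x) \<longlonglongrightarrow> f n x - g x"
        using lim by eventually_elim (intro tendsto_intros)
      show "AE x in lborel. (\<lambda>k. f n x - f (r k) x) \<longlonglongrightarrow> f n x - g x"
        using lim by eventually_elim (intro tendsto_intros)
      show "eventually (\<lambda>k. n2 (\<lambda>x. f n x - f (r k) x) \<le> e) sequentially"
        using eventually_ge_at_top[of N]
        by eventually_elim (use N n seq_suble[OF r] order_trans in blast)
      then show "eventually (\<lambda>k. n2 (\<lambda>x. f n x - f (r k) x) \<le> e) sequentially" .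
    qed (use \<open>0 < e\<close> in \<open>auto intro: L2_diff f\<close>)
    then show ?thesis by blast
  qed
  obtain n0 where "L2 (\<lambda>x. f n0 x - g x)" using *[of 1] by force
  then have "L2 (\<lambda>x. f n0 x - (f n0 x - g x))" by (rule L2_diff[OF f])
  moreover have "(\<lambda>x. f n0 x - (f n0 x - g x)) = g" by auto
  ultimately have "L2 g" by metis
  moreover have "(\<lambda>n. n2 (\<lambda>x. f n x - g x)) \<longlonglongrightarrow> 0"
  proof (rule LIMSEQ_I)
    fix e :: real assume "0 < e"
    then obtain N where "\<forall>n\<ge>N. n2 (\<lambda>x. f n x - g x) \<le> e/2" using *[of "e/2"] by auto
    then show "\<exists>N. \<forall>n\<ge>N. norm (n2 (\<lambda>x. f n x - g x) - 0) < e"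
      using \<open>0 < e\<close> by (intro exI[of _ N]) auto
  qed
  ultimately show thesis by (rule that)
qed

section \<open>Translations and dilations\<close>

lemma lborel_integral_translate:
  fixes f :: "'a::euclidean_space \<Rightarrow> 'b::{banach, second_countable_topology}"
  assumes [measurable]: "f \<in> borel_measurable borel"
  shows "(LINT x|lborel. f (x + h)) = (LINT x|lborel. f x)"
    "integrable lborel (\<lambda>x. f (x + h)) \<longleftrightarrow> integrable lborel f"
proof -
  have "(LINT x|distr lborel borel ((+) h). f x) = (LINT x|lborel. f (h + x))"
    by (intro integral_distr) auto
  then show "(LINT x|lborel. f (x + h)) = (LINT x|lborel. f x)"
    by (simp add: lborel_distr_plus add.commute)
  have "integrable (distr lborel borel ((+) h)) f \<longleftrightarrow> integrable lborel (\<lambda>x. f (h + x))"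
    by (intro integrable_distr_eq) auto
  then show "integrable lborel (\<lambda>x. f (x + h)) \<longleftrightarrow> integrable lborel f"
    by (simp add: lborel_distr_plus add.commute)
qed

lemma L2_translate:
  assumes f: "L2 f"
  shows "L2 (\<lambda>x. f (x + h))" "n2 (\<lambda>x. f (x + h)) = n2 f"
proof -
  have [measurable]: "f \<in> borel_measurable borel" using f by (simp add: L2_def)
  have m: "(\<lambda>x. (norm (f x))\<^sup>2) \<in> borel_measurable borel" by measurable
  have "(\<lambda>x. f (x + h)) \<in> borel_measurable borel" by measurable
  then show "L2 (\<lambda>x. f (x + h))" "n2 (\<lambda>x. f (x + h)) = n2 f"
    using lborel_integral_translate[OF m, of h] f by (simp_all add: L2_def n2_def)
qed

lemma lborel_integral_scale:
  fixes f :: "'a::euclidean_space \<Rightarrow> 'b::{banach, second_countable_topology}"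
  assumes [measurable]: "f \<in> borel_measurable borel" and t: "0 < t"
  shows "(LINT x|lborel. f (x /\<^sub>R t)) = t ^ DIM('a) *\<^sub>R (LINT x|lborel. f x)"
    "integrable lborel (\<lambda>x. f (x /\<^sub>R t)) \<longleftrightarrow> integrable lborel f"
proof -
  have eq: "(lborel::'a measure) = density (distr lborel borel (\<lambda>x. 0 + t *\<^sub>R x)) (\<lambda>_. \<bar>t\<bar>^DIM('a))"
    by (rule lborel_affine) (use t in auto)
  have "(LINT x|lborel. f (x /\<^sub>R t)) = (LINT x|density (distr lborel borel (\<lambda>x::'a. 0 + t *\<^sub>R x)) (\<lambda>_. \<bar>t\<bar>^DIM('a)). f (x /\<^sub>R t))"
    using eq by simp
  also have "\<dots> = (LINT x|distr lborel borel (\<lambda>x::'a. 0 + t *\<^sub>R x). \<bar>t\<bar>^DIM('a) *\<^sub>R f (x /\<^sub>R t))"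
    using t by (subst integral_density) auto
  also have "\<dots> = (LINT x|lborel. \<bar>t\<bar>^DIM('a) *\<^sub>R f x)"
    using t by (subst integral_distr) auto
  finally show "(LINT x|lborel. f (x /\<^sub>R t)) = t ^ DIM('a) *\<^sub>R (LINT x|lborel. f x)"
    using t by simp
  have "integrable lborel (\<lambda>x. f (x /\<^sub>R t)) \<longleftrightarrow> integrable (density (distr lborel borel (\<lambda>x::'a. 0 + t *\<^sub>R x)) (\<lambda>_. \<bar>t\<bar>^DIM('a))) (\<lambda>x. f (x /\<^sub>R t))"
    using eq by simp
  also have "\<dots> \<longleftrightarrow> integrable (distr lborel borel (\<lambda>x::'a. 0 + t *\<^sub>R x)) (\<lambda>x. \<bar>t\<bar>^DIM('a) *\<^sub>R f (x /\<^sub>R t))"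
    using t by (subst integrable_density) auto
  also have "\<dots> \<longleftrightarrow> integrable lborel (\<lambda>x. \<bar>t\<bar>^DIM('a) *\<^sub>R f x)"
    using t by (subst integrable_distr_eq) auto
  also have "\<dots> \<longleftrightarrow> integrable lborel f"
    using t integrable_scaleR_right[of "inverse (t ^ DIM('a))" lborel "\<lambda>x. t ^ DIM('a) *\<^sub>R f x"]
    by (auto intro: integrable_scaleR_right)
  finally show "integrable lborel (\<lambda>x. f (x /\<^sub>R t)) \<longleftrightarrow> integrable lborel f" .
qed

lemma L2_scale:
  fixes f :: "'a::euclidean_space \<Rightarrow> 'b::euclidean_space"
  assumes f: "L2 f" and t: "0 < t"
  shows "L2 (\<lambda>x. f (x /\<^sub>R t))" "n2 (\<lambda>x. f (x /\<^sub>R t)) = t ^ DIM('a) * n2 f"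
proof -
  have [measurable]: "f \<in> borel_measurable borel" using f by (simp add: L2_def)
  have m: "(\<lambda>x. (norm (f x))\<^sup>2) \<in> borel_measurable borel" by measurable
  have "(\<lambda>x. f (x /\<^sub>R t)) \<in> borel_measurable borel" by measurable
  then show "L2 (\<lambda>x. f (x /\<^sub>R t))" "n2 (\<lambda>x. f (x /\<^sub>R t)) = t ^ DIM('a) * n2 f"
    using lborel_integral_scale[OF m t] f by (simp_all add: L2_def n2_def)
qed

section \<open>Test functions\<close>

text \<open>Counting derivatives by recursion gives closure under sums and products by induction on
  the count; smoothness is then the statement for all counts.\<close>

primrec times_diff :: "nat \<Rightarrow> (real \<Rightarrow> real) \<Rightarrow> bool" where
  "times_diff 0 f \<longleftrightarrow> True"
| "times_diff (Suc n) f \<longleftrightarrow> (\<exists>f'. (\<forall>t. (f has_real_derivative f' t) (at t)) \<and> times_diff n f')"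

lemma times_diff_Suc: "times_diff (Suc n) f \<Longrightarrow> times_diff n f"
proof (induction n arbitrary: f)
  case (Suc n)
  then show ?case by (metis times_diff.simps(2))
qed simp

lemma times_diff_add: "times_diff n f \<Longrightarrow> times_diff n g \<Longrightarrow> times_diff n (\<lambda>t. f t + g t)"
proof (induction n arbitrary: f g)
  case (Suc n)
  from Suc.prems obtain f' g' where d: "\<And>t. (f has_real_derivative f' t) (at t)" "times_diff n f'"
      "\<And>t. (g has_real_derivative g' t) (at t)" "times_diff n g'" by auto
  then have "((\<lambda>t. f t + g t) has_real_derivative f' t + g' t) (at t)" for t
    by (intro derivative_intros)
  with Suc.IH[OF d(2,4)] show ?case by (auto intro!: exI[of _ "\<lambda>t. f' t + g' t"])
qed simp

lemma times_diff_mult: "times_diff n f \<Longrightarrow> times_diff n g \<Longrightarrow> times_diff n (\<lambda>t. f t * g t)"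
proof (induction n arbitrary: f g)
  case (Suc n)
  from Suc.prems obtain f' g' where d: "\<And>t. (f has_real_derivative f' t) (at t)" "times_diff n f'"
      "\<And>t. (g has_real_derivative g' t) (at t)" "times_diff n g'" by auto
  then have "((\<lambda>t. f t * g t) has_real_derivative f' t * g t + g' t * f t) (at t)" for t
    by (intro DERIV_mult)
  moreover have "times_diff n (\<lambda>t. f' t * g t + g' t * f t)"
    by (intro times_diff_add Suc.IH d times_diff_Suc[OF Suc.prems(1)] times_diff_Suc[OF Suc.prems(2)])
  ultimately show ?case by (auto intro!: exI[of _ "\<lambda>t. f' t * g t + g' t * f t"])
qed simp

lemma times_diff_affine: "times_diff n f \<Longrightarrow> times_diff n (\<lambda>t. c * f (a * t + b))"
proof (induction n arbitrary: f c)
  case (Suc n)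
  from Suc.prems obtain f' where d: "\<And>t. (f has_real_derivative f' t) (at t)" "times_diff n f'" by auto
  have "((\<lambda>t. c * f (a * t + b)) has_real_derivative (c * a) * f' (a * t + b)) (at t)" for t
    by (rule DERIV_cong[OF DERIV_cmult[OF DERIV_chain2[OF d(1)]]]) (auto intro!: derivative_eq_intros)
  with Suc.IH[OF d(2)] show ?case by (auto intro!: exI[of _ "\<lambda>t. (c * a) * f' (a * t + b)"])
qed simp

definition smooth1 :: "(real \<Rightarrow> real) \<Rightarrow> bool" where
  "smooth1 f \<longleftrightarrow> (\<forall>n. times_diff n f)"

lemma smooth1_deriv:
  assumes "smooth1 f"
  shows "(f has_real_derivative deriv f t) (at t)" "smooth1 (deriv f)"
proof -
  have "\<exists>f'. (\<forall>t. (f has_real_derivative f' t) (at t)) \<and> times_diff n f'" for n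
    using assms by (metis smooth1_def times_diff.simps(2))
  then have *: "(\<forall>t. (f has_real_derivative deriv f t) (at t)) \<and> times_diff n (deriv f)" for n
    by (metis (no_types, lifting) DERIV_imp_deriv ext)
  then show "(f has_real_derivative deriv f t) (at t)" by blast
  show "smooth1 (deriv f)" using * by (simp add: smooth1_def)
qed

text \<open>The classical flat function with a polynomial factor in 1/t. The factor closes the
  family under differentiation: p becomes X^2 (p - p'), so smoothness follows by induction over all
  p together.\<close>

definition flat_exp :: "real poly \<Rightarrow> real \<Rightarrow> real" where
  "flat_exp p t = (if 0 < t then poly p (1 / t) * exp (- (1 / t)) else 0)"

lemma poly_div_exp_tendsto_0: "((\<lambda>y. poly p y / exp y) \<longlongrightarrow> (0::real)) at_top"
proof -
  have "((\<lambda>y. \<Sum>i\<le>degree p. coeff p i * (y ^ i / exp y)) \<longlongrightarrow> (\<Sum>i\<le>degree p. coeff p i * 0)) at_top"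
    by (intro tendsto_intros tendsto_power_div_exp_0)
  then show ?thesis by (simp add: poly_altdef sum_divide_distrib)
qed

lemma flat_exp_deriv:
  "(flat_exp p has_real_derivative flat_exp ([:0, 0, 1:] * (p - pderiv p)) t) (at t)"
proof -
  consider "t < 0" | "t = 0" | "0 < t" by linarith
  then show ?thesis
  proof cases
    case 1
    have "((\<lambda>_. 0) has_real_derivative 0) (at t)" by simp
    then have "(flat_exp p has_real_derivative 0) (at t)"
      by (rule has_field_derivative_transform_within_open[where S="{..<0}"])
        (use 1 in \<open>auto simp: flat_exp_def\<close>)
    then show ?thesis using 1 by (simp add: flat_exp_def)
  next
    case 2
    have "((\<lambda>h. flat_exp p h / h) \<longlongrightarrow> 0) (at 0)"
    proof (rule filterlim_split_at)
      have "((\<lambda>h::real. 0) \<longlongrightarrow> (0::real)) (at_left 0)" by simp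
      then show "((\<lambda>h. flat_exp p h / h) \<longlongrightarrow> 0) (at_left 0)"
        by (rule Lim_transform_eventually) (auto simp: flat_exp_def eventually_at_filter)
      have "((\<lambda>h. poly ([:0, 1:] * p) (inverse h) / exp (inverse h)) \<longlongrightarrow> 0) (at_right (0::real))"
        by (rule filterlim_compose[OF poly_div_exp_tendsto_0 filterlim_inverse_at_top_right])
      then show "((\<lambda>h. flat_exp p h / h) \<longlongrightarrow> 0) (at_right 0)"
        by (rule Lim_transform_eventually)
          (auto simp: flat_exp_def eventually_at_filter exp_minus field_simps)
    qed
    then show ?thesis using 2 by (simp add: DERIV_def flat_exp_def)
  next
    case 3
    have "((\<lambda>t. poly p (1 / t) * exp (- (1 / t))) has_real_derivative
        flat_exp ([:0, 0, 1:] * (p - pderiv p)) t) (at t)"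
    proof -
      have i: "((\<lambda>t::real. 1 / t) has_real_derivative - (1 / t\<^sup>2)) (at t)"
        using 3 by (auto intro!: derivative_eq_intros simp: power2_eq_square)
      have "((\<lambda>t. poly p (1 / t)) has_real_derivative poly (pderiv p) (1 / t) * (- (1 / t\<^sup>2))) (at t)"
        by (rule DERIV_chain2[OF poly_DERIV i])
      moreover have "((\<lambda>t. exp (- (1 / t))) has_real_derivative exp (- (1 / t)) * (- (- (1 / t\<^sup>2)))) (at t)"
        by (rule DERIV_chain2[OF DERIV_exp DERIV_minus[OF i]])
      ultimately have "((\<lambda>t. poly p (1 / t) * exp (- (1 / t))) has_real_derivative
         poly (pderiv p) (1 / t) * (- (1 / t\<^sup>2)) * exp (- (1 / t)) + exp (- (1 / t)) * (- (- (1 / t\<^sup>2))) * poly p (1 / t)) (at t)"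
        by (rule DERIV_mult)
      then show ?thesis
        by (rule DERIV_cong) (use 3 in \<open>simp add: flat_exp_def power2_eq_square algebra_simps\<close>)
    qed
    then show ?thesis
      by (rule has_field_derivative_transform_within_open[where S="{0<..}"])
        (use 3 in \<open>auto simp: flat_exp_def\<close>)
  qed
qed

lemma smooth1_flat_exp: "smooth1 (flat_exp p)"
proof -
  have "times_diff n (flat_exp p)" for n
  proof (induction n arbitrary: p)
    case (Suc n)
    then show ?case
      using flat_exp_deriv[of p]
      by (auto intro!: exI[of _ "flat_exp ([:0, 0, 1:] * (p - pderiv p))"])
  qed simp
  then show ?thesis by (simp add: smooth1_def)
qed

text \<open>The factor \<open>Suc k\<close> steepens both flanks, so that for fixed end points the
  bumps tend pointwise to the indicator of the open interval while staying between 0 and 1.\<close>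

definition bump :: "real \<Rightarrow> real \<Rightarrow> nat \<Rightarrow> real \<Rightarrow> real" where
  "bump a b k t = flat_exp 1 (real (Suc k) * (t - a)) * flat_exp 1 (real (Suc k) * (b - t))"

lemma smooth1_bump: "smooth1 (bump a b k)"
proof -
  have "times_diff n (\<lambda>t. (1 * flat_exp 1 (real (Suc k) * t + (- (real (Suc k) * a)))) *
      (1 * flat_exp 1 ((- real (Suc k)) * t + real (Suc k) * b)))" for n
    using smooth1_flat_exp[of 1] unfolding smooth1_def
    by (intro times_diff_mult times_diff_affine) auto
  moreover have "bump a b k = (\<lambda>t. (1 * flat_exp 1 (real (Suc k) * t + (- (real (Suc k) * a)))) *
      (1 * flat_exp 1 ((- real (Suc k)) * t + real (Suc k) * b)))"
    by (auto simp: bump_def algebra_simps)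
  ultimately show ?thesis by (simp add: smooth1_def)
qed

lemma bump_bounds: "0 \<le> bump a b k t" "bump a b k t \<le> 1"
  by (auto simp: bump_def flat_exp_def mult_le_one)

lemma bump_outside: "t \<notin> {a<..<b} \<Longrightarrow> bump a b k t = 0"
  by (auto simp: bump_def flat_exp_def zero_less_mult_iff)

lemma bump_tendsto:
  assumes "t \<in> {a<..<b}"
  shows "(\<lambda>k. bump a b k t) \<longlonglongrightarrow> 1"
proof -
  have *: "(\<lambda>k. flat_exp 1 (real (Suc k) * s)) \<longlonglongrightarrow> 1" if "0 < s" for s
  proof -
    have "(\<lambda>k. exp (- (inverse (real (Suc k)) * (1 / s)))) \<longlonglongrightarrow> exp (- (0 * (1 / s)))"
      by (intro tendsto_intros LIMSEQ_inverse_real_of_nat)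
    moreover have "flat_exp 1 (real (Suc k) * s) = exp (- (inverse (real (Suc k)) * (1 / s)))" for k
    proof -
      have "0 < real (Suc k) * s" using that by simp
      then show ?thesis unfolding flat_exp_def by (simp add: divide_inverse)
    qed
    ultimately show ?thesis by simp
  qed
  show ?thesis
    unfolding bump_def using tendsto_mult[OF *[of "t - a"] *[of "b - t"]] assms by simp
qed

lemma prod_has_derivative:
  fixes h :: "'n::finite \<Rightarrow> real \<Rightarrow> real"
  assumes "\<And>i. smooth1 (h i)"
  shows "((\<lambda>x. \<Prod>i\<in>UNIV. h i (x $ i)) has_derivative
    (\<lambda>v. \<Sum>i\<in>UNIV. (v $ i * deriv (h i) (x $ i)) * (\<Prod>j\<in>UNIV - {i}. h j (x $ j)))) (at x)"
proof (rule has_derivative_prod)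
  fix i
  have "(h i has_derivative (\<lambda>v. v * deriv (h i) (x $ i))) (at (x $ i))"
    using smooth1_deriv(1)[OF assms, of i "x $ i"]
    by (simp add: has_field_derivative_def mult.commute[of _ "deriv (h i) (x $ i)"])
  moreover have "((\<lambda>x::real^'n. x $ i) has_derivative (\<lambda>v. v $ i)) (at x)"
    by (rule bounded_linear_imp_has_derivative) (rule bounded_linear_vec_nth)
  ultimately show "((\<lambda>x. h i (x $ i)) has_derivative (\<lambda>v. v $ i * deriv (h i) (x $ i))) (at x)"
    using has_derivative_compose[of "\<lambda>x. x $ i" "\<lambda>v. v $ i" x UNIV "h i"] by simp
qed

lemma partial_deriv_prod:
  fixes h :: "'n::finite \<Rightarrow> real \<Rightarrow> real"
  assumes "\<And>i. smooth1 (h i)"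
  shows "partial_deriv (\<lambda>x. \<Prod>i\<in>UNIV. h i (x $ i)) k
    = (\<lambda>x. \<Prod>i\<in>UNIV. (h(k := deriv (h k))) i (x $ i))"
proof
  fix x :: "real^'n"
  have "partial_deriv (\<lambda>x. \<Prod>i\<in>UNIV. h i (x $ i)) k x
    = (\<Sum>i\<in>UNIV. (axis k 1 $ i * deriv (h i) (x $ i)) * (\<Prod>j\<in>UNIV - {i}. h j (x $ j)))"
    unfolding partial_deriv_def
    by (subst frechet_derivative_at[OF prod_has_derivative[of h x, OF assms], symmetric]) simp
  also have "\<dots> = (\<Sum>i\<in>UNIV. if i = k then deriv (h k) (x $ k) * (\<Prod>j\<in>UNIV - {k}. h j (x $ j)) else 0)"
    by (intro sum.cong) (auto simp: axis_def)
  also have "\<dots> = deriv (h k) (x $ k) * (\<Prod>j\<in>UNIV - {k}. h j (x $ j))"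
    by simp
  also have "\<dots> = (\<Prod>i\<in>UNIV. (h(k := deriv (h k))) i (x $ i))"
    by (subst prod.remove[of UNIV k]) (auto intro!: prod.cong)
  finally show "partial_deriv (\<lambda>x. \<Prod>i\<in>UNIV. h i (x $ i)) k x
    = (\<Prod>i\<in>UNIV. (h(k := deriv (h k))) i (x $ i))" .
qed

text \<open>Coinduction with the products themselves as invariant: a partial derivative only
  replaces one factor by its derivative.\<close>

lemma smooth_fun_prod:
  fixes h :: "'n::finite \<Rightarrow> real \<Rightarrow> real"
  assumes "\<And>i. smooth1 (h i)"
  shows "smooth_fun (\<lambda>x. \<Prod>i\<in>UNIV. h i (x $ i))"
proof -
  show ?thesis
  proof (rule smooth_fun.coinduct[where X="\<lambda>\<phi>. \<exists>h. (\<forall>i. smooth1 (h i)) \<and> \<phi> = (\<lambda>x. \<Prod>i\<in>UNIV. h i (x $ i))"])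
    show "\<exists>ha. (\<forall>i. smooth1 (ha i)) \<and> (\<lambda>x::real^'n. \<Prod>i\<in>UNIV. h i (x $ i)) = (\<lambda>x. \<Prod>i\<in>UNIV. ha i (x $ i))"
      by (rule exI[of _ h]) (use assms in auto)
    fix \<phi> :: "real^'n \<Rightarrow> real"
    assume "\<exists>h. (\<forall>i. smooth1 (h i)) \<and> \<phi> = (\<lambda>x. \<Prod>i\<in>UNIV. h i (x $ i))"
    then obtain h where h: "\<And>i. smooth1 (h i)" and \<phi>: "\<phi> = (\<lambda>x. \<Prod>i\<in>UNIV. h i (x $ i))" by blast
    have "\<phi> differentiable (at x)" for x
      unfolding \<phi> differentiable_def using prod_has_derivative[of h x, OF h] by blast
    moreover have "\<exists>h'. (\<forall>i. smooth1 (h' i)) \<and> partial_deriv \<phi> k = (\<lambda>x. \<Prod>i\<in>UNIV. h' i (x $ i))" for k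
      unfolding \<phi> partial_deriv_prod[of h k, OF h]
      by (rule exI[of _ "h(k := deriv (h k))"]) (use h smooth1_deriv(2) in auto)
    ultimately show "\<exists>\<phi>'. \<phi> = \<phi>' \<and> (\<forall>x. \<phi>' differentiable at x) \<and>
       (\<forall>i. (\<exists>h. (\<forall>i. smooth1 (h i)) \<and> partial_deriv \<phi>' i = (\<lambda>x. \<Prod>i\<in>UNIV. h i (x $ i))) \<or> smooth_fun (partial_deriv \<phi>' i))"
      by blast
  qed
qed

section \<open>Calculus of smooth functions and test functions\<close>

lemma smooth_fun_differentiable: "smooth_fun \<phi> \<Longrightarrow> \<phi> differentiable (at x)"
  by (erule smooth_fun.cases) auto

lemma smooth_fun_partial_deriv: "smooth_fun \<phi> \<Longrightarrow> smooth_fun (partial_deriv \<phi> i)"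
  by (erule smooth_fun.cases) auto

lemma smooth_fun_continuous: "smooth_fun \<phi> \<Longrightarrow> continuous_on UNIV \<phi>"
  by (simp add: continuous_at_imp_continuous_on differentiable_imp_continuous_within smooth_fun_differentiable)

lemma vec_eq_sum_axis: "v = (\<Sum>i\<in>UNIV. v $ i *\<^sub>R axis i (1::real))" for v :: "real^'n"
  by (simp add: vec_eq_iff axis_def if_distrib cong: if_cong)

lemma smooth_fun_has_derivative:
  fixes \<phi> :: "real^'n::finite \<Rightarrow> real"
  assumes "smooth_fun \<phi>"
  shows "(\<phi> has_derivative (\<lambda>v. v \<bullet> (\<chi> i. partial_deriv \<phi> i x))) (at x)"
proof -
  have d: "(\<phi> has_derivative frechet_derivative \<phi> (at x)) (at x)"
    using smooth_fun_differentiable[OF assms] by (simp add: frechet_derivative_works)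
  have "frechet_derivative \<phi> (at x) = (\<lambda>v. v \<bullet> (\<chi> i. partial_deriv \<phi> i x))"
  proof
    fix v :: "real^'n"
    interpret bounded_linear "frechet_derivative \<phi> (at x)" using d by (rule has_derivative_bounded_linear)
    have "frechet_derivative \<phi> (at x) v = frechet_derivative \<phi> (at x) (\<Sum>i\<in>UNIV. v $ i *\<^sub>R axis i 1)"
      using vec_eq_sum_axis[of v] by simp
    also have "\<dots> = v \<bullet> (\<chi> i. partial_deriv \<phi> i x)"
      by (simp add: sum scaleR partial_deriv_def inner_vec_def)
    finally show "frechet_derivative \<phi> (at x) v = v \<bullet> (\<chi> i. partial_deriv \<phi> i x)" .
  qed
  with d show ?thesis by simp
qed

lemma partial_derivI:
  assumes "(\<phi> has_derivative D) (at x)"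
  shows "partial_deriv \<phi> i x = D (axis i 1)"
  unfolding partial_deriv_def using frechet_derivative_at[OF assms] by metis

lemma affine_has_derivative:
  fixes \<phi> :: "real^'n::finite \<Rightarrow> real"
  assumes "smooth_fun \<phi>"
  shows "((\<lambda>x. k * \<phi> (c *\<^sub>R x + a)) has_derivative (\<lambda>v. (k * c) * (v \<bullet> (\<chi> i. partial_deriv \<phi> i (c *\<^sub>R x + a))))) (at x)"
proof -
  have "((\<lambda>x. c *\<^sub>R x + a) has_derivative (\<lambda>v. c *\<^sub>R v)) (at x)"
    by (auto intro!: derivative_eq_intros)
  from has_derivative_compose[OF this, of \<phi>, OF smooth_fun_has_derivative[OF assms]]
  have "((\<lambda>x. \<phi> (c *\<^sub>R x + a)) has_derivative (\<lambda>v. (c *\<^sub>R v) \<bullet> (\<chi> i. partial_deriv \<phi> i (c *\<^sub>R x + a)))) (at x)" .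
  from has_derivative_mult_right[OF this, of k] show ?thesis by (simp add: mult.assoc)
qed

lemma partial_deriv_affine:
  fixes \<phi> :: "real^'n::finite \<Rightarrow> real"
  assumes "smooth_fun \<phi>"
  shows "partial_deriv (\<lambda>x. k * \<phi> (c *\<^sub>R x + a)) i = (\<lambda>x. (k * c) * partial_deriv \<phi> i (c *\<^sub>R x + a))"
  by (rule ext, subst partial_derivI[OF affine_has_derivative[OF assms]]) (simp add: inner_axis')

text \<open>The scalar k belongs to the coinductive invariant because each differentiation
  multiplies by c.\<close>

lemma smooth_fun_affine:
  fixes \<phi> :: "real^'n::finite \<Rightarrow> real"
  assumes "smooth_fun \<phi>"
  shows "smooth_fun (\<lambda>x. k * \<phi> (c *\<^sub>R x + a))"
proof (rule smooth_fun.coinduct[where X="\<lambda>\<psi>. \<exists>k \<phi>. smooth_fun \<phi> \<and> \<psi> = (\<lambda>x. k * \<phi> (c *\<^sub>R x + a))"])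
  show "\<exists>ka \<phi>'. smooth_fun \<phi>' \<and> (\<lambda>x. k * \<phi> (c *\<^sub>R x + a)) = (\<lambda>x. ka * \<phi>' (c *\<^sub>R x + a))"
    using assms by blast
  fix \<psi> :: "real^'n \<Rightarrow> real"
  assume "\<exists>k \<phi>. smooth_fun \<phi> \<and> \<psi> = (\<lambda>x. k * \<phi> (c *\<^sub>R x + a))"
  then obtain k \<phi> where \<phi>: "smooth_fun \<phi>" and \<psi>: "\<psi> = (\<lambda>x. k * \<phi> (c *\<^sub>R x + a))" by blast
  have "\<psi> differentiable (at x)" for x
    unfolding \<psi> differentiable_def using affine_has_derivative[OF \<phi>] by blast
  moreover have "\<exists>k \<phi>. smooth_fun \<phi> \<and> partial_deriv \<psi> i = (\<lambda>x. k * \<phi> (c *\<^sub>R x + a))" for i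
    unfolding \<psi> partial_deriv_affine[OF \<phi>] using smooth_fun_partial_deriv[OF \<phi>] by blast
  ultimately show "\<exists>\<phi>'. \<psi> = \<phi>' \<and> (\<forall>x. \<phi>' differentiable at x) \<and>
     (\<forall>i. (\<exists>k \<phi>. smooth_fun \<phi> \<and> partial_deriv \<phi>' i = (\<lambda>x. k * \<phi> (c *\<^sub>R x + a))) \<or> smooth_fun (partial_deriv \<phi>' i))"
    by blast
qed

lemma test_fun_affine:
  fixes \<phi> :: "real^'n::finite \<Rightarrow> real"
  assumes "test_fun \<phi>" "c \<noteq> 0"
  shows "test_fun (\<lambda>x. k * \<phi> (c *\<^sub>R x + a))"
proof -
  obtain R where R: "\<And>x. norm x > R \<Longrightarrow> \<phi> x = 0" using assms by (auto simp: test_fun_def)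
  have "k * \<phi> (c *\<^sub>R x + a) = 0" if "norm x > (R + norm a) / \<bar>c\<bar>" for x
  proof -
    have "R + norm a < \<bar>c\<bar> * norm x" using that assms(2) by (simp add: field_simps)
    then have "R < norm (c *\<^sub>R x + a)"
      using norm_diff_ineq[of "c *\<^sub>R x" a] by simp
    then show ?thesis using R by simp
  qed
  then show ?thesis using assms smooth_fun_affine by (auto simp: test_fun_def)
qed

lemma test_fun_partial_deriv:
  fixes \<phi> :: "real^'n::finite \<Rightarrow> real"
  assumes "test_fun \<phi>"
  shows "test_fun (partial_deriv \<phi> i)"
proof -
  obtain R where R: "\<And>x. norm x > R \<Longrightarrow> \<phi> x = 0" using assms by (auto simp: test_fun_def)
  have "partial_deriv \<phi> i x = 0" if "norm x > R" for x
  proof -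
    have "open {x::real^'n. R < norm x}" by (intro open_Collect_less continuous_intros)
    then have "(\<phi> has_derivative (\<lambda>_. 0)) (at x)"
      using has_derivative_transform_within_open[of "\<lambda>_. 0" "\<lambda>_. 0" x UNIV "{x. R < norm x}" \<phi>] that R
      by auto
    then show ?thesis by (rule partial_derivI)
  qed
  then show ?thesis using assms smooth_fun_partial_deriv by (auto simp: test_fun_def)
qed

lemma continuous_support_L2:
  fixes f :: "'a::euclidean_space \<Rightarrow> 'b::euclidean_space"
  assumes c: "continuous_on UNIV f" and R: "\<And>x. norm x > R \<Longrightarrow> f x = 0"
  shows "L2 f" "\<exists>C\<ge>0. \<forall>x. norm (f x) \<le> C"
proof -
  have "compact (f ` cball 0 R)"
    by (intro compact_continuous_image continuous_on_subset[OF c]) auto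
  then obtain C where C: "\<And>y. y \<in> f ` cball 0 R \<Longrightarrow> norm y \<le> C"
    using compact_imp_bounded bounded_iff by metis
  have le: "norm (f x) \<le> \<bar>C\<bar> * norm (indicator (cball 0 R) x :: real)" for x
    using C[of "f x"] R[of x] by (cases "x \<in> cball 0 R") auto
  have ind: "L2 (indicator (cball 0 R) :: 'a \<Rightarrow> real)"
  proof -
    have "(\<lambda>x. (norm (indicator (cball 0 R) x :: real))\<^sup>2) = (indicator (cball 0 R) :: 'a \<Rightarrow> real)"
      by (auto simp: indicator_def)
    moreover have "integrable lborel (indicator (cball 0 R) :: 'a \<Rightarrow> real)"
      using emeasure_lborel_cball_finite[of "0::'a" R] by (intro integrable_real_indicator) auto
    ultimately show ?thesis unfolding L2_def by simp
  qed
  have "f \<in> borel_measurable borel" using c by (rule borel_measurable_continuous_onI)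
  then show "L2 f" by (rule L2_bounded(1)[OF ind _ le])
  show "\<exists>C\<ge>0. \<forall>x. norm (f x) \<le> C"
  proof (intro exI conjI allI)
    fix x :: 'a
    have "\<bar>C\<bar> * norm (indicator (cball 0 R) x :: real) \<le> \<bar>C\<bar> * 1"
      by (intro mult_left_mono) (auto simp: indicator_def)
    with le[of x] show "norm (f x) \<le> \<bar>C\<bar>" by linarith
  qed (rule abs_ge_zero)
qed

lemma test_fun_L2:
  fixes \<phi> :: "real^'n::finite \<Rightarrow> real"
  assumes "test_fun \<phi>"
  shows "L2 \<phi>"
proof -
  obtain R where "\<And>x. norm x > R \<Longrightarrow> \<phi> x = 0" using assms by (auto simp: test_fun_def)
  then show ?thesis
    using continuous_support_L2(1)[of \<phi> R] assms smooth_fun_continuous by (auto simp: test_fun_def)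
qed

section \<open>The fundamental lemma of the calculus of variations\<close>

lemma L2_indicator:
  fixes A :: "'a::euclidean_space set"
  assumes "A \<in> sets borel" "emeasure lborel A < \<infinity>"
  shows "L2 (indicator A :: 'a \<Rightarrow> real)"
proof -
  have "(\<lambda>x. (norm (indicator A x :: real))\<^sup>2) = (indicator A :: 'a \<Rightarrow> real)"
    by (auto simp: indicator_def)
  moreover have "integrable lborel (indicator A :: 'a \<Rightarrow> real)"
    using assms by (intro integrable_real_indicator) auto
  ultimately show ?thesis using assms unfolding L2_def by simp
qed

text \<open>\<open>ennreal\<close> cuts off negative values, so \<open>M\<close> and
  \<open>N\<close> have the positive and the negative part of P as densities. They agree on boxes,
  an intersection-stable generator of the Borel sets on which they are finite, hence coincide;
  equality of the two parts forces P = 0.\<close>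

lemma AE_zero_of_box_integrals:
  fixes P :: "'a::euclidean_space \<Rightarrow> real"
  assumes P: "L2 P" and box: "\<And>l u. (LINT x|lborel. P x * indicator (box l u) x) = 0"
  shows "AE x in lborel. P x = 0"
proof -
  have [measurable]: "P \<in> borel_measurable borel" using P by (simp add: L2_def)
  define M where "M = density lborel (\<lambda>x. ennreal (P x))"
  define N where "N = density lborel (\<lambda>x. ennreal (- P x))"
  have int: "integrable lborel (\<lambda>x. P x * indicator (box l u) x)" for l u
    using L2_mult_integrable[OF P L2_indicator[of "box l u"]] by (simp add: emeasure_lborel_box_eq)
  have pos: "integrable lborel (\<lambda>x. max 0 (P x * indicator (box l u) x))"
    and neg: "integrable lborel (\<lambda>x. max 0 (- (P x * indicator (box l u) x)))" for l u
    using int[of l u] by auto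
  have eM: "emeasure M (box l u) = ennreal (LINT x|lborel. max 0 (P x * indicator (box l u) x))" for l u
  proof -
    have "emeasure M (box l u) = (\<integral>\<^sup>+x. ennreal (P x) * indicator (box l u) x \<partial>lborel)"
      unfolding M_def by (subst emeasure_density) auto
    also have "\<dots> = (\<integral>\<^sup>+x. ennreal (max 0 (P x * indicator (box l u) x)) \<partial>lborel)"
      by (intro nn_integral_cong) (auto simp: indicator_def max_def ennreal_neg)
    also have "\<dots> = ennreal (LINT x|lborel. max 0 (P x * indicator (box l u) x))"
      by (intro nn_integral_eq_integral pos) auto
    finally show ?thesis .
  qed
  have eN: "emeasure N (box l u) = ennreal (LINT x|lborel. max 0 (- (P x * indicator (box l u) x)))" for l u
  proof -
    have "emeasure N (box l u) = (\<integral>\<^sup>+x. ennreal (- P x) * indicator (box l u) x \<partial>lborel)"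
      unfolding N_def by (subst emeasure_density) auto
    also have "\<dots> = (\<integral>\<^sup>+x. ennreal (max 0 (- (P x * indicator (box l u) x))) \<partial>lborel)"
      by (intro nn_integral_cong) (auto simp: indicator_def max_def ennreal_neg)
    also have "\<dots> = ennreal (LINT x|lborel. max 0 (- (P x * indicator (box l u) x)))"
      by (intro nn_integral_eq_integral neg) auto
    finally show ?thesis .
  qed
  have eq: "(LINT x|lborel. max 0 (P x * indicator (box l u) x)) = (LINT x|lborel. max 0 (- (P x * indicator (box l u) x)))" for l u
  proof -
    have "(LINT x|lborel. max 0 (P x * indicator (box l u) x)) - (LINT x|lborel. max 0 (- (P x * indicator (box l u) x)))
      = (LINT x|lborel. max 0 (P x * indicator (box l u) x) - max 0 (- (P x * indicator (box l u) x)))"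
      by (rule Bochner_Integration.integral_diff[symmetric]) (rule pos neg)+
    also have "\<dots> = (LINT x|lborel. P x * indicator (box l u) x)"
      by (intro Bochner_Integration.integral_cong) (auto simp: max_def)
    finally show ?thesis using box by simp
  qed
  have "M = N"
  proof (rule measure_eqI_generator_eq[where E="range (\<lambda>(a, b). box a b::'a set)" and \<Omega>=UNIV])
    let ?E = "range (\<lambda>(a, b). box a b::'a set)"
    show "Int_stable ?E"
      by (auto simp: Int_stable_def box_Int_box)
    show "?E \<subseteq> Pow UNIV" "sets M = sigma_sets UNIV ?E" "sets N = sigma_sets UNIV ?E"
      by (simp_all add: M_def N_def borel_eq_box)
    show "emeasure M X = emeasure N X" if "X \<in> ?E" for X
      using that eM eN eq by auto
    let ?A = "\<lambda>n::nat. box (- (real n *\<^sub>R One)) (real n *\<^sub>R One) :: 'a set"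
    show "range ?A \<subseteq> ?E" "(\<Union>i. ?A i) = UNIV"
      unfolding UN_box_eq_UNIV by auto
    show "emeasure M (?A i) \<noteq> \<infinity>" for i unfolding eM by simp
  qed
  then have "AE x in lborel. ennreal (P x) = ennreal (- P x)"
    unfolding M_def N_def by (intro sigma_finite_measure.density_unique[OF sigma_finite_lborel]) auto
  then show ?thesis
  proof eventually_elim
    case (elim x)
    show ?case
    proof (cases "0 \<le> P x")
      case True
      with elim show ?thesis by (simp add: ennreal_neg)
    next
      case False
      with elim have "ennreal (- P x) = 0" by (simp add: ennreal_neg)
      with False show ?thesis by simp
    qed
  qed
qed

text \<open>Products of one-dimensional bumps are test functions that converge to the indicator of a
  box and are dominated by it, so the box integrals vanish too.\<close>

lemma AE_zero_of_test_integrals: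
  fixes P :: "real^'n::finite \<Rightarrow> real"
  assumes P: "L2 P" and test: "\<And>\<phi>. test_fun \<phi> \<Longrightarrow> (LINT x|lborel. P x * \<phi> x) = 0"
  shows "AE x in lborel. P x = 0"
proof (rule AE_zero_of_box_integrals[OF P])
  fix l u :: "real^'n"
  have [measurable]: "P \<in> borel_measurable borel" using P by (simp add: L2_def)
  define \<phi> where "\<phi> k x = (\<Prod>i\<in>UNIV. bump (l $ i) (u $ i) k (x $ i))" for k and x :: "real^'n"
  have out: "\<phi> k x = 0" if nb: "x \<notin> box l u" for k x
  proof -
    obtain i where "\<not> (l $ i < x $ i \<and> x $ i < u $ i)" using nb unfolding mem_box_cart by blast
    then have "bump (l $ i) (u $ i) k (x $ i) = 0" by (intro bump_outside) simp
    then show ?thesis unfolding \<phi>_def by (intro prod_zero) auto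
  qed
  have sm: "smooth_fun (\<phi> k)" for k
    unfolding \<phi>_def by (intro smooth_fun_prod smooth1_bump)
  obtain R where R: "\<And>x. x \<in> box l u \<Longrightarrow> norm x \<le> R"
    using bounded_box bounded_iff by metis
  have t: "test_fun (\<phi> k)" for k
  proof -
    have "\<phi> k x = 0" if "R < norm x" for x using out[of x k] R[of x] that by force
    then show ?thesis unfolding test_fun_def using sm by auto
  qed
  have [measurable]: "\<phi> k \<in> borel_measurable borel" for k
    by (intro borel_measurable_continuous_onI smooth_fun_continuous sm)
  have "0 \<le> \<phi> k x" "\<phi> k x \<le> 1" for k x
    unfolding \<phi>_def by (auto intro!: prod_nonneg prod_le_1 bump_bounds)
  then have le: "\<bar>\<phi> k x\<bar> \<le> indicator (box l u) x" for k x
    using out[of x k] by (auto simp: indicator_def)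
  have "(\<lambda>k. LINT x|lborel. P x * \<phi> k x) \<longlonglongrightarrow> (LINT x|lborel. P x * indicator (box l u) x)"
  proof (rule integral_dominated_convergence[where w="\<lambda>x. \<bar>P x * indicator (box l u) x\<bar>"])
    show "integrable lborel (\<lambda>x. \<bar>P x * indicator (box l u) x\<bar>)"
      by (intro integrable_abs L2_mult_integrable[OF P L2_indicator]) (auto simp: emeasure_lborel_box_eq)
    show "AE x in lborel. (\<lambda>k. P x * \<phi> k x) \<longlonglongrightarrow> P x * indicator (box l u) x"
    proof (rule AE_I2)
      fix x
      have "(\<lambda>k. \<phi> k x) \<longlonglongrightarrow> indicator (box l u) x"
      proof (cases "x \<in> box l u")
        case True
        have "(\<lambda>k. \<phi> k x) \<longlonglongrightarrow> (\<Prod>i\<in>(UNIV::'n set). 1)"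
          unfolding \<phi>_def using True by (intro tendsto_prod bump_tendsto) (auto simp: mem_box_cart)
        then show ?thesis using True by simp
      qed (simp add: out)
      then show "(\<lambda>k. P x * \<phi> k x) \<longlonglongrightarrow> P x * indicator (box l u) x" by (intro tendsto_intros)
    qed
    show "AE x in lborel. norm (P x * \<phi> k x) \<le> \<bar>P x * indicator (box l u) x\<bar>" for k
      using le by (intro AE_I2) (auto simp: abs_mult intro: mult_left_mono)
  qed auto
  moreover have "(\<lambda>k. LINT x|lborel. P x * \<phi> k x) \<longlonglongrightarrow> 0"
    using test[OF t] by simp
  ultimately show "(LINT x|lborel. P x * indicator (box l u) x) = 0"
    by (rule LIMSEQ_unique)
qed

section \<open>Averages\<close>

lemma borel_measurable_nth [measurable (raw)]:
  fixes f :: "'a \<Rightarrow> real^'n::finite"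
  assumes "f \<in> borel_measurable M"
  shows "(\<lambda>x. f x $ i) \<in> borel_measurable M"
proof -
  have "(\<lambda>v::real^'n. v $ i) \<in> borel_measurable borel"
    by (intro borel_measurable_continuous_onI continuous_intros)
  from measurable_compose[OF assms this] show ?thesis .
qed

lemma L2_nth:
  fixes w :: "real^'n::finite \<Rightarrow> real^'n"
  assumes w: "L2 w"
  shows "L2 (\<lambda>x. w x $ i)" "n2 (\<lambda>x. w x $ i) \<le> n2 w"
proof -
  have m: "(\<lambda>x. w x $ i) \<in> borel_measurable borel" using w by measurable
  have "norm (w x $ i) \<le> 1 * norm (w x)" for x using component_le_norm_cart[of "w x" i] by simp
  from L2_bounded[OF w m this] show "L2 (\<lambda>x. w x $ i)" "n2 (\<lambda>x. w x $ i) \<le> n2 w" by simp_all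
qed

lemma L2_inner_const:
  fixes w :: "'a::euclidean_space \<Rightarrow> 'b::euclidean_space"
  assumes w: "L2 w"
  shows "L2 (\<lambda>x. w x \<bullet> h)" "n2 (\<lambda>x. w x \<bullet> h) \<le> (norm h)\<^sup>2 * n2 w"
proof -
  have m: "(\<lambda>x. w x \<bullet> h) \<in> borel_measurable borel" using w by measurable
  have "norm (w x \<bullet> h) \<le> norm h * norm (w x)" for x
    using Cauchy_Schwarz_ineq2[of "w x" h] by (simp add: mult.commute)
  from L2_bounded[OF w m this] show "L2 (\<lambda>x. w x \<bullet> h)" "n2 (\<lambda>x. w x \<bullet> h) \<le> (norm h)\<^sup>2 * n2 w" by simp_all
qed

lemma L2_AE_subseq:
  fixes f :: "nat \<Rightarrow> 'a::euclidean_space \<Rightarrow> 'b::euclidean_space"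
  assumes f: "\<And>n. L2 (f n)" and g: "L2 g" and lim: "(\<lambda>n. n2 (\<lambda>x. f n x - g x)) \<longlonglongrightarrow> 0"
  obtains r where "strict_mono (r::nat\<Rightarrow>nat)" "AE x in lborel. (\<lambda>n. f (r n) x) \<longlonglongrightarrow> g x"
proof -
  have [measurable]: "f n \<in> borel_measurable borel" "g \<in> borel_measurable borel" for n
    using f g by (auto simp: L2_def)
  obtain r where r: "strict_mono r" and AE: "AE x in lborel. (\<lambda>n. (norm (f (r n) x - g x))\<^sup>2) \<longlonglongrightarrow> 0"
  proof -
    have "integrable lborel (\<lambda>x. (norm (f n x - g x))\<^sup>2)" for n
      by (intro L2_integrable L2_diff f g)
    moreover have "(\<lambda>n. \<integral>x. norm ((norm (f n x - g x))\<^sup>2) \<partial>lborel) \<longlonglongrightarrow> 0"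
      using lim by (simp add: n2_def)
    ultimately show ?thesis
      using tendsto_L1_AE_subseq[of lborel "\<lambda>n x. (norm (f n x - g x))\<^sup>2"] that by blast
  qed
  show thesis
  proof (rule that[OF r])
    show "AE x in lborel. (\<lambda>n. f (r n) x) \<longlonglongrightarrow> g x"
      using AE
    proof eventually_elim
      case (elim x)
      from tendsto_real_sqrt[OF elim] have "(\<lambda>n. norm (f (r n) x - g x)) \<longlonglongrightarrow> 0" by simp
      then show ?case using LIM_zero_iff tendsto_norm_zero_iff by blast
    qed
  qed
qed

text \<open>Cauchy-Schwarz in t against the indicator of Q, then Tonelli. Nonnegative integrals are
  used throughout because integrability in t, for almost every x, is itself a conclusion. It is
  applied to the unit interval, for averages along a segment, and to cubes.\<close>

lemma L2_average_set:
  fixes F :: "'c::euclidean_space \<Rightarrow> 'a::euclidean_space \<Rightarrow> real"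
  assumes F [measurable]: "(\<lambda>(t, x). F t x) \<in> borel_measurable (lborel \<Otimes>\<^sub>M lborel)"
    and Q [measurable]: "Q \<in> sets borel" and q: "emeasure lborel Q = ennreal q" "0 \<le> q"
    and c: "\<And>t. t \<in> Q \<Longrightarrow> (\<integral>\<^sup>+x. ennreal ((F t x)\<^sup>2) \<partial>lborel) \<le> ennreal c" "0 \<le> c"
  shows "L2 (\<lambda>x. LINT t|lborel. indicator Q t * F t x)"
    "n2 (\<lambda>x. LINT t|lborel. indicator Q t * F t x) \<le> q\<^sup>2 * c"
    "AE x in lborel. integrable lborel (\<lambda>t. indicator Q t * F t x)"
proof -
  let ?i = "indicator Q :: 'c \<Rightarrow> real"
  let ?Q = "\<lambda>x. LINT t|lborel. ?i t * F t x"
  have [measurable]: "(\<lambda>t. F t x) \<in> borel_measurable borel" for x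
    using measurable_Pair2'[of x lborel lborel] measurable_compose[OF measurable_Pair2'[of x lborel lborel] F]
    by (simp add: comp_def)
  have mQ: "?Q \<in> borel_measurable borel" by measurable
  have CS: "(\<integral>\<^sup>+t. ennreal (norm (?i t * F t x)) \<partial>lborel)\<^sup>2 \<le> ennreal q * (\<integral>\<^sup>+t. ennreal (?i t * (F t x)\<^sup>2) \<partial>lborel)" for x
  proof -
    have "(\<integral>\<^sup>+t. ennreal (norm (?i t * F t x)) \<partial>lborel)\<^sup>2
        = (\<integral>\<^sup>+t. ennreal (?i t) * ennreal (?i t * \<bar>F t x\<bar>) \<partial>lborel)\<^sup>2"
      by (intro arg_cong[where f="\<lambda>x. x\<^sup>2"] nn_integral_cong) (auto simp: indicator_def)
    also have "\<dots> \<le> (\<integral>\<^sup>+t. (ennreal (?i t))\<^sup>2 \<partial>lborel) * (\<integral>\<^sup>+t. (ennreal (?i t * \<bar>F t x\<bar>))\<^sup>2 \<partial>lborel)"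
      by (rule Cauchy_Schwarz_nn_integral) auto
    also have "(\<integral>\<^sup>+t. (ennreal (?i t))\<^sup>2 \<partial>lborel) = (\<integral>\<^sup>+t. indicator Q t \<partial>lborel)"
      by (intro nn_integral_cong) (auto simp: indicator_def)
    also have "\<dots> = ennreal q" using q by simp
    also have "(\<integral>\<^sup>+t. (ennreal (?i t * \<bar>F t x\<bar>))\<^sup>2 \<partial>lborel) = (\<integral>\<^sup>+t. ennreal (?i t * (F t x)\<^sup>2) \<partial>lborel)"
      by (intro nn_integral_cong) (auto simp: indicator_def ennreal_power)
    finally show ?thesis .
  qed
  have total: "(\<integral>\<^sup>+x. (\<integral>\<^sup>+t. ennreal (?i t * (F t x)\<^sup>2) \<partial>lborel) \<partial>lborel) \<le> ennreal (c * q)"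
  proof -
    have "(\<integral>\<^sup>+x. (\<integral>\<^sup>+t. ennreal (?i t * (F t x)\<^sup>2) \<partial>lborel) \<partial>lborel)
        = (\<integral>\<^sup>+t. (\<integral>\<^sup>+x. ennreal (?i t * (F t x)\<^sup>2) \<partial>lborel) \<partial>lborel)"
      by (rule lborel_pair.Fubini') measurable
    also have "\<dots> \<le> (\<integral>\<^sup>+t. ennreal c * indicator Q t \<partial>lborel)"
      by (intro nn_integral_mono) (use c in \<open>auto simp: indicator_def\<close>)
    also have "\<dots> = ennreal (c * q)"
      using q c by (subst nn_integral_cmult_indicator) (auto simp: ennreal_mult)
    finally show ?thesis .
  qed
  show AE: "AE x in lborel. integrable lborel (\<lambda>t. ?i t * F t x)"
  proof -
    have "AE x in lborel. (\<integral>\<^sup>+t. ennreal (?i t * (F t x)\<^sup>2) \<partial>lborel) \<noteq> \<infinity>"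
      using total by (intro nn_integral_PInf_AE) (auto simp: top_unique)
    then show ?thesis
    proof eventually_elim
      case (elim x)
      have "(\<integral>\<^sup>+t. ennreal (norm (?i t * F t x)) \<partial>lborel)\<^sup>2 \<noteq> \<infinity>"
        using CS[of x] elim by (auto simp: top_unique ennreal_mult_eq_top_iff)
      then have "(\<integral>\<^sup>+t. ennreal (norm (?i t * F t x)) \<partial>lborel) < \<infinity>"
        by (auto simp: less_top power2_eq_square ennreal_mult_eq_top_iff)
      then show ?case by (intro integrableI_bounded) auto
    qed
  qed
  \<comment> \<open>Where the inner integral does not exist it defaults to 0, so the bound holds at
    every x.\<close>
  have "ennreal ((norm (?Q x))\<^sup>2) \<le> ennreal q * (\<integral>\<^sup>+t. ennreal (?i t * (F t x)\<^sup>2) \<partial>lborel)" for x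
  proof (cases "integrable lborel (\<lambda>t. ?i t * F t x)")
    case True
    have "ennreal ((norm (?Q x))\<^sup>2) = (ennreal (norm (?Q x)))\<^sup>2" by (simp add: ennreal_power)
    also have "\<dots> \<le> (\<integral>\<^sup>+t. ennreal (norm (?i t * F t x)) \<partial>lborel)\<^sup>2"
      using integral_norm_bound_ennreal[OF True] by (intro power_mono) auto
    also note CS
    finally show ?thesis .
  qed (simp add: not_integrable_integral_eq)
  then have "(\<integral>\<^sup>+x. ennreal ((norm (?Q x))\<^sup>2) \<partial>lborel)
      \<le> (\<integral>\<^sup>+x. ennreal q * (\<integral>\<^sup>+t. ennreal (?i t * (F t x)\<^sup>2) \<partial>lborel) \<partial>lborel)"
    by (rule nn_integral_mono)
  also have "\<dots> = ennreal q * (\<integral>\<^sup>+x. (\<integral>\<^sup>+t. ennreal (?i t * (F t x)\<^sup>2) \<partial>lborel) \<partial>lborel)"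
    by (rule nn_integral_cmult) measurable
  also have "\<dots> \<le> ennreal q * ennreal (c * q)" by (intro mult_left_mono total) simp
  also have "\<dots> = ennreal (q\<^sup>2 * c)"
    using q c by (subst ennreal_mult[symmetric]) (auto simp: power2_eq_square mult_ac)
  finally have "(\<integral>\<^sup>+x. ennreal ((norm (?Q x))\<^sup>2) \<partial>lborel) \<le> ennreal (q\<^sup>2 * c)" .
  from L2I_nn_integral[OF mQ this] c(2)
  show "L2 ?Q" "n2 ?Q \<le> q\<^sup>2 * c" by auto
qed

lemma L2_average:
  fixes F :: "real \<Rightarrow> 'a::euclidean_space \<Rightarrow> real"
  assumes "(\<lambda>(t, x). F t x) \<in> borel_measurable (lborel \<Otimes>\<^sub>M lborel)"
    and "\<And>t. t \<in> {0..1} \<Longrightarrow> (\<integral>\<^sup>+x. ennreal ((F t x)\<^sup>2) \<partial>lborel) \<le> ennreal c" "0 \<le> c"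
  shows "L2 (\<lambda>x. LINT t|lborel. indicator {0..1} t * F t x)"
    "n2 (\<lambda>x. LINT t|lborel. indicator {0..1} t * F t x) \<le> c"
    "AE x in lborel. integrable lborel (\<lambda>t. indicator {0..1} t * F t x)"
  using L2_average_set[OF assms(1), of "{0..1}" 1 c] assms(2,3) by simp_all

lemma pair_mult_integrable:
  fixes a b :: "'a::euclidean_space \<Rightarrow> real"
  assumes a: "L2 a" and b: "L2 b"
  shows "integrable (lborel \<Otimes>\<^sub>M lborel) (\<lambda>(t, x). indicator {0..1::real} t * (a x * b (x + t *\<^sub>R h)))"
proof (rule integrableI_bounded)
  have [measurable]: "a \<in> borel_measurable borel" "b \<in> borel_measurable borel"
    using a b by (auto simp: L2_def)
  show "(\<lambda>(t, x). indicator {0..1::real} t * (a x * b (x + t *\<^sub>R h))) \<in> borel_measurable (lborel \<Otimes>\<^sub>M lborel)"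
    by measurable
  let ?f = "\<lambda>(t, x). ennreal (indicator {0..1::real} t * ((a x)\<^sup>2 + (b (x + t *\<^sub>R h))\<^sup>2))"
  have "(\<integral>\<^sup>+ z. ennreal (norm (case z of (t, x) \<Rightarrow> indicator {0..1::real} t * (a x * b (x + t *\<^sub>R h)))) \<partial>(lborel \<Otimes>\<^sub>M lborel))
     \<le> (\<integral>\<^sup>+ z. ?f z \<partial>(lborel \<Otimes>\<^sub>M lborel))"
  proof (intro nn_integral_mono, clarify intro!: ennreal_leI)
    fix t :: real and x :: 'a
    have "\<bar>a x * b (x + t *\<^sub>R h)\<bar> \<le> (a x)\<^sup>2 + (b (x + t *\<^sub>R h))\<^sup>2"
      using sum_squares_bound[of "\<bar>a x\<bar>" "\<bar>b (x + t *\<^sub>R h)\<bar>"] mult_nonneg_nonneg[OF abs_ge_zero[of "a x"] abs_ge_zero[of "b (x + t *\<^sub>R h)"]]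
      unfolding abs_mult power2_abs by linarith
    then show "norm (indicator {0..1::real} t * (a x * b (x + t *\<^sub>R h)))
        \<le> indicator {0..1} t * ((a x)\<^sup>2 + (b (x + t *\<^sub>R h))\<^sup>2)"
      by (auto simp: indicator_def)
  qed
  also have "\<dots> = (\<integral>\<^sup>+t. (\<integral>\<^sup>+x. ?f (t, x) \<partial>lborel) \<partial>lborel)"
    by (rule lborel.nn_integral_fst[symmetric]) measurable
  also have "\<dots> \<le> (\<integral>\<^sup>+t. ennreal (n2 a + n2 b) * indicator {0..1::real} t \<partial>lborel)"
  proof (intro nn_integral_mono)
    fix t :: real
    have "(\<integral>\<^sup>+x. ennreal ((a x)\<^sup>2 + (b (x + t *\<^sub>R h))\<^sup>2) \<partial>lborel)
       = (\<integral>\<^sup>+x. ennreal ((norm (a x))\<^sup>2) \<partial>lborel) + (\<integral>\<^sup>+x. ennreal ((norm (b (x + t *\<^sub>R h)))\<^sup>2) \<partial>lborel)"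
      by (subst nn_integral_add[symmetric]) auto
    also have "\<dots> = ennreal (n2 a + n2 b)"
      using L2_nn_integral[OF a] L2_nn_integral[OF L2_translate(1)[OF b]] L2_translate(2)[OF b]
      by simp
    finally show "(\<integral>\<^sup>+x. ?f (t, x) \<partial>lborel) \<le> ennreal (n2 a + n2 b) * indicator {0..1::real} t"
      by (auto simp: indicator_def)
  qed
  also have "\<dots> = ennreal (n2 a + n2 b)"
    by (subst nn_integral_cmult_indicator) auto
  also have "\<dots> < \<infinity>" by simp
  finally show "(\<integral>\<^sup>+ z. ennreal (norm (case z of (t, x) \<Rightarrow> indicator {0..1::real} t * (a x * b (x + t *\<^sub>R h)))) \<partial>(lborel \<Otimes>\<^sub>M lborel)) < \<infinity>" .
qed

text \<open>Lets an average along a segment move from one factor of a pairing to the other;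
  \<open>sob_increment\<close> uses it once in each direction.\<close>

lemma Fubini_average:
  fixes a b :: "'a::euclidean_space \<Rightarrow> real"
  assumes a: "L2 a" and b: "L2 b"
  shows "(LINT x|lborel. a x * (LINT t|lborel. indicator {0..1::real} t * b (x + t *\<^sub>R h)))
    = (LINT t|lborel. indicator {0..1::real} t * (LINT x|lborel. a x * b (x + t *\<^sub>R h)))"
proof -
  have "(LINT x|lborel. a x * (LINT t|lborel. indicator {0..1::real} t * b (x + t *\<^sub>R h)))
     = (LINT x|lborel. LINT t|lborel. indicator {0..1::real} t * (a x * b (x + t *\<^sub>R h)))"
    by (simp add: mult.left_commute flip: integral_mult_right_zero)
  also have "\<dots> = (LINT t|lborel. LINT x|lborel. indicator {0..1::real} t * (a x * b (x + t *\<^sub>R h)))"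
    by (rule lborel_pair.Fubini_integral) (rule pair_mult_integrable[OF a b])
  finally show ?thesis by simp
qed

section \<open>Sobolev functions\<close>

text \<open>Pairs of a Borel representative of an \<open>H1\<close> function and one of its weak gradient; \<open>H1_sob\<close> and
  \<open>sob_weak_grad\<close> relate them to \<open>H1\<close> and \<open>grad\<close>, which refer to \<open>lebesgue\<close>.\<close>

definition sob :: "(real^'n::finite \<Rightarrow> real) \<Rightarrow> (real^'n \<Rightarrow> real^'n) \<Rightarrow> bool" where
  "sob u w \<longleftrightarrow> L2 u \<and> L2 w \<and> (\<forall>i \<phi>. test_fun \<phi> \<longrightarrow>
     (LINT x|lborel. u x * partial_deriv \<phi> i x) = - (LINT x|lborel. w x $ i * \<phi> x))"

lemma sobD:
  assumes "sob u w"
  shows "L2 u" "L2 w" "test_fun \<phi> \<Longrightarrow> (LINT x|lborel. u x * partial_deriv \<phi> i x) = - (LINT x|lborel. w x $ i * \<phi> x)"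
  using assms by (auto simp: sob_def)

lemma vec_inner_sum: "v \<bullet> h = (\<Sum>i\<in>UNIV. h $ i * v $ i)" for v h :: "real^'n::finite"
  by (simp add: inner_vec_def mult.commute)

text \<open>The fundamental theorem of calculus along the segment from \<open>x\<close> to \<open>x + h\<close>, obtained by testing
  against translated test functions.\<close>

lemma sob_increment:
  fixes u :: "real^'n::finite \<Rightarrow> real"
  assumes s: "sob u w"
  shows "AE x in lborel. u (x + h) - u x = (LINT t|lborel. indicator {0..1} t * (w (x + t *\<^sub>R h) \<bullet> h))"
    and "n2 (\<lambda>x. u (x + h) - u x) \<le> (norm h)\<^sup>2 * n2 w"
proof -
  note u = sobD(1)[OF s] and w = sobD(2)[OF s]
  have [measurable]: "u \<in> borel_measurable borel" "w \<in> borel_measurable borel"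
    using u w by (auto simp: L2_def)
  define b where "b x = w x \<bullet> h" for x
  have b: "L2 b" unfolding b_def by (rule L2_inner_const[OF w])
  then have [measurable]: "b \<in> borel_measurable borel" by (simp add: L2_def)
  define Q where "Q x = (LINT t|lborel. indicator {0..1::real} t * b (x + t *\<^sub>R h))" for x
  have avg: "(\<integral>\<^sup>+x. ennreal ((b (x + t *\<^sub>R h))\<^sup>2) \<partial>lborel) \<le> ennreal ((norm h)\<^sup>2 * n2 w)" for t
  proof -
    have "n2 b \<le> (norm h)\<^sup>2 * n2 w" using L2_inner_const(2)[OF w, of h] by (simp add: b_def[abs_def])
    then show ?thesis
      using L2_nn_integral[OF L2_translate(1)[OF b, of "t *\<^sub>R h"]] L2_translate(2)[OF b]
      by (simp add: ennreal_leI)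
  qed
  have Q: "L2 Q" "n2 Q \<le> (norm h)\<^sup>2 * n2 w"
    unfolding Q_def by (rule L2_average[OF _ avg]; simp)+
  have "AE x in lborel. (u (x + h) - u x) - Q x = 0"
  proof (rule AE_zero_of_test_integrals)
    show "L2 (\<lambda>x. u (x + h) - u x - Q x)"
      by (intro L2_diff L2_translate u Q)
    fix \<phi> :: "real^'n \<Rightarrow> real"
    assume t: "test_fun \<phi>"
    then have sm: "smooth_fun \<phi>" by (simp add: test_fun_def)
    note \<phi> = test_fun_L2[OF t]
    have [measurable]: "\<phi> \<in> borel_measurable borel" using \<phi> by (simp add: L2_def)
    define d where "d x = h \<bullet> (\<chi> i. partial_deriv \<phi> i x)" for x
    have d_sum: "d x = (\<Sum>i\<in>UNIV. h $ i * partial_deriv \<phi> i x)" for x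
      by (simp add: d_def inner_vec_def)
    have d: "L2 d"
      unfolding d_sum by (intro L2_sum L2_cmult test_fun_L2 test_fun_partial_deriv t)
    have contd: "continuous_on UNIV d"
      unfolding d_sum
      by (intro continuous_intros smooth_fun_continuous smooth_fun_partial_deriv sm)
    \<comment> \<open>The translation is moved onto the test function before integrating by parts,
      which reverses its sign.\<close>
    have shift: "(LINT x|lborel. \<phi> x * b (x + t *\<^sub>R h)) = - (LINT y|lborel. u y * d (y + t *\<^sub>R (- h)))" for t
    proof -
      let ?\<psi> = "\<lambda>y. 1 * \<phi> (1 *\<^sub>R y + (- (t *\<^sub>R h)))"
      have tt: "test_fun ?\<psi>" by (rule test_fun_affine[OF \<open>test_fun \<phi>\<close>]) simp
      have pd: "partial_deriv ?\<psi> i y = partial_deriv \<phi> i (y + t *\<^sub>R (- h))" for i y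
        by (subst partial_deriv_affine[OF sm]) simp
      have "(LINT x|lborel. \<phi> x * b (x + t *\<^sub>R h)) = (LINT y|lborel. \<phi> (y + (- (t *\<^sub>R h)) ) * b y)"
        using lborel_integral_translate(1)[of "\<lambda>y. \<phi> (y + (- (t *\<^sub>R h)) ) * b y" "t *\<^sub>R h"] by simp
      also have "\<dots> = (LINT y|lborel. (\<Sum>i\<in>UNIV. h $ i * (w y $ i * ?\<psi> y)))"
        by (intro Bochner_Integration.integral_cong)
          (auto simp: b_def vec_inner_sum sum_distrib_right sum_distrib_left algebra_simps)
      also have "\<dots> = (\<Sum>i\<in>UNIV. h $ i * (LINT y|lborel. w y $ i * ?\<psi> y))"
        by (subst Bochner_Integration.integral_sum)
          (intro integrable_mult_right L2_mult_integrable L2_nth w test_fun_L2 tt, simp)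
      also have "\<dots> = (\<Sum>i\<in>UNIV. - (h $ i * (LINT y|lborel. u y * partial_deriv ?\<psi> i y)))"
        using sobD(3)[OF s tt] by (intro sum.cong) auto
      also have "\<dots> = - (\<Sum>i\<in>UNIV. (LINT y|lborel. h $ i * (u y * partial_deriv ?\<psi> i y)))"
        by (simp add: sum_negf)
      also have "(\<Sum>i\<in>UNIV. (LINT y|lborel. h $ i * (u y * partial_deriv ?\<psi> i y)))
          = (LINT y|lborel. (\<Sum>i\<in>UNIV. h $ i * (u y * partial_deriv ?\<psi> i y)))"
        by (rule Bochner_Integration.integral_sum[symmetric])
          (intro integrable_mult_right L2_mult_integrable u test_fun_L2 test_fun_partial_deriv tt)
      also have "\<dots> = (LINT y|lborel. u y * d (y + t *\<^sub>R (- h)))"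
        unfolding pd d_sum by (simp add: sum_distrib_left algebra_simps)
      finally show ?thesis .
    qed
    \<comment> \<open>For the smooth function this is the classical fundamental theorem, along the
      reversed segment from y to y - h.\<close>
    have FTC: "(LINT t|lborel. indicator {0..1::real} t * d (y + t *\<^sub>R (- h))) = \<phi> y - \<phi> (y - h)" for y
    proof -
      have "((\<lambda>t. - \<phi> (y + t *\<^sub>R (- h))) has_vector_derivative d (y + t *\<^sub>R (- h))) (at t within {0..1})" for t
      proof -
        have "((\<lambda>t. y + t *\<^sub>R (- h)) has_derivative (\<lambda>s. s *\<^sub>R (- h))) (at t)"
          by (auto intro!: derivative_eq_intros)
        from has_derivative_compose[OF this smooth_fun_has_derivative[OF sm]]
        have "((\<lambda>t. \<phi> (y + t *\<^sub>R (- h))) has_derivative (\<lambda>s. s *\<^sub>R (- d (y + t *\<^sub>R (- h))))) (at t)"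
          by (simp add: d_def)
        from has_derivative_minus[OF this]
        have "((\<lambda>t. - \<phi> (y + t *\<^sub>R (- h))) has_vector_derivative d (y + t *\<^sub>R (- h))) (at t)"
          by (simp add: has_vector_derivative_def)
        then show ?thesis by (rule has_vector_derivative_at_within)
      qed
      then have "(LINT t|lborel. indicator {0..1} t *\<^sub>R d (y + t *\<^sub>R (- h))) = - \<phi> (y + 1 *\<^sub>R (- h)) - - \<phi> (y + 0 *\<^sub>R (- h))"
        by (intro integral_FTC_atLeastAtMost)
          (auto intro!: continuous_on_compose2[OF contd] continuous_intros)
      then show ?thesis by simp
    qed
    have "(LINT x|lborel. Q x * \<phi> x) = (LINT x|lborel. \<phi> x * (LINT t|lborel. indicator {0..1::real} t * b (x + t *\<^sub>R h)))"
      by (simp add: Q_def mult.commute)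
    also have "\<dots> = (LINT t|lborel. indicator {0..1::real} t * (LINT x|lborel. \<phi> x * b (x + t *\<^sub>R h)))"
      by (rule Fubini_average[OF \<phi> b])
    also have "\<dots> = - (LINT t|lborel. indicator {0..1::real} t * (LINT y|lborel. u y * d (y + t *\<^sub>R (- h))))"
      unfolding shift by simp
    also have "(LINT t|lborel. indicator {0..1::real} t * (LINT y|lborel. u y * d (y + t *\<^sub>R (- h))))
       = (LINT y|lborel. u y * (LINT t|lborel. indicator {0..1::real} t * d (y + t *\<^sub>R (- h))))"
      by (rule Fubini_average[OF u d, symmetric])
    also have "\<dots> = (LINT y|lborel. u y * \<phi> y - u y * \<phi> (y - h))"
      unfolding FTC by (simp add: right_diff_distrib)
    also have "\<dots> = (LINT y|lborel. u y * \<phi> y) - (LINT y|lborel. u y * \<phi> (y - h))"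
      using L2_mult_integrable[OF u L2_translate(1)[OF \<phi>, of "-h"]] L2_mult_integrable[OF u \<phi>]
      by (intro Bochner_Integration.integral_diff) auto
    also have "(LINT y|lborel. u y * \<phi> (y - h)) = (LINT x|lborel. u (x + h) * \<phi> x)"
      using lborel_integral_translate(1)[of "\<lambda>y. u y * \<phi> (y - h)" h] by simp
    finally have Q\<phi>: "(LINT x|lborel. Q x * \<phi> x) = (LINT x|lborel. u (x + h) * \<phi> x) - (LINT x|lborel. u x * \<phi> x)"
      by simp
    have "(LINT x|lborel. (u (x + h) - u x - Q x) * \<phi> x) = (LINT x|lborel. (u (x + h) * \<phi> x - u x * \<phi> x) - Q x * \<phi> x)"
      by (simp add: left_diff_distrib)
    also have "\<dots> = (LINT x|lborel. u (x + h) * \<phi> x) - (LINT x|lborel. u x * \<phi> x) - (LINT x|lborel. Q x * \<phi> x)"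
      using L2_mult_integrable[OF L2_translate(1)[OF u, of h] \<phi>] L2_mult_integrable[OF u \<phi>] L2_mult_integrable[OF Q(1) \<phi>]
      by (subst Bochner_Integration.integral_diff Bochner_Integration.integral_diff; (intro Bochner_Integration.integrable_diff)?; simp)+
    finally show "(LINT x|lborel. (u (x + h) - u x - Q x) * \<phi> x) = 0" using Q\<phi> by simp
  qed
  then have *: "AE x in lborel. u (x + h) - u x = Q x" by eventually_elim simp
  then show "AE x in lborel. u (x + h) - u x = (LINT t|lborel. indicator {0..1} t * (w (x + t *\<^sub>R h) \<bullet> h))"
    by (simp add: Q_def b_def)
  have "AE x in lborel. Q x = u (x + h) - u x" using * by eventually_elim simp
  from L2_cong_AE(2)[OF Q(1) _ this] Q(2)
  show "n2 (\<lambda>x. u (x + h) - u x) \<le> (norm h)\<^sup>2 * n2 w" by simp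
qed

section \<open>Uniqueness, limits and transformations of weak gradients\<close>

lemma sob_unique:
  assumes "sob u w" "sob u' w'" "AE x in lborel. u x = u' x"
  shows "AE x in lborel. w x = w' x"
proof -
  note w = sobD(1,2)[OF assms(1)] sobD(1,2)[OF assms(2)]
  have [measurable]: "u \<in> borel_measurable borel" "u' \<in> borel_measurable borel"
    using w by (auto simp: L2_def)
  have "AE x in lborel. w x $ i - w' x $ i = 0" for i
  proof (rule AE_zero_of_test_integrals)
    show "L2 (\<lambda>x. w x $ i - w' x $ i)" by (intro L2_diff L2_nth w)
    fix \<phi> :: "real^'a \<Rightarrow> real" assume t: "test_fun \<phi>"
    have [measurable]: "partial_deriv \<phi> i \<in> borel_measurable borel"
      using test_fun_L2[OF test_fun_partial_deriv[OF t]] by (simp add: L2_def)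
    have "(LINT x|lborel. (w x $ i - w' x $ i) * \<phi> x) = (LINT x|lborel. w x $ i * \<phi> x) - (LINT x|lborel. w' x $ i * \<phi> x)"
      unfolding left_diff_distrib
      by (intro Bochner_Integration.integral_diff L2_mult_integrable L2_nth w test_fun_L2 t)
    also have "\<dots> = (LINT x|lborel. u' x * partial_deriv \<phi> i x) - (LINT x|lborel. u x * partial_deriv \<phi> i x)"
      using sobD(3)[OF assms(1) t] sobD(3)[OF assms(2) t] by simp
    also have "(LINT x|lborel. u' x * partial_deriv \<phi> i x) = (LINT x|lborel. u x * partial_deriv \<phi> i x)"
      by (intro integral_cong_AE) (use assms(3) in auto)
    finally show "(LINT x|lborel. (w x $ i - w' x $ i) * \<phi> x) = 0" by simp
  qed
  then have "AE x in lborel. \<forall>i. w x $ i - w' x $ i = 0"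
    by (subst AE_all_countable) auto
  then show ?thesis by eventually_elim (simp add: vec_eq_iff)
qed

lemma L2_indicator_cball: "L2 (indicator (cball 0 r) :: 'a::euclidean_space \<Rightarrow> real)"
  by (rule L2_indicator) (simp, rule emeasure_lborel_cball_finite)

lemma sob_limit:
  assumes s: "\<And>n. sob (u n) (w n)" and U: "L2 U" and W: "L2 W"
    and lu: "(\<lambda>n. n2 (\<lambda>x. u n x - U x)) \<longlonglongrightarrow> 0" and lw: "(\<lambda>n. n2 (\<lambda>x. w n x - W x)) \<longlonglongrightarrow> 0"
  shows "sob U W"
  unfolding sob_def
proof (intro conjI allI impI U W)
  fix i and \<phi> :: "real^'a \<Rightarrow> real"
  assume t: "test_fun \<phi>"
  note \<phi> = test_fun_L2[OF t] and d\<phi> = test_fun_L2[OF test_fun_partial_deriv[OF t]]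
  have 1: "(\<lambda>n. LINT x|lborel. u n x * partial_deriv \<phi> i x) \<longlonglongrightarrow> (LINT x|lborel. U x * partial_deriv \<phi> i x)"
    using L2_limit_inner[OF sobD(1)[OF s] U lu d\<phi>] by simp
  have "(\<lambda>n. n2 (\<lambda>x. w n x $ i - W x $ i)) \<longlonglongrightarrow> 0"
  proof (rule Lim_null_comparison[OF _ lw], intro always_eventually allI)
    fix n
    show "norm (n2 (\<lambda>x. w n x $ i - W x $ i)) \<le> n2 (\<lambda>x. w n x - W x)"
      using L2_nth(2)[OF L2_diff[OF sobD(2)[OF s] W], of n i] by simp
  qed
  then have "(\<lambda>n. LINT x|lborel. w n x $ i * \<phi> x) \<longlonglongrightarrow> (LINT x|lborel. W x $ i * \<phi> x)"
    using L2_limit_inner[OF L2_nth(1)[OF sobD(2)[OF s]] L2_nth(1)[OF W] _ \<phi>] by simp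
  then have 2: "(\<lambda>n. LINT x|lborel. u n x * partial_deriv \<phi> i x) \<longlonglongrightarrow> - (LINT x|lborel. W x $ i * \<phi> x)"
    unfolding sobD(3)[OF s t] by (rule tendsto_minus)
  show "(LINT x|lborel. U x * partial_deriv \<phi> i x) = - (LINT x|lborel. W x $ i * \<phi> x)"
    by (rule LIMSEQ_unique[OF 1 2])
qed

lemma sob_add:
  assumes a: "sob u w" and b: "sob u' w'"
  shows "sob (\<lambda>x. u x + u' x) (\<lambda>x. w x + w' x)"
  unfolding sob_def
proof (intro conjI allI impI L2_add sobD[OF a] sobD[OF b])
  fix i and \<phi> :: "real^'a \<Rightarrow> real"
  assume t: "test_fun \<phi>"
  note \<phi> = test_fun_L2[OF t] and d\<phi> = test_fun_L2[OF test_fun_partial_deriv[OF t]]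
  have "(LINT x|lborel. (u x + u' x) * partial_deriv \<phi> i x)
      = (LINT x|lborel. u x * partial_deriv \<phi> i x) + (LINT x|lborel. u' x * partial_deriv \<phi> i x)"
    unfolding distrib_right
    by (intro Bochner_Integration.integral_add L2_mult_integrable d\<phi> sobD[OF a] sobD[OF b])
  moreover have "(LINT x|lborel. (w x + w' x) $ i * \<phi> x) = (LINT x|lborel. w x $ i * \<phi> x) + (LINT x|lborel. w' x $ i * \<phi> x)"
    unfolding distrib_right vector_add_component
    by (intro Bochner_Integration.integral_add L2_mult_integrable \<phi> L2_nth sobD[OF a] sobD[OF b])
  ultimately show "(LINT x|lborel. (u x + u' x) * partial_deriv \<phi> i x) = - (LINT x|lborel. (w x + w' x) $ i * \<phi> x)"
    using sobD(3)[OF a t] sobD(3)[OF b t] by simp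
qed

lemma sob_cmult:
  assumes a: "sob u w"
  shows "sob (\<lambda>x. c * u x) (\<lambda>x. c *\<^sub>R w x)"
  unfolding sob_def
proof (intro conjI allI impI L2_cmult L2_scaleR sobD[OF a])
  fix i and \<phi> :: "real^'a \<Rightarrow> real"
  assume t: "test_fun \<phi>"
  show "(LINT x|lborel. c * u x * partial_deriv \<phi> i x) = - (LINT x|lborel. (c *\<^sub>R w x) $ i * \<phi> x)"
    using sobD(3)[OF a t, of i] by (simp add: mult.assoc)
qed

lemma sob_diff: "sob u w \<Longrightarrow> sob u' w' \<Longrightarrow> sob (\<lambda>x. u x - u' x) (\<lambda>x. w x - w' x)"
  using sob_add[OF _ sob_cmult[of u' w' "-1"], of u w] by simp

lemma sob_translate:
  assumes a: "sob u w"
  shows "sob (\<lambda>x. u (x + h)) (\<lambda>x. w (x + h))"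
  unfolding sob_def
proof (intro conjI allI impI L2_translate sobD[OF a])
  fix i and \<phi> :: "real^'a \<Rightarrow> real"
  assume t: "test_fun \<phi>"
  let ?\<psi> = "\<lambda>y. 1 * \<phi> (1 *\<^sub>R y + (- h))"
  have tt: "test_fun ?\<psi>" by (rule test_fun_affine[OF t]) simp
  have pd: "partial_deriv ?\<psi> i y = partial_deriv \<phi> i (y - h)" for y
    using t by (subst partial_deriv_affine) (auto simp: test_fun_def)
  have [measurable]: "\<phi> \<in> borel_measurable borel" "partial_deriv \<phi> i \<in> borel_measurable borel"
    using test_fun_L2[OF t] test_fun_L2[OF test_fun_partial_deriv[OF t]] by (auto simp: L2_def)
  have [measurable]: "u \<in> borel_measurable borel" "w \<in> borel_measurable borel"
    using sobD(1,2)[OF a] by (auto simp: L2_def)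
  have "(LINT x|lborel. u (x + h) * partial_deriv \<phi> i x) = (LINT y|lborel. u y * partial_deriv ?\<psi> i y)"
    using lborel_integral_translate(1)[of "\<lambda>y. u y * partial_deriv \<phi> i (y - h)" h] unfolding pd by simp
  also have "\<dots> = - (LINT y|lborel. w y $ i * ?\<psi> y)" by (rule sobD(3)[OF a tt])
  also have "(LINT y|lborel. w y $ i * ?\<psi> y) = (LINT x|lborel. w (x + h) $ i * \<phi> x)"
    using lborel_integral_translate(1)[of "\<lambda>y. w y $ i * \<phi> (y - h)" h] by simp
  finally show "(LINT x|lborel. u (x + h) * partial_deriv \<phi> i x) = - (LINT x|lborel. w (x + h) $ i * \<phi> x)" .
qed

lemma sob_dilate:
  assumes a: "sob u w" and r: "0 < r"
  shows "sob (\<lambda>x. u (x /\<^sub>R r)) (\<lambda>x. w (x /\<^sub>R r) /\<^sub>R r)"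
  unfolding sob_def
proof (intro conjI allI impI L2_scale L2_scaleR sobD[OF a] r)
  fix i and \<phi> :: "real^'a \<Rightarrow> real"
  assume t: "test_fun \<phi>"
  let ?\<psi> = "\<lambda>y. 1 * \<phi> (r *\<^sub>R y + 0)"
  have tt: "test_fun ?\<psi>" by (rule test_fun_affine[OF t]) (use r in simp)
  have pd: "partial_deriv ?\<psi> i y = r * partial_deriv \<phi> i (r *\<^sub>R y)" for y
    using t by (subst partial_deriv_affine) (auto simp: test_fun_def)
  have [measurable]: "\<phi> \<in> borel_measurable borel" "partial_deriv \<phi> i \<in> borel_measurable borel"
    using test_fun_L2[OF t] test_fun_L2[OF test_fun_partial_deriv[OF t]] by (auto simp: L2_def)
  have [measurable]: "u \<in> borel_measurable borel" "w \<in> borel_measurable borel"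
    using sobD(1,2)[OF a] by (auto simp: L2_def)
  have "r * (LINT x|lborel. u (x /\<^sub>R r) * partial_deriv \<phi> i x) = r ^ DIM(real^'a) * (LINT y|lborel. u y * partial_deriv ?\<psi> i y)"
    using lborel_integral_scale(1)[of "\<lambda>y. u y * partial_deriv \<phi> i (r *\<^sub>R y)" r] r
    unfolding pd by (simp add: mult.left_commute)
  also have "\<dots> = - (r ^ DIM(real^'a) * (LINT y|lborel. w y $ i * ?\<psi> y))"
    unfolding sobD(3)[OF a tt] by simp
  also have "r ^ DIM(real^'a) * (LINT y|lborel. w y $ i * ?\<psi> y) = (LINT x|lborel. w (x /\<^sub>R r) $ i * \<phi> x)"
    using lborel_integral_scale(1)[of "\<lambda>y. w y $ i * \<phi> (r *\<^sub>R y)" r] r by simp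
  finally show "(LINT x|lborel. u (x /\<^sub>R r) * partial_deriv \<phi> i x) = - (LINT x|lborel. (w (x /\<^sub>R r) /\<^sub>R r) $ i * \<phi> x)"
    using r by (simp add: field_simps)
qed

text \<open>First f is cut off in space by \<open>cf k\<close> and in height by \<open>T k\<close>.
  The result is then approximated by putting continuous functions \<open>G n\<close>, converging to
  f off a negligible set, through the same two truncations, which supply the dominating function.
  Each error is below e/4 since \<open>n2_add_le\<close> doubles both.\<close>

lemma L2_approx_continuous:
  fixes f :: "'a::euclidean_space \<Rightarrow> real"
  assumes f: "L2 f" and e: "0 < e"
  obtains g R where "continuous_on UNIV g" "\<And>x. norm x > R \<Longrightarrow> g x = 0" "n2 (\<lambda>x. f x - g x) \<le> e"
proof -
  have [measurable]: "f \<in> borel_measurable borel" using f by (simp add: L2_def)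
  define cf where "cf k x = max 0 (min 1 (real k + 1 - norm x))" for k :: nat and x :: 'a
  define T where "T k s = max (- real k) (min (real k) s)" for k :: nat and s :: real
  have [measurable]: "cf k \<in> borel_measurable borel" for k unfolding cf_def by measurable
  have [measurable]: "T k \<in> borel_measurable borel" for k unfolding T_def by measurable
  have cf01: "0 \<le> cf k x" "cf k x \<le> 1" for k x by (auto simp: cf_def)
  have "(\<lambda>k. n2 (\<lambda>x. cf k x * T k (f x) - f x)) \<longlonglongrightarrow> 0"
  proof (rule L2_dominated_convergence[OF _ _ f])
    show "AE x in lborel. (\<lambda>k. cf k x * T k (f x)) \<longlonglongrightarrow> f x"
    proof (rule AE_I2, rule tendsto_eventually)
      fix x
      obtain n :: nat where n: "norm x + \<bar>f x\<bar> \<le> real n" using real_arch_simple by blast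
      show "\<forall>\<^sub>F k in sequentially. cf k x * T k (f x) = f x"
        using eventually_ge_at_top[of n]
      proof eventually_elim
        case (elim k)
        then have "real n \<le> real k" by simp
        then have "norm x \<le> real k" "- real k \<le> f x" "f x \<le> real k"
          using n norm_ge_zero[of x] by linarith+
        then have "cf k x = 1" "T k (f x) = f x"
          unfolding cf_def T_def by (simp_all add: max_def min_def)
        then show ?case by simp
      qed
    qed
    show "AE x in lborel. norm (cf k x * T k (f x) - f x) \<le> norm (f x)" for k
    proof (rule AE_I2)
      fix x
      let ?p = "cf k x * T k (f x)"
      show "norm (?p - f x) \<le> norm (f x)"
      proof (cases "0 \<le> f x")
        case True
        then have "0 \<le> T k (f x)" "T k (f x) \<le> f x" by (auto simp: T_def)
        then have "0 \<le> ?p" "?p \<le> 1 * f x"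
          using cf01[of k x] by (intro mult_nonneg_nonneg mult_mono; simp)+
        then show ?thesis by simp
      next
        case False
        then have "0 \<le> - T k (f x)" "- T k (f x) \<le> - f x" by (auto simp: T_def)
        then have "0 \<le> cf k x * (- T k (f x))" "cf k x * (- T k (f x)) \<le> 1 * (- f x)"
          using cf01[of k x] by (intro mult_nonneg_nonneg mult_mono; simp)+
        then show ?thesis using False by simp
      qed
    qed
  qed auto
  then have "\<forall>\<^sub>F k in sequentially. n2 (\<lambda>x. cf k x * T k (f x) - f x) < e / 4"
    using e by (intro order_tendstoD) auto
  then obtain k where k: "n2 (\<lambda>x. cf k x * T k (f x) - f x) < e / 4"
    by (meson eventually_sequentially le_refl)
  define fk where "fk x = cf k x * T k (f x)" for x
  have [measurable]: "fk \<in> borel_measurable borel" unfolding fk_def by measurable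
  have ccf: "continuous_on UNIV (cf k)" unfolding cf_def by (intro continuous_intros)
  have cT: "continuous_on UNIV (T k)" unfolding T_def by (intro continuous_intros)
  have supp: "cf k x = 0" if "norm x > real k + 1" for x using that by (simp add: cf_def)
  have Tb: "\<bar>T k s\<bar> \<le> real k" for s by (auto simp: T_def)
  have Lcf: "L2 (cf k)" by (rule continuous_support_L2(1)[OF ccf supp])
  have Lfk: "L2 fk"
  proof (rule L2_bounded(1)[OF Lcf])
    show "norm (fk x) \<le> real k * norm (cf k x)" for x
      using mult_right_mono[OF Tb[of "f x"] abs_ge_zero[of "cf k x"]] by (simp add: fk_def abs_mult mult.commute)
  qed simp
  have "f \<in> borel_measurable lebesgue" by (rule measurable_completion) simp
  then have "f measurable_on UNIV" by (rule lebesgue_measurable_imp_measurable_on) simp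
  then obtain N G where N: "negligible N" and G: "\<And>n. continuous_on UNIV (G n)"
    and lim: "\<And>x. x \<notin> N \<Longrightarrow> (\<lambda>n. G n x) \<longlonglongrightarrow> f x"
    unfolding measurable_on_def by auto
  have "AE x in lebesgue. x \<notin> N" using N by (intro AE_not_in) (simp add: negligible_iff_null_sets)
  then have AEN: "AE x in lborel. x \<notin> N" by (simp add: AE_completion_iff)
  define g where "g n x = cf k x * T k (G n x)" for n x
  have cg: "continuous_on UNIV (g n)" for n
    unfolding g_def by (intro continuous_intros ccf continuous_on_compose2[OF cT] G) auto
  then have [measurable]: "g n \<in> borel_measurable borel" for n by (rule borel_measurable_continuous_onI)
  have gs: "g n x = 0" if "norm x > real k + 1" for n x using supp[OF that] by (simp add: g_def)
  have "(\<lambda>n. n2 (\<lambda>x. g n x - fk x)) \<longlonglongrightarrow> 0"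
  proof (rule L2_dominated_convergence[OF _ _ L2_cmult[OF Lcf, of "2 * real k"]])
    show "AE x in lborel. (\<lambda>n. g n x) \<longlonglongrightarrow> fk x"
      using AEN
    proof eventually_elim
      case (elim x)
      have "isCont (T k) (f x)" using cT by (simp add: continuous_on_eq_continuous_at)
      from isCont_tendsto_compose[OF this lim[OF elim]]
      show ?case unfolding g_def fk_def by (intro tendsto_intros)
    qed
    show "AE x in lborel. norm (g n x - fk x) \<le> norm (2 * real k * cf k x)" for n
    proof (rule AE_I2)
      fix x
      have "\<bar>T k (G n x) - T k (f x)\<bar> \<le> 2 * real k" using Tb[of "G n x"] Tb[of "f x"] by linarith
      then have "cf k x * \<bar>T k (G n x) - T k (f x)\<bar> \<le> cf k x * (2 * real k)"
        using cf01 by (intro mult_left_mono) auto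
      then show "norm (g n x - fk x) \<le> norm (2 * real k * cf k x)"
        using cf01[of k x] unfolding g_def fk_def right_diff_distrib[symmetric]
        by (simp add: abs_mult mult.commute)
    qed
  qed auto
  then have "\<forall>\<^sub>F n in sequentially. n2 (\<lambda>x. g n x - fk x) < e / 4"
    using e by (intro order_tendstoD) auto
  then obtain n where n: "n2 (\<lambda>x. g n x - fk x) < e / 4"
    by (meson eventually_sequentially le_refl)
  have Lg: "L2 (g n)" by (rule continuous_support_L2(1)[OF cg gs])
  have "n2 (\<lambda>x. (f x - fk x) + (fk x - g n x)) \<le> 2 * n2 (\<lambda>x. f x - fk x) + 2 * n2 (\<lambda>x. fk x - g n x)"
    by (intro n2_add_le L2_diff f Lfk Lg)
  also have "\<dots> \<le> e"
    using k n n2_commute[of f fk] n2_commute[of fk "g n"] by (simp add: fk_def)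
  finally have "n2 (\<lambda>x. f x - g n x) \<le> e" by simp
  with cg gs show thesis by (rule that)
qed

text \<open>Otherwise shifts h tending to 0 move f by more than e. For a continuous approximation g
  of bounded support dominated convergence applies; transferring to f costs 6
  \<open>n2 (f - g)\<close> plus 4 times the shift error of g, which explains e/24 and e/8.\<close>

lemma L2_translate_continuous:
  fixes f :: "'a::euclidean_space \<Rightarrow> real"
  assumes f: "L2 f" and e: "0 < e"
  shows "\<exists>d>0. \<forall>h. norm h < d \<longrightarrow> n2 (\<lambda>x. f (x + h) - f x) \<le> e"
proof (rule ccontr)
  assume neg: "\<not> ?thesis"
  obtain g R where g: "continuous_on UNIV g" and R: "\<And>x. norm x > R \<Longrightarrow> g x = 0"
    and ng: "n2 (\<lambda>x. f x - g x) \<le> e / 24"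
    using L2_approx_continuous[OF f, of "e / 24"] e by auto
  have "\<exists>h. norm h < 1 / real (Suc n) \<and> n2 (\<lambda>x. f (x + h) - f x) > e" for n
  proof -
    have "0 < 1 / real (Suc n)" by simp
    then show ?thesis using neg not_le by blast
  qed
  then obtain h where h: "\<And>n. norm (h n) < 1 / real (Suc n)" and he: "\<And>n. n2 (\<lambda>x. f (x + h n) - f x) > e"
    by metis
  have h0: "h \<longlonglongrightarrow> 0"
  proof (rule Lim_null_comparison)
    show "\<forall>\<^sub>F n in sequentially. norm (h n) \<le> inverse (real (Suc n))"
      using h by (intro always_eventually allI) (simp add: less_imp_le inverse_eq_divide)
  qed (rule LIMSEQ_inverse_real_of_nat)
  have h1: "norm (h n) \<le> 1" for n
    using h[of n] by (rule less_imp_le[OF less_le_trans]) simp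
  note Lg = continuous_support_L2(1)[OF g R]
  obtain C where C: "\<And>x. norm (g x) \<le> C" "0 \<le> C" using continuous_support_L2(2)[OF g R] by auto
  have [measurable]: "g \<in> borel_measurable borel" using g by (rule borel_measurable_continuous_onI)
  have LI: "L2 (indicator (cball 0 (R + 1)) :: 'a \<Rightarrow> real)"
    by (rule L2_indicator_cball)
  have "(\<lambda>n. n2 (\<lambda>x. g (x + h n) - g x)) \<longlonglongrightarrow> 0"
  proof (rule L2_dominated_convergence[OF _ _ L2_cmult[OF LI, of "2 * C"]])
    show "AE x in lborel. (\<lambda>n. g (x + h n)) \<longlonglongrightarrow> g x"
    proof (rule AE_I2)
      fix x
      have "(\<lambda>n. x + h n) \<longlonglongrightarrow> x + 0" by (intro tendsto_intros h0)
      moreover have "isCont g x" using g by (simp add: continuous_on_eq_continuous_at)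
      ultimately show "(\<lambda>n. g (x + h n)) \<longlonglongrightarrow> g x" using isCont_tendsto_compose[of x g] by simp
    qed
    show "AE x in lborel. norm (g (x + h n) - g x) \<le> norm (2 * C * indicator (cball 0 (R + 1)) x :: real)" for n
    proof (rule AE_I2)
      fix x
      show "norm (g (x + h n) - g x) \<le> norm (2 * C * indicator (cball 0 (R + 1)) x :: real)"
      proof (cases "norm x \<le> R + 1")
        case True
        then show ?thesis
          using C(1)[of x] C(1)[of "x + h n"] C(2) norm_triangle_ineq4[of "g (x + h n)" "g x"] by simp
      next
        case False
        then have "norm (x + h n) > R" "norm x > R"
          using h1[of n] norm_diff_ineq[of x "h n"] by auto
        then show ?thesis using R by simp
      qed
    qed
  qed auto
  then have "\<forall>\<^sub>F n in sequentially. n2 (\<lambda>x. g (x + h n) - g x) < e / 8"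
    using e by (intro order_tendstoD) auto
  then obtain n where n: "n2 (\<lambda>x. g (x + h n) - g x) < e / 8"
    by (meson eventually_sequentially le_refl)
  define p where "p x = f x - g x" for x
  have Lp: "L2 p" unfolding p_def by (intro L2_diff f Lg)
  have "n2 (\<lambda>x. p (x + h n) + ((g (x + h n) - g x) - p x))
      \<le> 2 * n2 (\<lambda>x. p (x + h n)) + 2 * n2 (\<lambda>x. (g (x + h n) - g x) - p x)"
    by (intro n2_add_le L2_diff L2_translate Lp Lg)
  also have "n2 (\<lambda>x. (g (x + h n) - g x) - p x) \<le> 2 * n2 (\<lambda>x. g (x + h n) - g x) + 2 * n2 p"
    by (intro n2_diff_le L2_diff L2_translate Lp Lg)
  also have "n2 (\<lambda>x. p (x + h n)) = n2 p" by (rule L2_translate(2)[OF Lp])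
  finally have "n2 (\<lambda>x. f (x + h n) - f x) \<le> 6 * n2 p + 4 * n2 (\<lambda>x. g (x + h n) - g x)"
    by (simp add: p_def[abs_def])
  also have "\<dots> \<le> 6 * (e / 24) + 4 * (e / 8)" using ng n by (simp add: p_def[abs_def])
  also have "\<dots> \<le> e" using e by simp
  finally show False using he[of n] by simp
qed

section \<open>Characterisation of weak gradients by difference quotients\<close>

definition dquot :: "(real^'n \<Rightarrow> real) \<Rightarrow> real \<Rightarrow> 'n \<Rightarrow> real^'n::finite \<Rightarrow> real" where
  "dquot F s i x = (F (x + s *\<^sub>R axis i 1) - F x) / s"

lemma L2_dquot:
  assumes "L2 F"
  shows "L2 (dquot F s i)"
proof -
  have "L2 (\<lambda>x. (1 / s) * (F (x + s *\<^sub>R axis i 1) - F x))"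
    by (intro L2_cmult L2_diff L2_translate assms)
  then show ?thesis by (simp add: dquot_def[abs_def])
qed

text \<open>By \<open>sob_increment\<close>, the quotient minus \<open>w x $ i\<close> is the
  average over t in [0,1] of the increments of that component from x to x + t h, and these are small
  by continuity of translations in L2.\<close>

lemma dquot_sob:
  fixes u :: "real^'n::finite \<Rightarrow> real"
  assumes a: "sob u w" and s: "s \<longlonglongrightarrow> 0" "\<And>k. s k \<noteq> 0"
  shows "(\<lambda>k. n2 (\<lambda>x. dquot u (s k) i x - w x $ i)) \<longlonglongrightarrow> 0"
proof (rule LIMSEQ_I)
  fix e :: real assume e: "0 < e"
  note u = sobD(1)[OF a] and w = sobD(2)[OF a]
  note wi = L2_nth(1)[OF w, of i]
  have [measurable]: "w \<in> borel_measurable borel" using w by (simp add: L2_def)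
  obtain d where d: "0 < d" "\<And>h. norm h < d \<Longrightarrow> n2 (\<lambda>x. w (x + h) $ i - w x $ i) \<le> e / 2"
    using L2_translate_continuous[OF wi, of "e/2"] e by auto
  have "\<forall>\<^sub>F k in sequentially. norm (s k - 0) < d"
    using s(1) d(1) by (simp add: tendsto_iff dist_norm)
  then obtain K where K: "\<And>k. k \<ge> K \<Longrightarrow> \<bar>s k\<bar> < d" by (auto simp: eventually_sequentially)
  show "\<exists>no. \<forall>n\<ge>no. norm (n2 (\<lambda>x. dquot u (s n) i x - w x $ i) - 0) < e"
  proof (intro exI allI impI)
    fix k assume k: "K \<le> k"
    let ?h = "s k *\<^sub>R axis i (1::real)"
    let ?F = "\<lambda>t x. w (x + t *\<^sub>R ?h) $ i"
    have small: "norm (t *\<^sub>R ?h) < d" if "t \<in> {0..1}" for t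
    proof -
      have "norm (t *\<^sub>R ?h) = \<bar>t\<bar> * \<bar>s k\<bar>" by (simp add: norm_axis_1 abs_mult)
      also have "\<dots> \<le> 1 * \<bar>s k\<bar>" using that by (intro mult_right_mono) auto
      finally show ?thesis using K[OF k] by simp
    qed
    have 1: "(\<integral>\<^sup>+x. ennreal ((?F t x - w x $ i)\<^sup>2) \<partial>lborel) \<le> ennreal (e / 2)" if "t \<in> {0..1}" for t
      using L2_nn_integral[OF L2_diff[OF L2_translate(1)[OF wi, of "t *\<^sub>R ?h"] wi]] d(2)[OF small[OF that]]
      by (simp add: ennreal_leI)
    have 2: "(\<integral>\<^sup>+x. ennreal ((?F t x)\<^sup>2) \<partial>lborel) \<le> ennreal (n2 w)" if "t \<in> {0..1}" for t
      using L2_nn_integral[OF L2_translate(1)[OF wi, of "t *\<^sub>R ?h"]] L2_translate(2)[OF wi, of "t *\<^sub>R ?h"] L2_nth(2)[OF w, of i]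
      by (simp add: ennreal_leI)
    let ?Q = "\<lambda>x. LINT t|lborel. indicator {0..1::real} t * (?F t x - w x $ i)"
    have m1: "(\<lambda>(t, x). ?F t x - w x $ i) \<in> borel_measurable (lborel \<Otimes>\<^sub>M lborel)" by measurable
    have m2: "(\<lambda>(t, x). ?F t x) \<in> borel_measurable (lborel \<Otimes>\<^sub>M lborel)" by measurable
    have Q: "L2 ?Q" "n2 ?Q \<le> e / 2"
      using L2_average(1,2)[of "\<lambda>t x. ?F t x - w x $ i" "e/2", OF m1 1] e by auto
    have AEi: "AE x in lborel. integrable lborel (\<lambda>t. indicator {0..1} t * ?F t x)"
      using L2_average(3)[of ?F "n2 w", OF m2 2] by simp
    have "AE x in lborel. ?Q x = dquot u (s k) i x - w x $ i"
      using sob_increment(1)[OF a, of ?h] AEi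
    proof eventually_elim
      case (elim x)
      have ind: "integrable lborel (\<lambda>t. indicator {0..1::real} t * w x $ i)"
        by (intro integrable_mult_left integrable_real_indicator) auto
      have "u (x + ?h) - u x = (LINT t|lborel. s k * (indicator {0..1} t * ?F t x))"
        unfolding elim(1) by (intro Bochner_Integration.integral_cong) (auto simp: inner_axis)
      then have "(LINT t|lborel. indicator {0..1} t * ?F t x) = dquot u (s k) i x"
        using s(2)[of k] by (simp add: dquot_def)
      moreover have "?Q x = (LINT t|lborel. indicator {0..1} t * ?F t x) - (LINT t|lborel. indicator {0..1::real} t * w x $ i)"
        unfolding right_diff_distrib by (rule Bochner_Integration.integral_diff[OF elim(2) ind])
      moreover have "(LINT t|lborel. indicator {0..1::real} t * w x $ i) = w x $ i" by simp
      ultimately show ?case by simp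
    qed
    from L2_cong_AE(2)[OF Q(1) _ this] L2_diff[OF L2_dquot[OF u] wi, of "s k" i] Q(2)
    show "norm (n2 (\<lambda>x. dquot u (s k) i x - w x $ i) - 0) < e"
      using e by (simp add: L2_def)
  qed
qed

lemma C1_lipschitz:
  fixes F :: "real^'n::finite \<Rightarrow> real"
  assumes F: "\<And>x. (F has_derivative (\<lambda>v. v \<bullet> DF x)) (at x)" and C: "\<And>x. norm (DF x) \<le> C"
  shows "\<bar>F x - F y\<bar> \<le> C * norm (x - y)"
proof -
  have "norm (F x - F y) \<le> C * norm (x - y)"
  proof (rule differentiable_bound[where S=UNIV and f'="\<lambda>x v. v \<bullet> DF x"])
    show "onorm (\<lambda>v. v \<bullet> DF x) \<le> C" for x
    proof (rule onorm_le)
      fix v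
      have "norm (v \<bullet> DF x) \<le> norm v * norm (DF x)" using Cauchy_Schwarz_ineq2 by simp
      also have "\<dots> \<le> norm v * C" by (intro mult_left_mono C) simp
      finally show "norm (v \<bullet> DF x) \<le> C * norm v" by (simp add: mult.commute)
    qed
  qed (use F in auto)
  then show ?thesis by simp
qed

lemma dquot_tendsto:
  fixes F :: "real^'n::finite \<Rightarrow> real"
  assumes F: "(F has_derivative (\<lambda>v. v \<bullet> D)) (at x)" and s: "s \<longlonglongrightarrow> 0" "\<And>k. s k \<noteq> 0"
  shows "(\<lambda>k. dquot F (s k) i x) \<longlonglongrightarrow> D $ i"
proof -
  have "((\<lambda>t. x + t *\<^sub>R axis i (1::real)) has_derivative (\<lambda>t. t *\<^sub>R axis i 1)) (at 0)"
    by (auto intro!: derivative_eq_intros)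
  moreover have "(F has_derivative (\<lambda>v. v \<bullet> D)) (at (x + 0 *\<^sub>R axis i (1::real)))" using F by simp
  ultimately have "((\<lambda>t. F (x + t *\<^sub>R axis i 1)) has_derivative (\<lambda>t. (t *\<^sub>R axis i 1) \<bullet> D)) (at 0)"
    by (rule has_derivative_compose)
  then have "((\<lambda>t. F (x + t *\<^sub>R axis i 1)) has_real_derivative D $ i) (at 0)"
    by (simp add: has_field_derivative_def inner_axis' mult_commute_abs)
  then have "((\<lambda>h. (F (x + h *\<^sub>R axis i 1) - F x) / h) \<longlongrightarrow> D $ i) (at 0)"
    by (simp add: DERIV_def)
  moreover have "filterlim s (at 0) sequentially"
    using s by (simp add: filterlim_at)
  ultimately show ?thesis unfolding dquot_def by (rule filterlim_compose)
qed

text \<open>Outside the ball of radius R + S, with S bounding all steps, the quotient and the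
  derivative vanish; inside, both are at most C. So dominated convergence applies.\<close>

lemma dquot_C1_support:
  fixes F :: "real^'n::finite \<Rightarrow> real"
  assumes F: "\<And>x. (F has_derivative (\<lambda>v. v \<bullet> DF x)) (at x)" and cont: "continuous_on UNIV DF"
    and R: "\<And>x. norm x > R \<Longrightarrow> F x = 0" and s: "s \<longlonglongrightarrow> 0" "\<And>k. s k \<noteq> 0"
  shows "L2 F" "L2 DF" "(\<lambda>k. n2 (\<lambda>x. dquot F (s k) i x - DF x $ i)) \<longlonglongrightarrow> 0"
proof -
  have cF: "continuous_on UNIV F"
    using F by (meson continuous_at_imp_continuous_on has_derivative_continuous)
  show LF: "L2 F" by (rule continuous_support_L2(1)[OF cF R])
  have R': "DF x = 0" if "norm x > R" for x
  proof -
    have "open {x::real^'n. R < norm x}" by (intro open_Collect_less continuous_intros)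
    then have "(F has_derivative (\<lambda>_. 0)) (at x)"
      using has_derivative_transform_within_open[of "\<lambda>_. 0" "\<lambda>_. 0" x UNIV "{x. R < norm x}" F] that R
      by auto
    from has_derivative_unique[OF F[of x] this] have "DF x \<bullet> DF x = 0" by metis
    then show ?thesis by simp
  qed
  show LDF: "L2 DF" by (rule continuous_support_L2(1)[OF cont R'])
  obtain C where C: "\<And>x. norm (DF x) \<le> C" "0 \<le> C" using continuous_support_L2(2)[OF cont R'] by auto
  have "Bseq s" using s(1) by (intro convergent_imp_Bseq) (auto simp: convergent_def)
  then obtain S where S: "\<And>k. \<bar>s k\<bar> \<le> S" "0 < S" by (auto simp: Bseq_def)
  have LI: "L2 (indicator (cball 0 (R + S)) :: real^'n \<Rightarrow> real)"
    by (rule L2_indicator_cball)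
  have [measurable]: "F \<in> borel_measurable borel" "DF \<in> borel_measurable borel"
    using LF LDF by (auto simp: L2_def)
  show "(\<lambda>k. n2 (\<lambda>x. dquot F (s k) i x - DF x $ i)) \<longlonglongrightarrow> 0"
  proof (rule L2_dominated_convergence[OF _ _ L2_cmult[OF LI, of "2 * C"]])
    show "dquot F (s k) i \<in> borel_measurable borel" for k unfolding dquot_def by measurable
    show "AE x in lborel. (\<lambda>k. dquot F (s k) i x) \<longlonglongrightarrow> DF x $ i"
      using dquot_tendsto[OF F s] by simp
    show "AE x in lborel. norm (dquot F (s k) i x - DF x $ i) \<le> norm (2 * C * indicator (cball 0 (R + S)) x :: real)" for k
    proof (rule AE_I2)
      fix x
      show "norm (dquot F (s k) i x - DF x $ i) \<le> norm (2 * C * indicator (cball 0 (R + S)) x :: real)"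
      proof (cases "norm x \<le> R + S")
        case True
        have "\<bar>F (x + s k *\<^sub>R axis i 1) - F x\<bar> \<le> C * \<bar>s k\<bar>"
          using C1_lipschitz[of F DF C "x + s k *\<^sub>R axis i 1" x, OF F C(1)] by (simp add: norm_axis_1)
        then have "\<bar>dquot F (s k) i x\<bar> \<le> C"
          using s(2)[of k] by (simp add: dquot_def field_simps)
        moreover have "\<bar>DF x $ i\<bar> \<le> C" using C(1)[of x] component_le_norm_cart order_trans by blast
        ultimately show ?thesis using True C(2) by simp
      next
        case False
        have "norm x - \<bar>s k\<bar> \<le> norm (x + s k *\<^sub>R axis i 1)"
          using norm_diff_ineq[of x "s k *\<^sub>R axis i 1"] by (simp add: norm_axis_1)
        then have "norm (x + s k *\<^sub>R axis i 1) > R" "norm x > R"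
          using S(1)[of k] S(2) False by linarith+
        then show ?thesis using R R' by (simp add: dquot_def)
      qed
    qed
  qed auto
qed

text \<open>Summation by parts for quotients: the step s on F corresponds to the step - s on the
  test function. Together with \<open>dquot_sob\<close> this reduces the chain and product rules to
  identities for quotients. The steps may depend on i because they will be extracted as
  subsequences.\<close>

lemma sob_of_dquot:
  fixes F :: "real^'n::finite \<Rightarrow> real"
  assumes F: "L2 F" and W: "L2 W"
    and dq: "\<And>i. \<exists>s. s \<longlonglongrightarrow> 0 \<and> (\<forall>k. s k \<noteq> 0) \<and> (\<lambda>k. n2 (\<lambda>x. dquot F (s k) i x - W x $ i)) \<longlonglongrightarrow> 0"
  shows "sob F W"
  unfolding sob_def
proof (intro conjI allI impI F W)
  fix i and \<phi> :: "real^'n \<Rightarrow> real"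
  assume t: "test_fun \<phi>"
  then have sm: "smooth_fun \<phi>" and "\<exists>R. \<forall>x. norm x > R \<longrightarrow> \<phi> x = 0" by (auto simp: test_fun_def)
  then obtain R where R: "\<And>x. norm x > R \<Longrightarrow> \<phi> x = 0" by blast
  note \<phi> = test_fun_L2[OF t] and d\<phi> = test_fun_L2[OF test_fun_partial_deriv[OF t]]
  have [measurable]: "\<phi> \<in> borel_measurable borel" "F \<in> borel_measurable borel" using \<phi> F by (auto simp: L2_def)
  obtain s where s: "s \<longlonglongrightarrow> 0" "\<And>k. s k \<noteq> 0"
    and lim: "(\<lambda>k. n2 (\<lambda>x. dquot F (s k) i x - W x $ i)) \<longlonglongrightarrow> 0" using dq by blast
  have ms: "(\<lambda>k. - s k) \<longlonglongrightarrow> 0" using tendsto_minus[OF s(1)] by simp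
  have "continuous_on UNIV (\<lambda>x. \<chi> i. partial_deriv \<phi> i x)"
    by (intro continuous_on_vec_lambda smooth_fun_continuous smooth_fun_partial_deriv sm)
  from dquot_C1_support(3)[OF smooth_fun_has_derivative[OF sm] this R ms, where i=i]
  have "(\<lambda>k. n2 (\<lambda>x. dquot \<phi> (- s k) i x - partial_deriv \<phi> i x)) \<longlonglongrightarrow> 0"
    using s(2) by simp
  from L2_limit_inner[OF L2_dquot[OF \<phi>] d\<phi> this F]
  have 1: "(\<lambda>k. LINT x|lborel. F x * dquot \<phi> (- s k) i x) \<longlonglongrightarrow> (LINT x|lborel. F x * partial_deriv \<phi> i x)"
    by (simp add: mult.commute)
  have "(LINT x|lborel. F x * dquot \<phi> (- s k) i x) = - (LINT x|lborel. dquot F (s k) i x * \<phi> x)" for k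
  proof -
    let ?h = "s k *\<^sub>R axis i (1::real)"
    have i1: "integrable lborel (\<lambda>x. F x * \<phi> x)" by (rule L2_mult_integrable[OF F \<phi>])
    have i2: "integrable lborel (\<lambda>x. F x * \<phi> (x - ?h))"
      using L2_mult_integrable[OF F L2_translate(1)[OF \<phi>, of "- ?h"]] by simp
    have i3: "integrable lborel (\<lambda>x. F (x + ?h) * \<phi> x)"
      by (rule L2_mult_integrable[OF L2_translate(1)[OF F] \<phi>])
    have tr: "(LINT x|lborel. F (x + ?h) * \<phi> x) = (LINT x|lborel. F x * \<phi> (x - ?h))"
      using lborel_integral_translate(1)[of "\<lambda>x. F x * \<phi> (x - ?h)" ?h] by simp
    have "(LINT x|lborel. F x * dquot \<phi> (- s k) i x) = (LINT x|lborel. (F x * \<phi> x - F x * \<phi> (x - ?h)) / s k)"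
      using s(2)[of k] by (intro Bochner_Integration.integral_cong) (auto simp: dquot_def field_simps)
    also have "\<dots> = ((LINT x|lborel. F x * \<phi> x) - (LINT x|lborel. F (x + ?h) * \<phi> x)) / s k"
      using i1 i2 tr by simp
    also have "\<dots> = (LINT x|lborel. (F x * \<phi> x - F (x + ?h) * \<phi> x) / s k)"
      using i1 i3 by simp
    also have "\<dots> = (LINT x|lborel. - (dquot F (s k) i x * \<phi> x))"
      using s(2)[of k] by (intro Bochner_Integration.integral_cong) (auto simp: dquot_def field_simps)
    finally show ?thesis by simp
  qed
  moreover have "(\<lambda>k. - (LINT x|lborel. dquot F (s k) i x * \<phi> x)) \<longlonglongrightarrow> - (LINT x|lborel. W x $ i * \<phi> x)"
    using L2_limit_inner[OF L2_dquot[OF F] L2_nth(1)[OF W] lim \<phi>] by (intro tendsto_minus) simp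
  ultimately have 2: "(\<lambda>k. LINT x|lborel. F x * dquot \<phi> (- s k) i x) \<longlonglongrightarrow> - (LINT x|lborel. W x $ i * \<phi> x)"
    by simp
  show "(LINT x|lborel. F x * partial_deriv \<phi> i x) = - (LINT x|lborel. W x $ i * \<phi> x)"
    by (rule LIMSEQ_unique[OF 1 2])
qed

lemma sob_C1_support:
  fixes F :: "real^'n::finite \<Rightarrow> real"
  assumes "\<And>x. (F has_derivative (\<lambda>v. v \<bullet> DF x)) (at x)" "continuous_on UNIV DF"
    and "\<And>x. norm x > R \<Longrightarrow> F x = 0"
  shows "sob F DF"
proof -
  have s: "(\<lambda>n. inverse (real (Suc n))) \<longlonglongrightarrow> 0" "\<And>n. inverse (real (Suc n)) \<noteq> 0"
    by (rule LIMSEQ_inverse_real_of_nat) simp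
  show ?thesis
    by (rule sob_of_dquot) (use dquot_C1_support[OF assms s] s in blast)+
qed

section \<open>Chain rule and product rule\<close>

lemma real_lipschitz:
  fixes F :: "real \<Rightarrow> real"
  assumes F: "\<And>t. (F has_real_derivative F' t) (at t)" and L: "\<And>t. \<bar>F' t\<bar> \<le> L"
  shows "\<bar>F s - F t\<bar> \<le> L * \<bar>s - t\<bar>"
proof -
  have "norm (F s - F t) \<le> L * norm (s - t)"
  proof (rule differentiable_bound[where S=UNIV and f'="\<lambda>x. (*) (F' x)"])
    show "onorm ((*) (F' x)) \<le> L" for x
      by (rule onorm_le) (use L in \<open>auto simp: abs_mult intro: mult_right_mono\<close>)
  qed (use F in \<open>auto simp: has_field_derivative_def\<close>)
  then show ?thesis by simp
qed

lemma null_sequence_squeeze: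
  fixes f :: "nat \<Rightarrow> real"
  assumes "\<And>k. 0 \<le> f k" "\<And>k. f k \<le> g k" "g \<longlonglongrightarrow> 0"
  shows "f \<longlonglongrightarrow> 0"
  by (rule Lim_null_comparison[OF _ assms(3)]) (use assms in \<open>auto intro!: always_eventually\<close>)

text \<open>The quotients of F(u) involve u at the shifted point, so the shifts must converge
  pointwise. They converge in L2 because their distance to u is at most |s| times the norm of the
  gradient.\<close>

lemma sob_shift_AE_subseq:
  fixes u :: "real^'n::finite \<Rightarrow> real"
  assumes a: "sob u w"
  obtains s where "s \<longlonglongrightarrow> 0" "\<And>k. s k \<noteq> 0" "AE x in lborel. (\<lambda>k. u (x + s k *\<^sub>R axis i 1)) \<longlonglongrightarrow> u x"
proof -
  note u = sobD(1)[OF a] and w = sobD(2)[OF a]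
  let ?s = "\<lambda>k. inverse (real (Suc k))"
  have s0: "?s \<longlonglongrightarrow> 0" by (rule LIMSEQ_inverse_real_of_nat)
  have "(\<lambda>k. n2 (\<lambda>x. u (x + ?s k *\<^sub>R axis i 1) - u x)) \<longlonglongrightarrow> 0"
  proof (rule null_sequence_squeeze)
    show "n2 (\<lambda>x. u (x + ?s k *\<^sub>R axis i 1) - u x) \<le> (?s k)\<^sup>2 * n2 w" for k
      using sob_increment(2)[OF a, of "?s k *\<^sub>R axis i 1"] by (simp add: norm_axis_1)
    show "(\<lambda>k. (?s k)\<^sup>2 * n2 w) \<longlonglongrightarrow> 0"
      using tendsto_mult_right[OF tendsto_power[OF s0, of 2], of "n2 w"] by simp
  qed simp
  from L2_AE_subseq[OF L2_translate(1)[OF u] u this]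
  obtain r :: "nat \<Rightarrow> nat" where r: "strict_mono r" "AE x in lborel. (\<lambda>k. u (x + ?s (r k) *\<^sub>R axis i 1)) \<longlonglongrightarrow> u x"
    by blast
  show thesis
  proof (rule that[of "\<lambda>k. ?s (r k)"])
    show "(\<lambda>k. ?s (r k)) \<longlonglongrightarrow> 0"
      using LIMSEQ_subseq_LIMSEQ[OF s0 r(1)] by (simp add: o_def)
  qed (use r(2) in auto)
qed

text \<open>The quotient of F(u) is \<open>A k\<close> times the quotient of u, where
  \<open>A k\<close> is bounded by L and tends to F'(u) almost everywhere. The error is a bounded
  factor times the quotient error of u, plus \<open>(A k - F'(u))\<close> times the gradient
  component, which dominated convergence handles.\<close>

lemma sob_chain:
  fixes u :: "real^'n::finite \<Rightarrow> real"
  assumes a: "sob u w" and F: "\<And>t. (F has_real_derivative F' t) (at t)"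
    and F'm [measurable]: "F' \<in> borel_measurable borel" and L: "\<And>t. \<bar>F' t\<bar> \<le> L" and F0: "F 0 = 0"
  shows "sob (\<lambda>x. F (u x)) (\<lambda>x. F' (u x) *\<^sub>R w x)"
proof -
  note u = sobD(1)[OF a] and w = sobD(2)[OF a]
  have [measurable]: "u \<in> borel_measurable borel" "w \<in> borel_measurable borel" using u w by (auto simp: L2_def)
  have "continuous_on UNIV F" using F by (meson DERIV_isCont continuous_at_imp_continuous_on)
  then have [measurable]: "F \<in> borel_measurable borel" by (rule borel_measurable_continuous_onI)
  have L0: "0 \<le> L" using L[of 0] by linarith
  have lip: "\<bar>F s - F t\<bar> \<le> L * \<bar>s - t\<bar>" for s t by (rule real_lipschitz[OF F L])
  have LF: "L2 (\<lambda>x. F (u x))"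
    by (rule L2_bounded(1)[OF u, of _ L]) (use lip[of _ 0] F0 in auto)
  have LW: "L2 (\<lambda>x. F' (u x) *\<^sub>R w x)"
    by (rule L2_bounded(1)[OF w, of _ L]) (use L in \<open>auto intro: mult_right_mono\<close>)
  show ?thesis
  proof (rule sob_of_dquot[OF LF LW])
    fix i
    obtain s where s: "s \<longlonglongrightarrow> 0" "\<And>k. s k \<noteq> 0"
      and AE: "AE x in lborel. (\<lambda>k. u (x + s k *\<^sub>R axis i 1)) \<longlonglongrightarrow> u x"
      using sob_shift_AE_subseq[OF a] by blast
    define U where "U k x = u (x + s k *\<^sub>R axis i 1)" for k x
    have [measurable]: "U k \<in> borel_measurable borel" for k unfolding U_def by measurable
    \<comment> \<open>Where the two values of u coincide, both sides of \<open>dq\<close> are 0; the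
      value F'(u) makes the secant slope continuous there.\<close>
    define A where "A k x = (if U k x = u x then F' (u x) else (F (U k x) - F (u x)) / (U k x - u x))" for k x
    have [measurable]: "A k \<in> borel_measurable borel" for k unfolding A_def by measurable
    have AL: "\<bar>A k x\<bar> \<le> L" for k x
      using L lip[of "U k x" "u x"] by (auto simp: A_def field_simps)
    have dq: "dquot (\<lambda>x. F (u x)) (s k) i x = A k x * dquot u (s k) i x" for k x
      by (auto simp: dquot_def A_def U_def)
    have Alim: "AE x in lborel. (\<lambda>k. A k x) \<longlonglongrightarrow> F' (u x)"
      using AE
    proof eventually_elim
      case (elim x)
      have "((\<lambda>y. (F y - F (u x)) / (y - u x)) \<longlongrightarrow> F' (u x)) (at (u x))"
        using F[of "u x"] by (simp add: has_field_derivative_iff)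
      then have "((\<lambda>y. if y = u x then F' (u x) else (F y - F (u x)) / (y - u x)) \<longlongrightarrow> F' (u x)) (at (u x))"
        by (rule Lim_transform_eventually) (auto simp: eventually_at_filter)
      then have "isCont (\<lambda>y. if y = u x then F' (u x) else (F y - F (u x)) / (y - u x)) (u x)"
        by (simp add: isCont_def)
      from isCont_tendsto_compose[OF this elim]
      show ?case unfolding A_def U_def by simp
    qed
    have wi: "L2 (\<lambda>x. w x $ i)" by (rule L2_nth[OF w])
    have p1: "L2 (\<lambda>x. A k x * (dquot u (s k) i x - w x $ i))"
      "n2 (\<lambda>x. A k x * (dquot u (s k) i x - w x $ i)) \<le> L\<^sup>2 * n2 (\<lambda>x. dquot u (s k) i x - w x $ i)" for k
    proof -
      have d: "L2 (\<lambda>x. dquot u (s k) i x - w x $ i)" by (intro L2_diff L2_dquot u wi)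
      then have [measurable]: "(\<lambda>x. dquot u (s k) i x - w x $ i) \<in> borel_measurable borel" by (simp add: L2_def)
      have m: "(\<lambda>x. A k x * (dquot u (s k) i x - w x $ i)) \<in> borel_measurable borel" by (intro borel_measurable_times) measurable
      have "norm (A k x * (dquot u (s k) i x - w x $ i)) \<le> L * norm (dquot u (s k) i x - w x $ i)" for x
        using AL by (auto simp: abs_mult intro: mult_right_mono)
      from L2_bounded[OF d m this] show "L2 (\<lambda>x. A k x * (dquot u (s k) i x - w x $ i))"
        "n2 (\<lambda>x. A k x * (dquot u (s k) i x - w x $ i)) \<le> L\<^sup>2 * n2 (\<lambda>x. dquot u (s k) i x - w x $ i)" .
    qed
    have bd: "norm (A k x * w x $ i - F' (u x) * w x $ i) \<le> norm (2 * L * w x $ i)" for k x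
    proof -
      have "\<bar>A k x - F' (u x)\<bar> \<le> 2 * L" using AL[of k x] L[of "u x"] by linarith
      then have "\<bar>A k x - F' (u x)\<bar> * \<bar>w x $ i\<bar> \<le> 2 * L * \<bar>w x $ i\<bar>" by (intro mult_right_mono) auto
      then show ?thesis using L0 unfolding left_diff_distrib[symmetric] by (simp add: abs_mult)
    qed
    have p2: "L2 (\<lambda>x. A k x * w x $ i - F' (u x) * w x $ i)" for k
      by (rule L2_bounded(1)[OF wi, of _ "2 * L"]) (use bd L0 in \<open>auto simp: abs_mult\<close>)
    have l2: "(\<lambda>k. n2 (\<lambda>x. A k x * w x $ i - F' (u x) * w x $ i)) \<longlonglongrightarrow> 0"
    proof (rule L2_dominated_convergence[OF _ _ L2_cmult[OF wi, of "2 * L"]])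
      show "AE x in lborel. (\<lambda>k. A k x * w x $ i) \<longlonglongrightarrow> F' (u x) * w x $ i"
        using Alim by eventually_elim (intro tendsto_intros)
    qed (use bd in auto)
    have "(\<lambda>k. n2 (\<lambda>x. dquot (\<lambda>x. F (u x)) (s k) i x - (F' (u x) *\<^sub>R w x) $ i)) \<longlonglongrightarrow> 0"
    proof (rule null_sequence_squeeze)
      fix k
      have "n2 (\<lambda>x. dquot (\<lambda>x. F (u x)) (s k) i x - (F' (u x) *\<^sub>R w x) $ i)
         = n2 (\<lambda>x. A k x * (dquot u (s k) i x - w x $ i) + (A k x * w x $ i - F' (u x) * w x $ i))"
        unfolding dq by (simp add: right_diff_distrib)
      also have "\<dots> \<le> 2 * n2 (\<lambda>x. A k x * (dquot u (s k) i x - w x $ i)) + 2 * n2 (\<lambda>x. A k x * w x $ i - F' (u x) * w x $ i)"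
        by (rule n2_add_le[OF p1(1) p2])
      also have "\<dots> \<le> 2 * (L\<^sup>2 * n2 (\<lambda>x. dquot u (s k) i x - w x $ i)) + 2 * n2 (\<lambda>x. A k x * w x $ i - F' (u x) * w x $ i)"
        using p1(2) by simp
      finally show "n2 (\<lambda>x. dquot (\<lambda>x. F (u x)) (s k) i x - (F' (u x) *\<^sub>R w x) $ i)
         \<le> 2 * (L\<^sup>2 * n2 (\<lambda>x. dquot u (s k) i x - w x $ i)) + 2 * n2 (\<lambda>x. A k x * w x $ i - F' (u x) * w x $ i)" .
    next
      have "(\<lambda>k. 2 * (L\<^sup>2 * n2 (\<lambda>x. dquot u (s k) i x - w x $ i)) + 2 * n2 (\<lambda>x. A k x * w x $ i - F' (u x) * w x $ i))
         \<longlonglongrightarrow> 2 * (L\<^sup>2 * 0) + 2 * 0"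
        by (intro tendsto_intros dquot_sob[OF a s] l2)
      then show "(\<lambda>k. 2 * (L\<^sup>2 * n2 (\<lambda>x. dquot u (s k) i x - w x $ i)) + 2 * n2 (\<lambda>x. A k x * w x $ i - F' (u x) * w x $ i))
         \<longlonglongrightarrow> 0" by simp
    qed simp
    then show "\<exists>s. s \<longlonglongrightarrow> 0 \<and> (\<forall>k. s k \<noteq> 0) \<and>
        (\<lambda>k. n2 (\<lambda>x. dquot (\<lambda>x. F (u x)) (s k) i x - (F' (u x) *\<^sub>R w x) $ i)) \<longlonglongrightarrow> 0"
      using s by blast
  qed
qed

text \<open>The discrete product rule, with the shifted c in front of the quotient of v. The error
  splits into the quotient error of v, the shift error of c, and the quotient error of c, the last
  two by dominated convergence.\<close>

lemma sob_mult_C1: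
  fixes v :: "real^'n::finite \<Rightarrow> real"
  assumes a: "sob v w" and c: "\<And>x. (c has_derivative (\<lambda>v. v \<bullet> Dc x)) (at x)"
    and [measurable]: "Dc \<in> borel_measurable borel"
    and B: "\<And>x. \<bar>c x\<bar> \<le> B" and K: "\<And>x. norm (Dc x) \<le> K"
  shows "sob (\<lambda>x. c x * v x) (\<lambda>x. c x *\<^sub>R w x + v x *\<^sub>R Dc x)"
proof -
  note v = sobD(1)[OF a] and w = sobD(2)[OF a]
  have [measurable]: "v \<in> borel_measurable borel" "w \<in> borel_measurable borel" using v w by (auto simp: L2_def)
  have cc: "continuous_on UNIV c"
    using c by (meson continuous_at_imp_continuous_on has_derivative_continuous)
  then have [measurable]: "c \<in> borel_measurable borel" by (rule borel_measurable_continuous_onI)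
  have B0: "0 \<le> B" using B[of 0] by linarith
  have K0: "0 \<le> K" using K[of 0] norm_ge_zero order_trans by blast
  have LF: "L2 (\<lambda>x. c x * v x)"
    by (rule L2_bounded(1)[OF v, of _ B]) (use B in \<open>auto simp: abs_mult intro: mult_right_mono\<close>)
  have LW1: "L2 (\<lambda>x. c x *\<^sub>R w x)"
    by (rule L2_bounded(1)[OF w, of _ B]) (use B in \<open>auto intro: mult_right_mono\<close>)
  have LW2: "L2 (\<lambda>x. v x *\<^sub>R Dc x)"
    by (rule L2_bounded(1)[OF v, of _ K]) (use K in \<open>auto simp: mult.commute[of K] intro: mult_left_mono\<close>)
  show ?thesis
  proof (rule sob_of_dquot[OF LF L2_add[OF LW1 LW2]])
    fix i
    define s where "s k = inverse (real (Suc k))" for k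
    have s: "s \<longlonglongrightarrow> 0" "\<And>k. s k \<noteq> 0"
      unfolding s_def by (rule LIMSEQ_inverse_real_of_nat) simp
    define C where "C k x = c (x + s k *\<^sub>R axis i 1)" for k x
    have [measurable]: "C k \<in> borel_measurable borel" for k unfolding C_def by measurable
    have [measurable]: "dquot c (s k) i \<in> borel_measurable borel" for k unfolding dquot_def by measurable
    have CB: "\<bar>C k x\<bar> \<le> B" for k x using B by (simp add: C_def)
    have wi: "L2 (\<lambda>x. w x $ i)" by (rule L2_nth[OF w])
    have dq: "dquot (\<lambda>x. c x * v x) (s k) i x = C k x * dquot v (s k) i x + dquot c (s k) i x * v x" for k x
      using s(2)[of k] by (simp add: dquot_def C_def field_simps)
    have dcK: "\<bar>dquot c (s k) i x\<bar> \<le> K" for k x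
      using C1_lipschitz[of c Dc K "x + s k *\<^sub>R axis i 1" x, OF c K] s(2)[of k]
      by (simp add: norm_axis_1 dquot_def field_simps)
    have DcK: "\<bar>Dc x $ i\<bar> \<le> K" for x using K[of x] component_le_norm_cart order_trans by blast
    have d: "L2 (\<lambda>x. dquot v (s k) i x - w x $ i)" for k by (intro L2_diff L2_dquot v wi)
    then have [measurable]: "(\<lambda>x. dquot v (s k) i x - w x $ i) \<in> borel_measurable borel" for k by (simp add: L2_def)
    have p1: "L2 (\<lambda>x. C k x * (dquot v (s k) i x - w x $ i))"
      "n2 (\<lambda>x. C k x * (dquot v (s k) i x - w x $ i)) \<le> B\<^sup>2 * n2 (\<lambda>x. dquot v (s k) i x - w x $ i)" for k
    proof -
      have m: "(\<lambda>x. C k x * (dquot v (s k) i x - w x $ i)) \<in> borel_measurable borel" by (intro borel_measurable_times) measurable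
      have "norm (C k x * (dquot v (s k) i x - w x $ i)) \<le> B * norm (dquot v (s k) i x - w x $ i)" for x
        using CB by (auto simp: abs_mult intro: mult_right_mono)
      from L2_bounded[OF d m this] show "L2 (\<lambda>x. C k x * (dquot v (s k) i x - w x $ i))"
        "n2 (\<lambda>x. C k x * (dquot v (s k) i x - w x $ i)) \<le> B\<^sup>2 * n2 (\<lambda>x. dquot v (s k) i x - w x $ i)" .
    qed
    have bd2: "norm (C k x * w x $ i - c x * w x $ i) \<le> norm (2 * B * w x $ i)" for k x
    proof -
      have "\<bar>C k x - c x\<bar> \<le> 2 * B" using CB[of k x] B[of x] by linarith
      then have "\<bar>C k x - c x\<bar> * \<bar>w x $ i\<bar> \<le> 2 * B * \<bar>w x $ i\<bar>" by (intro mult_right_mono) auto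
      then show ?thesis using B0 unfolding left_diff_distrib[symmetric] by (simp add: abs_mult)
    qed
    have bd3: "norm (dquot c (s k) i x * v x - Dc x $ i * v x) \<le> norm (2 * K * v x)" for k x
    proof -
      have "\<bar>dquot c (s k) i x - Dc x $ i\<bar> \<le> 2 * K" using dcK[of k x] DcK[of x] by linarith
      then have "\<bar>dquot c (s k) i x - Dc x $ i\<bar> * \<bar>v x\<bar> \<le> 2 * K * \<bar>v x\<bar>" by (intro mult_right_mono) auto
      then show ?thesis using K0 unfolding left_diff_distrib[symmetric] by (simp add: abs_mult)
    qed
    have p2: "L2 (\<lambda>x. C k x * w x $ i - c x * w x $ i)" for k
      by (rule L2_bounded(1)[OF wi, of _ "2 * B"]) (use bd2 B0 in \<open>auto simp: abs_mult\<close>)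
    have p3: "L2 (\<lambda>x. dquot c (s k) i x * v x - Dc x $ i * v x)" for k
      by (rule L2_bounded(1)[OF v, of _ "2 * K"]) (use bd3 K0 in \<open>auto simp: abs_mult\<close>)
    have l2: "(\<lambda>k. n2 (\<lambda>x. C k x * w x $ i - c x * w x $ i)) \<longlonglongrightarrow> 0"
    proof (rule L2_dominated_convergence[OF _ _ L2_cmult[OF wi, of "2 * B"]])
      show "AE x in lborel. (\<lambda>k. C k x * w x $ i) \<longlonglongrightarrow> c x * w x $ i"
      proof (rule AE_I2)
        fix x :: "real^'n"
        have "(\<lambda>k. x + s k *\<^sub>R axis i 1) \<longlonglongrightarrow> x + 0 *\<^sub>R axis i 1" by (intro tendsto_intros s)
        moreover have "isCont c x" using cc by (simp add: continuous_on_eq_continuous_at)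
        ultimately have "(\<lambda>k. C k x) \<longlonglongrightarrow> c x"
          unfolding C_def using isCont_tendsto_compose[of x c] by simp
        then show "(\<lambda>k. C k x * w x $ i) \<longlonglongrightarrow> c x * w x $ i" by (intro tendsto_intros)
      qed
    qed (use bd2 in auto)
    have l3: "(\<lambda>k. n2 (\<lambda>x. dquot c (s k) i x * v x - Dc x $ i * v x)) \<longlonglongrightarrow> 0"
    proof (rule L2_dominated_convergence[OF _ _ L2_cmult[OF v, of "2 * K"]])
      show "AE x in lborel. (\<lambda>k. dquot c (s k) i x * v x) \<longlonglongrightarrow> Dc x $ i * v x"
        using dquot_tendsto[OF c s] by (intro AE_I2 tendsto_intros)
    qed (use bd3 in auto)
    have "(\<lambda>k. n2 (\<lambda>x. dquot (\<lambda>x. c x * v x) (s k) i x - (c x *\<^sub>R w x + v x *\<^sub>R Dc x) $ i)) \<longlonglongrightarrow> 0"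
    proof (rule null_sequence_squeeze)
      fix k
      let ?X = "\<lambda>x. C k x * (dquot v (s k) i x - w x $ i)" and ?Y = "\<lambda>x. C k x * w x $ i - c x * w x $ i"
        and ?Z = "\<lambda>x. dquot c (s k) i x * v x - Dc x $ i * v x"
      have "n2 (\<lambda>x. dquot (\<lambda>x. c x * v x) (s k) i x - (c x *\<^sub>R w x + v x *\<^sub>R Dc x) $ i) = n2 (\<lambda>x. ?X x + (?Y x + ?Z x))"
        unfolding dq by (simp add: algebra_simps)
      also have "\<dots> \<le> 2 * n2 ?X + 2 * n2 (\<lambda>x. ?Y x + ?Z x)"
        by (intro n2_add_le p1(1) L2_add p2 p3)
      also have "n2 (\<lambda>x. ?Y x + ?Z x) \<le> 2 * n2 ?Y + 2 * n2 ?Z" by (intro n2_add_le p2 p3)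
      finally show "n2 (\<lambda>x. dquot (\<lambda>x. c x * v x) (s k) i x - (c x *\<^sub>R w x + v x *\<^sub>R Dc x) $ i)
         \<le> 2 * (B\<^sup>2 * n2 (\<lambda>x. dquot v (s k) i x - w x $ i)) + 2 * (2 * n2 ?Y + 2 * n2 ?Z)"
        using p1(2)[of k] by simp
    next
      have "(\<lambda>k. 2 * (B\<^sup>2 * n2 (\<lambda>x. dquot v (s k) i x - w x $ i)) + 2 * (2 * n2 (\<lambda>x. C k x * w x $ i - c x * w x $ i)
          + 2 * n2 (\<lambda>x. dquot c (s k) i x * v x - Dc x $ i * v x))) \<longlonglongrightarrow> 2 * (B\<^sup>2 * 0) + 2 * (2 * 0 + 2 * 0)"
        by (intro tendsto_intros dquot_sob[OF a s] l2 l3)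
      then show "(\<lambda>k. 2 * (B\<^sup>2 * n2 (\<lambda>x. dquot v (s k) i x - w x $ i)) + 2 * (2 * n2 (\<lambda>x. C k x * w x $ i - c x * w x $ i)
          + 2 * n2 (\<lambda>x. dquot c (s k) i x * v x - Dc x $ i * v x))) \<longlonglongrightarrow> 0" by simp
    qed simp
    then show "\<exists>s. s \<longlonglongrightarrow> 0 \<and> (\<forall>k. s k \<noteq> 0) \<and>
        (\<lambda>k. n2 (\<lambda>x. dquot (\<lambda>x. c x * v x) (s k) i x - (c x *\<^sub>R w x + v x *\<^sub>R Dc x) $ i)) \<longlonglongrightarrow> 0"
      using s by blast
  qed
qed

text \<open>Lower semicontinuity of the Dirichlet integral without weak compactness: among all Sobolev functions
  close to \<open>A\<close>, gradients of nearly minimal norm form a Cauchy sequence by the parallelogram identity.\<close>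

lemma sob_lsc:
  fixes a :: "nat \<Rightarrow> real^'n::finite \<Rightarrow> real"
  assumes s: "\<And>n. sob (a n) (b n)" and A: "L2 A"
    and lim: "(\<lambda>n. n2 (\<lambda>x. a n x - A x)) \<longlonglongrightarrow> 0" and c: "\<And>n. n2 (b n) \<le> c"
  shows "\<exists>B. sob A B \<and> n2 B \<le> c"
proof -
  \<comment> \<open>Squared gradient norms available within squared distance e of A. Their infimum
    grows as e shrinks and is bounded by c, hence converges.\<close>
  define K where "K e = {n2 w | u w. sob u w \<and> n2 (\<lambda>x. u x - A x) \<le> e}" for e
  define q where "q k = inverse (real (Suc k))" for k
  have q: "q \<longlonglongrightarrow> 0" "\<And>k. 0 < q k" "\<And>k l. k \<le> l \<Longrightarrow> q l \<le> q k"
    unfolding q_def by (rule LIMSEQ_inverse_real_of_nat) (auto simp: field_simps)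
  define d where "d k = Inf (K (q k))" for k
  have bdd: "bdd_below (K e)" for e by (rule bdd_belowI[of _ 0]) (auto simp: K_def)
  have ex: "\<exists>t\<in>K (q k). t \<le> c" for k
  proof -
    have "\<forall>\<^sub>F n in sequentially. n2 (\<lambda>x. a n x - A x) < q k"
      using order_tendstoD(2)[OF lim q(2)] .
    then obtain n where "n2 (\<lambda>x. a n x - A x) < q k" by (meson eventually_sequentially le_refl)
    then have "n2 (b n) \<in> K (q k)" using s unfolding K_def by force
    with c show ?thesis by blast
  qed
  have dc: "d k \<le> c" for k
    using ex[of k] cInf_lower[OF _ bdd] unfolding d_def by force
  have mono: "d k \<le> d l" if "k \<le> l" for k l
    unfolding d_def
  proof (rule cInf_superset_mono)
    show "K (q l) \<noteq> {}" using ex[of l] by blast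
    show "K (q l) \<subseteq> K (q k)" using q(3)[OF that] unfolding K_def by force
  qed (rule bdd)
  have "\<exists>u w. sob u w \<and> n2 (\<lambda>x. u x - A x) \<le> q k \<and> n2 w < d k + q k" for k
  proof -
    have "K (q k) \<noteq> {}" using ex[of k] by blast
    moreover have "Inf (K (q k)) < d k + q k" using q(2)[of k] by (simp add: d_def)
    ultimately obtain t where "t \<in> K (q k)" "t < d k + q k" by (meson cInf_lessD)
    then show ?thesis unfolding K_def by blast
  qed
  then obtain u w where u: "\<And>k. sob (u k) (w k)" and uA: "\<And>k. n2 (\<lambda>x. u k x - A x) \<le> q k"
    and w: "\<And>k. n2 (w k) < d k + q k" by metis
  have "incseq d" using mono by (auto simp: incseq_def)
  moreover have bda: "bdd_above (range d)" using dc by (intro bdd_aboveI[of _ c]) auto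
  ultimately have dl: "d \<longlonglongrightarrow> (SUP i. d i)" by (intro LIMSEQ_incseq_SUP)
  let ?D = "SUP i. d i"
  have dD: "d k \<le> ?D" for k by (intro cSUP_upper bda) auto
  \<comment> \<open>The midpoint of \<open>u k\<close> and \<open>u l\<close> stays within
    \<open>q k\<close> of A, so its gradient has squared norm at least \<open>d k\<close>. This
    bounds the sum in the parallelogram identity from below and hence the difference from
    above.\<close>
  have diff: "n2 (\<lambda>x. w k x - w l x) \<le> 2 * (?D - d k) + 4 * q k" if kl: "k \<le> l" for k l
  proof -
    note wk = sobD(2)[OF u[of k]] and wl = sobD(2)[OF u[of l]]
    note uk = sobD(1)[OF u[of k]] and ul = sobD(1)[OF u[of l]]
    have "n2 (\<lambda>x. (1/2) * (u k x + u l x) - A x) = n2 (\<lambda>x. (1/2) *\<^sub>R ((u k x - A x) + (u l x - A x)))"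
      by (simp add: field_simps)
    also have "\<dots> = (1/4) * n2 (\<lambda>x. (u k x - A x) + (u l x - A x))"
      unfolding n2_scaleR by (simp add: power2_eq_square)
    also have "\<dots> \<le> (1/4) * (2 * n2 (\<lambda>x. u k x - A x) + 2 * n2 (\<lambda>x. u l x - A x))"
      by (intro mult_left_mono n2_add_le L2_diff uk ul A) auto
    also have "\<dots> \<le> q k" using uA[of k] uA[of l] q(3)[OF kl] by simp
    finally have "n2 (\<lambda>x. (1/2) *\<^sub>R (w k x + w l x)) \<in> K (q k)"
      using sob_cmult[OF sob_add[OF u[of k] u[of l]], of "1/2"] unfolding K_def by blast
    then have "d k \<le> n2 (\<lambda>x. (1/2) *\<^sub>R (w k x + w l x))" unfolding d_def by (rule cInf_lower[OF _ bdd])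
    also have "\<dots> = (1/4) * n2 (\<lambda>x. w k x + w l x)"
      unfolding n2_scaleR by (simp add: power2_eq_square)
    finally have "n2 (\<lambda>x. w k x - w l x) \<le> 2 * n2 (w k) + 2 * n2 (w l) - 4 * d k"
      using n2_parallelogram[OF wk wl] by simp
    then show ?thesis using w[of k] w[of l] dD[of l] q(3)[OF kl] by simp
  qed
  have "(\<lambda>k. 2 * (?D - d k) + 4 * q k) \<longlonglongrightarrow> 2 * (?D - ?D) + 4 * 0"
    by (intro tendsto_intros dl q(1))
  then have lim0: "(\<lambda>k. 2 * (?D - d k) + 4 * q k) \<longlonglongrightarrow> 0" by simp
  obtain W where W: "L2 W" and lw: "(\<lambda>k. n2 (\<lambda>x. w k x - W x)) \<longlonglongrightarrow> 0"
  proof (rule L2_complete[of w])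
    show "L2 (w n)" for n by (rule sobD(2)[OF u])
    fix e :: real assume "0 < e"
    with lim0 have "\<forall>\<^sub>F k in sequentially. 2 * (?D - d k) + 4 * q k < e" by (rule order_tendstoD)
    then obtain N where N: "\<And>k. k \<ge> N \<Longrightarrow> 2 * (?D - d k) + 4 * q k < e" by (auto simp: eventually_sequentially)
    have "n2 (\<lambda>x. w m x - w n x) \<le> e" if "N \<le> m" "N \<le> n" for m n
    proof (cases "m \<le> n")
      case True
      then show ?thesis using diff[of m n] N[OF that(1)] by simp
    next
      case False
      then show ?thesis using diff[of n m] N[OF that(2)] n2_commute[of "w m" "w n"] by simp
    qed
    then show "\<exists>N. \<forall>m\<ge>N. \<forall>n\<ge>N. n2 (\<lambda>x. w m x - w n x) \<le> e" by blast
  qed blast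
  have lu: "(\<lambda>k. n2 (\<lambda>x. u k x - A x)) \<longlonglongrightarrow> 0"
    by (rule null_sequence_squeeze[OF _ uA q(1)]) simp
  have "sob A W" by (rule sob_limit[OF u A W lu lw])
  moreover have "n2 W \<le> c"
  proof (rule LIMSEQ_le)
    show "(\<lambda>k. n2 (w k)) \<longlonglongrightarrow> n2 W" by (rule L2_limit_n2[OF sobD(2)[OF u] W lw])
    have "(\<lambda>k. c + q k) \<longlonglongrightarrow> c + 0" by (intro tendsto_intros q)
    then show "(\<lambda>k. c + q k) \<longlonglongrightarrow> c" by simp
    show "\<exists>N. \<forall>n\<ge>N. n2 (w n) \<le> c + q n"
      using w dc by (intro exI[of _ 0] allI impI) (meson add_le_cancel_right less_imp_le order_trans)
  qed
  ultimately show ?thesis by blast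
qed

section \<open>Passage between \<open>lborel\<close> and \<open>lebesgue\<close>\<close>

lemma lebesgue_integral_borel:
  fixes f :: "'a::euclidean_space \<Rightarrow> 'b::{banach, second_countable_topology}"
  assumes "f \<in> borel_measurable borel"
  shows "integrable lebesgue f \<longleftrightarrow> integrable lborel f" "(LINT x|lebesgue. f x) = (LINT x|lborel. f x)"
  using assms by (auto intro!: integrable_completion integral_completion)

text \<open>Completeness of Lebesgue measure: preimages under f and g differ by a null set.\<close>

lemma lebesgue_measurable_AE:
  fixes f :: "'a::euclidean_space \<Rightarrow> 'b::topological_space"
  assumes g: "g \<in> borel_measurable borel" and eq: "AE x in lborel. f x = g x"
  shows "f \<in> borel_measurable lebesgue"
proof (rule measurableI)
  have g': "g \<in> borel_measurable lebesgue" by (rule measurable_completion) (use g in simp)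
  fix A :: "'b set" assume A: "A \<in> sets borel"
  have 1: "g -` A \<inter> space lebesgue \<in> sets lebesgue" by (rule measurable_sets[OF g' A])
  have "AE x in lebesgue. x \<in> g -` A \<inter> space lebesgue \<longleftrightarrow> x \<in> f -` A \<inter> space lebesgue"
    using AE_completion[OF eq] by eventually_elim simp
  from completion.in_sets_AE[OF this 1] show "f -` A \<inter> space lebesgue \<in> sets lebesgue" by simp
qed simp

lemma lebesgue_integral_AE:
  fixes f :: "'a::euclidean_space \<Rightarrow> 'b::{banach, second_countable_topology}"
  assumes g: "g \<in> borel_measurable borel" and eq: "AE x in lborel. f x = g x"
  shows "integrable lebesgue f \<longleftrightarrow> integrable lborel g" "(LINT x|lebesgue. f x) = (LINT x|lborel. g x)"
proof -
  note f = lebesgue_measurable_AE[OF g eq] and g' = lebesgue_measurable_AE[OF g, of g, simplified]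
  show "integrable lebesgue f \<longleftrightarrow> integrable lborel g"
    using integrable_cong_AE[OF f g' AE_completion[OF eq]] lebesgue_integral_borel(1)[OF g] by simp
  show "(LINT x|lebesgue. f x) = (LINT x|lborel. g x)"
    using integral_cong_AE[OF f g' AE_completion[OF eq]] lebesgue_integral_borel(2)[OF g] by simp
qed

lemma sob_weak_grad:
  assumes a: "sob u w" and u': "AE x in lborel. u' x = u x" and w': "AE x in lborel. w' x = w x"
  shows "L2_grad u' w'" "u' \<in> H1"
proof -
  note u = sobD(1)[OF a] and w = sobD(2)[OF a]
  have [measurable]: "u \<in> borel_measurable borel" "w \<in> borel_measurable borel" using u w by (auto simp: L2_def)
  have "weak_grad u' w'"
    unfolding weak_grad_def
  proof (intro allI impI)
    fix i and \<phi> :: "real^'a \<Rightarrow> real" assume t: "test_fun \<phi>"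
    note \<phi> = test_fun_L2[OF t] and d\<phi> = test_fun_L2[OF test_fun_partial_deriv[OF t, of i]]
    have [measurable]: "\<phi> \<in> borel_measurable borel" "partial_deriv \<phi> i \<in> borel_measurable borel"
      using \<phi> d\<phi> by (auto simp: L2_def)
    have e1: "AE x in lborel. u' x * partial_deriv \<phi> i x = u x * partial_deriv \<phi> i x"
      using u' by eventually_elim simp
    have e2: "AE x in lborel. w' x $ i * \<phi> x = w x $ i * \<phi> x" using w' by eventually_elim simp
    show "integrable lebesgue (\<lambda>x. u' x * partial_deriv \<phi> i x) \<and> integrable lebesgue (\<lambda>x. w' x $ i * \<phi> x) \<and>
        (LINT x|lebesgue. u' x * partial_deriv \<phi> i x) = - (LINT x|lebesgue. w' x $ i * \<phi> x)"
      using lebesgue_integral_AE[OF _ e1] lebesgue_integral_AE[OF _ e2] sobD(3)[OF a t, of i]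
        L2_mult_integrable[OF u d\<phi>] L2_mult_integrable[OF L2_nth(1)[OF w] \<phi>] by simp
  qed
  moreover have "w' \<in> borel_measurable lebesgue" by (rule lebesgue_measurable_AE[OF _ w']) simp
  moreover have "integrable lebesgue (\<lambda>x. (norm (w' x))\<^sup>2)"
  proof -
    have "AE x in lborel. (norm (w' x))\<^sup>2 = (norm (w x))\<^sup>2" using w' by eventually_elim simp
    from lebesgue_integral_AE(1)[OF _ this] L2_integrable[OF w] show ?thesis by simp
  qed
  ultimately show g: "L2_grad u' w'" by (simp add: L2_grad_def)
  have "u' \<in> borel_measurable lebesgue" by (rule lebesgue_measurable_AE[OF _ u']) simp
  moreover have "integrable lebesgue (\<lambda>x. (u' x)\<^sup>2)"
  proof -
    have "AE x in lborel. (u' x)\<^sup>2 = (norm (u x))\<^sup>2" using u' by eventually_elim simp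
    from lebesgue_integral_AE(1)[OF _ this] L2_integrable[OF u] show ?thesis by simp
  qed
  ultimately show "u' \<in> H1" using g by (auto simp: H1_def)
qed

lemma H1_sob:
  fixes u :: "real^'n::finite \<Rightarrow> real"
  assumes "u \<in> H1"
  obtains u' w' where "sob u' w'" "AE x in lborel. u x = u' x" "AE x in lborel. grad u x = w' x"
proof -
  have "\<exists>w. L2_grad u w" using assms by (auto simp: H1_def)
  then have "L2_grad u (grad u)" unfolding grad_def by (rule someI_ex)
  then have gm: "grad u \<in> borel_measurable lebesgue" and gi: "integrable lebesgue (\<lambda>x. (norm (grad u x))\<^sup>2)"
    and gw: "weak_grad u (grad u)" by (auto simp: L2_grad_def)
  have um: "u \<in> borel_measurable lebesgue" and ui: "integrable lebesgue (\<lambda>x. (u x)\<^sup>2)"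
    using assms by (auto simp: H1_def)
  obtain u' where [measurable]: "u' \<in> borel_measurable borel" and u': "AE x in lborel. u x = u' x"
    using completion_ex_borel_measurable_real[OF um] by auto
  \<comment> \<open>The Borel representative of the gradient is found component by component;
    finitely many null sets are then merged.\<close>
  have "\<exists>f. f \<in> borel_measurable borel \<and> (AE x in lborel. grad u x $ i = f x)" for i
    using completion_ex_borel_measurable_real[OF borel_measurable_nth[OF gm, of i]] by auto
  then obtain f where fm [measurable]: "\<And>i. f i \<in> borel_measurable borel" and f: "\<And>i. AE x in lborel. grad u x $ i = f i x"
    by metis
  define w' where "w' x = (\<Sum>i\<in>UNIV. f i x *\<^sub>R axis i (1::real))" for x
  have w'm [measurable]: "w' \<in> borel_measurable borel" unfolding w'_def by measurable
  have "AE x in lborel. \<forall>i. grad u x $ i = f i x" using f by (subst AE_all_countable) auto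
  then have w': "AE x in lborel. grad u x = w' x"
  proof eventually_elim
    case (elim x)
    then show ?case using vec_eq_sum_axis[of "grad u x"] by (simp add: w'_def)
  qed
  have "sob u' w'"
    unfolding sob_def
  proof (intro conjI allI impI)
    have "AE x in lborel. (u x)\<^sup>2 = (norm (u' x))\<^sup>2" using u' by eventually_elim simp
    from lebesgue_integral_AE(1)[OF _ this] ui show "L2 u'" by (simp add: L2_def)
    have "AE x in lborel. (norm (grad u x))\<^sup>2 = (norm (w' x))\<^sup>2" using w' by eventually_elim simp
    from lebesgue_integral_AE(1)[OF _ this] gi show "L2 w'" by (simp add: L2_def)
    fix i and \<phi> :: "real^'n \<Rightarrow> real" assume t: "test_fun \<phi>"
    have [measurable]: "\<phi> \<in> borel_measurable borel" "partial_deriv \<phi> i \<in> borel_measurable borel"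
      using test_fun_L2[OF t] test_fun_L2[OF test_fun_partial_deriv[OF t, of i]] by (auto simp: L2_def)
    have e1: "AE x in lborel. u x * partial_deriv \<phi> i x = u' x * partial_deriv \<phi> i x"
      using u' by eventually_elim simp
    have e2: "AE x in lborel. grad u x $ i * \<phi> x = w' x $ i * \<phi> x" using w' by eventually_elim simp
    show "(LINT x|lborel. u' x * partial_deriv \<phi> i x) = - (LINT x|lborel. w' x $ i * \<phi> x)"
      using gw t lebesgue_integral_AE(2)[OF _ e1] lebesgue_integral_AE(2)[OF _ e2]
      unfolding weak_grad_def by simp
  qed
  then show thesis using u' w' by (rule that)
qed

text \<open>\<open>grad\<close> is a Hilbert choice; uniqueness of weak gradients is what ties it,
  almost everywhere, to a gradient known explicitly.\<close>

lemma grad_AE: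
  assumes a: "sob u w" and u': "AE x in lborel. u' x = u x"
  shows "AE x in lborel. grad u' x = w x"
proof -
  have "u' \<in> H1" by (rule sob_weak_grad(2)[OF a u', of w]) simp
  then obtain u'' w'' where s: "sob u'' w''" and e: "AE x in lborel. u' x = u'' x" "AE x in lborel. grad u' x = w'' x"
    by (rule H1_sob)
  have "AE x in lborel. u'' x = u x" using e(1) u' by eventually_elim simp
  from sob_unique[OF s a this] e(2) show ?thesis by eventually_elim simp
qed

section \<open>The Gagliardo--Nirenberg inequality\<close>

lemma norm_cbox_One_le:
  fixes h :: "'a::euclidean_space"
  assumes "h \<in> cbox 0 (r *\<^sub>R One)"
  shows "(norm h)\<^sup>2 \<le> real DIM('a) * r\<^sup>2"
proof -
  have "(norm h)\<^sup>2 = (\<Sum>b\<in>Basis. (h \<bullet> b)\<^sup>2)"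
    unfolding power2_norm_eq_inner by (subst euclidean_inner) (simp add: power2_eq_square)
  also have "\<dots> \<le> (\<Sum>b\<in>(Basis::'a set). r\<^sup>2)"
    using assms by (intro sum_mono power_mono) (auto simp: mem_box)
  finally show ?thesis by simp
qed

lemma emeasure_cube:
  assumes "0 \<le> r"
  shows "emeasure lborel (cbox 0 (r *\<^sub>R One :: 'a::euclidean_space)) = ennreal (r ^ DIM('a))"
  using assms by (subst emeasure_lborel_cbox) auto

text \<open>If translates over a cube \<open>Q\<close> of side \<open>r\<close> drop below half the level \<open>a\<close> on half of \<open>Q\<close>, then the
  translation estimate bounds the measure of the superlevel set. This one lemma yields both the
  Gagliardo--Nirenberg inequality and the non-vanishing of minimizing sequences.\<close>

lemma sob_superlevel:
  fixes z :: "real^'n::finite \<Rightarrow> real"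
  assumes s: "sob z w" and a: "0 < a" and r: "0 < r"
    and half: "\<And>x. a \<le> \<bar>z x\<bar> \<Longrightarrow>
      emeasure lborel {h \<in> cbox 0 (r *\<^sub>R One). a / 2 \<le> \<bar>z (x + h)\<bar>} \<le> ennreal (r ^ CARD('n) / 2)"
  shows "emeasure lborel {x. a \<le> \<bar>z x\<bar>} \<le> ennreal (8 * real CARD('n) * r\<^sup>2 * n2 w / a\<^sup>2)"
proof -
  note z = sobD(1)[OF s] and w = sobD(2)[OF s]
  have [measurable]: "z \<in> borel_measurable borel" using z by (simp add: L2_def)
  let ?Q = "cbox 0 (r *\<^sub>R One) :: (real^'n) set"
  let ?N = "CARD('n)"
  have Q: "emeasure lborel ?Q = ennreal (r ^ ?N)" using emeasure_cube[of r, where 'a="real^'n"] r by simp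
  have up: "(\<integral>\<^sup>+h. (\<integral>\<^sup>+x. ennreal ((z (x + h) - z x)\<^sup>2) * indicator ?Q h \<partial>lborel) \<partial>lborel)
      \<le> ennreal (real ?N * r\<^sup>2 * n2 w * r ^ ?N)"
  proof -
    have "(\<integral>\<^sup>+x. ennreal ((z (x + h) - z x)\<^sup>2) * indicator ?Q h \<partial>lborel)
        \<le> ennreal (real ?N * r\<^sup>2 * n2 w) * indicator ?Q h" for h
    proof (cases "h \<in> ?Q")
      case True
      have "(\<integral>\<^sup>+x. ennreal ((z (x + h) - z x)\<^sup>2) \<partial>lborel) = ennreal (n2 (\<lambda>x. z (x + h) - z x))"
        using L2_nn_integral[OF L2_diff[OF L2_translate(1)[OF z, of h] z]] by simp
      also have "\<dots> \<le> ennreal (real ?N * r\<^sup>2 * n2 w)"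
      proof (rule ennreal_leI)
        have "n2 (\<lambda>x. z (x + h) - z x) \<le> (norm h)\<^sup>2 * n2 w" by (rule sob_increment(2)[OF s])
        also have "\<dots> \<le> (real ?N * r\<^sup>2) * n2 w"
          using norm_cbox_One_le[OF True] by (intro mult_right_mono) auto
        finally show "n2 (\<lambda>x. z (x + h) - z x) \<le> real ?N * r\<^sup>2 * n2 w" .
      qed
      finally show ?thesis using True by simp
    qed simp
    then have "(\<integral>\<^sup>+h. (\<integral>\<^sup>+x. ennreal ((z (x + h) - z x)\<^sup>2) * indicator ?Q h \<partial>lborel) \<partial>lborel)
        \<le> (\<integral>\<^sup>+h. ennreal (real ?N * r\<^sup>2 * n2 w) * indicator ?Q h \<partial>lborel)"
      by (rule nn_integral_mono)
    also have "\<dots> = ennreal (real ?N * r\<^sup>2 * n2 w) * ennreal (r ^ ?N)"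
      by (subst nn_integral_cmult_indicator) (auto simp: Q)
    also have "\<dots> = ennreal (real ?N * r\<^sup>2 * n2 w * r ^ ?N)"
      using r by (subst ennreal_mult[symmetric]) auto
    finally show ?thesis .
  qed
  \<comment> \<open>If |z| is at least a at x, then on at least half of the cube |z(x+h)| is below
    a/2, so the squared increment exceeds a^2/4. The two factors 1/2 and 1/4 give the constant
    8.\<close>
  have low: "ennreal (r ^ ?N / 2 * (a\<^sup>2 / 4)) * emeasure lborel {x. a \<le> \<bar>z x\<bar>}
      \<le> (\<integral>\<^sup>+x. (\<integral>\<^sup>+h. ennreal ((z (x + h) - z x)\<^sup>2) * indicator ?Q h \<partial>lborel) \<partial>lborel)"
  proof -
    have "ennreal (r ^ ?N / 2 * (a\<^sup>2 / 4)) * indicator {x. a \<le> \<bar>z x\<bar>} x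
        \<le> (\<integral>\<^sup>+h. ennreal ((z (x + h) - z x)\<^sup>2) * indicator ?Q h \<partial>lborel)" for x
    proof (cases "a \<le> \<bar>z x\<bar>")
      case True
      define T where "T = {h \<in> ?Q. \<bar>z (x + h)\<bar> < a / 2}"
      define U where "U = {h \<in> ?Q. a / 2 \<le> \<bar>z (x + h)\<bar>}"
      have [measurable]: "T \<in> sets borel" "U \<in> sets borel" unfolding T_def U_def by measurable
      have "ennreal (r ^ ?N) = emeasure lborel (T \<union> U)"
        unfolding Q[symmetric] by (intro arg_cong2[where f=emeasure]) (auto simp: T_def U_def)
      also have "\<dots> \<le> emeasure lborel T + emeasure lborel U"
        by (rule emeasure_subadditive) auto
      also have "\<dots> \<le> emeasure lborel T + ennreal (r ^ ?N / 2)"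
        using half[OF True] by (intro add_left_mono) (simp add: U_def)
      finally have *: "ennreal (r ^ ?N) \<le> emeasure lborel T + ennreal (r ^ ?N / 2)" .
      have T: "ennreal (r ^ ?N / 2) \<le> emeasure lborel T"
      proof (cases "emeasure lborel T")
        case (real t)
        then have "ennreal (r ^ ?N) \<le> ennreal (t + r ^ ?N / 2)" using * r by simp
        then have "r ^ ?N \<le> t + r ^ ?N / 2" using real r by (subst (asm) ennreal_le_iff) auto
        then show ?thesis using real by (simp add: ennreal_leI)
      qed simp
      have "ennreal (r ^ ?N / 2 * (a\<^sup>2 / 4)) * indicator {x. a \<le> \<bar>z x\<bar>} x = ennreal (a\<^sup>2 / 4) * ennreal (r ^ ?N / 2)"
        using True r by (subst ennreal_mult[symmetric]) (auto simp: mult.commute)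
      also have "\<dots> \<le> ennreal (a\<^sup>2 / 4) * emeasure lborel T" by (intro mult_left_mono T) simp
      also have "\<dots> = (\<integral>\<^sup>+h. ennreal (a\<^sup>2 / 4) * indicator T h \<partial>lborel)"
        by (rule nn_integral_cmult_indicator[symmetric]) simp
      also have "\<dots> \<le> (\<integral>\<^sup>+h. ennreal ((z (x + h) - z x)\<^sup>2) * indicator ?Q h \<partial>lborel)"
      proof (rule nn_integral_mono)
        fix h
        show "ennreal (a\<^sup>2 / 4) * indicator T h \<le> ennreal ((z (x + h) - z x)\<^sup>2) * indicator ?Q h"
        proof (cases "h \<in> T")
          case hT: True
          then have "\<bar>z (x + h)\<bar> < a / 2" by (simp add: T_def)
          then have "a / 2 \<le> \<bar>z (x + h) - z x\<bar>" using True by linarith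
          then have "(a / 2)\<^sup>2 \<le> \<bar>z (x + h) - z x\<bar>\<^sup>2" using a by (intro power_mono) auto
          then have "a\<^sup>2 / 4 \<le> (z (x + h) - z x)\<^sup>2" by (simp add: power_divide)
          then show ?thesis using hT by (simp add: T_def ennreal_leI)
        qed simp
      qed
      finally show ?thesis .
    qed simp
    then have "(\<integral>\<^sup>+x. ennreal (r ^ ?N / 2 * (a\<^sup>2 / 4)) * indicator {x. a \<le> \<bar>z x\<bar>} x \<partial>lborel)
        \<le> (\<integral>\<^sup>+x. (\<integral>\<^sup>+h. ennreal ((z (x + h) - z x)\<^sup>2) * indicator ?Q h \<partial>lborel) \<partial>lborel)"
      by (rule nn_integral_mono)
    then show ?thesis by (subst (asm) nn_integral_cmult_indicator) auto
  qed
  have "(\<integral>\<^sup>+x. (\<integral>\<^sup>+h. ennreal ((z (x + h) - z x)\<^sup>2) * indicator ?Q h \<partial>lborel) \<partial>lborel)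
      = (\<integral>\<^sup>+h. (\<integral>\<^sup>+x. ennreal ((z (x + h) - z x)\<^sup>2) * indicator ?Q h \<partial>lborel) \<partial>lborel)"
    by (rule lborel_pair.Fubini') measurable
  with low up have main: "ennreal (r ^ ?N / 2 * (a\<^sup>2 / 4)) * emeasure lborel {x. a \<le> \<bar>z x\<bar>}
      \<le> ennreal (real ?N * r\<^sup>2 * n2 w * r ^ ?N)" by simp
  show ?thesis
  proof (cases "emeasure lborel {x. a \<le> \<bar>z x\<bar>}")
    case (real t)
    have "r ^ ?N / 2 * (a\<^sup>2 / 4) * t \<le> real ?N * r\<^sup>2 * n2 w * r ^ ?N"
      using main real r by (simp add: ennreal_mult[symmetric] ennreal_le_iff)
    then have "t \<le> 8 * real ?N * r\<^sup>2 * n2 w / a\<^sup>2"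
      using a r by (simp add: field_simps)
    then show ?thesis using real by (simp add: ennreal_leI)
  next
    case top
    then show ?thesis using main a r by (simp add: ennreal_mult_top top_unique)
  qed
qed

section \<open>From level sets to the critical power\<close>

lemma L2_Markov:
  fixes u :: "'a::euclidean_space \<Rightarrow> real"
  assumes u: "L2 u" and c: "0 < c"
  shows "emeasure lborel {x. c \<le> \<bar>u x\<bar>} \<le> ennreal (n2 u / c\<^sup>2)"
proof -
  have [measurable]: "u \<in> borel_measurable borel" using u by (simp add: L2_def)
  have "ennreal (c\<^sup>2) * emeasure lborel {x. c \<le> \<bar>u x\<bar>} = (\<integral>\<^sup>+x. ennreal (c\<^sup>2) * indicator {x. c \<le> \<bar>u x\<bar>} x \<partial>lborel)"
    by (rule nn_integral_cmult_indicator[symmetric]) simp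
  also have "\<dots> \<le> (\<integral>\<^sup>+x. ennreal ((norm (u x))\<^sup>2) \<partial>lborel)"
  proof (rule nn_integral_mono)
    fix x
    have "c\<^sup>2 \<le> (u x)\<^sup>2" if "c \<le> \<bar>u x\<bar>" using power_mono[OF that, of 2] c by simp
    then show "ennreal (c\<^sup>2) * indicator {x. c \<le> \<bar>u x\<bar>} x \<le> ennreal ((norm (u x))\<^sup>2)"
      by (auto simp: indicator_def intro: ennreal_leI)
  qed
  also have "\<dots> = ennreal (n2 u)" by (rule L2_nn_integral[OF u])
  finally have main: "ennreal (c\<^sup>2) * emeasure lborel {x. c \<le> \<bar>u x\<bar>} \<le> ennreal (n2 u)" .
  show ?thesis
  proof (cases "emeasure lborel {x. c \<le> \<bar>u x\<bar>}")
    case (real t)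
    have "c\<^sup>2 * t \<le> n2 u"
      using main real by (simp add: ennreal_mult[symmetric] ennreal_le_iff)
    then have "t \<le> n2 u / c\<^sup>2" using c by (simp add: field_simps)
    then show ?thesis using real by (simp add: ennreal_leI)
  next
    case top
    then show ?thesis using main c by (simp add: ennreal_mult_top top_unique)
  qed
qed

text \<open>The cubic smoothstep: C1, which suffices for the chain rule, with slope at most 3/2.
  That slope is the source of the 3 in \<open>sob_level\<close> and of the 6 in
  \<open>dcutoff_bound\<close>.\<close>

definition step :: "real \<Rightarrow> real" where
  "step y = (if y \<le> 0 then 0 else if y \<le> 1 then 3 * y\<^sup>2 - 2 * y ^ 3 else 1)"

definition dstep :: "real \<Rightarrow> real" where
  "dstep y = (if 0 < y \<and> y < 1 then 6 * y * (1 - y) else 0)"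

lemma DERIV_at_within_Un:
  fixes f :: "real \<Rightarrow> real"
  assumes "(f has_real_derivative d) (at x within S)" "(f has_real_derivative d) (at x within T)"
  shows "(f has_real_derivative d) (at x within S \<union> T)"
  using assms unfolding has_field_derivative_iff by (rule Lim_Un)

lemma step_deriv: "(step has_real_derivative dstep y) (at y)"
proof -
  have poly: "((\<lambda>y. 3 * y\<^sup>2 - 2 * y ^ 3) has_real_derivative 6 * y * (1 - y)) (at y within S)" for y :: real and S
    by (auto intro!: derivative_eq_intros simp: power2_eq_square algebra_simps)
  consider "y < 0" | "y = 0" | "0 < y" "y < 1" | "y = 1" | "1 < y" by linarith
  then show ?thesis
  proof cases
    case 1
    have "((\<lambda>_. 0) has_real_derivative 0) (at y)" by simp
    then have "(step has_real_derivative 0) (at y)"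
      by (rule has_field_derivative_transform_within_open[where S="{..<0}"]) (use 1 in \<open>auto simp: step_def\<close>)
    then show ?thesis using 1 by (simp add: dstep_def)
  next
    case 3
    have "(step has_real_derivative 6 * y * (1 - y)) (at y)"
      by (rule has_field_derivative_transform_within_open[where S="{0<..<1}", OF poly]) (use 3 in \<open>auto simp: step_def\<close>)
    then show ?thesis using 3 by (simp add: dstep_def)
  next
    case 5
    have "((\<lambda>_. 1) has_real_derivative 0) (at y)" by simp
    then have "(step has_real_derivative 0) (at y)"
      by (rule has_field_derivative_transform_within_open[where S="{1<..}"]) (use 5 in \<open>auto simp: step_def\<close>)
    then show ?thesis using 5 by (simp add: dstep_def)
  next
    case 2
    have l: "(step has_real_derivative 0) (at 0 within {..0})"
      by (rule has_field_derivative_transform_within[of "\<lambda>_. 0" _ _ _ 1]) (auto simp: step_def)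
    have r: "(step has_real_derivative 0) (at 0 within {0..})"
      by (rule has_field_derivative_transform_within[of "\<lambda>y. 3 * y\<^sup>2 - 2 * y ^ 3" _ _ _ 1])
        (use poly[of 0] in \<open>auto simp: step_def dist_real_def\<close>)
    have "{..0} \<union> {0..} = (UNIV :: real set)" by auto
    with DERIV_at_within_Un[OF l r] show ?thesis using 2 by (simp add: dstep_def)
  next
    case 4
    have l: "(step has_real_derivative 0) (at 1 within {..1})"
      by (rule has_field_derivative_transform_within[of "\<lambda>y. 3 * y\<^sup>2 - 2 * y ^ 3" _ _ _ 1])
        (use poly[of 1] in \<open>auto simp: step_def dist_real_def\<close>)
    have r: "(step has_real_derivative 0) (at 1 within {1..})"
      by (rule has_field_derivative_transform_within[of "\<lambda>_. 1" _ _ _ 1]) (auto simp: step_def)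
    have "{..1} \<union> {1..} = (UNIV :: real set)" by auto
    with DERIV_at_within_Un[OF l r] show ?thesis using 4 by (simp add: dstep_def)
  qed
qed

lemma dstep_bounds: "0 \<le> dstep y" "dstep y \<le> 3 / 2"
proof -
  have "6 * y * (1 - y) \<le> 3 / 2" using zero_le_power2[of "y - 1/2"] by (simp add: power2_eq_square algebra_simps)
  then show "dstep y \<le> 3 / 2" by (simp add: dstep_def)
qed (simp add: dstep_def)

lemma dstep_continuous: "continuous_on UNIV dstep"
proof -
  have "dstep = (\<lambda>y. max 0 (6 * y * (1 - y)))"
  proof
    fix y :: real
    show "dstep y = max 0 (6 * y * (1 - y))"
      by (cases "0 < y \<and> y < 1") (auto simp: dstep_def max_def zero_le_mult_iff mult_le_0_iff not_less)
  qed
  moreover have "continuous_on UNIV (\<lambda>y::real. max 0 (6 * y * (1 - y)))" by (intro continuous_intros)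
  ultimately show ?thesis by (simp only:)
qed

lemma step_bounds: "0 \<le> step y" "step y \<le> 1"
proof -
  have "3 * y\<^sup>2 - 2 * y ^ 3 = y\<^sup>2 * (3 - 2 * y)" by (simp add: power2_eq_square power3_eq_cube algebra_simps)
  then show "0 \<le> step y" by (simp add: step_def)
  have "1 - (3 * y\<^sup>2 - 2 * y ^ 3) = (1 - y)\<^sup>2 * (1 + 2 * y)" by (simp add: power2_eq_square power3_eq_cube algebra_simps)
  then have "3 * y\<^sup>2 - 2 * y ^ 3 \<le> 1" if "0 < y"
  proof -
    have "0 \<le> (1 - y)\<^sup>2 * (1 + 2 * y)" using that by simp
    with \<open>1 - (3 * y\<^sup>2 - 2 * y ^ 3) = (1 - y)\<^sup>2 * (1 + 2 * y)\<close> show ?thesis by linarith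
  qed
  then show "step y \<le> 1" by (simp add: step_def)
qed

lemma step_eq_0: "y \<le> 0 \<Longrightarrow> step y = 0" and step_eq_1: "1 \<le> y \<Longrightarrow> step y = 1"
  by (auto simp: step_def)

text \<open>Apply \<open>sob_superlevel\<close> to a truncation z of u^2 that rises from 0 to b
  while u^2 goes from b to 2 b. Its gradient is at most 3 |u| |grad u| and lives only on that layer,
  so that different dyadic layers can later be added. The constant is 72 = 8 * 9.\<close>

lemma sob_level:
  fixes u :: "real^'n::finite \<Rightarrow> real"
  assumes s: "sob u w" and b: "0 < b" and m: "0 < m" "n2 u \<le> m"
  shows "emeasure lborel {x. 2 * b \<le> (u x)\<^sup>2}
    \<le> ennreal (72 * real CARD('n) * (2 * m / b) powr (2 / real CARD('n)) / b\<^sup>2) *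
      (\<integral>\<^sup>+x. ennreal ((u x)\<^sup>2 * (norm (w x))\<^sup>2) * indicator {x. b \<le> (u x)\<^sup>2 \<and> (u x)\<^sup>2 < 2 * b} x \<partial>lborel)"
proof -
  note u = sobD(1)[OF s] and w = sobD(2)[OF s]
  have [measurable]: "u \<in> borel_measurable borel" "w \<in> borel_measurable borel" using u w by (auto simp: L2_def)
  let ?N = "CARD('n)"
  define F where "F t = b * step (t\<^sup>2 / b - 1)" for t
  define F' where "F' t = 2 * t * dstep (t\<^sup>2 / b - 1)" for t
  have F: "(F has_real_derivative F' t) (at t)" for t
  proof -
    have "((\<lambda>t. t\<^sup>2 / b - 1) has_real_derivative 2 * t / b) (at t)"
      using b by (auto intro!: derivative_eq_intros)
    from DERIV_cmult[OF DERIV_chain2[OF step_deriv this], of b]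
    show ?thesis unfolding F_def[abs_def] by (rule DERIV_cong) (use b in \<open>simp add: F'_def\<close>)
  qed
  have contF': "continuous_on UNIV F'"
  proof -
    have "continuous_on UNIV (\<lambda>t. t\<^sup>2 * inverse b - 1)" by (intro continuous_intros)
    then have "continuous_on UNIV (\<lambda>t. dstep (t\<^sup>2 * inverse b - 1))"
      by (rule continuous_on_compose2[OF dstep_continuous]) auto
    then show ?thesis unfolding F'_def divide_inverse by (intro continuous_intros)
  qed
  have F'0: "F' t = 0" if "\<not> (b \<le> t\<^sup>2 \<and> t\<^sup>2 < 2 * b)" for t
    using that b by (auto simp: F'_def dstep_def field_simps)
  have F'le: "\<bar>F' t\<bar> \<le> 3 * \<bar>t\<bar>" for t
    using dstep_bounds[of "t\<^sup>2 / b - 1"] mult_left_mono[of "dstep (t\<^sup>2 / b - 1)" "3/2" "2 * \<bar>t\<bar>"]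
    by (simp add: F'_def abs_mult)
  have F'L: "\<bar>F' t\<bar> \<le> 3 * sqrt (2 * b)" for t
  proof (cases "b \<le> t\<^sup>2 \<and> t\<^sup>2 < 2 * b")
    case True
    then have "\<bar>t\<bar> \<le> sqrt (2 * b)" by (intro real_le_rsqrt) simp
    then show ?thesis using F'le[of t] by simp
  qed (use F'0 b in simp)
  have F0: "F 0 = 0" by (simp add: F_def step_eq_0)
  define z where "z x = F (u x)" for x
  define v where "v x = F' (u x) *\<^sub>R w x" for x
  have sz: "sob z v"
    unfolding z_def v_def
    by (rule sob_chain[OF s F _ F'L F0]) (rule borel_measurable_continuous_onI[OF contF'])
  \<comment> \<open>The cube has volume 2 m / b, twice the bound m / b that Markov gives for the
    measure of the set where u^2 is at least b, which is the half required by
    \<open>sob_superlevel\<close>.\<close>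
  define r where "r = (2 * m / b) powr (1 / real ?N)"
  have r: "0 < r" "r ^ ?N = 2 * m / b" "r\<^sup>2 = (2 * m / b) powr (2 / real ?N)"
    using m b by (auto simp: r_def powr_realpow[symmetric] powr_powr powr_power)
  have "emeasure lborel {x. 2 * b \<le> (u x)\<^sup>2} \<le> emeasure lborel {x. b \<le> \<bar>z x\<bar>}"
  proof (rule emeasure_mono)
    have [measurable]: "z \<in> borel_measurable borel" using sobD(1)[OF sz] by (simp add: L2_def)
    show "{x. b \<le> \<bar>z x\<bar>} \<in> sets lborel" by measurable
    show "{x. 2 * b \<le> (u x)\<^sup>2} \<subseteq> {x. b \<le> \<bar>z x\<bar>}"
      using b by (auto simp: z_def F_def step_eq_1 field_simps)
  qed
  also have "\<dots> \<le> ennreal (8 * real ?N * r\<^sup>2 * n2 v / b\<^sup>2)"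
  proof (rule sob_superlevel[OF sz b r(1)])
    fix x
    have "b \<le> (u y)\<^sup>2" if "b / 2 \<le> \<bar>z y\<bar>" for y
    proof (rule ccontr)
      assume "\<not> ?thesis"
      then have "z y = 0" using b by (simp add: z_def F_def step_eq_0 field_simps)
      then show False using that b by simp
    qed
    then have sub: "sqrt b \<le> \<bar>u y\<bar>" if "b / 2 \<le> \<bar>z y\<bar>" for y
      using that by (metis real_sqrt_abs real_sqrt_le_mono)
    have "emeasure lborel {h \<in> cbox 0 (r *\<^sub>R One). b / 2 \<le> \<bar>z (x + h)\<bar>} \<le> emeasure lborel {h. sqrt b \<le> \<bar>u (h + x)\<bar>}"
      using sub by (intro emeasure_mono) (auto simp: add.commute)
    also have "\<dots> \<le> ennreal (n2 u / (sqrt b)\<^sup>2)"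
      using L2_Markov[OF L2_translate(1)[OF u, of x], of "sqrt b"] L2_translate(2)[OF u, of x] b by simp
    also have "\<dots> \<le> ennreal (r ^ ?N / 2)"
      unfolding r(2) using m b by (intro ennreal_leI) (simp add: divide_right_mono)
    finally show "emeasure lborel {h \<in> cbox 0 (r *\<^sub>R One). b / 2 \<le> \<bar>z (x + h)\<bar>} \<le> ennreal (r ^ ?N / 2)" .
  qed
  also have "\<dots> = ennreal (8 * real ?N * (2 * m / b) powr (2 / real ?N) / b\<^sup>2) * ennreal (n2 v)"
    unfolding r(3) by (subst ennreal_mult[symmetric]) auto
  also have "\<dots> \<le> ennreal (8 * real ?N * (2 * m / b) powr (2 / real ?N) / b\<^sup>2) *
      (9 * (\<integral>\<^sup>+x. ennreal ((u x)\<^sup>2 * (norm (w x))\<^sup>2) * indicator {x. b \<le> (u x)\<^sup>2 \<and> (u x)\<^sup>2 < 2 * b} x \<partial>lborel))"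
  proof (intro mult_left_mono)
    have "ennreal (n2 v) = (\<integral>\<^sup>+x. ennreal ((norm (v x))\<^sup>2) \<partial>lborel)"
      by (rule L2_nn_integral[OF sobD(2)[OF sz], symmetric])
    also have "\<dots> \<le> (\<integral>\<^sup>+x. 9 * (ennreal ((u x)\<^sup>2 * (norm (w x))\<^sup>2) * indicator {x. b \<le> (u x)\<^sup>2 \<and> (u x)\<^sup>2 < 2 * b} x) \<partial>lborel)"
    proof (rule nn_integral_mono)
      fix x
      show "ennreal ((norm (v x))\<^sup>2) \<le> 9 * (ennreal ((u x)\<^sup>2 * (norm (w x))\<^sup>2) * indicator {x. b \<le> (u x)\<^sup>2 \<and> (u x)\<^sup>2 < 2 * b} x)"
      proof (cases "b \<le> (u x)\<^sup>2 \<and> (u x)\<^sup>2 < 2 * b")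
        case True
        have "(norm (v x))\<^sup>2 = \<bar>F' (u x)\<bar>\<^sup>2 * (norm (w x))\<^sup>2" by (simp add: v_def power_mult_distrib)
        also have "\<dots> \<le> (3 * \<bar>u x\<bar>)\<^sup>2 * (norm (w x))\<^sup>2"
          by (intro mult_right_mono power_mono F'le) auto
        also have "\<dots> = 9 * ((u x)\<^sup>2 * (norm (w x))\<^sup>2)" by (simp add: power_mult_distrib)
        finally have "ennreal ((norm (v x))\<^sup>2) \<le> ennreal (9 * ((u x)\<^sup>2 * (norm (w x))\<^sup>2))" by (rule ennreal_leI)
        also have "\<dots> = 9 * ennreal ((u x)\<^sup>2 * (norm (w x))\<^sup>2)"
          by (subst ennreal_mult) auto
        finally show ?thesis using True by simp
      next
        case False
        then show ?thesis using F'0[of "u x"] by (simp add: v_def)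
      qed
    qed
    also have "\<dots> = 9 * (\<integral>\<^sup>+x. ennreal ((u x)\<^sup>2 * (norm (w x))\<^sup>2) * indicator {x. b \<le> (u x)\<^sup>2 \<and> (u x)\<^sup>2 < 2 * b} x \<partial>lborel)"
      by (rule nn_integral_cmult) measurable
    finally show "ennreal (n2 v) \<le> \<dots>" .
  qed simp
  also have "\<dots> = ennreal (72 * real ?N * (2 * m / b) powr (2 / real ?N) / b\<^sup>2) *
      (\<integral>\<^sup>+x. ennreal ((u x)\<^sup>2 * (norm (w x))\<^sup>2) * indicator {x. b \<le> (u x)\<^sup>2 \<and> (u x)\<^sup>2 < 2 * b} x \<partial>lborel)"
  proof -
    have "ennreal (8 * real ?N * (2 * m / b) powr (2 / real ?N) / b\<^sup>2) * 9
        = ennreal (8 * real ?N * (2 * m / b) powr (2 / real ?N) / b\<^sup>2 * 9)"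
      by (subst ennreal_mult) auto
    also have "8 * real ?N * (2 * m / b) powr (2 / real ?N) / b\<^sup>2 * 9 = 72 * real ?N * (2 * m / b) powr (2 / real ?N) / b\<^sup>2"
      by simp
    finally show ?thesis by (simp add: mult.assoc[symmetric])
  qed
  finally show ?thesis .
qed

lemma ennreal_term_le_suminf: "f k \<le> suminf f" for f :: "nat \<Rightarrow> ennreal"
  using sum_le_suminf[of f "{k}"] by simp

text \<open>Where u^2 >= 2, the value of |u|^p is bounded by the dyadic level below it, and
  \<open>sob_level\<close> at b = 2^k pays for each level with the Dirichlet integral over its own
  layer. The layers are disjoint, so the sum is controlled by the whole integral. Where u^2 < 2,
  |u|^p is at most 2^p u^2.\<close>

lemma sob_Gagliardo_Nirenberg:
  fixes u :: "real^'n::finite \<Rightarrow> real"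
  assumes s: "sob u w" and m: "0 < m" "n2 u \<le> m" and p: "p = 4 + 4 / real CARD('n)"
    and int: "integrable lborel (\<lambda>x. (u x)\<^sup>2 * (norm (w x))\<^sup>2)"
  defines "C \<equiv> 2 powr p * (72 * real CARD('n) * (2 * m) powr (2 / real CARD('n)))"
  shows "integrable lborel (\<lambda>x. \<bar>u x\<bar> powr p)"
    "(LINT x|lborel. \<bar>u x\<bar> powr p) \<le> 2 powr p * m + C * (LINT x|lborel. (u x)\<^sup>2 * (norm (w x))\<^sup>2)"
proof -
  note u = sobD(1)[OF s] and w = sobD(2)[OF s]
  have [measurable]: "u \<in> borel_measurable borel" "w \<in> borel_measurable borel" using u w by (auto simp: L2_def)
  let ?N = "CARD('n)"
  have p4: "4 \<le> p" unfolding p by simp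
  define A where "A k = {x. 2 ^ k \<le> (u x)\<^sup>2 \<and> (u x)\<^sup>2 < 2 * 2 ^ k}" for k :: nat
  have [measurable]: "A k \<in> sets borel" for k unfolding A_def by measurable
  define c where "c k = (2 * sqrt (2 ^ k)) powr p" for k :: nat
  let ?D = "\<lambda>x. ennreal ((u x)\<^sup>2 * (norm (w x))\<^sup>2)"
  have C0: "0 \<le> C" unfolding C_def by simp
  \<comment> \<open>Criticality of p: since p/2 = 2 + 2/N, the powers of 2^k cancel and every level
    contributes with the same constant.\<close>
  have ck: "c k * (72 * real ?N * (2 * m / 2 ^ k) powr (2 / real ?N) / (2 ^ k)\<^sup>2) = C" for k
  proof -
    have "c k = 2 powr p * (2 ^ k) powr (p / 2)"
      by (simp add: c_def powr_mult powr_half_sqrt[symmetric] powr_powr)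
    moreover have "(2 * m / 2 ^ k) powr (2 / real ?N) = (2 * m) powr (2 / real ?N) / (2 ^ k) powr (2 / real ?N)"
      using m by (simp add: powr_divide)
    moreover have "(2 ^ k) powr (p / 2) = (2 ^ k) powr (2 / real ?N) * ((2::real) ^ k)\<^sup>2"
    proof -
      have "p / 2 = 2 / real ?N + 2" by (simp add: p)
      then have "(2 ^ k) powr (p / 2) = (2 ^ k) powr (2 / real ?N) * ((2::real) ^ k) powr 2" by (simp only: powr_add)
      then show ?thesis by simp
    qed
    ultimately show ?thesis by (simp add: C_def)
  qed
  have pw: "ennreal (\<bar>u x\<bar> powr p) \<le> ennreal (2 powr p * (norm (u x))\<^sup>2)
      + (\<Sum>k. ennreal (c k) * indicator {x. 2 * 2 ^ k \<le> (u x)\<^sup>2} x)" for x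
  proof (cases "2 \<le> (u x)\<^sup>2")
    case True
    \<comment> \<open>As u^2 >= 2, the least n with u^2 < 2^n is at least 2, and k = n - 2 satisfies
      2 * 2^k <= u^2 < 4 * 2^k.\<close>
    define n where "n = (LEAST n. (u x)\<^sup>2 < 2 ^ n)"
    obtain n0 where "(u x)\<^sup>2 < 2 ^ n0" using real_arch_pow[of 2 "(u x)\<^sup>2"] by auto
    then have n: "(u x)\<^sup>2 < 2 ^ n" unfolding n_def by (rule LeastI)
    have "n \<noteq> 0"
    proof
      assume "n = 0"
      with n True show False by simp
    qed
    moreover have "n \<noteq> 1"
    proof
      assume "n = 1"
      with n True show False by simp
    qed
    ultimately
    obtain k where k: "n = Suc (Suc k)" by (metis One_nat_def not0_implies_Suc)
    have "\<not> (u x)\<^sup>2 < 2 ^ Suc k" using not_less_Least[of "Suc k" "\<lambda>n. (u x)\<^sup>2 < 2 ^ n"] k by (simp add: n_def)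
    then have ge: "2 * 2 ^ k \<le> (u x)\<^sup>2" by simp
    have "\<bar>u x\<bar> \<le> 2 * sqrt (2 ^ k)"
    proof -
      have "(u x)\<^sup>2 \<le> 4 * 2 ^ k" using n k by simp
      then have "sqrt ((u x)\<^sup>2) \<le> sqrt (4 * 2 ^ k)" by (rule real_sqrt_le_mono)
      then show ?thesis by (simp add: real_sqrt_mult)
    qed
    then have "\<bar>u x\<bar> powr p \<le> c k" unfolding c_def using p4 by (intro powr_mono2) auto
    then have "ennreal (\<bar>u x\<bar> powr p) \<le> ennreal (c k) * indicator {x. 2 * 2 ^ k \<le> (u x)\<^sup>2} x"
      using ge by (simp add: ennreal_leI)
    also have "\<dots> \<le> (\<Sum>k. ennreal (c k) * indicator {x. 2 * 2 ^ k \<le> (u x)\<^sup>2} x)"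
      by (rule ennreal_term_le_suminf)
    finally show ?thesis by (simp add: add_increasing)
  next
    case False
    have "\<bar>u x\<bar> powr p \<le> 2 powr p * (norm (u x))\<^sup>2"
    proof (cases "u x = 0")
      case nz: False
      have "\<bar>u x\<bar> \<le> 2"
      proof (rule ccontr)
        assume "\<not> ?thesis"
        then have "2\<^sup>2 \<le> \<bar>u x\<bar>\<^sup>2" by (intro power_mono) auto
        then show False using False by simp
      qed
      then have "\<bar>u x\<bar> powr (p - 2) \<le> 2 powr (p - 2)" using p4 by (intro powr_mono2) auto
      also have "\<dots> \<le> 2 powr p" by (intro powr_mono) auto
      finally have "\<bar>u x\<bar> powr (p - 2) * \<bar>u x\<bar> powr 2 \<le> 2 powr p * \<bar>u x\<bar> powr 2" by (intro mult_right_mono) auto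
      moreover have "\<bar>u x\<bar> powr (p - 2) * \<bar>u x\<bar> powr 2 = \<bar>u x\<bar> powr p" unfolding powr_add[symmetric] by simp
      moreover have "\<bar>u x\<bar> powr 2 = (norm (u x))\<^sup>2" using nz by simp
      ultimately show ?thesis by simp
    qed simp
    then show ?thesis by (intro add_increasing2) (auto intro: ennreal_leI)
  qed
  have "(\<integral>\<^sup>+x. ennreal (\<bar>u x\<bar> powr p) \<partial>lborel)
      \<le> (\<integral>\<^sup>+x. ennreal (2 powr p * (norm (u x))\<^sup>2) + (\<Sum>k. ennreal (c k) * indicator {x. 2 * 2 ^ k \<le> (u x)\<^sup>2} x) \<partial>lborel)"
    by (rule nn_integral_mono) (rule pw)
  also have "\<dots> = (\<integral>\<^sup>+x. ennreal (2 powr p * (norm (u x))\<^sup>2) \<partial>lborel)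
      + (\<integral>\<^sup>+x. (\<Sum>k. ennreal (c k) * indicator {x. 2 * 2 ^ k \<le> (u x)\<^sup>2} x) \<partial>lborel)"
    by (rule nn_integral_add) measurable
  also have "(\<integral>\<^sup>+x. ennreal (2 powr p * (norm (u x))\<^sup>2) \<partial>lborel) = ennreal (2 powr p * n2 u)"
    using L2_nn_integral[OF u] by (subst ennreal_mult) (auto simp: nn_integral_cmult ennreal_mult)
  also have "\<dots> \<le> ennreal (2 powr p * m)"
    using m by (intro ennreal_leI mult_left_mono) auto
  also have "(\<integral>\<^sup>+x. (\<Sum>k. ennreal (c k) * indicator {x. 2 * 2 ^ k \<le> (u x)\<^sup>2} x) \<partial>lborel)
      = (\<Sum>k. \<integral>\<^sup>+x. ennreal (c k) * indicator {x. 2 * 2 ^ k \<le> (u x)\<^sup>2} x \<partial>lborel)"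
    by (rule nn_integral_suminf) measurable
  also have "\<dots> \<le> (\<Sum>k. \<integral>\<^sup>+x. ennreal C * (?D x * indicator (A k) x) \<partial>lborel)"
  proof (rule suminf_le)
    fix k
    have "(\<integral>\<^sup>+x. ennreal (c k) * indicator {x. 2 * 2 ^ k \<le> (u x)\<^sup>2} x \<partial>lborel) = ennreal (c k) * emeasure lborel {x. 2 * 2 ^ k \<le> (u x)\<^sup>2}"
      by (rule nn_integral_cmult_indicator) measurable
    also have "\<dots> \<le> ennreal (c k) * (ennreal (72 * real ?N * (2 * m / 2 ^ k) powr (2 / real ?N) / (2 ^ k)\<^sup>2) *
        (\<integral>\<^sup>+x. ?D x * indicator (A k) x \<partial>lborel))"
      unfolding A_def by (intro mult_left_mono sob_level[OF s _ m]) auto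
    also have "\<dots> = ennreal C * (\<integral>\<^sup>+x. ?D x * indicator (A k) x \<partial>lborel)"
    proof -
      have "ennreal (c k) * ennreal (72 * real ?N * (2 * m / 2 ^ k) powr (2 / real ?N) / (2 ^ k)\<^sup>2) = ennreal C"
        unfolding ck[of k, symmetric] by (rule ennreal_mult[symmetric]) (auto simp: c_def)
      then show ?thesis by (simp only: mult.assoc[symmetric])
    qed
    also have "\<dots> = (\<integral>\<^sup>+x. ennreal C * (?D x * indicator (A k) x) \<partial>lborel)"
      by (rule nn_integral_cmult[symmetric]) measurable
    finally show "(\<integral>\<^sup>+x. ennreal (c k) * indicator {x. 2 * 2 ^ k \<le> (u x)\<^sup>2} x \<partial>lborel) \<le> \<dots>" .
  qed auto
  also have "\<dots> = (\<integral>\<^sup>+x. (\<Sum>k. ennreal C * (?D x * indicator (A k) x)) \<partial>lborel)"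
    by (rule nn_integral_suminf[symmetric]) measurable
  also have "\<dots> \<le> (\<integral>\<^sup>+x. ennreal C * ?D x \<partial>lborel)"
  proof (rule nn_integral_mono)
    fix x
    have "disjoint_family A"
      unfolding disjoint_family_on_def
    proof (intro ballI impI)
      have *: "A i \<inter> A j = {}" if "i < j" for i j
      proof -
        have "(2::real) * 2 ^ i \<le> 2 ^ j" using power_increasing[of "Suc i" j "2::real"] that by simp
        then show ?thesis unfolding A_def by force
      qed
      fix i j :: nat assume "i \<noteq> j"
      then show "A i \<inter> A j = {}" using *[of i j] *[of j i] by (cases "i < j") auto
    qed
    then have "(\<Sum>k. indicator (A k) x :: ennreal) = indicator (\<Union>k. A k) x" by (rule suminf_indicator)
    also have "\<dots> \<le> 1" by (simp add: indicator_def)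
    finally have "ennreal C * ?D x * (\<Sum>k. indicator (A k) x) \<le> ennreal C * ?D x * 1" by (rule mult_left_mono) simp
    then show "(\<Sum>k. ennreal C * (?D x * indicator (A k) x)) \<le> ennreal C * ?D x"
      by (simp add: mult.assoc)
  qed
  also have "\<dots> = ennreal (C * (LINT x|lborel. (u x)\<^sup>2 * (norm (w x))\<^sup>2))"
  proof -
    have "(\<integral>\<^sup>+x. ?D x \<partial>lborel) = ennreal (LINT x|lborel. (u x)\<^sup>2 * (norm (w x))\<^sup>2)"
      by (rule nn_integral_eq_integral[OF int]) auto
    then show ?thesis using C0 by (simp only: nn_integral_cmult ennreal_mult') (subst nn_integral_cmult; simp)
  qed
  finally have main: "(\<integral>\<^sup>+x. ennreal (\<bar>u x\<bar> powr p) \<partial>lborel)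
      \<le> ennreal (2 powr p * m + C * (LINT x|lborel. (u x)\<^sup>2 * (norm (w x))\<^sup>2))"
    using m C0 by (simp add: add_left_mono add_mono)
  have "(\<integral>\<^sup>+x. ennreal (norm (\<bar>u x\<bar> powr p)) \<partial>lborel) < \<infinity>"
    using main by (simp add: order_le_less_trans ennreal_less_top)
  then show I: "integrable lborel (\<lambda>x. \<bar>u x\<bar> powr p)"
    by (intro integrableI_bounded) auto
  have "ennreal (LINT x|lborel. \<bar>u x\<bar> powr p) \<le> ennreal (2 powr p * m + C * (LINT x|lborel. (u x)\<^sup>2 * (norm (w x))\<^sup>2))"
    using main by (subst (asm) nn_integral_eq_integral[OF I]) auto
  then show "(LINT x|lborel. \<bar>u x\<bar> powr p) \<le> 2 powr p * m + C * (LINT x|lborel. (u x)\<^sup>2 * (norm (w x))\<^sup>2)"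
    using m C0 by (subst (asm) ennreal_le_iff) (auto intro!: add_nonneg_nonneg mult_nonneg_nonneg)
qed

section \<open>Local compactness\<close>

lemma L2_indicator_mult:
  fixes f :: "'a::euclidean_space \<Rightarrow> real"
  assumes f: "L2 f" and [measurable]: "A \<in> sets borel"
  shows "L2 (\<lambda>x. indicator A x * f x)" "n2 (\<lambda>x. indicator A x * f x) \<le> n2 f"
proof -
  have m: "(\<lambda>x. indicator A x * f x) \<in> borel_measurable borel" using f by measurable
  have "norm (indicator A x * f x) \<le> 1 * norm (f x)" for x by (simp add: indicator_def)
  from L2_bounded[OF f m this] show "L2 (\<lambda>x. indicator A x * f x)" "n2 (\<lambda>x. indicator A x * f x) \<le> n2 f" by simp_all
qed

text \<open>Not divided by the volume of the cube, so comparisons with v carry the factor r^N. The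
  cube has x as its lower corner, not as its centre.\<close>

definition cube_int :: "real \<Rightarrow> ('a::euclidean_space \<Rightarrow> real) \<Rightarrow> 'a \<Rightarrow> real" where
  "cube_int r v x = (LINT h|lborel. indicator (cbox 0 (r *\<^sub>R One)) h * v (x + h))"

lemma L2_indicator_cube:
  assumes "0 \<le> r"
  shows "L2 (indicator (cbox 0 (r *\<^sub>R One)) :: 'a::euclidean_space \<Rightarrow> real)"
    "n2 (indicator (cbox 0 (r *\<^sub>R One)) :: 'a::euclidean_space \<Rightarrow> real) = r ^ DIM('a)"
proof -
  show L: "L2 (indicator (cbox 0 (r *\<^sub>R One)) :: 'a \<Rightarrow> real)"
    by (rule L2_indicator) (auto simp: emeasure_cube[OF assms])
  have "ennreal (n2 (indicator (cbox 0 (r *\<^sub>R One)) :: 'a \<Rightarrow> real)) = (\<integral>\<^sup>+x. indicator (cbox 0 (r *\<^sub>R One) :: 'a set) x \<partial>lborel)"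
    unfolding L2_nn_integral[OF L, symmetric] by (intro nn_integral_cong) (auto simp: indicator_def)
  also have "\<dots> = ennreal (r ^ DIM('a))" using emeasure_cube[OF assms, where 'a='a] by simp
  finally show "n2 (indicator (cbox 0 (r *\<^sub>R One)) :: 'a \<Rightarrow> real) = r ^ DIM('a)"
    using assms by simp
qed

lemma cube_int_bound:
  fixes v :: "'a::euclidean_space \<Rightarrow> real"
  assumes v: "L2 v" and r: "0 \<le> r"
  shows "\<bar>cube_int r v x\<bar> \<le> sqrt (r ^ DIM('a)) * sqrt (n2 v)"
  using L2_Cauchy_Schwarz[OF L2_indicator_cube(1)[OF r] L2_translate(1)[OF v, of x]]
    L2_indicator_cube(2)[OF r, where 'a='a] L2_translate(2)[OF v, of x]
  by (simp add: cube_int_def add.commute)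

lemma cube_int_diff:
  assumes u: "L2 u" and v: "L2 v" and r: "0 \<le> r"
  shows "cube_int r u x - cube_int r v y = (LINT h|lborel. indicator (cbox 0 (r *\<^sub>R One)) h * (u (h + x) - v (h + y)))"
  unfolding cube_int_def right_diff_distrib
  using L2_mult_integrable[OF L2_indicator_cube(1)[OF r] L2_translate(1)[OF u, of x]]
    L2_mult_integrable[OF L2_indicator_cube(1)[OF r] L2_translate(1)[OF v, of y]]
  by (subst Bochner_Integration.integral_diff) (auto simp: add.commute)

lemma cube_int_lipschitz:
  fixes v :: "real^'n::finite \<Rightarrow> real"
  assumes s: "sob v w" and r: "0 \<le> r"
  shows "\<bar>cube_int r v x - cube_int r v y\<bar> \<le> sqrt (r ^ CARD('n)) * (norm (x - y) * sqrt (n2 w))"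
proof -
  note v = sobD(1)[OF s]
  have d: "L2 (\<lambda>h. v (h + x) - v (h + y))" by (intro L2_diff L2_translate v)
  have "n2 (\<lambda>h. v (h + x) - v (h + y)) = n2 (\<lambda>h. v (h + (x - y)) - v h)"
  proof -
    have "L2 (\<lambda>h. v (h + (x - y)) - v h)" by (intro L2_diff L2_translate v)
    from L2_translate(2)[OF this, of y] show ?thesis by (simp add: algebra_simps)
  qed
  also have "\<dots> \<le> (norm (x - y))\<^sup>2 * n2 w" by (rule sob_increment(2)[OF s])
  finally have "sqrt (n2 (\<lambda>h. v (h + x) - v (h + y))) \<le> norm (x - y) * sqrt (n2 w)"
    by (metis abs_norm_cancel real_sqrt_abs real_sqrt_le_mono real_sqrt_mult)
  moreover have "\<bar>cube_int r v x - cube_int r v y\<bar> \<le> sqrt (r ^ CARD('n)) * sqrt (n2 (\<lambda>h. v (h + x) - v (h + y)))"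
    using L2_Cauchy_Schwarz[OF L2_indicator_cube(1)[OF r] d] L2_indicator_cube(2)[OF r, where 'a="real^'n"]
    unfolding cube_int_diff[OF v v r] by simp
  ultimately show ?thesis
    using r by (meson mult_left_mono order_trans real_sqrt_ge_zero zero_le_power)
qed

text \<open>The difference is the integral over the cube of the increments v(x+h) - v(x), each of
  squared norm at most N r^2 \<open>n2 w\<close>; \<open>L2_average_set\<close> integrates
  them.\<close>

lemma cube_int_Poincare:
  fixes v :: "real^'n::finite \<Rightarrow> real"
  assumes s: "sob v w" and r: "0 \<le> r"
  shows "L2 (cube_int r v)" "n2 (\<lambda>x. cube_int r v x - r ^ CARD('n) * v x) \<le> (r ^ CARD('n))\<^sup>2 * (real CARD('n) * r\<^sup>2 * n2 w)"
proof -
  note v = sobD(1)[OF s]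
  have [measurable]: "v \<in> borel_measurable borel" using v by (simp add: L2_def)
  let ?Q = "cbox 0 (r *\<^sub>R One) :: (real^'n) set"
  have c: "(\<integral>\<^sup>+x. ennreal ((v (x + h) - v x)\<^sup>2) \<partial>lborel) \<le> ennreal (real CARD('n) * r\<^sup>2 * n2 w)" if "h \<in> ?Q" for h
  proof -
    have "(\<integral>\<^sup>+x. ennreal ((v (x + h) - v x)\<^sup>2) \<partial>lborel) = ennreal (n2 (\<lambda>x. v (x + h) - v x))"
      using L2_nn_integral[OF L2_diff[OF L2_translate(1)[OF v, of h] v]] by simp
    also have "\<dots> \<le> ennreal (real CARD('n) * r\<^sup>2 * n2 w)"
    proof (rule ennreal_leI)
      have "n2 (\<lambda>x. v (x + h) - v x) \<le> (norm h)\<^sup>2 * n2 w" by (rule sob_increment(2)[OF s])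
      also have "\<dots> \<le> (real CARD('n) * r\<^sup>2) * n2 w"
        using norm_cbox_One_le[OF that] by (intro mult_right_mono) auto
      finally show "n2 (\<lambda>x. v (x + h) - v x) \<le> real CARD('n) * r\<^sup>2 * n2 w" .
    qed
    finally show ?thesis .
  qed
  have q: "emeasure lborel ?Q = ennreal (r ^ CARD('n))" using emeasure_cube[OF r, where 'a="real^'n"] by simp
  have m: "(\<lambda>(h, x). v (x + h) - v x) \<in> borel_measurable (lborel \<Otimes>\<^sub>M lborel)" by measurable
  have eq: "(LINT h|lborel. indicator ?Q h * (v (x + h) - v x)) = cube_int r v x - r ^ CARD('n) * v x" for x
  proof -
    have i: "integrable lborel (\<lambda>h. indicator ?Q h * v (x + h))"
      using L2_mult_integrable[OF L2_indicator_cube(1)[OF r] L2_translate(1)[OF v, of x]] by (simp add: add.commute)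
    have j: "integrable lborel (\<lambda>h. indicator ?Q h * v x)"
      by (intro integrable_mult_left integrable_real_indicator) (auto simp: q)
    have "(LINT h|lborel. indicator ?Q h * (v (x + h) - v x)) = cube_int r v x - (LINT h|lborel. indicator ?Q h * v x)"
      unfolding cube_int_def right_diff_distrib by (rule Bochner_Integration.integral_diff[OF i j])
    also have "(LINT h|lborel. indicator ?Q h * v x) = r ^ CARD('n) * v x"
      using q r by (simp add: measure_def)
    finally show ?thesis .
  qed
  have L: "L2 (\<lambda>x. cube_int r v x - r ^ CARD('n) * v x)"
    and b: "n2 (\<lambda>x. cube_int r v x - r ^ CARD('n) * v x) \<le> (r ^ CARD('n))\<^sup>2 * (real CARD('n) * r\<^sup>2 * n2 w)"
    using L2_average_set(1,2)[OF m _ q _ c] r unfolding eq by auto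
  show "n2 (\<lambda>x. cube_int r v x - r ^ CARD('n) * v x) \<le> (r ^ CARD('n))\<^sup>2 * (real CARD('n) * r\<^sup>2 * n2 w)" by (rule b)
  have "L2 (\<lambda>x. (cube_int r v x - r ^ CARD('n) * v x) + r ^ CARD('n) * v x)"
    by (intro L2_add L L2_cmult v)
  then show "L2 (cube_int r v)" by simp
qed

text \<open>Cube averages are uniformly bounded and equi-Lipschitz, hence converge along a
  diagonal subsequence, and they are uniformly close in \<open>L2\<close> to the functions themselves.\<close>

lemma sob_compactness:
  fixes v :: "nat \<Rightarrow> real^'n::finite \<Rightarrow> real"
  assumes s: "\<And>n. sob (v n) (w n)" and vM: "\<And>n. n2 (v n) \<le> M" and wM: "\<And>n. n2 (w n) \<le> M"
  obtains k V where "strict_mono (k::nat\<Rightarrow>nat)" "L2 V" "n2 V \<le> M" "AE x in lborel. (\<lambda>n. v (k n) x) \<longlonglongrightarrow> V x"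
    "\<And>R. (\<lambda>n. n2 (\<lambda>x. indicator (cball 0 R) x * (v (k n) x - V x))) \<longlonglongrightarrow> 0"
proof -
  note v = sobD(1)[OF s]
  have [measurable]: "v n \<in> borel_measurable borel" for n using v by (simp add: L2_def)
  have M0: "0 \<le> M" using vM[of 0] n2_nonneg order_trans by blast
  define q where "q j = inverse (real (Suc j))" for j
  have q: "0 < q j" "q j \<le> 1" for j by (auto simp: q_def inverse_le_1_iff)
  have q0: "q \<longlonglongrightarrow> 0" unfolding q_def by (rule LIMSEQ_inverse_real_of_nat)
  \<comment> \<open>Sides at most 1 make the sup bound and the Lipschitz constant equal to
    \<open>sqrt M\<close> for all j and n at once.\<close>
  have q1: "sqrt (q j ^ CARD('n)) \<le> 1" for j using q[of j] by (simp add: power_le_one)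
  define A where "A j n x = cube_int (q j) (v n) x" for j n x
  have Ab: "\<bar>A j n x\<bar> \<le> sqrt M" for j n x
  proof -
    have "\<bar>A j n x\<bar> \<le> sqrt (q j ^ CARD('n)) * sqrt (n2 (v n))"
      using cube_int_bound[OF v, of "q j" n x] q[of j] by (simp add: A_def)
    also have "\<dots> \<le> 1 * sqrt M" using q1 vM[of n] by (intro mult_mono) auto
    finally show ?thesis by simp
  qed
  have Al: "\<bar>A j n x - A j n y\<bar> \<le> sqrt M * norm (x - y)" for j n x y
  proof -
    have "\<bar>A j n x - A j n y\<bar> \<le> sqrt (q j ^ CARD('n)) * (norm (x - y) * sqrt (n2 (w n)))"
      using cube_int_lipschitz[OF s, of "q j" n x y] q[of j] by (simp add: A_def)
    also have "\<dots> \<le> 1 * (norm (x - y) * sqrt M)" using q1 wM[of n] by (intro mult_mono) auto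
    finally show ?thesis by (simp add: mult.commute)
  qed
  obtain D :: "(real^'n) set" where D: "countable D" "\<And>X. open X \<Longrightarrow> X \<noteq> {} \<Longrightarrow> \<exists>d\<in>D. d \<in> X"
    using countable_dense_exists by blast
  have cD: "countable ((UNIV :: nat set) \<times> D)" using D(1) by auto
  obtain k where k: "strict_mono (k::nat\<Rightarrow>nat)"
    and lim: "\<And>jd. jd \<in> (UNIV :: nat set) \<times> D \<Longrightarrow> \<exists>l. (\<lambda>n. A (fst jd) (k n) (snd jd)) \<longlonglongrightarrow> l"
  proof (rule function_convergent_subsequence[OF cD, of "\<lambda>n jd. A (fst jd) n (snd jd)" "sqrt M"])
    show "norm (A (fst jd) n (snd jd)) \<le> sqrt M" for n jd using Ab by simp
  qed blast
  \<comment> \<open>The diagonal subsequence converges on a countable dense set; the common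
    Lipschitz constant extends this to every point.\<close>
  have conv: "convergent (\<lambda>n. A j (k n) x)" for j x
  proof (rule Cauchy_convergent, rule metric_CauchyI)
    fix e :: real assume e: "0 < e"
    define \<delta> where "\<delta> = (e / 4) / (sqrt M + 1)"
    have \<delta>: "0 < \<delta>" using e M0 by (auto simp: \<delta>_def intro!: divide_pos_pos add_nonneg_pos)
    obtain d where d: "d \<in> D" "d \<in> ball x \<delta>" using D(2)[of "ball x \<delta>"] \<delta> by auto
    have small: "\<bar>A j n x - A j n d\<bar> \<le> e / 4" for n
    proof -
      have "\<bar>A j n x - A j n d\<bar> \<le> sqrt M * norm (x - d)" by (rule Al)
      also have "\<dots> \<le> (sqrt M + 1) * \<delta>"
        using d(2) M0 by (intro mult_mono) (auto simp: dist_norm)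
      also have "\<dots> = e / 4"
      proof -
        have "sqrt M + 1 \<noteq> 0" using real_sqrt_ge_zero[OF M0] by linarith
        moreover have "c * (b / c) = b" if "c \<noteq> 0" for b c :: real using that by simp
        ultimately show ?thesis unfolding \<delta>_def by blast
      qed
      finally show ?thesis .
    qed
    have "convergent (\<lambda>n. A j (k n) d)" using lim[of "(j, d)"] d(1) by (auto simp: convergent_def)
    then have "Cauchy (\<lambda>n. A j (k n) d)" by (rule convergent_Cauchy)
    then obtain N where N: "\<And>m n. m \<ge> N \<Longrightarrow> n \<ge> N \<Longrightarrow> dist (A j (k m) d) (A j (k n) d) < e / 4"
      using e by (meson metric_CauchyD divide_pos_pos zero_less_numeral)
    show "\<exists>N. \<forall>m\<ge>N. \<forall>n\<ge>N. dist (A j (k m) x) (A j (k n) x) < e"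
    proof (intro exI allI impI)
      fix m n assume "N \<le> m" "N \<le> n"
      with N[of m n] small[of "k m"] small[of "k n"] show "dist (A j (k m) x) (A j (k n) x) < e"
        using e unfolding dist_real_def by linarith
    qed
  qed
  define \<kappa> where "\<kappa> j x = lim (\<lambda>n. A j (k n) x)" for j x
  have \<kappa>: "(\<lambda>n. A j (k n) x) \<longlonglongrightarrow> \<kappa> j x" for j x
    using conv unfolding \<kappa>_def by (simp add: convergent_LIMSEQ_iff)
  have LA: "L2 (A j n)" for j n
    unfolding A_def using cube_int_Poincare(1)[OF s, of "q j" n] q[of j] by simp
  have [measurable]: "A j n \<in> borel_measurable borel" for j n using LA by (simp add: L2_def)
  have [measurable]: "\<kappa> j \<in> borel_measurable borel" for j unfolding \<kappa>_def by measurable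
  have \<kappa>b: "\<bar>\<kappa> j x\<bar> \<le> sqrt M" for j x
    using Ab by (intro LIMSEQ_le_const2[OF tendsto_rabs[OF \<kappa>]]) auto
  let ?I = "\<lambda>R x. indicator (cball 0 R) x :: real"
  have LI: "L2 (?I R :: real^'n \<Rightarrow> real)" for R by (rule L2_indicator_cball)
  have I\<kappa>: "L2 (\<lambda>x. ?I R x * \<kappa> j x)" for R j
    by (rule L2_bounded(1)[OF LI[of R], of _ "sqrt M"]) (use \<kappa>b in \<open>auto simp: abs_mult indicator_def\<close>)
  have IA: "L2 (\<lambda>x. ?I R x * A j n x)" for R j n by (rule L2_indicator_mult[OF LA]) simp
  have Alim: "(\<lambda>n. n2 (\<lambda>x. ?I R x * A j (k n) x - ?I R x * \<kappa> j x)) \<longlonglongrightarrow> 0" for j R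
  proof (rule L2_dominated_convergence[OF L2_measurable[OF IA] L2_measurable[OF I\<kappa>] L2_cmult[OF LI[of R], of "2 * sqrt M"]])
    show "AE x in lborel. (\<lambda>n. ?I R x * A j (k n) x) \<longlonglongrightarrow> ?I R x * \<kappa> j x"
      by (intro AE_I2 tendsto_intros \<kappa>)
    show "AE x in lborel. norm (?I R x * A j (k n) x - ?I R x * \<kappa> j x) \<le> norm (2 * sqrt M * ?I R x)" for n
    proof (rule AE_I2)
      fix x
      show "norm (?I R x * A j (k n) x - ?I R x * \<kappa> j x) \<le> norm (2 * sqrt M * ?I R x)"
        using Ab[of j "k n" x] \<kappa>b[of j x] M0 by (auto simp: indicator_def)
    qed
  qed
  \<comment> \<open>The order of choices matters: the side \<open>q j\<close> first, to make the
    Poincare error small uniformly in n, and only then n, for the averages over cubes of that side.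
    The volume \<open>a\<close> of the cube is divided out at the end.\<close>
  have CauchyB: "\<exists>N. \<forall>m\<ge>N. \<forall>n\<ge>N. n2 (\<lambda>x. ?I R x * (v (k m) x - v (k n) x)) \<le> e" if e: "0 < e" for R e
  proof -
    have "(\<lambda>j. 8 * (real CARD('n) * (q j)\<^sup>2 * M)) \<longlonglongrightarrow> 8 * (real CARD('n) * 0\<^sup>2 * M)"
      by (intro tendsto_intros q0)
    then have z: "(\<lambda>j. 8 * (real CARD('n) * (q j)\<^sup>2 * M)) \<longlonglongrightarrow> 0" by simp
    have "\<forall>\<^sub>F j in sequentially. 8 * (real CARD('n) * (q j)\<^sup>2 * M) < e / 2"
      using e by (intro order_tendstoD(2)[OF z]) auto
    then obtain j where j: "8 * (real CARD('n) * (q j)\<^sup>2 * M) < e / 2"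
      by (meson eventually_sequentially le_refl)
    define a where "a = q j ^ CARD('n)"
    have a: "0 < a" using q[of j] by (simp add: a_def)
    have "\<forall>\<^sub>F n in sequentially. n2 (\<lambda>x. ?I R x * A j (k n) x - ?I R x * \<kappa> j x) < a\<^sup>2 * e / 16"
      using e a by (intro order_tendstoD(2)[OF Alim]) auto
    then obtain N where N: "\<And>n. n \<ge> N \<Longrightarrow> n2 (\<lambda>x. ?I R x * A j (k n) x - ?I R x * \<kappa> j x) < a\<^sup>2 * e / 16"
      by (auto simp: eventually_sequentially)
    have "n2 (\<lambda>x. ?I R x * (v (k m) x - v (k n) x)) \<le> e" if "N \<le> m" "N \<le> n" for m n
    proof -
      let ?P = "\<lambda>n x. ?I R x * (A j (k n) x - a * v (k n) x)"
      have LP: "L2 (?P n)" and nP: "n2 (?P n) \<le> a\<^sup>2 * (real CARD('n) * (q j)\<^sup>2 * M)" for n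
      proof -
        have d: "L2 (\<lambda>x. A j (k n) x - a * v (k n) x)" by (intro L2_diff LA L2_cmult v)
        show "L2 (?P n)" by (rule L2_indicator_mult(1)[OF d]) simp
        have "n2 (?P n) \<le> n2 (\<lambda>x. A j (k n) x - a * v (k n) x)" by (rule L2_indicator_mult(2)[OF d]) simp
        also have "\<dots> \<le> a\<^sup>2 * (real CARD('n) * (q j)\<^sup>2 * n2 (w (k n)))"
          unfolding a_def A_def using q[of j] by (intro cube_int_Poincare(2)[OF s]) simp
        also have "\<dots> \<le> a\<^sup>2 * (real CARD('n) * (q j)\<^sup>2 * M)" by (intro mult_left_mono wM) auto
        finally show "n2 (?P n) \<le> a\<^sup>2 * (real CARD('n) * (q j)\<^sup>2 * M)" .
      qed
      let ?S = "\<lambda>n x. ?I R x * A j (k n) x - ?I R x * \<kappa> j x"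
      have LS: "L2 (?S n)" for n by (intro L2_diff IA I\<kappa>)
      have "a\<^sup>2 * n2 (\<lambda>x. ?I R x * (v (k m) x - v (k n) x)) = n2 (\<lambda>x. a *\<^sub>R (?I R x * (v (k m) x - v (k n) x)))"
        by (rule n2_scaleR[symmetric])
      also have "\<dots> = n2 (\<lambda>x. (?P n x - ?P m x) + (?S m x - ?S n x))"
        by (simp add: algebra_simps)
      also have "\<dots> \<le> 2 * n2 (\<lambda>x. ?P n x - ?P m x) + 2 * n2 (\<lambda>x. ?S m x - ?S n x)"
        by (intro n2_add_le L2_diff[OF LP LP] L2_diff[OF LS LS])
      also have "\<dots> \<le> 2 * (2 * n2 (?P n) + 2 * n2 (?P m)) + 2 * (2 * n2 (?S m) + 2 * n2 (?S n))"
        by (intro add_mono mult_left_mono n2_diff_le LP LS) auto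
      also have "\<dots> \<le> a\<^sup>2 * (8 * (real CARD('n) * (q j)\<^sup>2 * M)) + a\<^sup>2 * (e / 2)"
        using nP[of m] nP[of n] N[OF that(1)] N[OF that(2)] by simp
      also have "\<dots> \<le> a\<^sup>2 * (e / 2) + a\<^sup>2 * (e / 2)"
        using j by (intro add_right_mono mult_left_mono) auto
      also have "\<dots> = a\<^sup>2 * e" by simp
      finally show ?thesis using a by simp
    qed
    then show ?thesis by blast
  qed
  obtain r V where r: "strict_mono (r::nat\<Rightarrow>nat)" and Vm [measurable]: "V \<in> borel_measurable borel"
    and AE: "AE x in lborel. x \<in> (\<Union>j::nat. cball (0::real^'n) (real j)) \<longrightarrow> (\<lambda>n. v (k (r n)) x) \<longlonglongrightarrow> V x"
  proof (rule L2_local_complete[of "\<lambda>n. v (k n)" "\<lambda>j. cball 0 (real j)"])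
    show "incseq (\<lambda>j. cball (0::real^'n) (real j))" by (auto simp: incseq_def)
    fix j :: nat and e :: real assume "0 < e"
    then obtain N where N: "\<And>m n. N \<le> m \<Longrightarrow> N \<le> n \<Longrightarrow> n2 (\<lambda>x. ?I (real j) x * (v (k m) x - v (k n) x)) \<le> e"
      using CauchyB by blast
    have "(\<integral>\<^sup>+x. ennreal ((norm (v (k m) x - v (k n) x))\<^sup>2 * indicator (cball 0 (real j)) x) \<partial>lborel)
        = ennreal (n2 (\<lambda>x. ?I (real j) x * (v (k m) x - v (k n) x)))" for m n
      unfolding L2_nn_integral[OF L2_indicator_mult(1)[OF L2_diff[OF v v]], symmetric, of "cball 0 (real j)", simplified]
      by (intro nn_integral_cong) (auto simp: indicator_def)
    then show "\<exists>N. \<forall>m\<ge>N. \<forall>n\<ge>N.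
       (\<integral>\<^sup>+x. ennreal ((norm (v (k m) x - v (k n) x))\<^sup>2 * indicator (cball 0 (real j)) x) \<partial>lborel) \<le> ennreal e"
      using N by (intro exI[of _ N]) (auto intro: ennreal_leI)
  qed auto
  have AEV: "AE x in lborel. (\<lambda>n. v (k (r n)) x) \<longlonglongrightarrow> V x"
    using AE
  proof eventually_elim
    case (elim x)
    have "x \<in> (\<Union>j::nat. cball 0 (real j))" using real_arch_simple[of "norm x"] by auto
    with elim show ?case by blast
  qed
  have V: "L2 V" "n2 V \<le> M"
    using L2_Fatou[OF v Vm AEV _ M0] vM by auto
  show thesis
  proof (rule that[of "k \<circ> r" V])
    show "strict_mono (k \<circ> r)" using k r by (simp add: strict_mono_o)
    show "AE x in lborel. (\<lambda>n. v ((k \<circ> r) n) x) \<longlonglongrightarrow> V x" using AEV by simp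
    show "(\<lambda>n. n2 (\<lambda>x. ?I R x * (v ((k \<circ> r) n) x - V x))) \<longlonglongrightarrow> 0" for R
    proof (rule LIMSEQ_I)
      fix e :: real assume e: "0 < e"
      obtain N where N: "\<And>m n. N \<le> m \<Longrightarrow> N \<le> n \<Longrightarrow> n2 (\<lambda>x. ?I R x * (v (k m) x - v (k n) x)) \<le> e / 2"
        using CauchyB[of "e/2" R] e by auto
      have "n2 (\<lambda>x. ?I R x * (v (k (r n)) x - V x)) \<le> e / 2" if n: "N \<le> n" for n
      proof (rule L2_Fatou(2)[where f="\<lambda>m x. ?I R x * (v (k (r n)) x - v (k (r m)) x)"])
        show "L2 (\<lambda>x. ?I R x * (v (k (r n)) x - v (k (r m)) x))" for m
          by (intro L2_indicator_mult L2_diff v) simp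
        show "(\<lambda>x. ?I R x * (v (k (r n)) x - V x)) \<in> borel_measurable borel"
          by (rule L2_measurable, intro L2_indicator_mult L2_diff v V) simp
        show "AE x in lborel. (\<lambda>m. ?I R x * (v (k (r n)) x - v (k (r m)) x)) \<longlonglongrightarrow> ?I R x * (v (k (r n)) x - V x)"
          using AEV by eventually_elim (intro tendsto_intros)
        show "\<forall>\<^sub>F m in sequentially. n2 (\<lambda>x. ?I R x * (v (k (r n)) x - v (k (r m)) x)) \<le> e / 2"
          using eventually_ge_at_top[of N]
          by eventually_elim (use N n seq_suble[OF r] order_trans in blast)
      qed (use e in auto)
      then show "\<exists>no. \<forall>n\<ge>no. norm (n2 (\<lambda>x. ?I R x * (v ((k \<circ> r) n) x - V x)) - 0) < e"
        using e by (intro exI[of _ N]) force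
    qed
  qed (use V in auto)
qed

section \<open>The change of variables\<close>

text \<open>The primitive of sqrt (1 + 2 s^2) vanishing at 0. Separating variables in the equation
  for \<open>fchange\<close> gives \<open>Phi (f t) = t\<close>, so \<open>fchange\<close> is the
  inverse of this function.\<close>

definition Phi :: "real \<Rightarrow> real" where
  "Phi s = s * sqrt (1 + 2 * s\<^sup>2) / 2 + arsinh (sqrt 2 * s) / (2 * sqrt 2)"

lemma one_plus_pos: "0 < 1 + 2 * s\<^sup>2" for s :: real
  using zero_le_power2[of s] by linarith

lemma Phi_deriv: "(Phi has_real_derivative sqrt (1 + 2 * s\<^sup>2)) (at s)"
proof -
  let ?q = "sqrt (1 + 2 * s\<^sup>2)"
  have q: "0 < ?q" using one_plus_pos by simp
  have qq: "?q * ?q = 1 + 2 * s\<^sup>2" using one_plus_pos[of s] by simp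
  have "((\<lambda>s. 1 + 2 * s\<^sup>2) has_real_derivative 4 * s) (at s)"
    by (auto intro!: derivative_eq_intros)
  from DERIV_chain2[OF DERIV_real_sqrt[OF one_plus_pos] this]
  have dq: "((\<lambda>s. sqrt (1 + 2 * s\<^sup>2)) has_real_derivative 2 * s / ?q) (at s)"
    by (rule DERIV_cong) (simp add: field_simps)
  have "((\<lambda>s. sqrt 2 * s) has_real_derivative sqrt 2) (at s)"
    by (auto intro!: derivative_eq_intros)
  from DERIV_chain2[OF arsinh_real_has_field_derivative this]
  have da: "((\<lambda>s. arsinh (sqrt 2 * s)) has_real_derivative sqrt 2 / ?q) (at s)"
    by (rule DERIV_cong) (simp add: power_mult_distrib add.commute)
  have "((\<lambda>s. s * sqrt (1 + 2 * s\<^sup>2) / 2 + arsinh (sqrt 2 * s) / (2 * sqrt 2)) has_real_derivative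
      (1 * ?q + 2 * s / ?q * s) / 2 + sqrt 2 / ?q / (2 * sqrt 2)) (at s)"
    by (intro DERIV_add DERIV_cdivide DERIV_mult dq da DERIV_ident)
  moreover have "(1 * ?q + 2 * s / ?q * s) / 2 + sqrt 2 / ?q / (2 * sqrt 2) = ?q"
  proof -
    have "(1 * ?q + 2 * s / ?q * s) / 2 + sqrt 2 / ?q / (2 * sqrt 2) = (?q * ?q + 2 * s\<^sup>2 + 1) / (2 * ?q)"
      using q by (simp add: field_simps power2_eq_square)
    also have "\<dots> = (?q * ?q + ?q * ?q) / (2 * ?q)" by (simp only: qq) simp
    also have "\<dots> = ?q" using q by (simp add: field_simps)
    finally show ?thesis .
  qed
  ultimately show ?thesis unfolding Phi_def[abs_def] by simp
qed

lemma Phi_0 [simp]: "Phi 0 = 0"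
  by (simp add: Phi_def)

lemma Phi_diff_ge: "s \<le> t \<Longrightarrow> t - s \<le> Phi t - Phi s"
proof -
  assume st: "s \<le> t"
  have "Phi s - s \<le> Phi t - t"
  proof (rule DERIV_nonneg_imp_nondecreasing[OF st])
    fix x
    have "((\<lambda>x. Phi x - x) has_real_derivative sqrt (1 + 2 * x\<^sup>2) - 1) (at x)"
      by (intro DERIV_diff Phi_deriv DERIV_ident)
    moreover have "1 \<le> sqrt (1 + 2 * x\<^sup>2)" by simp
    ultimately show "\<exists>y. ((\<lambda>x. Phi x - x) has_real_derivative y) (at x) \<and> 0 \<le> y" by force
  qed
  then show ?thesis by simp
qed

text \<open>The slope is at least 1. From this come injectivity, continuity of the inverse, and the
  Lipschitz constant 1 of \<open>fchange\<close>.\<close>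

lemma Phi_expand: "\<bar>s - t\<bar> \<le> \<bar>Phi s - Phi t\<bar>"
  using Phi_diff_ge[of s t] Phi_diff_ge[of t s] by (cases "s \<le> t") auto

lemma Phi_inj: "Phi s = Phi t \<longleftrightarrow> s = t"
  using Phi_expand[of s t] by auto

lemma Phi_continuous: "continuous_on S Phi"
  by (meson DERIV_isCont Phi_deriv continuous_at_imp_continuous_on)

lemma Phi_surj: "\<exists>s. Phi s = t"
proof -
  have "- \<bar>t\<bar> \<le> \<bar>t\<bar>" by simp
  moreover have "Phi (- \<bar>t\<bar>) \<le> t" "t \<le> Phi \<bar>t\<bar>"
    using Phi_diff_ge[of "- \<bar>t\<bar>" 0] Phi_diff_ge[of 0 "\<bar>t\<bar>"] by auto
  ultimately show ?thesis using IVT'[of Phi "- \<bar>t\<bar>" t "\<bar>t\<bar>"] Phi_continuous by blast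
qed

definition invPhi :: "real \<Rightarrow> real" where
  "invPhi = inv Phi"

lemma Phi_invPhi: "Phi (invPhi t) = t"
  unfolding invPhi_def using Phi_surj[of t] by (metis f_inv_into_f rangeI)

lemma invPhi_deriv: "(invPhi has_real_derivative 1 / sqrt (1 + 2 * (invPhi t)\<^sup>2)) (at t)"
proof -
  have lip: "\<bar>invPhi s - invPhi t\<bar> \<le> \<bar>s - t\<bar>" for s t
    using Phi_expand[of "invPhi s" "invPhi t"] by (simp add: Phi_invPhi)
  have "isCont invPhi t"
    unfolding continuous_at_eps_delta
  proof (intro allI impI)
    fix e :: real assume "0 < e"
    then show "\<exists>d>0. \<forall>x'. dist x' t < d \<longrightarrow> dist (invPhi x') (invPhi t) < e"
      using lip by (intro exI[of _ e]) (auto simp: dist_real_def intro: le_less_trans)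
  qed
  then have "(invPhi has_real_derivative inverse (sqrt (1 + 2 * (invPhi t)\<^sup>2))) (at t)"
    using one_plus_pos[of "invPhi t"]
    by (intro DERIV_inverse_function[where f=Phi and a="t-1" and b="t+1"] Phi_deriv) (auto simp: Phi_invPhi)
  then show ?thesis by (simp add: inverse_eq_divide)
qed

text \<open>Along any solution h of the differential equation, \<open>Phi (h t) - t\<close> has
  derivative 0; this gives the uniqueness that the definite description requires.\<close>

lemma fchange_eq: "fchange = invPhi"
  unfolding fchange_def
proof (rule the_equality)
  have "invPhi 0 = 0" using Phi_invPhi[of 0] Phi_inj[of "invPhi 0" 0] by simp
  then show "invPhi 0 = 0 \<and> (\<forall>t. (invPhi has_real_derivative 1 / sqrt (1 + 2 * (invPhi t)\<^sup>2)) (at t))"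
    using invPhi_deriv by blast
  fix h assume h: "h 0 = 0 \<and> (\<forall>t. (h has_real_derivative 1 / sqrt (1 + 2 * (h t)\<^sup>2)) (at t))"
  show "h = invPhi"
  proof
    fix t
    have "((\<lambda>t. Phi (h t) - t) has_real_derivative 0) (at t)" for t
    proof -
      have "((\<lambda>t. Phi (h t)) has_real_derivative sqrt (1 + 2 * (h t)\<^sup>2) * (1 / sqrt (1 + 2 * (h t)\<^sup>2))) (at t)"
        using h by (intro DERIV_chain2[OF Phi_deriv]) blast
      moreover have "sqrt (1 + 2 * (h t)\<^sup>2) * (1 / sqrt (1 + 2 * (h t)\<^sup>2)) = 1"
        using one_plus_pos[of "h t"] by simp
      ultimately have "((\<lambda>t. Phi (h t)) has_real_derivative 1) (at t)" by simp
      from DERIV_diff[OF this DERIV_ident] show ?thesis by simp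
    qed
    then have "Phi (h t) - t = Phi (h 0) - 0" using DERIV_isconst_all[of "\<lambda>t. Phi (h t) - t" t 0] by simp
    then have "Phi (h t) = Phi (invPhi t)" using h by (simp add: Phi_invPhi)
    then show "h t = invPhi t" by (simp add: Phi_inj)
  qed
qed

section \<open>Elementary bounds on the change of variables\<close>

lemma Phi_fchange: "Phi (fchange t) = t"
  by (simp add: fchange_eq Phi_invPhi)

lemma fchange_Phi: "fchange (Phi s) = s"
  using Phi_fchange[of "Phi s"] by (simp add: Phi_inj)

lemma fchange_0 [simp]: "fchange 0 = 0"
  using fchange_Phi[of 0] by simp

lemma fchange_deriv: "(fchange has_real_derivative 1 / sqrt (1 + 2 * (fchange t)\<^sup>2)) (at t)"
  unfolding fchange_eq by (rule invPhi_deriv)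

lemma fchange_continuous: "continuous_on S fchange"
  by (meson DERIV_isCont fchange_deriv continuous_at_imp_continuous_on)

lemma fchange_measurable [measurable]: "fchange \<in> borel_measurable borel"
  by (intro borel_measurable_continuous_onI fchange_continuous)

lemma fchange_lipschitz: "\<bar>fchange s - fchange t\<bar> \<le> \<bar>s - t\<bar>"
  using Phi_expand[of "fchange s" "fchange t"] by (simp add: Phi_fchange)

lemma fchange_le: "\<bar>fchange t\<bar> \<le> \<bar>t\<bar>"
  using fchange_lipschitz[of t 0] by simp

lemma Phi_minus: "Phi (- s) = - Phi s"
  by (simp add: Phi_def arsinh_minus_real)

lemma fchange_minus: "fchange (- t) = - fchange t"
  using Phi_minus[of "fchange t"] Phi_fchange fchange_Phi by metis

lemma Phi_mono: "Phi s \<le> Phi t \<longleftrightarrow> s \<le> t"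
  using Phi_diff_ge[of s t] Phi_diff_ge[of t s] Phi_inj[of s t] by (cases "s \<le> t") auto

lemma fchange_mono: "fchange s \<le> fchange t \<longleftrightarrow> s \<le> t"
  using Phi_mono[of "fchange s" "fchange t"] by (simp add: Phi_fchange)

lemma fchange_abs: "\<bar>fchange t\<bar> = fchange \<bar>t\<bar>"
  using fchange_mono[of 0 t] fchange_minus[of t] by (cases "0 \<le> t") (auto simp: abs_if)

lemma fchange_abs_mono: "\<bar>s\<bar> \<le> \<bar>t\<bar> \<Longrightarrow> \<bar>fchange s\<bar> \<le> \<bar>fchange t\<bar>"
  by (simp add: fchange_abs fchange_mono)

lemma Phi_abs_ge: "\<bar>s\<bar> \<le> \<bar>Phi s\<bar>"
  using Phi_expand[of s 0] by simp

lemma Phi_abs_le: "\<bar>Phi s\<bar> \<le> \<bar>s\<bar> * sqrt (1 + 2 * s\<^sup>2)"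
proof -
  have pos: "Phi s \<le> s * sqrt (1 + 2 * s\<^sup>2)" if "0 \<le> s" for s
  proof (cases "s = 0")
    case False
    then have "0 < s" using that by simp
    then obtain z where z: "0 < z" "z < s" "Phi s - Phi 0 = (s - 0) * sqrt (1 + 2 * z\<^sup>2)"
      using MVT2[of 0 s Phi "\<lambda>x. sqrt (1 + 2 * x\<^sup>2)"] Phi_deriv by blast
    have "z\<^sup>2 \<le> s\<^sup>2" using z by (intro power_mono) auto
    then have "s * sqrt (1 + 2 * z\<^sup>2) \<le> s * sqrt (1 + 2 * s\<^sup>2)" using that by (intro mult_left_mono) auto
    then show ?thesis using z by simp
  qed simp
  have abs: "\<bar>Phi s\<bar> = Phi \<bar>s\<bar>"
    using Phi_mono[of 0 s] Phi_minus[of s] by (cases "0 \<le> s") (auto simp: abs_if)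
  show ?thesis using pos[of "\<bar>s\<bar>"] abs by simp
qed

text \<open>A reverse to \<open>fchange_le\<close>: with u = f(v) it says that v^2 is at most u^2 +
  2 u^4. Since p >= 4, the L2 norm of v is thus controlled by the mass and the critical power of
  u.\<close>

lemma square_le_fchange: "t\<^sup>2 \<le> (fchange t)\<^sup>2 * (1 + 2 * (fchange t)\<^sup>2)"
proof -
  have "\<bar>t\<bar> \<le> \<bar>fchange t\<bar> * sqrt (1 + 2 * (fchange t)\<^sup>2)" using Phi_abs_le[of "fchange t"] by (simp add: Phi_fchange)
  then have "\<bar>t\<bar>\<^sup>2 \<le> (\<bar>fchange t\<bar> * sqrt (1 + 2 * (fchange t)\<^sup>2))\<^sup>2" by (intro power_mono) auto
  then show ?thesis using one_plus_pos[of "fchange t"] by (simp add: power_mult_distrib less_imp_le)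
qed

lemma fchange_half_le:
  assumes "\<bar>t\<bar> \<le> 1"
  shows "\<bar>t\<bar> / 2 \<le> \<bar>fchange t\<bar>"
proof -
  have "(fchange t)\<^sup>2 \<le> 1" using fchange_le[of t] assms by (simp add: abs_square_le_1)
  then have "(fchange t)\<^sup>2 * (1 + 2 * (fchange t)\<^sup>2) \<le> (fchange t)\<^sup>2 * 4" by (intro mult_left_mono) auto
  then have "t\<^sup>2 \<le> (2 * \<bar>fchange t\<bar>)\<^sup>2" using square_le_fchange[of t] by (simp add: power_mult_distrib)
  then have "\<bar>t\<bar> \<le> 2 * \<bar>fchange t\<bar>" using power2_le_imp_le[of "\<bar>t\<bar>" "2 * \<bar>fchange t\<bar>"] by simp
  then show ?thesis by simp
qed

lemma sob_fchange:
  assumes "sob v w"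
  shows "sob (\<lambda>x. fchange (v x)) (\<lambda>x. (1 / sqrt (1 + 2 * (fchange (v x))\<^sup>2)) *\<^sub>R w x)"
proof (rule sob_chain[OF assms fchange_deriv, where L=1])
  show "(\<lambda>x. 1 / sqrt (1 + 2 * (fchange x)\<^sup>2)) \<in> borel_measurable borel" by measurable
  show "\<bar>1 / sqrt (1 + 2 * (fchange t)\<^sup>2)\<bar> \<le> 1" for t
  proof -
    have s: "1 \<le> sqrt (1 + 2 * (fchange t)\<^sup>2)" by simp
    then have "1 / sqrt (1 + 2 * (fchange t)\<^sup>2) \<le> 1"
      by (simp only: divide_le_eq_1_pos[OF less_le_trans[OF zero_less_one s]])
    moreover have "0 \<le> 1 / sqrt (1 + 2 * (fchange t)\<^sup>2)" by simp
    ultimately show ?thesis by linarith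
  qed
qed simp

lemma scaled_arctan_tendsto: "(\<lambda>n. real (Suc n) * arctan (y / real (Suc n))) \<longlonglongrightarrow> y"
proof (cases "y = 0")
  case False
  have "(\<lambda>n. y * inverse (real (Suc n))) \<longlonglongrightarrow> y * 0" by (intro tendsto_intros LIMSEQ_inverse_real_of_nat)
  then have "filterlim (\<lambda>n. y / real (Suc n)) (at 0) sequentially"
    using False by (simp add: filterlim_at divide_inverse)
  moreover
  have "((\<lambda>h. (arctan (0 + h) - arctan 0) / h) \<longlongrightarrow> inverse (1 + 0\<^sup>2)) (at 0)"
    using DERIV_arctan[of 0] by (simp only: DERIV_def)
  then have "((\<lambda>h::real. arctan h / h) \<longlongrightarrow> 1) (at 0)" by simp
  ultimately have "(\<lambda>n. arctan (y / real (Suc n)) / (y / real (Suc n))) \<longlonglongrightarrow> 1"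
    by (rule filterlim_compose[rotated])
  then have "(\<lambda>n. y * (arctan (y / real (Suc n)) / (y / real (Suc n)))) \<longlonglongrightarrow> y * 1"
    by (intro tendsto_intros)
  moreover have "y * (arctan (y / real (Suc n)) / (y / real (Suc n))) = real (Suc n) * arctan (y / real (Suc n))" for n
    using False by simp
  ultimately show ?thesis by simp
qed simp

lemma arctan_between: "\<bar>arctan x - x\<bar> \<le> \<bar>x\<bar>" for x :: real
proof -
  have *: "0 \<le> arctan x" "arctan x \<le> x" if "0 \<le> x" for x :: real
    using that arctan_le_self by auto
  show ?thesis
    using *[of x] *[of "- x"] by (cases "0 \<le> x") (auto simp: arctan_minus)
qed

text \<open>\<open>Phi\<close> has unbounded derivative, so the chain rule is first applied to the truncations
  \<open>k * arctan (Phi / k)\<close>.\<close>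

lemma sob_Phi:
  fixes u :: "real^'n::finite \<Rightarrow> real"
  assumes s: "sob u w" and LP: "L2 (\<lambda>x. Phi (u x))"
    and int: "integrable lborel (\<lambda>x. (u x)\<^sup>2 * (norm (w x))\<^sup>2)"
  shows "sob (\<lambda>x. Phi (u x)) (\<lambda>x. sqrt (1 + 2 * (u x)\<^sup>2) *\<^sub>R w x)"
proof -
  note u = sobD(1)[OF s] and w = sobD(2)[OF s]
  have [measurable]: "u \<in> borel_measurable borel" "w \<in> borel_measurable borel" using u w by (auto simp: L2_def)
  have Pm [measurable]: "Phi \<in> borel_measurable borel" by (intro borel_measurable_continuous_onI Phi_continuous)
  have LW: "L2 (\<lambda>x. sqrt (1 + 2 * (u x)\<^sup>2) *\<^sub>R w x)"
  proof -
    have "integrable lborel (\<lambda>x. (norm (w x))\<^sup>2 + 2 * ((u x)\<^sup>2 * (norm (w x))\<^sup>2))"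
      by (intro Bochner_Integration.integrable_add L2_integrable w integrable_mult_right int)
    moreover have "(norm (sqrt (1 + 2 * (u x)\<^sup>2) *\<^sub>R w x))\<^sup>2 = (norm (w x))\<^sup>2 + 2 * ((u x)\<^sup>2 * (norm (w x))\<^sup>2)" for x
      using one_plus_pos[of "u x"] by (simp add: power_mult_distrib less_imp_le algebra_simps)
    ultimately show ?thesis by (simp add: L2_def)
  qed
  define F where "F n t = real (Suc n) * arctan (Phi t / real (Suc n))" for n t
  define F' where "F' n t = sqrt (1 + 2 * t\<^sup>2) / (1 + (Phi t / real (Suc n))\<^sup>2)" for n t
  have F: "(F n has_real_derivative F' n t) (at t)" for n t
  proof -
    have "((\<lambda>t. arctan (Phi t / real (Suc n))) has_real_derivative
        inverse (1 + (Phi t / real (Suc n))\<^sup>2) * (sqrt (1 + 2 * t\<^sup>2) / real (Suc n))) (at t)"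
      by (rule DERIV_chain2[OF DERIV_arctan DERIV_cdivide[OF Phi_deriv]])
    moreover have "c * (inverse i * (q / c)) = q / i" if "c \<noteq> 0" for c i q :: real
      using that by (simp add: divide_inverse)
    ultimately show ?thesis
      using DERIV_cmult[of "\<lambda>t. arctan (Phi t / real (Suc n))" _ t UNIV "real (Suc n)"]
      unfolding F_def[abs_def] F'_def by (metis of_nat_neq_0)
  qed
  have den: "1 \<le> 1 + (Phi t / real (Suc n))\<^sup>2" for n t by simp
  have F'0: "0 \<le> F' n t" "F' n t \<le> sqrt (1 + 2 * t\<^sup>2)" for n t
  proof -
    have q: "0 \<le> sqrt (1 + 2 * t\<^sup>2)" by simp
    show "0 \<le> F' n t" unfolding F'_def using q by (intro divide_nonneg_nonneg) auto
    have "sqrt (1 + 2 * t\<^sup>2) / (1 + (Phi t / real (Suc n))\<^sup>2) \<le> sqrt (1 + 2 * t\<^sup>2) / 1"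
      using den[of t n] q less_le_trans[OF zero_less_one den[of t n]] by (intro divide_left_mono) simp_all
    then show "F' n t \<le> sqrt (1 + 2 * t\<^sup>2)" unfolding F'_def by simp
  qed
  have F'L: "\<bar>F' n t\<bar> \<le> 1 + real (Suc n)" for n t
  proof -
    define y where "y = \<bar>Phi t\<bar>"
    define k where "k = real (Suc n)"
    have k: "0 < k" by (simp add: k_def)
    have "(1 + 2 * \<bar>t\<bar>)\<^sup>2 = 1 + 4 * \<bar>t\<bar> + 4 * t\<^sup>2" by (simp add: power2_sum power_mult_distrib)
    then have "1 + 2 * t\<^sup>2 \<le> (1 + 2 * \<bar>t\<bar>)\<^sup>2" using zero_le_power2[of t] abs_ge_zero[of t] by linarith
    then have "sqrt (1 + 2 * t\<^sup>2) \<le> 1 + 2 * \<bar>t\<bar>" by (intro real_le_lsqrt) auto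
    also have "\<dots> \<le> 1 + 2 * y" using Phi_abs_ge[of t] by (simp add: y_def)
    \<comment> \<open>The linear growth of the slope of Phi is absorbed by the quadratic growth of
      the denominator, so each truncation has bounded derivative.\<close>
    also have "2 * y \<le> k + y\<^sup>2 / k"
    proof -
      have "0 \<le> (y - k)\<^sup>2 / k" using k by simp
      also have "\<dots> = k + y\<^sup>2 / k - 2 * y" using k by (simp add: power2_eq_square field_simps)
      finally show ?thesis by simp
    qed
    also have "1 + (k + y\<^sup>2 / k) \<le> (1 + k) * (1 + (y / k)\<^sup>2)"
      using k by (simp add: power2_eq_square field_simps)
    finally have "sqrt (1 + 2 * t\<^sup>2) \<le> (1 + k) * (1 + (Phi t / k)\<^sup>2)" by (simp add: y_def power_divide)
    then have "F' n t \<le> 1 + k"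
      using less_le_trans[OF zero_less_one den[of t n]] unfolding F'_def k_def
      by (simp only: pos_divide_le_eq)
    then show ?thesis using F'0(1)[of n t] by (simp add: k_def)
  qed
  have F'm [measurable]: "F' n \<in> borel_measurable borel" for n unfolding F'_def by measurable
  have Fm [measurable]: "F n \<in> borel_measurable borel" for n unfolding F_def by measurable
  have sF: "sob (\<lambda>x. F n (u x)) (\<lambda>x. F' n (u x) *\<^sub>R w x)" for n
    by (rule sob_chain[OF s F F'm F'L]) (simp add: F_def)
  show ?thesis
  proof (rule sob_limit[OF sF LP LW])
    show "(\<lambda>n. n2 (\<lambda>x. F n (u x) - Phi (u x))) \<longlonglongrightarrow> 0"
    proof (rule L2_dominated_convergence[OF _ _ LP])
      show "AE x in lborel. (\<lambda>n. F n (u x)) \<longlonglongrightarrow> Phi (u x)"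
        unfolding F_def by (intro AE_I2 scaled_arctan_tendsto)
      have "\<bar>F n t - Phi t\<bar> \<le> \<bar>Phi t\<bar>" for n t
      proof -
        have "F n t - Phi t = real (Suc n) * (arctan (Phi t / real (Suc n)) - Phi t / real (Suc n))"
          unfolding F_def right_diff_distrib by (simp del: of_nat_Suc)
        then have "\<bar>F n t - Phi t\<bar> = real (Suc n) * \<bar>arctan (Phi t / real (Suc n)) - Phi t / real (Suc n)\<bar>"
          by (simp add: abs_mult del: of_nat_Suc)
        also have "\<dots> \<le> real (Suc n) * \<bar>Phi t / real (Suc n)\<bar>" by (intro mult_left_mono arctan_between) simp
        also have "\<dots> = \<bar>Phi t\<bar>" by simp
        finally show ?thesis .
      qed
      then show "AE x in lborel. norm (F n (u x) - Phi (u x)) \<le> norm (Phi (u x))" for n by simp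
    qed auto
    show "(\<lambda>n. n2 (\<lambda>x. F' n (u x) *\<^sub>R w x - sqrt (1 + 2 * (u x)\<^sup>2) *\<^sub>R w x)) \<longlonglongrightarrow> 0"
    proof (rule L2_dominated_convergence[OF _ _ LW])
      have "(\<lambda>n. F' n t) \<longlonglongrightarrow> sqrt (1 + 2 * t\<^sup>2)" for t
      proof -
        have "(\<lambda>n. sqrt (1 + 2 * t\<^sup>2) / (1 + (Phi t * inverse (real (Suc n)))\<^sup>2)) \<longlonglongrightarrow> sqrt (1 + 2 * t\<^sup>2) / (1 + (Phi t * 0)\<^sup>2)"
          by (intro tendsto_intros LIMSEQ_inverse_real_of_nat) simp
        then show ?thesis by (simp add: F'_def divide_inverse)
      qed
      then show "AE x in lborel. (\<lambda>n. F' n (u x) *\<^sub>R w x) \<longlonglongrightarrow> sqrt (1 + 2 * (u x)\<^sup>2) *\<^sub>R w x"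
        by (intro AE_I2 tendsto_intros)
      show "AE x in lborel. norm (F' n (u x) *\<^sub>R w x - sqrt (1 + 2 * (u x)\<^sup>2) *\<^sub>R w x) \<le> norm (sqrt (1 + 2 * (u x)\<^sup>2) *\<^sub>R w x)" for n
      proof (rule AE_I2)
        fix x
        have "\<bar>F' n (u x) - sqrt (1 + 2 * (u x)\<^sup>2)\<bar> \<le> sqrt (1 + 2 * (u x)\<^sup>2)"
          using F'0[of n "u x"] by simp
        then show "norm (F' n (u x) *\<^sub>R w x - sqrt (1 + 2 * (u x)\<^sup>2) *\<^sub>R w x) \<le> norm (sqrt (1 + 2 * (u x)\<^sup>2) *\<^sub>R w x)"
          using one_plus_pos[of "u x"] unfolding scaleR_left_diff_distrib[symmetric]
          by (auto simp: less_imp_le intro: mult_right_mono)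
      qed
    qed auto
  qed
qed

section \<open>The energy in the dual variable\<close>

text \<open>The exponent is a parameter with an equation, so that it stays a symbol where only p >=
  4 matters. Condition (g4) is not part of the locale; it enters as the hypothesis on
  \<open>s0\<close> in the lemmas about \<open>m1\<close>.\<close>

locale quasilinear =
  fixes g :: "real \<Rightarrow> real" and dim :: "'n::finite itself" and p :: real
  assumes p_eq: "p = 4 + 4 / real CARD('n)"
    and g_cont: "continuous_on UNIV g"
    and g_zero: "((\<lambda>s. g s / s) \<longlongrightarrow> 0) (at 0)"
    and g_infinity: "((\<lambda>s. \<bar>g s\<bar> / \<bar>s\<bar> powr (p - 1)) \<longlongrightarrow> 0) at_infinity"
    and g_odd: "\<And>s. g (- s) = - g s"
    and g_sign: "\<And>s. 0 \<le> g s * s"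
begin

section \<open>Growth of the primitive of g\<close>

lemma p_ge: "4 \<le> p"
  by (simp add: p_eq)

lemma G_deriv: "(Gp g has_real_derivative g s) (at s)"
proof -
  have "((\<lambda>u. LBINT y=ereal 0..ereal u. g y) has_vector_derivative (g s)) (at s within {- \<bar>s\<bar> - 1..\<bar>s\<bar> + 1})"
    by (rule interval_integral_FTC2) (auto intro: continuous_on_subset[OF g_cont])
  moreover have "at s within {- \<bar>s\<bar> - 1..\<bar>s\<bar> + 1} = at s"
    by (rule at_within_interior) (auto simp: interior_atLeastAtMost_real)
  moreover have "(\<lambda>u. LBINT y=ereal 0..ereal u. g y) = Gp g"
    by (auto simp: Gp_def zero_ereal_def)
  ultimately show ?thesis by (simp add: has_real_derivative_iff_has_vector_derivative)
qed

lemma G_0 [simp]: "Gp g 0 = 0"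
  unfolding Gp_def zero_ereal_def by (rule interval_integral_endpoints_same)

lemma G_continuous: "continuous_on S (Gp g)"
  by (meson DERIV_isCont G_deriv continuous_at_imp_continuous_on)

lemma G_measurable [measurable]: "Gp g \<in> borel_measurable borel"
  by (intro borel_measurable_continuous_onI G_continuous)

lemma g_0 [simp]: "g 0 = 0"
  using g_odd[of 0] by simp

lemma g_nonneg: "0 \<le> s \<Longrightarrow> 0 \<le> g s"
  using g_sign[of s] by (cases "s = 0") (auto simp: zero_le_mult_iff)

lemma G_minus: "Gp g (- s) = Gp g s"
proof -
  have "((\<lambda>s. Gp g (- s) - Gp g s) has_real_derivative 0) (at s)" for s
  proof -
    have "((\<lambda>s. Gp g (- s)) has_real_derivative g (- s) * (- 1)) (at s)"
      by (rule DERIV_chain2[OF G_deriv]) (auto intro!: derivative_eq_intros)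
    from DERIV_diff[OF this G_deriv] show ?thesis by (simp add: g_odd)
  qed
  then have "Gp g (- s) - Gp g s = Gp g (- 0) - Gp g 0" using DERIV_isconst_all[of "\<lambda>s. Gp g (- s) - Gp g s" s 0] by simp
  then show ?thesis by simp
qed

lemma G_abs: "Gp g \<bar>s\<bar> = Gp g s"
  by (simp add: abs_if G_minus)

lemma G_mono: "\<bar>s\<bar> \<le> \<bar>t\<bar> \<Longrightarrow> Gp g s \<le> Gp g t"
proof -
  assume "\<bar>s\<bar> \<le> \<bar>t\<bar>"
  then have "Gp g \<bar>s\<bar> \<le> Gp g \<bar>t\<bar>"
    by (rule DERIV_nonneg_imp_nondecreasing) (use G_deriv g_nonneg in fastforce)
  then show ?thesis by (simp add: G_abs)
qed

lemma G_nonneg: "0 \<le> Gp g s"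
  using G_mono[of 0 s] by simp

lemma G_small:
  assumes "0 < \<epsilon>"
  obtains \<delta> where "0 < \<delta>" "\<And>s. \<bar>s\<bar> < \<delta> \<Longrightarrow> Gp g s \<le> \<epsilon> * s\<^sup>2"
proof -
  have "\<forall>\<^sub>F s in at 0. \<bar>g s / s\<bar> < \<epsilon>"
    using tendstoD[OF g_zero assms] by (simp add: dist_real_def)
  then obtain \<delta> where \<delta>: "0 < \<delta>" and b: "\<And>s. s \<noteq> 0 \<Longrightarrow> \<bar>s\<bar> < \<delta> \<Longrightarrow> \<bar>g s / s\<bar> < \<epsilon>"
    by (auto simp: eventually_at dist_real_def)
  have "Gp g s \<le> \<epsilon> * s\<^sup>2" if s: "0 \<le> s" "s < \<delta>" for s
  proof -
    have "\<epsilon> * 0\<^sup>2 - Gp g 0 \<le> \<epsilon> * s\<^sup>2 - Gp g s"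
    proof (rule DERIV_nonneg_imp_nondecreasing[OF s(1)])
      fix x assume x: "0 \<le> x" "x \<le> s"
      have "((\<lambda>s. \<epsilon> * s\<^sup>2 - Gp g s) has_real_derivative \<epsilon> * (2 * x) - g x) (at x)"
        by (intro DERIV_diff G_deriv) (auto intro!: derivative_eq_intros)
      moreover have "g x \<le> \<epsilon> * (2 * x)"
      proof (cases "x = 0")
        case False
        then have "0 < x" using x by simp
        then have "g x < \<epsilon> * x" using b[of x] x s by (simp add: abs_less_iff field_simps)
        moreover have "0 \<le> \<epsilon> * x" using assms x by simp
        ultimately show ?thesis by simp
      qed simp
      ultimately show "\<exists>y. ((\<lambda>s. \<epsilon> * s\<^sup>2 - Gp g s) has_real_derivative y) (at x) \<and> 0 \<le> y" by force
    qed
    then show ?thesis by simp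
  qed
  then have "Gp g s \<le> \<epsilon> * s\<^sup>2" if "\<bar>s\<bar> < \<delta>" for s
    using that G_abs[of s] by (metis abs_ge_zero power2_abs)
  with \<delta> show thesis by (rule that)
qed

lemma G_large:
  assumes "0 < \<epsilon>"
  obtains K where "0 < K" "\<And>s. K \<le> \<bar>s\<bar> \<Longrightarrow> Gp g s \<le> Gp g K + \<epsilon> * \<bar>s\<bar> powr p"
proof -
  have "\<forall>\<^sub>F s in at_infinity. \<bar>g s\<bar> / \<bar>s\<bar> powr (p - 1) < \<epsilon>"
    using tendstoD[OF g_infinity assms] by (simp add: dist_real_def)
  then obtain K0 where K0: "\<And>s. K0 \<le> \<bar>s\<bar> \<Longrightarrow> \<bar>g s\<bar> / \<bar>s\<bar> powr (p - 1) < \<epsilon>"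
    by (auto simp: eventually_at_infinity)
  define K where "K = max K0 1"
  have K: "0 < K" "K0 \<le> K" by (auto simp: K_def)
  have "Gp g s \<le> Gp g K + \<epsilon> * s powr p" if s: "K \<le> s" for s
  proof -
    have "\<epsilon> * K powr p - Gp g K \<le> \<epsilon> * s powr p - Gp g s"
    proof (rule DERIV_nonneg_imp_nondecreasing[OF s])
      fix x assume x: "K \<le> x" "x \<le> s"
      have x0: "0 < x" using x K by simp
      have "((\<lambda>s. \<epsilon> * s powr p - Gp g s) has_real_derivative \<epsilon> * (p * x powr (p - 1)) - g x) (at x)"
        by (intro DERIV_diff G_deriv DERIV_cmult has_real_derivative_powr x0)
      moreover have "g x \<le> \<epsilon> * (p * x powr (p - 1))"
      proof -
        have "\<bar>g x\<bar> / x powr (p - 1) < \<epsilon>" using K0[of x] x K x0 by simp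
        then have "g x < \<epsilon> * x powr (p - 1)" using x0 by (simp add: divide_less_eq abs_less_iff)
        also have "\<dots> \<le> \<epsilon> * (p * x powr (p - 1))"
          using mult_right_mono[of 1 p "x powr (p - 1)"] p_ge assms by (intro mult_left_mono) auto
        finally show ?thesis by simp
      qed
      ultimately show "\<exists>y. ((\<lambda>s. \<epsilon> * s powr p - Gp g s) has_real_derivative y) (at x) \<and> 0 \<le> y" by force
    qed
    moreover have "0 \<le> \<epsilon> * K powr p" using assms by simp
    ultimately show ?thesis by simp
  qed
  then have "Gp g s \<le> Gp g K + \<epsilon> * \<bar>s\<bar> powr p" if "K \<le> \<bar>s\<bar>" for s
    using that G_abs[of s] by metis
  with K(1) show thesis by (rule that)
qed

text \<open>Three zones: (g2) near 0, (g3) beyond K, and monotonicity of G in between, where it is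
  at most G(K). The indicator form is made for the nonvanishing argument: the \<epsilon> terms have
  bounded integrals, so a large integral of G forces the set where |s| >= \<delta> to have definite
  measure.\<close>

lemma G_growth:
  assumes e: "0 < \<epsilon>"
  obtains \<delta> C where "0 < \<delta>" "0 < C" "\<And>s. Gp g s \<le> \<epsilon> * (s\<^sup>2 + \<bar>s\<bar> powr p) + C * indicator {s. \<delta> \<le> \<bar>s\<bar>} s"
proof -
  obtain \<delta> where \<delta>: "0 < \<delta>" "\<And>s. \<bar>s\<bar> < \<delta> \<Longrightarrow> Gp g s \<le> \<epsilon> * s\<^sup>2" using G_small[OF e] by blast
  obtain K where K: "0 < K" "\<And>s. K \<le> \<bar>s\<bar> \<Longrightarrow> Gp g s \<le> Gp g K + \<epsilon> * \<bar>s\<bar> powr p" using G_large[OF e] by blast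
  have "Gp g s \<le> \<epsilon> * (s\<^sup>2 + \<bar>s\<bar> powr p) + (Gp g K + 1) * indicator {s. \<delta> \<le> \<bar>s\<bar>} s" for s
  proof -
    have nn: "0 \<le> \<epsilon> * s\<^sup>2" "0 \<le> \<epsilon> * \<bar>s\<bar> powr p" using e by auto
    consider "\<bar>s\<bar> < \<delta>" | "\<delta> \<le> \<bar>s\<bar>" "\<bar>s\<bar> \<le> K" | "\<delta> \<le> \<bar>s\<bar>" "K \<le> \<bar>s\<bar>" by linarith
    then show ?thesis
    proof cases
      case 1
      then show ?thesis using \<delta>(2)[of s] nn by (simp add: distrib_left)
    next
      case 2
      then have "Gp g s \<le> Gp g K" using K(1) by (intro G_mono) simp
      then show ?thesis using 2 nn by (simp add: distrib_left)
    next
      case 3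
      then show ?thesis using K(2)[of s] nn by (simp add: distrib_left)
    qed
  qed
  then show thesis using \<delta>(1) G_nonneg[of K] by (intro that[of \<delta> "Gp g K + 1"]) auto
qed

lemma G_growth_square:
  assumes e: "0 < \<epsilon>"
  obtains C where "0 \<le> C" "\<And>s. Gp g s \<le> \<epsilon> * \<bar>s\<bar> powr p + C * s\<^sup>2"
proof -
  obtain \<delta> C where d: "0 < \<delta>" "0 < C" "\<And>s. Gp g s \<le> \<epsilon> * (s\<^sup>2 + \<bar>s\<bar> powr p) + C * indicator {s. \<delta> \<le> \<bar>s\<bar>} s"
    using G_growth[OF e] by blast
  have "Gp g s \<le> \<epsilon> * \<bar>s\<bar> powr p + (\<epsilon> + C / \<delta>\<^sup>2) * s\<^sup>2" for s
  proof -
    have "C * indicator {s. \<delta> \<le> \<bar>s\<bar>} s \<le> C / \<delta>\<^sup>2 * s\<^sup>2"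
    proof (cases "\<delta> \<le> \<bar>s\<bar>")
      case True
      then have "\<delta>\<^sup>2 \<le> s\<^sup>2" using power_mono[OF True, of 2] d(1) by simp
      then have "C * \<delta>\<^sup>2 \<le> C * s\<^sup>2" using d(2) by (intro mult_left_mono) auto
      then show ?thesis using True d(1) by (simp add: field_simps)
    qed (use d in simp)
    then show ?thesis using d(3)[of s] by (simp add: distrib_left distrib_right)
  qed
  then show thesis using d e by (intro that[of "\<epsilon> + C / \<delta>\<^sup>2"]) auto
qed

section \<open>Coercivity and scaling of the dual energy\<close>

definition mass :: "(real^'n \<Rightarrow> real) \<Rightarrow> real" where
  "mass v = n2 (\<lambda>x. fchange (v x))"

definition Gint :: "(real^'n \<Rightarrow> real) \<Rightarrow> real" where
  "Gint v = (LINT x|lborel. Gp g (fchange (v x)))"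

text \<open>The gradient is an explicit argument, so that scaled, cut off and limiting functions
  come with the gradient computed for them instead of a chosen one.\<close>

definition energy :: "(real^'n \<Rightarrow> real) \<Rightarrow> (real^'n \<Rightarrow> real^'n) \<Rightarrow> real" where
  "energy v w = (1/2) * n2 w - Gint v"

lemma L2_fchange: "L2 v \<Longrightarrow> L2 (\<lambda>x. fchange (v x))" for v :: "real^'n \<Rightarrow> real"
  by (rule L2_bounded(1)[of v _ 1]) (auto intro: fchange_le)

lemma mass_nonneg: "0 \<le> mass v"
  by (simp add: mass_def)

lemma Gint_nonneg: "0 \<le> Gint v"
  unfolding Gint_def by (intro Bochner_Integration.integral_nonneg G_nonneg)

text \<open>With u = f(v), the quantity u^2 |grad u|^2 equals u^2 / (1 + 2 u^2) times |w|^2, hence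
  is at most |w|^2. So the critical inequality for u is controlled by the plain Dirichlet integral
  of v, with a constant depending only on the mass bound.\<close>

lemma GN_constant:
  obtains C where "0 \<le> C" "\<And>(v :: real^'n \<Rightarrow> real) w. sob v w \<Longrightarrow> mass v \<le> m \<Longrightarrow>
    integrable lborel (\<lambda>x. \<bar>fchange (v x)\<bar> powr p) \<and> (LINT x|lborel. \<bar>fchange (v x)\<bar> powr p) \<le> C * (1 + n2 w)"
proof -
  \<comment> \<open>The critical inequality asks for a positive mass bound, while m is arbitrary
    here.\<close>
  define m' where "m' = max m 1"
  define C where "C = 2 powr p * (72 * real CARD('n) * (2 * m') powr (2 / real CARD('n)))"
  have C: "0 \<le> C" by (simp add: C_def)
  have m': "0 < m'" "m \<le> m'" by (auto simp: m'_def)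
  have "integrable lborel (\<lambda>x. \<bar>fchange (v x)\<bar> powr p) \<and>
      (LINT x|lborel. \<bar>fchange (v x)\<bar> powr p) \<le> (2 powr p * m' + C) * (1 + n2 w)"
    if s: "sob v w" and vm: "mass v \<le> m" for v :: "real^'n \<Rightarrow> real" and w
  proof -
    have [measurable]: "v \<in> borel_measurable borel" "w \<in> borel_measurable borel"
      using sobD(1,2)[OF s] by (auto simp: L2_def)
    let ?u = "\<lambda>x. fchange (v x)"
    let ?w = "\<lambda>x. (1 / sqrt (1 + 2 * (?u x)\<^sup>2)) *\<^sub>R w x"
    have le: "(?u x)\<^sup>2 * (norm (?w x))\<^sup>2 \<le> (norm (w x))\<^sup>2" for x
    proof -
      have "(?u x)\<^sup>2 * (norm (?w x))\<^sup>2 = ((?u x)\<^sup>2 / (1 + 2 * (?u x)\<^sup>2)) * (norm (w x))\<^sup>2"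
        using one_plus_pos[of "?u x"] by (simp add: power_mult_distrib power_divide less_imp_le)
      also have "\<dots> \<le> 1 * (norm (w x))\<^sup>2"
        using one_plus_pos[of "?u x"] by (intro mult_right_mono) (auto simp: divide_le_eq_1)
      finally show ?thesis by simp
    qed
    have int: "integrable lborel (\<lambda>x. (?u x)\<^sup>2 * (norm (?w x))\<^sup>2)"
      by (rule Bochner_Integration.integrable_bound[OF L2_integrable[OF sobD(2)[OF s]]]) (measurable, use le in auto)
    have D: "(LINT x|lborel. (?u x)\<^sup>2 * (norm (?w x))\<^sup>2) \<le> n2 w"
      unfolding n2_def by (rule integral_mono[OF int L2_integrable[OF sobD(2)[OF s]] le])
    have "n2 ?u \<le> m'" using vm m' by (simp add: mass_def)
    note GN = sob_Gagliardo_Nirenberg[OF sob_fchange[OF s] m'(1) this p_eq int, folded C_def]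
    have "(LINT x|lborel. \<bar>?u x\<bar> powr p) \<le> 2 powr p * m' + C * (LINT x|lborel. (?u x)\<^sup>2 * (norm (?w x))\<^sup>2)"
      by (rule GN(2))
    also have "\<dots> \<le> 2 powr p * m' + C * n2 w" using C D by (intro add_left_mono mult_left_mono)
    also have "\<dots> \<le> (2 powr p * m' + C) * (1 + n2 w)"
      using C m' by (simp add: algebra_simps)
    finally show ?thesis using GN(1) by blast
  qed
  then show thesis using C m' by (intro that[of "2 powr p * m' + C"]) auto
qed

lemma powr_p_integrable: "sob v w \<Longrightarrow> integrable lborel (\<lambda>x. \<bar>fchange (v x)\<bar> powr p)" for v :: "real^'n \<Rightarrow> real"
  using GN_constant[of "mass v"] by (metis order_refl)

lemma G_integrable:
  fixes v :: "real^'n \<Rightarrow> real"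
  assumes s: "sob v w"
  shows "integrable lborel (\<lambda>x. Gp g (fchange (v x)))"
proof -
  obtain C where C: "0 \<le> C" "\<And>s. Gp g s \<le> 1 * \<bar>s\<bar> powr p + C * s\<^sup>2" using G_growth_square[of 1] by auto
  have [measurable]: "v \<in> borel_measurable borel" using sobD(1)[OF s] by (simp add: L2_def)
  have "integrable lborel (\<lambda>x. 1 * \<bar>fchange (v x)\<bar> powr p + C * (norm (fchange (v x)))\<^sup>2)"
    by (intro Bochner_Integration.integrable_add integrable_mult_right powr_p_integrable[OF s] L2_integrable L2_fchange sobD(1)[OF s])
  then show ?thesis
  proof (rule Bochner_Integration.integrable_bound)
    show "AE x in lborel. norm (Gp g (fchange (v x))) \<le> norm (1 * \<bar>fchange (v x)\<bar> powr p + C * (norm (fchange (v x)))\<^sup>2)"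
    proof (rule AE_I2)
      fix x
      show "norm (Gp g (fchange (v x))) \<le> norm (1 * \<bar>fchange (v x)\<bar> powr p + C * (norm (fchange (v x)))\<^sup>2)"
        using C(2)[of "fchange (v x)"] G_nonneg[of "fchange (v x)"] unfolding real_norm_def power2_abs by linarith
    qed
  qed measurable
qed

text \<open>Condition (g3) permits an arbitrarily small multiple of the critical power in the bound
  for G, so no smallness of the mass is required.\<close>

lemma energy_coercive:
  obtains C where "\<And>(v :: real^'n \<Rightarrow> real) w. sob v w \<Longrightarrow> mass v \<le> m \<Longrightarrow> n2 w / 4 - C \<le> energy v w"
proof -
  obtain K where K: "0 \<le> K" and GN: "\<And>(v :: real^'n \<Rightarrow> real) w. sob v w \<Longrightarrow> mass v \<le> m \<Longrightarrow>
    integrable lborel (\<lambda>x. \<bar>fchange (v x)\<bar> powr p) \<and> (LINT x|lborel. \<bar>fchange (v x)\<bar> powr p) \<le> K * (1 + n2 w)"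
    using GN_constant[of m] by blast
  \<comment> \<open>Makes the critical term absorb at most a quarter of \<open>n2 w\<close>, half of
    what the energy contains.\<close>
  define \<epsilon> where "\<epsilon> = 1 / (4 * (K + 1))"
  have e: "0 < \<epsilon>" "\<epsilon> * K \<le> 1/4" using K by (auto simp: \<epsilon>_def divide_simps)
  obtain C where C: "0 \<le> C" "\<And>s. Gp g s \<le> \<epsilon> * \<bar>s\<bar> powr p + C * s\<^sup>2" using G_growth_square[OF e(1)] by blast
  have "n2 w / 4 - (1/4 + C * m) \<le> energy v w" if s: "sob v w" and vm: "mass v \<le> m" for v :: "real^'n \<Rightarrow> real" and w
  proof -
    note u = L2_fchange[OF sobD(1)[OF s]]
    have i: "integrable lborel (\<lambda>x. \<epsilon> * \<bar>fchange (v x)\<bar> powr p + C * (norm (fchange (v x)))\<^sup>2)"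
      using GN[OF s vm] by (intro Bochner_Integration.integrable_add integrable_mult_right L2_integrable u) auto
    have "Gint v \<le> (LINT x|lborel. \<epsilon> * \<bar>fchange (v x)\<bar> powr p + C * (norm (fchange (v x)))\<^sup>2)"
      unfolding Gint_def by (rule integral_mono[OF G_integrable[OF s] i]) (use C(2) in auto)
    also have "\<dots> = \<epsilon> * (LINT x|lborel. \<bar>fchange (v x)\<bar> powr p) + C * mass v"
      using GN[OF s vm] L2_integrable[OF u] by (simp add: mass_def n2_def)
    also have "\<dots> \<le> \<epsilon> * (K * (1 + n2 w)) + C * m"
      using GN[OF s vm] e C vm by (intro add_mono mult_left_mono) auto
    also have "\<epsilon> * (K * (1 + n2 w)) \<le> 1/4 * (1 + n2 w)"
      unfolding mult.assoc[symmetric] using e(2) by (intro mult_right_mono) auto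
    finally show ?thesis by (simp add: energy_def field_simps)
  qed
  then show thesis by (rule that)
qed

lemma fourth_power_le: "t\<^sup>2 * t\<^sup>2 \<le> t\<^sup>2 + \<bar>t\<bar> powr p" for t :: real
proof (cases "\<bar>t\<bar> \<le> 1")
  case True
  then have "t\<^sup>2 \<le> 1" by (simp add: abs_square_le_1)
  then have "t\<^sup>2 * t\<^sup>2 \<le> t\<^sup>2 * 1" by (rule mult_left_mono) simp
  then show ?thesis using powr_ge_zero[of "\<bar>t\<bar>" p] by linarith
next
  case False
  then have "\<bar>t\<bar> powr 4 \<le> \<bar>t\<bar> powr p" using p_ge by (intro powr_mono) auto
  moreover have "\<bar>t\<bar> powr 4 = \<bar>t\<bar> ^ 4" using False powr_realpow[of "\<bar>t\<bar>" 4] by simp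
  moreover have "\<bar>t\<bar> ^ 4 = t\<^sup>2 * t\<^sup>2" using power_add[of "\<bar>t\<bar>" 2 2] by simp
  ultimately show ?thesis using zero_le_power2[of t] by linarith
qed

lemma n2_le_mass:
  fixes v :: "real^'n \<Rightarrow> real"
  assumes s: "sob v w"
  shows "n2 v \<le> 3 * mass v + 2 * (LINT x|lborel. \<bar>fchange (v x)\<bar> powr p)"
proof -
  note u = L2_fchange[OF sobD(1)[OF s]]
  have i: "integrable lborel (\<lambda>x. 3 * (norm (fchange (v x)))\<^sup>2 + 2 * \<bar>fchange (v x)\<bar> powr p)"
    by (intro Bochner_Integration.integrable_add integrable_mult_right powr_p_integrable[OF s] L2_integrable u)
  have "n2 v \<le> (LINT x|lborel. 3 * (norm (fchange (v x)))\<^sup>2 + 2 * \<bar>fchange (v x)\<bar> powr p)"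
    unfolding n2_def
  proof (rule integral_mono[OF L2_integrable[OF sobD(1)[OF s]] i])
    fix x
    have "(v x)\<^sup>2 \<le> (fchange (v x))\<^sup>2 + 2 * ((fchange (v x))\<^sup>2 * (fchange (v x))\<^sup>2)"
    proof -
      have "s * (1 + 2 * s) = s + 2 * (s * s)" for s :: real by (simp add: algebra_simps)
      then show ?thesis using square_le_fchange[of "v x"] by (simp only:)
    qed
    then show "(norm (v x))\<^sup>2 \<le> 3 * (norm (fchange (v x)))\<^sup>2 + 2 * \<bar>fchange (v x)\<bar> powr p"
      using fourth_power_le[of "fchange (v x)"] unfolding real_norm_def power2_abs by linarith
  qed
  also have "\<dots> = 3 * mass v + 2 * (LINT x|lborel. \<bar>fchange (v x)\<bar> powr p)"
    using powr_p_integrable[OF s] L2_integrable[OF u] by (simp add: mass_def n2_def)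
  finally show ?thesis .
qed

lemma mass_zero:
  fixes v :: "real^'n \<Rightarrow> real"
  assumes v: "L2 v" and 0: "mass v = 0"
  shows "AE x in lborel. v x = 0"
proof -
  have "AE x in lborel. fchange (v x) = 0"
    using n2_eq_0_AE[OF L2_fchange[OF v]] 0 by (simp add: mass_def)
  then show ?thesis by eventually_elim (metis Phi_0 Phi_fchange)
qed

lemma Gint_zero:
  fixes v :: "real^'n \<Rightarrow> real"
  assumes "AE x in lborel. v x = 0"
  shows "Gint v = 0"
  unfolding Gint_def by (rule integral_eq_zero_AE) (use assms in \<open>eventually_elim, simp\<close>)

lemma translate_invariance:
  fixes v :: "real^'n \<Rightarrow> real"
  assumes s: "sob v w"
  shows "mass (\<lambda>x. v (x + h)) = mass v" "energy (\<lambda>x. v (x + h)) (\<lambda>x. w (x + h)) = energy v w"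
proof -
  have [measurable]: "v \<in> borel_measurable borel" using sobD(1)[OF s] by (simp add: L2_def)
  show "mass (\<lambda>x. v (x + h)) = mass v"
    unfolding mass_def by (rule L2_translate(2)[OF L2_fchange[OF sobD(1)[OF s]]])
  have "Gint (\<lambda>x. v (x + h)) = Gint v"
    unfolding Gint_def by (rule lborel_integral_translate(1)) measurable
  then show "energy (\<lambda>x. v (x + h)) (\<lambda>x. w (x + h)) = energy v w"
    by (simp add: energy_def L2_translate(2)[OF sobD(2)[OF s]])
qed

lemma dilate_scaling:
  fixes v :: "real^'n \<Rightarrow> real"
  assumes s: "sob v w" and r: "0 < r"
  shows "mass (\<lambda>x. v (x /\<^sub>R r)) = r ^ CARD('n) * mass v"
    "energy (\<lambda>x. v (x /\<^sub>R r)) (\<lambda>x. w (x /\<^sub>R r) /\<^sub>R r) = r ^ CARD('n) * (n2 w / (2 * r\<^sup>2) - Gint v)"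
    "Gint (\<lambda>x. v (x /\<^sub>R r)) = r ^ CARD('n) * Gint v"
    "n2 (\<lambda>x. w (x /\<^sub>R r) /\<^sub>R r) = r ^ CARD('n) * n2 w / r\<^sup>2"
proof -
  have [measurable]: "v \<in> borel_measurable borel" using sobD(1)[OF s] by (simp add: L2_def)
  show "mass (\<lambda>x. v (x /\<^sub>R r)) = r ^ CARD('n) * mass v"
    unfolding mass_def using L2_scale(2)[OF L2_fchange[OF sobD(1)[OF s]] r] by simp
  show G: "Gint (\<lambda>x. v (x /\<^sub>R r)) = r ^ CARD('n) * Gint v"
    unfolding Gint_def using lborel_integral_scale(1)[of "\<lambda>x. Gp g (fchange (v x))" r] r by simp
  show W: "n2 (\<lambda>x. w (x /\<^sub>R r) /\<^sub>R r) = r ^ CARD('n) * n2 w / r\<^sup>2"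
    using L2_scale(2)[OF sobD(2)[OF s] r] by (simp add: n2_scaleR field_simps power_divide)
  show "energy (\<lambda>x. v (x /\<^sub>R r)) (\<lambda>x. w (x /\<^sub>R r) /\<^sub>R r) = r ^ CARD('n) * (n2 w / (2 * r\<^sup>2) - Gint v)"
    unfolding energy_def G W using r by (simp add: field_simps)
qed

text \<open>Beyond a high level, \<open>G\<close> is controlled by a small multiple of the critical power, which makes
  the nonlinear integrals over sets of finite measure converge along bounded sequences.\<close>

lemma Gint_local_limit:
  fixes z :: "nat \<Rightarrow> real^'n \<Rightarrow> real"
  assumes z [measurable]: "\<And>n. z n \<in> borel_measurable borel" and Z [measurable]: "Z \<in> borel_measurable borel"
    and AE: "AE x in lborel. (\<lambda>n. z n x) \<longlonglongrightarrow> Z x"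
    and P: "\<And>n. (\<integral>\<^sup>+x. ennreal (\<bar>fchange (z n x)\<bar> powr p) \<partial>lborel) \<le> ennreal P" and P0: "0 \<le> P"
    and B [measurable]: "B \<in> sets borel" and fin: "emeasure lborel B < \<infinity>"
  shows "(\<lambda>n. LINT x|lborel. indicator B x * Gp g (fchange (z n x))) \<longlonglongrightarrow> (LINT x|lborel. indicator B x * Gp g (fchange (Z x)))"
proof -
  have cf: "isCont fchange t" for t using fchange_continuous[of UNIV] by (simp add: continuous_on_eq_continuous_at)
  have cG: "isCont (Gp g) t" for t using G_continuous[of UNIV] by (simp add: continuous_on_eq_continuous_at)
  have AEf: "AE x in lborel. (\<lambda>n. fchange (z n x)) \<longlonglongrightarrow> fchange (Z x)"
    using AE by eventually_elim (rule isCont_tendsto_compose[OF cf])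
  have PZ: "(\<integral>\<^sup>+x. ennreal (\<bar>fchange (Z x)\<bar> powr p) \<partial>lborel) \<le> ennreal P"
  proof -
    have "(\<integral>\<^sup>+x. ennreal (\<bar>fchange (Z x)\<bar> powr p) \<partial>lborel) \<le> (\<integral>\<^sup>+x. liminf (\<lambda>n. ennreal (\<bar>fchange (z n x)\<bar> powr p)) \<partial>lborel)"
    proof (rule nn_integral_mono_AE)
      show "AE x in lborel. ennreal (\<bar>fchange (Z x)\<bar> powr p) \<le> liminf (\<lambda>n. ennreal (\<bar>fchange (z n x)\<bar> powr p))"
        using AEf
      proof eventually_elim
        case (elim x)
        have "(\<lambda>n. ennreal (\<bar>fchange (z n x)\<bar> powr p)) \<longlonglongrightarrow> ennreal (\<bar>fchange (Z x)\<bar> powr p)"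
          using p_ge elim by (intro tendsto_ennrealI tendsto_powr2 tendsto_rabs tendsto_const) auto
        then have "liminf (\<lambda>n. ennreal (\<bar>fchange (z n x)\<bar> powr p)) = ennreal (\<bar>fchange (Z x)\<bar> powr p)"
          by (rule lim_imp_Liminf[OF sequentially_bot])
        then show ?case by simp
      qed
    qed
    also have "\<dots> \<le> liminf (\<lambda>n. \<integral>\<^sup>+x. ennreal (\<bar>fchange (z n x)\<bar> powr p) \<partial>lborel)"
      by (rule nn_integral_liminf) measurable
    also have "\<dots> \<le> limsup (\<lambda>n. \<integral>\<^sup>+x. ennreal (\<bar>fchange (z n x)\<bar> powr p) \<partial>lborel)"
      by (rule Liminf_le_Limsup) simp
    also have "\<dots> \<le> ennreal P"
      by (rule Limsup_bounded) (use P in auto)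
    finally show ?thesis .
  qed
  \<comment> \<open>Truncating G at height G(K) changes the integral by at most e P, uniformly along
    the sequence; the bound \<open>PZ\<close>, from Fatou, lets the same estimate apply to the
    limit.\<close>
  have tail: "integrable lborel (\<lambda>x. indicator B x * Gp g (fchange (y x))) \<and>
      \<bar>(LINT x|lborel. indicator B x * Gp g (fchange (y x))) - (LINT x|lborel. indicator B x * min (Gp g (fchange (y x))) (Gp g K))\<bar> \<le> e * P"
    if y [measurable]: "y \<in> borel_measurable borel" and Py: "(\<integral>\<^sup>+x. ennreal (\<bar>fchange (y x)\<bar> powr p) \<partial>lborel) \<le> ennreal P"
      and e: "0 < e" and K: "0 < K" "\<And>s. K \<le> \<bar>s\<bar> \<Longrightarrow> Gp g s \<le> Gp g K + e * \<bar>s\<bar> powr p" for y :: "real^'n \<Rightarrow> real" and e K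
  proof -
    have "(\<integral>\<^sup>+x. ennreal (norm (\<bar>fchange (y x)\<bar> powr p)) \<partial>lborel) < \<infinity>"
      using Py by (simp add: order_le_less_trans ennreal_less_top)
    then have ip: "integrable lborel (\<lambda>x. \<bar>fchange (y x)\<bar> powr p)" by (intro integrableI_bounded) auto
    then have Pr: "(LINT x|lborel. \<bar>fchange (y x)\<bar> powr p) \<le> P"
      using Py P0 by (subst (asm) nn_integral_eq_integral) auto
    have iB: "integrable lborel (\<lambda>x. indicator B x * Gp g K)"
      using fin by (intro integrable_mult_left integrable_real_indicator) auto
    have le: "Gp g s - min (Gp g s) (Gp g K) \<le> e * \<bar>s\<bar> powr p" for s
    proof (cases "K \<le> \<bar>s\<bar>")
      case True
      have "0 \<le> e * \<bar>s\<bar> powr p" using e by simp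
      then show ?thesis using K(2)[OF True] by (simp add: min_def)
    next
      case False
      then have "Gp g s \<le> Gp g K" using K(1) by (intro G_mono) auto
      then show ?thesis using e by simp
    qed
    have i1: "integrable lborel (\<lambda>x. indicator B x * min (Gp g (fchange (y x))) (Gp g K))"
      by (rule Bochner_Integration.integrable_bound[OF iB]) (use G_nonneg in \<open>auto simp: indicator_def\<close>)
    have i2: "integrable lborel (\<lambda>x. indicator B x * (Gp g (fchange (y x)) - min (Gp g (fchange (y x))) (Gp g K)))"
    proof (rule Bochner_Integration.integrable_bound[OF integrable_mult_right[OF ip, of e]])
      show "AE x in lborel. norm (indicator B x * (Gp g (fchange (y x)) - min (Gp g (fchange (y x))) (Gp g K))) \<le> norm (e * \<bar>fchange (y x)\<bar> powr p)"
        using le e by (intro AE_I2) (auto simp: indicator_def)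
    qed measurable
    have i3: "integrable lborel (\<lambda>x. indicator B x * Gp g (fchange (y x)))"
      using Bochner_Integration.integrable_add[OF i1 i2] by (simp add: algebra_simps)
    have "(LINT x|lborel. indicator B x * Gp g (fchange (y x))) - (LINT x|lborel. indicator B x * min (Gp g (fchange (y x))) (Gp g K))
        = (LINT x|lborel. indicator B x * (Gp g (fchange (y x)) - min (Gp g (fchange (y x))) (Gp g K)))"
      unfolding right_diff_distrib by (rule Bochner_Integration.integral_diff[OF i3 i1, symmetric])
    moreover have "0 \<le> (LINT x|lborel. indicator B x * (Gp g (fchange (y x)) - min (Gp g (fchange (y x))) (Gp g K)))"
      by (intro Bochner_Integration.integral_nonneg) auto
    moreover have "(LINT x|lborel. indicator B x * (Gp g (fchange (y x)) - min (Gp g (fchange (y x))) (Gp g K)))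
        \<le> (LINT x|lborel. e * \<bar>fchange (y x)\<bar> powr p)"
      by (rule integral_mono[OF i2 integrable_mult_right[OF ip]]) (use le e in \<open>auto simp: indicator_def\<close>)
    moreover have "(LINT x|lborel. e * \<bar>fchange (y x)\<bar> powr p) \<le> e * P"
      using Pr e by simp
    ultimately show ?thesis using i3 by simp
  qed
  show ?thesis
  proof (rule LIMSEQ_I)
    fix \<epsilon> :: real assume \<epsilon>: "0 < \<epsilon>"
    \<comment> \<open>Three errors add up: the truncations for \<open>z n\<close> and for Z, and the
      convergence at fixed height. The + 1 covers P = 0.\<close>
    define e where "e = \<epsilon> / (4 * (P + 1))"
    have e: "0 < e" "e * P < \<epsilon> / 3"
    proof -
      show "0 < e" using \<epsilon> P0 by (simp add: e_def)
      have "e * P \<le> e * (P + 1)" using \<open>0 < e\<close> by simp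
      also have "\<dots> = \<epsilon> / 4" using P0 by (simp add: e_def field_simps)
      also have "\<dots> < \<epsilon> / 3" using \<epsilon> by simp
      finally show "e * P < \<epsilon> / 3" .
    qed
    obtain K where K: "0 < K" "\<And>s. K \<le> \<bar>s\<bar> \<Longrightarrow> Gp g s \<le> Gp g K + e * \<bar>s\<bar> powr p" using G_large[OF e(1)] by blast
    let ?m = "\<lambda>y. LINT x|lborel. indicator B x * min (Gp g (fchange (y x))) (Gp g K)"
    have "(\<lambda>n. ?m (z n)) \<longlonglongrightarrow> ?m Z"
    proof (rule integral_dominated_convergence[where w="\<lambda>x. indicator B x * Gp g K"])
      show "integrable lborel (\<lambda>x. indicator B x * Gp g K)"
        using fin by (intro integrable_mult_left integrable_real_indicator) auto
      show "AE x in lborel. (\<lambda>n. indicator B x * min (Gp g (fchange (z n x))) (Gp g K)) \<longlonglongrightarrow> indicator B x * min (Gp g (fchange (Z x))) (Gp g K)"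
        using AEf
      proof eventually_elim
        case (elim x)
        from isCont_tendsto_compose[OF cG elim] show ?case by (intro tendsto_intros)
      qed
      show "AE x in lborel. norm (indicator B x * min (Gp g (fchange (z n x))) (Gp g K)) \<le> indicator B x * Gp g K" for n
        using G_nonneg by (intro AE_I2) (auto simp: indicator_def)
    qed measurable
    moreover have "0 < \<epsilon> / 3" using \<epsilon> by simp
    ultimately obtain N where N: "\<And>n. n \<ge> N \<Longrightarrow> norm (?m (z n) - ?m Z) < \<epsilon> / 3"
      using LIMSEQ_D by blast
    show "\<exists>N. \<forall>n\<ge>N. norm ((LINT x|lborel. indicator B x * Gp g (fchange (z n x))) - (LINT x|lborel. indicator B x * Gp g (fchange (Z x)))) < \<epsilon>"
    proof (intro exI allI impI)
      fix n assume "N \<le> n"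
      then show "norm ((LINT x|lborel. indicator B x * Gp g (fchange (z n x))) - (LINT x|lborel. indicator B x * Gp g (fchange (Z x)))) < \<epsilon>"
        using N[of n] tail[OF z P e(1) K, of n] tail[OF Z PZ e(1) K] e(2) unfolding real_norm_def by linarith
    qed
  qed
qed

end

section \<open>Existence of minimizers\<close>

text \<open>Built from the squared norm so as to be differentiable at the origin. It equals 1 up to
  radius r and already vanishes from sqrt 2 r on; the lemmas use the simpler radius 2 r.\<close>

definition cutoff :: "real \<Rightarrow> 'a::euclidean_space \<Rightarrow> real" where
  "cutoff r x = 1 - step ((norm x)\<^sup>2 / r\<^sup>2 - 1)"

definition dcutoff :: "real \<Rightarrow> 'a::euclidean_space \<Rightarrow> 'a" where
  "dcutoff r x = (- (2 / r\<^sup>2) * dstep ((norm x)\<^sup>2 / r\<^sup>2 - 1)) *\<^sub>R x"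

lemma cutoff_bounds: "0 \<le> cutoff r x" "cutoff r x \<le> 1"
  using step_bounds by (auto simp: cutoff_def)

lemma cutoff_inside: "norm x \<le> r \<Longrightarrow> cutoff r x = 1"
proof -
  assume "norm x \<le> r"
  then have "(norm x)\<^sup>2 \<le> r\<^sup>2" by (intro power_mono) auto
  then have "(norm x)\<^sup>2 / r\<^sup>2 \<le> 1" by (cases "r = 0") auto
  then show ?thesis by (simp add: cutoff_def step_eq_0)
qed

lemma cutoff_outside: "0 < r \<Longrightarrow> 2 * r \<le> norm x \<Longrightarrow> cutoff r x = 0"
proof -
  assume r: "0 < r" "2 * r \<le> norm x"
  then have "(2 * r)\<^sup>2 \<le> (norm x)\<^sup>2" by (intro power_mono) auto
  then have "4 \<le> (norm x)\<^sup>2 / r\<^sup>2" using r by (simp add: field_simps)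
  then show ?thesis by (simp add: cutoff_def step_eq_1)
qed

lemma cutoff_deriv: "(cutoff r has_derivative (\<lambda>v. v \<bullet> dcutoff r x)) (at x)"
proof -
  have "((\<lambda>x. x \<bullet> x) has_derivative (\<lambda>v. 2 * (v \<bullet> x))) (at x)"
    by (auto intro!: derivative_eq_intros simp: inner_commute)
  then have "((\<lambda>x. inverse (r\<^sup>2) * (x \<bullet> x) - 1) has_derivative (\<lambda>v. inverse (r\<^sup>2) * (2 * (v \<bullet> x)) - 0)) (at x)"
    by (intro has_derivative_diff has_derivative_mult_right has_derivative_const)
  then have "((\<lambda>x. (x \<bullet> x) / r\<^sup>2 - 1) has_derivative (\<lambda>v. (2 / r\<^sup>2) * (v \<bullet> x))) (at x)"
    by (simp add: divide_inverse mult_ac)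
  moreover have "(step has_derivative (*) (dstep ((x \<bullet> x) / r\<^sup>2 - 1))) (at ((x \<bullet> x) / r\<^sup>2 - 1))"
    using step_deriv by (simp add: has_field_derivative_def)
  ultimately have "((\<lambda>x. step ((x \<bullet> x) / r\<^sup>2 - 1)) has_derivative
      (\<lambda>v. dstep ((x \<bullet> x) / r\<^sup>2 - 1) * ((2 / r\<^sup>2) * (v \<bullet> x)))) (at x)"
    by (rule has_derivative_compose)
  from has_derivative_diff[OF has_derivative_const[of 1] this]
  show ?thesis by (simp add: cutoff_def[abs_def] dcutoff_def power2_norm_eq_inner mult_ac)
qed

lemma dcutoff_continuous: "continuous_on UNIV (dcutoff r)"
proof -
  have "continuous_on UNIV (\<lambda>x::'a. (norm x)\<^sup>2 * inverse (r\<^sup>2) - 1)" by (intro continuous_intros)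
  then have "continuous_on UNIV (\<lambda>x::'a. dstep ((norm x)\<^sup>2 * inverse (r\<^sup>2) - 1))"
    by (rule continuous_on_compose2[OF dstep_continuous]) auto
  then show ?thesis unfolding dcutoff_def divide_inverse by (intro continuous_intros)
qed

lemma dcutoff_measurable [measurable]: "dcutoff r \<in> borel_measurable borel"
  by (intro borel_measurable_continuous_onI dcutoff_continuous)

lemma cutoff_continuous: "continuous_on UNIV (cutoff r)"
  by (meson continuous_at_imp_continuous_on has_derivative_continuous cutoff_deriv)

lemma cutoff_measurable [measurable]: "cutoff r \<in> borel_measurable borel"
  by (intro borel_measurable_continuous_onI cutoff_continuous)

lemma dcutoff_bound: "0 < r \<Longrightarrow> norm (dcutoff r x) \<le> 6 / r"
proof -
  assume r: "0 < r"
  show ?thesis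
  proof (cases "dstep ((norm x)\<^sup>2 / r\<^sup>2 - 1) = 0")
    case False
    then have "(norm x)\<^sup>2 / r\<^sup>2 - 1 < 1" by (auto simp: dstep_def split: if_splits)
    then have "(norm x)\<^sup>2 < 2 * r\<^sup>2" using r by (simp add: field_simps)
    also have "\<dots> \<le> (2 * r)\<^sup>2" by (simp add: power_mult_distrib)
    finally have "(norm x)\<^sup>2 < (2 * r)\<^sup>2" .
    then have x: "norm x \<le> 2 * r" using r power_less_imp_less_base[of "norm x" 2 "2 * r"] by simp
    have "norm (dcutoff r x) = 2 / r\<^sup>2 * (dstep ((norm x)\<^sup>2 / r\<^sup>2 - 1) * norm x)"
      using dstep_bounds(1)[of "(norm x)\<^sup>2 / r\<^sup>2 - 1"] r by (simp add: dcutoff_def abs_mult)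
    also have "\<dots> \<le> 2 / r\<^sup>2 * (3 / 2 * (2 * r))"
    proof (rule mult_left_mono)
      show "dstep ((norm x)\<^sup>2 / r\<^sup>2 - 1) * norm x \<le> 3 / 2 * (2 * r)"
        by (rule mult_mono[OF dstep_bounds(2) x]) auto
    qed simp
    also have "\<dots> = 6 / r" using r by (simp add: power2_eq_square)
    finally show ?thesis .
  qed (use r in \<open>simp add: dcutoff_def\<close>)
qed

section \<open>Cutting a Sobolev function in two\<close>

lemma sob_cutoff:
  fixes v :: "real^'n::finite \<Rightarrow> real"
  assumes s: "sob v w" and r: "0 < r"
  shows "sob (\<lambda>x. cutoff r x * v x) (\<lambda>x. cutoff r x *\<^sub>R w x + v x *\<^sub>R dcutoff r x)"
proof (rule sob_mult_C1[OF s cutoff_deriv dcutoff_measurable])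
  show "\<bar>cutoff r x\<bar> \<le> 1" for x :: "real^'n" using cutoff_bounds[of r x] by simp
qed (rule dcutoff_bound[OF r])

lemma sob_cutoff_complement:
  fixes v :: "real^'n::finite \<Rightarrow> real"
  assumes s: "sob v w" and r: "0 < r"
  shows "sob (\<lambda>x. (1 - cutoff r x) * v x) (\<lambda>x. (1 - cutoff r x) *\<^sub>R w x - v x *\<^sub>R dcutoff r x)"
  using sob_diff[OF s sob_cutoff[OF s r]] by (simp add: algebra_simps)

text \<open>The leading parts cost nothing because c^2 + (1 - c)^2 <= 1 for c in [0,1]. The cross
  terms have opposite signs and combine to the factor 2 c - 1; they and the square of d are of order
  k, using k^2 <= k.\<close>

lemma split_gradient_le:
  fixes w d :: "'a::real_inner"
  assumes c: "0 \<le> c" "c \<le> 1" and d: "norm d \<le> k" and k: "k \<le> 1"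
  shows "(norm (c *\<^sub>R w + v *\<^sub>R d))\<^sup>2 + (norm ((1 - c) *\<^sub>R w - v *\<^sub>R d))\<^sup>2 \<le> (1 + k) * (norm w)\<^sup>2 + 3 * k * v\<^sup>2"
proof -
  have k0: "0 \<le> k" using d norm_ge_zero order_trans by blast
  have 1: "(c\<^sup>2 + (1 - c)\<^sup>2) * (norm w)\<^sup>2 \<le> 1 * (norm w)\<^sup>2"
  proof (rule mult_right_mono)
    have "c * c \<le> 1 * c" using c by (intro mult_right_mono) auto
    then show "c\<^sup>2 + (1 - c)\<^sup>2 \<le> 1" by (simp add: power2_eq_square algebra_simps)
  qed simp
  have 2: "2 * (2 * c - 1) * v * (w \<bullet> d) \<le> k * (v\<^sup>2 + (norm w)\<^sup>2)"
  proof -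
    have "2 * (2 * c - 1) * v * (w \<bullet> d) \<le> \<bar>2 * (2 * c - 1) * v * (w \<bullet> d)\<bar>" by simp
    also have "\<dots> = 2 * (\<bar>2 * c - 1\<bar> * (\<bar>v\<bar> * \<bar>w \<bullet> d\<bar>))" by (simp only: abs_mult abs_numeral mult.assoc)
    also have "\<dots> \<le> 2 * (1 * (\<bar>v\<bar> * (norm w * k)))"
    proof (intro mult_left_mono mult_mono)
      have "\<bar>w \<bullet> d\<bar> \<le> norm w * norm d" by (rule Cauchy_Schwarz_ineq2)
      also have "\<dots> \<le> norm w * k" by (intro mult_left_mono d) simp
      finally show "\<bar>w \<bullet> d\<bar> \<le> norm w * k" .
    qed (use c in auto)
    also have "\<dots> = k * (2 * \<bar>v\<bar> * norm w)" by simp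
    also have "\<dots> \<le> k * (v\<^sup>2 + (norm w)\<^sup>2)"
      using sum_squares_bound[of "\<bar>v\<bar>" "norm w"] k0 by (intro mult_left_mono) auto
    finally show ?thesis .
  qed
  have 3: "2 * v\<^sup>2 * (norm d)\<^sup>2 \<le> 2 * k * v\<^sup>2"
  proof -
    have "(norm d)\<^sup>2 \<le> k\<^sup>2" using d by (intro power_mono) auto
    also have "\<dots> \<le> k * 1" unfolding power2_eq_square using k k0 by (intro mult_left_mono)
    finally have "2 * v\<^sup>2 * (norm d)\<^sup>2 \<le> 2 * v\<^sup>2 * k" by (intro mult_left_mono) auto
    then show ?thesis by (simp add: mult_ac)
  qed
  have "(norm (c *\<^sub>R w + v *\<^sub>R d))\<^sup>2 + (norm ((1 - c) *\<^sub>R w - v *\<^sub>R d))\<^sup>2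
      = (c\<^sup>2 + (1 - c)\<^sup>2) * (norm w)\<^sup>2 + 2 * (2 * c - 1) * v * (w \<bullet> d) + 2 * v\<^sup>2 * (norm d)\<^sup>2"
    unfolding power2_norm_eq_inner
    by (simp add: inner_simps inner_commute[of d w] power2_eq_square algebra_simps)
  with 1 2 3 show ?thesis by (simp add: algebra_simps)
qed

section \<open>The minimal level and its comparison with masses below m\<close>

context quasilinear
begin

text \<open>A real infimum is meaningful only over a nonempty set bounded below. The lower bound is
  coercivity; nonemptiness is obtained by dilation in \<open>minimizer_exists\<close>.\<close>

definition e_inf :: "real \<Rightarrow> real" where
  "e_inf m = Inf {energy v w | v w. sob v w \<and> mass v = m}"

lemma energy_bdd_below: "bdd_below {energy v w | v w. sob v w \<and> mass v = m}"
proof -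
  obtain C where C: "\<And>(v :: real^'n \<Rightarrow> real) w. sob v w \<Longrightarrow> mass v \<le> m \<Longrightarrow> n2 w / 4 - C \<le> energy v w"
    using energy_coercive by blast
  have "- C \<le> energy v w" if "sob v w" "mass v = m" for v w
    using C[OF that(1)] that(2) n2_nonneg[of w] by linarith
  then show ?thesis by (intro bdd_belowI[of _ "- C"]) auto
qed

lemma e_inf_le: "sob v w \<Longrightarrow> mass v = m \<Longrightarrow> e_inf m \<le> energy v w"
  unfolding e_inf_def by (intro cInf_lower energy_bdd_below) auto

lemma e_inf_scaled:
  fixes v :: "real^'n \<Rightarrow> real"
  assumes s: "sob v w" and v: "0 < mass v" "mass v \<le> m"
  obtains r where "1 \<le> r" "r ^ CARD('n) = m / mass v" "e_inf m \<le> r ^ CARD('n) * (n2 w / (2 * r\<^sup>2) - Gint v)"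
proof -
  define r where "r = (m / mass v) powr (1 / real CARD('n))"
  have q: "1 \<le> m / mass v" using v by simp
  have r: "1 \<le> r" unfolding r_def using q by (intro ge_one_powr_ge_zero) auto
  have rN: "r ^ CARD('n) = m / mass v"
  proof -
    have "r ^ CARD('n) = r powr real CARD('n)" using r by (simp add: powr_realpow)
    also have "\<dots> = (m / mass v) powr 1" unfolding r_def powr_powr by simp
    finally show ?thesis using q v by simp
  qed
  have "mass (\<lambda>x. v (x /\<^sub>R r)) = m"
    using dilate_scaling(1)[OF s, of r] r rN v by simp
  then have "e_inf m \<le> r ^ CARD('n) * (n2 w / (2 * r\<^sup>2) - Gint v)"
    using e_inf_le[OF sob_dilate[OF s, of r]] dilate_scaling(2)[OF s, of r] r by simp
  with r rN show thesis by (rule that)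
qed

text \<open>Raising the mass to m takes a dilation with r >= 1; dividing the gradient term by r^2
  can only lower the energy.\<close>

lemma e_inf_scaled_le:
  fixes v :: "real^'n \<Rightarrow> real"
  assumes s: "sob v w" and v: "0 < mass v" "mass v \<le> m"
  shows "e_inf m \<le> m / mass v * energy v w"
proof -
  obtain r where r: "1 \<le> r" "r ^ CARD('n) = m / mass v" "e_inf m \<le> r ^ CARD('n) * (n2 w / (2 * r\<^sup>2) - Gint v)"
    using e_inf_scaled[OF assms] by blast
  have "n2 w / (2 * r\<^sup>2) \<le> n2 w / (2 * 1)" using r(1) by (intro divide_left_mono) auto
  then have "r ^ CARD('n) * (n2 w / (2 * r\<^sup>2) - Gint v) \<le> r ^ CARD('n) * energy v w"
    unfolding energy_def using r(1) by (intro mult_left_mono) auto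
  with r show ?thesis by simp
qed

text \<open>A rearrangement of \<open>e_inf_scaled_le\<close>. Mass 0 is separate, as no dilation
  brings it to m: there v = 0 almost everywhere and the energy is half the Dirichlet
  integral.\<close>

lemma energy_ge:
  fixes v :: "real^'n \<Rightarrow> real"
  assumes m: "0 < m" and s: "sob v w" and v: "mass v \<le> m"
  shows "mass v / m * e_inf m \<le> energy v w"
proof (cases "mass v = 0")
  case True
  then show ?thesis
    using Gint_zero[OF mass_zero[OF sobD(1)[OF s] True]] by (simp add: energy_def)
next
  case False
  then have pos: "0 < mass v" using mass_nonneg[of v] by linarith
  have "mass v / m * e_inf m \<le> mass v / m * (m / mass v * energy v w)"
    using e_inf_scaled_le[OF s pos v] m pos by (intro mult_left_mono) auto
  then show ?thesis using m pos by simp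
qed

lemma fchange_power_mono:
  assumes "\<bar>s\<bar> \<le> \<bar>t\<bar>"
  shows "\<bar>fchange s\<bar> powr p \<le> \<bar>fchange t\<bar> powr p" "Gp g (fchange s) \<le> Gp g (fchange t)"
    "(fchange s)\<^sup>2 \<le> (fchange t)\<^sup>2"
  using fchange_abs_mono[OF assms] p_ge
  by (auto intro!: powr_mono2 G_mono simp: abs_le_square_iff)

text \<open>Splitting by a cutoff at radius \<open>r\<close>: the outer piece is estimated by its own minimal level.\<close>

lemma cutoff_splitting:
  fixes v :: "real^'n \<Rightarrow> real"
  assumes s: "sob v w" and M: "n2 v \<le> M" "n2 w \<le> M" and r: "6 \<le> r"
    and m: "0 < m" "mass v \<le> m" and e: "e_inf m \<le> 0"
  shows "(1/2) * n2 (\<lambda>x. cutoff r x *\<^sub>R w x + v x *\<^sub>R dcutoff r x)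
    \<le> energy v w + Gint (\<lambda>x. cutoff r x * v x)
      + (LINT x|lborel. indicator (cball 0 (2 * r) - cball 0 r) x * Gp g (fchange (v x)))
      + 12 * M / r - (1 - n2 (\<lambda>x. indicator (cball 0 r) x * fchange (v x)) / m) * e_inf m"
proof -
  have r0: "0 < r" using r by simp
  have [measurable]: "v \<in> borel_measurable borel" "w \<in> borel_measurable borel"
    using sobD(1,2)[OF s] by (auto simp: L2_def)
  define a where "a x = cutoff r x * v x" for x
  define A where "A x = cutoff r x *\<^sub>R w x + v x *\<^sub>R dcutoff r x" for x
  define b where "b x = (1 - cutoff r x) * v x" for x
  define B where "B x = (1 - cutoff r x) *\<^sub>R w x - v x *\<^sub>R dcutoff r x" for x
  have sa: "sob a A" and sb: "sob b B"
    unfolding a_def A_def b_def B_def by (rule sob_cutoff[OF s r0] sob_cutoff_complement[OF s r0])+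
  define k where "k = 6 / r"
  have k: "0 \<le> k" "k \<le> 1" using r by (auto simp: k_def)
  have grad: "n2 A + n2 B \<le> n2 w + 4 * k * M"
  proof -
    have iw: "integrable lborel (\<lambda>x. (norm (w x))\<^sup>2)" "integrable lborel (\<lambda>x. (norm (v x))\<^sup>2)"
      by (intro L2_integrable sobD[OF s])+
    have iab: "integrable lborel (\<lambda>x. (norm (A x))\<^sup>2)" "integrable lborel (\<lambda>x. (norm (B x))\<^sup>2)"
      by (intro L2_integrable sobD(2)[OF sa] sobD(2)[OF sb])+
    have "n2 A + n2 B = (LINT x|lborel. (norm (A x))\<^sup>2 + (norm (B x))\<^sup>2)"
      unfolding n2_def by (rule Bochner_Integration.integral_add[OF iab, symmetric])
    also have "\<dots> \<le> (LINT x|lborel. (1 + k) * (norm (w x))\<^sup>2 + 3 * k * (norm (v x))\<^sup>2)"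
    proof (rule integral_mono)
      show "(norm (A x))\<^sup>2 + (norm (B x))\<^sup>2 \<le> (1 + k) * (norm (w x))\<^sup>2 + 3 * k * (norm (v x))\<^sup>2" for x
        unfolding A_def B_def
        using split_gradient_le[OF cutoff_bounds[of r x], of "dcutoff r x" k "w x" "v x"] dcutoff_bound[OF r0, of x] k
        by (simp add: k_def)
    qed (intro Bochner_Integration.integrable_add integrable_mult_right iw iab)+
    also have "\<dots> = (1 + k) * n2 w + 3 * k * n2 v"
      unfolding n2_def using iw by simp
    also have "\<dots> \<le> n2 w + k * M + 3 * k * M"
      using mult_left_mono[OF M(1), of "3 * k"] mult_left_mono[OF M(2), of k] k by (simp add: algebra_simps)
    finally show ?thesis by (simp add: mult_ac)
  qed
  let ?ann = "cball 0 (2 * r) - cball 0 r :: (real^'n) set"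
  \<comment> \<open>Inside radius r the inner piece is v, outside 2 r the outer piece is v. Only on
    the annulus is G(f(v)) not accounted for by the two pieces, and there it is added in
    full.\<close>
  have nl: "Gint v \<le> Gint a + Gint b + (LINT x|lborel. indicator ?ann x * Gp g (fchange (v x)))"
  proof -
    have ia: "integrable lborel (\<lambda>x. Gp g (fchange (a x)))" and ib: "integrable lborel (\<lambda>x. Gp g (fchange (b x)))"
      and iv: "integrable lborel (\<lambda>x. Gp g (fchange (v x)))"
      by (intro G_integrable[OF sa] G_integrable[OF sb] G_integrable[OF s])+
    have ii: "integrable lborel (\<lambda>x. indicator ?ann x * Gp g (fchange (v x)))"
      using integrable_mult_indicator[OF _ iv, of ?ann] by simp
    have "Gint v \<le> (LINT x|lborel. (Gp g (fchange (a x)) + Gp g (fchange (b x))) + indicator ?ann x * Gp g (fchange (v x)))"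
      unfolding Gint_def
    proof (rule integral_mono[OF iv])
      fix x
      consider "norm x \<le> r" | "2 * r \<le> norm x" | "x \<in> ?ann" by fastforce
      then show "Gp g (fchange (v x)) \<le> (Gp g (fchange (a x)) + Gp g (fchange (b x))) + indicator ?ann x * Gp g (fchange (v x))"
      proof cases
        case 1
        then show ?thesis using G_nonneg by (simp add: a_def b_def cutoff_inside)
      next
        case 2
        then show ?thesis using G_nonneg[of "fchange (v x)"] by (simp add: a_def b_def cutoff_outside[OF r0] indicator_def)
      next
        case 3
        then show ?thesis using G_nonneg[of "fchange (a x)"] G_nonneg[of "fchange (b x)"] by simp
      qed
    qed (intro Bochner_Integration.integrable_add ia ib ii)
    also have "\<dots> = Gint a + Gint b + (LINT x|lborel. indicator ?ann x * Gp g (fchange (v x)))"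
      unfolding Gint_def using ia ib ii by simp
    finally show ?thesis .
  qed
  let ?in = "\<lambda>x. indicator (cball 0 r) x * fchange (v x)"
  \<comment> \<open>The outer piece vanishes on the inner ball and is dominated by v elsewhere, so
    its mass is at most what v has outside that ball.\<close>
  have mb: "mass b + n2 ?in \<le> mass v"
  proof -
    note Lv = L2_fchange[OF sobD(1)[OF s]] and Lb = L2_fchange[OF sobD(1)[OF sb]]
    have Li: "L2 ?in" by (rule L2_indicator_mult[OF Lv]) simp
    have "mass b + n2 ?in = (LINT x|lborel. (norm (fchange (b x)))\<^sup>2 + (norm (?in x))\<^sup>2)"
      unfolding mass_def n2_def by (rule Bochner_Integration.integral_add[symmetric]) (intro L2_integrable Lb Li)+
    also have "\<dots> \<le> mass v"
      unfolding mass_def n2_def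
    proof (rule integral_mono)
      fix x
      show "(norm (fchange (b x)))\<^sup>2 + (norm (?in x))\<^sup>2 \<le> (norm (fchange (v x)))\<^sup>2"
      proof (cases "norm x \<le> r")
        case True
        then show ?thesis by (simp add: b_def cutoff_inside)
      next
        case False
        have "\<bar>1 - cutoff r x\<bar> * \<bar>v x\<bar> \<le> 1 * \<bar>v x\<bar>" using cutoff_bounds[of r x] by (intro mult_right_mono) auto
        then have "\<bar>b x\<bar> \<le> \<bar>v x\<bar>" by (simp add: b_def abs_mult)
        from fchange_power_mono(3)[OF this] show ?thesis using False by simp
      qed
    qed (intro Bochner_Integration.integrable_add L2_integrable Lb Li Lv)+
    finally show ?thesis .
  qed
  have "mass b \<le> m" using mb m n2_nonneg[of ?in] by linarith
  from energy_ge[OF m(1) sb this] have eb: "mass b / m * e_inf m \<le> energy b B" .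
  \<comment> \<open>The level is nonpositive, so an upper bound on the outer mass becomes a lower
    bound on its share.\<close>
  have "(1 - n2 ?in / m) * e_inf m \<le> mass b / m * e_inf m"
  proof (rule mult_right_mono_neg[OF _ e])
    show "mass b / m \<le> 1 - n2 ?in / m" using mb m by (simp add: field_simps)
  qed
  then have "(1 - n2 ?in / m) * e_inf m \<le> energy b B" using eb by linarith
  moreover have "12 * M / r = 2 * (k * M)" by (simp add: k_def)
  moreover have "2 * k * M = 2 * (k * M)" "4 * k * M = 4 * (k * M)" by simp_all
  ultimately have "(1/2) * n2 A \<le> energy v w + Gint a + (LINT x|lborel. indicator ?ann x * Gp g (fchange (v x)))
      + 12 * M / r - (1 - n2 ?in / m) * e_inf m"
    using grad nl unfolding energy_def by linarith
  then show ?thesis unfolding a_def A_def .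
qed

text \<open>Negative energy forces the integral of G to be at least -e, hence |f(v)| and so |v| to
  be at least \<delta> on a set of measure at least c. If no cube of side r carried half its volume
  of the set where |v| >= \<delta>/2, \<open>sob_superlevel\<close> would bound that measure below
  c.\<close>

lemma nonvanishing:
  assumes e: "e < 0" and M: "0 \<le> M" and m: "0 \<le> m"
  obtains \<delta> r where "0 < \<delta>" "0 < r"
    "\<And>(v :: real^'n \<Rightarrow> real) w. sob v w \<Longrightarrow> mass v \<le> m \<Longrightarrow> n2 w \<le> M \<Longrightarrow> energy v w \<le> e \<Longrightarrow>
      \<exists>y. ennreal (r ^ CARD('n) / 2) < emeasure lborel {h \<in> cbox 0 (r *\<^sub>R One). \<delta> / 2 \<le> \<bar>v (y + h)\<bar>}"
proof -
  obtain K where K: "0 \<le> K" and GN: "\<And>(v :: real^'n \<Rightarrow> real) w. sob v w \<Longrightarrow> mass v \<le> m \<Longrightarrow>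
    integrable lborel (\<lambda>x. \<bar>fchange (v x)\<bar> powr p) \<and> (LINT x|lborel. \<bar>fchange (v x)\<bar> powr p) \<le> K * (1 + n2 w)"
    using GN_constant[of m] by blast
  define T where "T = m + K * (1 + M) + 1"
  have T: "0 < T" using m K M by (simp add: T_def add_nonneg_pos)
  \<comment> \<open>The terms controlled by mass and critical power use up half of -e; the other
    half must come from the set where |f(v)| >= \<delta>.\<close>
  define \<epsilon> where "\<epsilon> = - e / (2 * T)"
  have \<epsilon>: "0 < \<epsilon>" "\<epsilon> * T = - e / 2" using e T divide_neg_pos[of e "2 * T"] by (auto simp: \<epsilon>_def)
  obtain \<delta> C where d: "0 < \<delta>" "0 < C" "\<And>s. Gp g s \<le> \<epsilon> * (s\<^sup>2 + \<bar>s\<bar> powr p) + C * indicator {s. \<delta> \<le> \<bar>s\<bar>} s"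
    using G_growth[OF \<epsilon>(1)] by blast
  define c where "c = - e / (2 * C)"
  have c: "0 < c" "C * c = - e / 2" using e d divide_neg_pos[of e "2 * C"] by (auto simp: c_def)
  \<comment> \<open>Solves for the bound of \<open>sob_superlevel\<close> to equal c M / (2 (M +
    1)), which is below c; the + 1 covers M = 0.\<close>
  define r where "r = sqrt (c * \<delta>\<^sup>2 / (16 * real CARD('n) * (M + 1)))"
  have r0: "0 < r" using c d M by (auto simp: r_def intro!: divide_pos_pos mult_pos_pos)
  have r2: "8 * real CARD('n) * r\<^sup>2 * M / \<delta>\<^sup>2 < c"
  proof -
    have "r\<^sup>2 = c * \<delta>\<^sup>2 / (16 * real CARD('n) * (M + 1))"
      using c d M by (simp add: r_def)
    moreover have "8 * N * (c * d / (16 * N * M')) * M / d = c * (M / (2 * M'))"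
      if "N \<noteq> 0" "d \<noteq> 0" "M' \<noteq> 0" for N d M' :: real
      using that by (simp add: field_simps)
    moreover have "real CARD('n) \<noteq> 0" "\<delta>\<^sup>2 \<noteq> 0" "M + 1 \<noteq> 0" using d M by auto
    ultimately have "8 * real CARD('n) * r\<^sup>2 * M / \<delta>\<^sup>2 = c * (M / (2 * (M + 1)))"
      by presburger
    also have "\<dots> < c * 1" using c M by (intro mult_strict_left_mono) (auto simp: divide_less_eq)
    finally show ?thesis by simp
  qed
  show thesis
  proof (rule that[OF d(1) r0])
    fix v :: "real^'n \<Rightarrow> real" and w
    assume s: "sob v w" and vm: "mass v \<le> m" and wM: "n2 w \<le> M" and ee: "energy v w \<le> e"
    have [measurable]: "v \<in> borel_measurable borel" using sobD(1)[OF s] by (simp add: L2_def)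
    note u = L2_fchange[OF sobD(1)[OF s]]
    let ?D = "{x. \<delta> \<le> \<bar>fchange (v x)\<bar>}"
    have Dfin: "emeasure lborel ?D < \<infinity>"
      using L2_Markov[OF u d(1)] by (rule le_less_trans) simp
    have iD: "integrable lborel (indicator ?D :: real^'n \<Rightarrow> real)"
      by (rule integrable_real_indicator[OF _ Dfin]) measurable
    have low: "- e \<le> Gint v" using ee n2_nonneg[of w] unfolding energy_def by linarith
    have i: "integrable lborel (\<lambda>x. \<epsilon> * ((norm (fchange (v x)))\<^sup>2 + \<bar>fchange (v x)\<bar> powr p) + C * indicator ?D x)"
      using GN[OF s vm] iD by (intro Bochner_Integration.integrable_add integrable_mult_right L2_integrable u) auto
    have "Gint v \<le> (LINT x|lborel. \<epsilon> * ((norm (fchange (v x)))\<^sup>2 + \<bar>fchange (v x)\<bar> powr p) + C * indicator ?D x)"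
      unfolding Gint_def
    proof (rule integral_mono[OF G_integrable[OF s] i])
      show "Gp g (fchange (v x)) \<le> \<epsilon> * ((norm (fchange (v x)))\<^sup>2 + \<bar>fchange (v x)\<bar> powr p) + C * indicator ?D x" for x
        using d(3)[of "fchange (v x)"] by (simp add: indicator_def)
    qed
    also have "\<dots> = \<epsilon> * (mass v + (LINT x|lborel. \<bar>fchange (v x)\<bar> powr p)) + C * measure lborel ?D"
      using GN[OF s vm] iD L2_integrable[OF u] by (simp add: mass_def n2_def)
    also have "\<dots> \<le> \<epsilon> * T + C * measure lborel ?D"
    proof -
      have "(LINT x|lborel. \<bar>fchange (v x)\<bar> powr p) \<le> K * (1 + n2 w)" using GN[OF s vm] by blast
      also have "\<dots> \<le> K * (1 + M)" using K wM by (intro mult_left_mono) auto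
      finally show ?thesis using \<epsilon>(1) vm by (intro add_right_mono mult_left_mono) (auto simp: T_def)
    qed
    finally have "C * c \<le> C * measure lborel ?D" using low \<epsilon>(2) c(2) by linarith
    then have "c \<le> measure lborel ?D" using d(2) by simp
    then have "ennreal c \<le> emeasure lborel ?D"
      using Dfin by (simp add: emeasure_eq_ennreal_measure less_top ennreal_leI)
    also have "\<dots> \<le> emeasure lborel {x. \<delta> \<le> \<bar>v x\<bar>}"
    proof (rule emeasure_mono)
      show "?D \<subseteq> {x. \<delta> \<le> \<bar>v x\<bar>}" using fchange_le by (auto intro: order_trans)
    qed measurable
    finally have big: "ennreal c \<le> emeasure lborel {x. \<delta> \<le> \<bar>v x\<bar>}" .
    show "\<exists>y. ennreal (r ^ CARD('n) / 2) < emeasure lborel {h \<in> cbox 0 (r *\<^sub>R One). \<delta> / 2 \<le> \<bar>v (y + h)\<bar>}"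
    proof (rule ccontr)
      assume "\<not> ?thesis"
      then have "emeasure lborel {x. \<delta> \<le> \<bar>v x\<bar>} \<le> ennreal (8 * real CARD('n) * r\<^sup>2 * n2 w / \<delta>\<^sup>2)"
        by (intro sob_superlevel[OF s d(1) r0]) (auto simp: not_less)
      also have "\<dots> \<le> ennreal (8 * real CARD('n) * r\<^sup>2 * M / \<delta>\<^sup>2)"
        using wM by (intro ennreal_leI divide_right_mono mult_left_mono) auto
      also have "\<dots> < ennreal c" using r2 M by (intro ennreal_lessI c)
      finally show False using big by simp
    qed
  qed
qed

section \<open>Minimizing sequences and their local limits\<close>

lemma cutoff_tendsto_L2:
  fixes V :: "real^'n \<Rightarrow> real"
  assumes V: "L2 V"
  shows "(\<lambda>j. n2 (\<lambda>x. cutoff (real (j + k)) x * V x - V x)) \<longlonglongrightarrow> 0"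
proof (rule L2_dominated_convergence[OF _ L2_measurable[OF V] V])
  have [measurable]: "V \<in> borel_measurable borel" using V by (simp add: L2_def)
  show "(\<lambda>x. cutoff (real (j + k)) x * V x) \<in> borel_measurable borel" for j by measurable
  show "AE x in lborel. (\<lambda>j. cutoff (real (j + k)) x * V x) \<longlonglongrightarrow> V x"
  proof (rule AE_I2, rule tendsto_eventually)
    fix x :: "real^'n"
    obtain J :: nat where J: "norm x \<le> real J" using real_arch_simple by blast
    show "\<forall>\<^sub>F j in sequentially. cutoff (real (j + k)) x * V x = V x"
      using eventually_ge_at_top[of J]
    proof eventually_elim
      case (elim j)
      then have "norm x \<le> real (j + k)" using J by simp
      then show ?case by (simp add: cutoff_inside)
    qed
  qed
  show "AE x in lborel. norm (cutoff (real (j + k)) x * V x - V x) \<le> norm (V x)" for j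
  proof (rule AE_I2)
    fix x
    have "\<bar>cutoff (real (j + k)) x - 1\<bar> * \<bar>V x\<bar> \<le> 1 * \<bar>V x\<bar>"
      using cutoff_bounds[of "real (j + k)" x] by (intro mult_right_mono) auto
    moreover have "cutoff (real (j + k)) x * V x - V x = (cutoff (real (j + k)) x - 1) * V x"
      by (simp add: left_diff_distrib)
    ultimately show "norm (cutoff (real (j + k)) x * V x - V x) \<le> norm (V x)"
      by (simp only: real_norm_def abs_mult mult_1)
  qed
qed


text \<open>Coercivity bounds the gradients; the L2 norm of v, which the mass alone does not
  control, is bounded through the critical power by \<open>n2_le_mass\<close>. Each member is
  translated so that the cube found by \<open>nonvanishing\<close> has its corner at the
  origin.\<close>

lemma minimizing_sequence:
  assumes m: "0 < m" and neg: "e_inf m < 0" and ne: "{energy v w | v w. sob v w \<and> mass v = m} \<noteq> {}"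
  obtains v :: "nat \<Rightarrow> real^'n \<Rightarrow> real" and w M \<delta> r where
    "\<And>n. sob (v n) (w n)" "\<And>n. mass (v n) = m" "\<And>n. energy (v n) (w n) < e_inf m + inverse (real (Suc n))"
    "\<And>n. n2 (v n) \<le> M" "\<And>n. n2 (w n) \<le> M" "0 \<le> M" "0 < \<delta>" "0 < r"
    "\<And>n. ennreal (r ^ CARD('n) / 2) < emeasure lborel {h \<in> cbox 0 (r *\<^sub>R One). \<delta> / 2 \<le> \<bar>v n h\<bar>}"
proof -
  obtain C where C: "\<And>(v :: real^'n \<Rightarrow> real) w. sob v w \<Longrightarrow> mass v \<le> m \<Longrightarrow> n2 w / 4 - C \<le> energy v w"
    using energy_coercive by blast
  obtain K where K: "0 \<le> K" and GN: "\<And>(v :: real^'n \<Rightarrow> real) w. sob v w \<Longrightarrow> mass v \<le> m \<Longrightarrow>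
    integrable lborel (\<lambda>x. \<bar>fchange (v x)\<bar> powr p) \<and> (LINT x|lborel. \<bar>fchange (v x)\<bar> powr p) \<le> K * (1 + n2 w)"
    using GN_constant[of m] by blast
  define M1 where "M1 = max 0 (4 * C)"
  have M1: "n2 w \<le> M1" if s: "sob v w" and "mass v = m" "energy v w \<le> 0" for v :: "real^'n \<Rightarrow> real" and w
    using C[OF s] that by (simp add: M1_def)
  define M where "M = max M1 (3 * m + 2 * (K * (1 + M1)))"
  have M: "n2 w \<le> M" "n2 v \<le> M" if s: "sob v w" and mv: "mass v = m" and e: "energy v w \<le> 0" for v :: "real^'n \<Rightarrow> real" and w
  proof -
    show "n2 w \<le> M" using M1[OF that] by (simp add: M_def)
    have "n2 v \<le> 3 * mass v + 2 * (LINT x|lborel. \<bar>fchange (v x)\<bar> powr p)" by (rule n2_le_mass[OF s])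
    also have "\<dots> \<le> 3 * m + 2 * (K * (1 + n2 w))" using GN[OF s] mv by simp
    also have "\<dots> \<le> 3 * m + 2 * (K * (1 + M1))"
      using M1[OF that] K by (intro add_left_mono mult_left_mono) auto
    finally show "n2 v \<le> M" by (simp add: M_def)
  qed
  have M0: "0 \<le> M" by (simp add: M_def M1_def)
  have half: "e_inf m / 2 < 0" using neg by simp
  obtain \<delta> r where d: "0 < \<delta>" "0 < r" and nv: "\<And>(v :: real^'n \<Rightarrow> real) w. sob v w \<Longrightarrow> mass v \<le> m \<Longrightarrow> n2 w \<le> M \<Longrightarrow>
      energy v w \<le> e_inf m / 2 \<Longrightarrow>
      \<exists>y. ennreal (r ^ CARD('n) / 2) < emeasure lborel {h \<in> cbox 0 (r *\<^sub>R One). \<delta> / 2 \<le> \<bar>v (y + h)\<bar>}"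
    by (rule nonvanishing[OF half M0 less_imp_le[OF m]]) blast
  define Q where "Q n v w \<longleftrightarrow> sob v w \<and> mass v = m \<and> energy v w < e_inf m + inverse (real (Suc n)) \<and> n2 v \<le> M \<and> n2 w \<le> M \<and>
      ennreal (r ^ CARD('n) / 2) < emeasure lborel {h \<in> cbox 0 (r *\<^sub>R One). \<delta> / 2 \<le> \<bar>v h\<bar>}"
    for n :: nat and v :: "real^'n \<Rightarrow> real" and w
  have "\<exists>v w. Q n v w" for n
  proof -
    \<comment> \<open>Capped so that every member of the sequence, including the first ones, has
      energy at most \<open>e_inf m / 2\<close> and \<open>nonvanishing\<close> applies with one
      \<delta> and r.\<close>
    define t where "t = min (inverse (real (Suc n))) (- e_inf m / 2)"
    have t: "0 < t" using neg by (simp add: t_def)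
    then have "Inf {energy v w | v w. sob v w \<and> mass v = m} < e_inf m + t" by (simp add: e_inf_def)
    from cInf_lessD[OF ne this] obtain v w where s: "sob v w" and mv: "mass v = m" and e: "energy v w < e_inf m + t"
      by blast
    have e1: "energy v w < e_inf m + inverse (real (Suc n))" "energy v w \<le> e_inf m / 2"
      using e unfolding t_def by linarith+
    have e0: "energy v w \<le> 0" using e1(2) neg by linarith
    obtain y where y: "ennreal (r ^ CARD('n) / 2) < emeasure lborel {h \<in> cbox 0 (r *\<^sub>R One). \<delta> / 2 \<le> \<bar>v (y + h)\<bar>}"
      using nv[OF s _ M(1)[OF s mv e0] e1(2)] mv by auto
    show ?thesis
      unfolding Q_def
    proof (intro exI conjI)
      show "sob (\<lambda>x. v (x + y)) (\<lambda>x. w (x + y))" by (rule sob_translate[OF s])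
      show "mass (\<lambda>x. v (x + y)) = m" using translate_invariance(1)[OF s] mv by simp
      show "energy (\<lambda>x. v (x + y)) (\<lambda>x. w (x + y)) < e_inf m + inverse (real (Suc n))"
        using translate_invariance(2)[OF s] e1 by simp
      show "n2 (\<lambda>x. v (x + y)) \<le> M" "n2 (\<lambda>x. w (x + y)) \<le> M"
        using M[OF s mv e0] L2_translate(2)[OF sobD(1)[OF s]] L2_translate(2)[OF sobD(2)[OF s]] by simp_all
      show "ennreal (r ^ CARD('n) / 2) < emeasure lborel {h \<in> cbox 0 (r *\<^sub>R One). \<delta> / 2 \<le> \<bar>v (h + y)\<bar>}"
        using y by (simp add: add.commute)
    qed
  qed
  then obtain v w where "\<And>n. Q n (v n) (w n)" by metis
  then show thesis using M0 d unfolding Q_def by (intro that[of v w M \<delta> r]) blast+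
qed

text \<open>On a fixed ball containing the cube, each \<open>v n\<close> has squared norm at least
  (\<delta>/2)^2 r^N / 2. Strong local convergence passes this to V, and f vanishes only at
  0.\<close>

lemma local_mass_pos:
  fixes v :: "nat \<Rightarrow> real^'n \<Rightarrow> real"
  assumes v: "\<And>n. L2 (v n)" and V: "L2 V" and d: "0 < \<delta>" "0 < r"
    and big: "\<And>n. ennreal (r ^ CARD('n) / 2) < emeasure lborel {h \<in> cbox 0 (r *\<^sub>R One). \<delta> / 2 \<le> \<bar>v n h\<bar>}"
    and loc: "\<And>R. (\<lambda>n. n2 (\<lambda>x. indicator (cball 0 R) x * (v n x - V x))) \<longlonglongrightarrow> 0"
  shows "0 < mass V"
proof -
  define R where "R = sqrt (real CARD('n) * r\<^sup>2)"
  let ?I = "\<lambda>x. indicator (cball 0 R) x :: real"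
  have sub: "cbox 0 (r *\<^sub>R One) \<subseteq> (cball 0 R :: (real^'n) set)"
  proof
    fix x :: "real^'n" assume "x \<in> cbox 0 (r *\<^sub>R One)"
    from norm_cbox_One_le[OF this] have "(norm x)\<^sup>2 \<le> real CARD('n) * r\<^sup>2" by simp
    then have "norm x \<le> R" unfolding R_def by (rule real_le_rsqrt)
    then show "x \<in> cball 0 R" by simp
  qed
  have LI: "L2 (\<lambda>x. ?I x * v n x)" for n by (rule L2_indicator_mult[OF v]) simp
  have LV: "L2 (\<lambda>x. ?I x * V x)" by (rule L2_indicator_mult[OF V]) simp
  define b where "b = (\<delta> / 2)\<^sup>2 * (r ^ CARD('n) / 2)"
  have b: "0 < b" using d by (simp add: b_def)
  have "b \<le> n2 (\<lambda>x. ?I x * v n x)" for n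
  proof -
    have [measurable]: "v n \<in> borel_measurable borel" using v by (simp add: L2_def)
    let ?D = "{h \<in> cbox 0 (r *\<^sub>R One). \<delta> / 2 \<le> \<bar>v n h\<bar>}"
    have "ennreal b = ennreal ((\<delta> / 2)\<^sup>2) * ennreal (r ^ CARD('n) / 2)"
      unfolding b_def using d by (subst ennreal_mult) auto
    also have "\<dots> \<le> ennreal ((\<delta> / 2)\<^sup>2) * emeasure lborel ?D"
      using big[of n] by (intro mult_left_mono) auto
    also have "\<dots> = (\<integral>\<^sup>+x. ennreal ((\<delta> / 2)\<^sup>2) * indicator ?D x \<partial>lborel)"
      by (rule nn_integral_cmult_indicator[symmetric]) measurable
    also have "\<dots> \<le> (\<integral>\<^sup>+x. ennreal ((norm (?I x * v n x))\<^sup>2) \<partial>lborel)"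
    proof (rule nn_integral_mono)
      fix x
      show "ennreal ((\<delta> / 2)\<^sup>2) * indicator ?D x \<le> ennreal ((norm (?I x * v n x))\<^sup>2)"
      proof (cases "x \<in> ?D")
        case True
        then have "x \<in> cball 0 R" using sub by auto
        moreover have "(\<delta> / 2)\<^sup>2 \<le> \<bar>v n x\<bar>\<^sup>2" using True d by (intro power_mono) auto
        ultimately show ?thesis using True by (simp add: ennreal_leI)
      qed simp
    qed
    also have "\<dots> = ennreal (n2 (\<lambda>x. ?I x * v n x))" by (rule L2_nn_integral[OF LI])
    finally show ?thesis by simp
  qed
  moreover have "(\<lambda>n. n2 (\<lambda>x. ?I x * v n x)) \<longlonglongrightarrow> n2 (\<lambda>x. ?I x * V x)"
    by (rule L2_limit_n2[OF LI LV]) (use loc[of R] in \<open>simp add: right_diff_distrib\<close>)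
  ultimately have ge: "b \<le> n2 (\<lambda>x. ?I x * V x)" by (intro LIMSEQ_le_const) auto
  show ?thesis
  proof (rule ccontr)
    assume "\<not> ?thesis"
    then have "mass V = 0" using mass_nonneg[of V] by linarith
    from mass_zero[OF V this] have "AE x in lborel. 0 = ?I x * V x" by eventually_elim simp
    from L2_cong_AE(2)[OF L2_zero L2_measurable[OF LV] this] ge b show False by (simp add: n2_def)
  qed
qed

text \<open>The energy of the local limit is at most its share of the minimal level: the escaping mass cannot
  have energy below its own share.\<close>

lemma limit_energy_le:
  fixes v :: "nat \<Rightarrow> real^'n \<Rightarrow> real"
  assumes m: "0 < m" and neg: "e_inf m < 0"
    and s: "\<And>n. sob (v n) (w n)" and mv: "\<And>n. mass (v n) = m"
    and en: "(\<lambda>n. energy (v n) (w n)) \<longlonglongrightarrow> e_inf m"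
    and M: "\<And>n. n2 (v n) \<le> M" "\<And>n. n2 (w n) \<le> M"
    and V: "L2 V" and AE: "AE x in lborel. (\<lambda>n. v n x) \<longlonglongrightarrow> V x"
    and loc: "\<And>R. (\<lambda>n. n2 (\<lambda>x. indicator (cball 0 R) x * (v n x - V x))) \<longlonglongrightarrow> 0"
  obtains W where "sob V W" "energy V W \<le> mass V / m * e_inf m"
proof -
  have [measurable]: "v n \<in> borel_measurable borel" "w n \<in> borel_measurable borel" "V \<in> borel_measurable borel" for n
    using sobD(1,2)[OF s] V by (auto simp: L2_def)
  note Lv = sobD(1)[OF s]
  have M0: "0 \<le> M" using M(1)[of 0] n2_nonneg order_trans by blast
  obtain K where K: "0 \<le> K" and GN: "\<And>(v :: real^'n \<Rightarrow> real) w. sob v w \<Longrightarrow> mass v \<le> m \<Longrightarrow>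
    integrable lborel (\<lambda>x. \<bar>fchange (v x)\<bar> powr p) \<and> (LINT x|lborel. \<bar>fchange (v x)\<bar> powr p) \<le> K * (1 + n2 w)"
    using GN_constant[of m] by blast
  define P where "P = K * (1 + M)"
  have P0: "0 \<le> P" using K M0 by (simp add: P_def)
  have P: "(\<integral>\<^sup>+x. ennreal (\<bar>fchange (v n x)\<bar> powr p) \<partial>lborel) \<le> ennreal P" for n
  proof -
    have i: "integrable lborel (\<lambda>x. \<bar>fchange (v n x)\<bar> powr p)"
      using GN[OF s[of n]] mv by auto
    have "(LINT x|lborel. \<bar>fchange (v n x)\<bar> powr p) \<le> K * (1 + n2 (w n))"
      using GN[OF s[of n]] mv by auto
    also have "K * (1 + n2 (w n)) \<le> P" unfolding P_def using K M by (intro mult_left_mono) auto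
    finally have "ennreal (LINT x|lborel. \<bar>fchange (v n x)\<bar> powr p) \<le> ennreal P" by (intro ennreal_leI)
    then show ?thesis using nn_integral_eq_integral[OF i] by simp
  qed
  \<comment> \<open>The radii start at 6, as \<open>cutoff_splitting\<close> requires, so that the
    gradient of the cutoff is at most 1.\<close>
  define c where "c j = (cutoff (real (j + 6)) :: real^'n \<Rightarrow> real)" for j
  have r6: "6 \<le> real (j + 6)" "0 < real (j + 6)" for j by auto
  have [measurable]: "c j \<in> borel_measurable borel" for j unfolding c_def by measurable
  have c01: "0 \<le> c j x" "c j x \<le> 1" for j x unfolding c_def by (rule cutoff_bounds)+
  have cle: "\<bar>c j x * t\<bar> \<le> \<bar>t\<bar>" for j x t
    using mult_right_mono[of "\<bar>c j x\<bar>" 1 "\<bar>t\<bar>"] c01[of j x] by (simp add: abs_mult)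
  have LcV: "L2 (\<lambda>x. c j x * V x)" for j
    by (rule L2_bounded(1)[OF V, of _ 1]) (use cle in auto)
  define A where "A j n x = c j x *\<^sub>R w n x + v n x *\<^sub>R dcutoff (real (j + 6)) x" for j n x
  have sA: "sob (\<lambda>x. c j x * v n x) (A j n)" for j n
    unfolding c_def A_def[abs_def] by (rule sob_cutoff[OF s r6(2)])
  have limA: "(\<lambda>n. n2 (\<lambda>x. c j x * v n x - c j x * V x)) \<longlonglongrightarrow> 0" for j
  proof (rule null_sequence_squeeze[OF _ _ loc[of "2 * real (j + 6)"]])
    fix n
    show "n2 (\<lambda>x. c j x * v n x - c j x * V x) \<le> n2 (\<lambda>x. indicator (cball 0 (2 * real (j + 6))) x * (v n x - V x))"
    proof (rule n2_mono)
      show "L2 (\<lambda>x. indicator (cball 0 (2 * real (j + 6))) x * (v n x - V x))"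
        by (intro L2_indicator_mult L2_diff Lv V) simp
      show "norm (c j x * v n x - c j x * V x) \<le> norm (indicator (cball 0 (2 * real (j + 6))) x * (v n x - V x))" for x
      proof (cases "norm x \<le> 2 * real (j + 6)")
        case True
        then show ?thesis using cle[of j x "v n x - V x"] by (simp add: right_diff_distrib)
      next
        case False
        then have "c j x = 0" unfolding c_def by (intro cutoff_outside r6) auto
        then show ?thesis by simp
      qed
    qed measurable
  qed simp
  let ?B = "\<lambda>j. cball 0 (real (j + 6)) :: (real^'n) set"
  let ?ann = "\<lambda>j. cball 0 (2 * real (j + 6)) - ?B j"
  let ?m = "\<lambda>j (u :: real^'n \<Rightarrow> real). n2 (\<lambda>x. indicator (?B j) x * fchange (u x))"
  let ?g = "\<lambda>j (u :: real^'n \<Rightarrow> real). LINT x|lborel. indicator (?ann j) x * Gp g (fchange (u x))"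
  have finB: "emeasure lborel (cball (0::real^'n) R) < \<infinity>" for R by (rule emeasure_lborel_cball_finite)
  have fin_ann: "emeasure lborel (?ann j) < \<infinity>" for j
    by (rule le_less_trans[OF emeasure_mono finB[of "2 * real (j + 6)"]]) auto
  \<comment> \<open>The right-hand side of \<open>cutoff_splitting\<close> at radius j + 6. Apart
    from the energy and constants its terms live on bounded sets, so it converges to
    \<open>Y' j\<close> as n grows with j fixed; j goes to infinity only afterwards.\<close>
  define Y where "Y j n = energy (v n) (w n) + Gint (\<lambda>x. c j x * v n x) + ?g j (v n) + 12 * M / real (j + 6)
      - (1 - ?m j (v n) / m) * e_inf m" for j n
  define Y' where "Y' j = e_inf m + Gint (\<lambda>x. c j x * V x) + ?g j V + 12 * M / real (j + 6) - (1 - ?m j V / m) * e_inf m" for j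
  have AY: "n2 (A j n) \<le> 2 * Y j n" for j n
  proof -
    have half: "a \<le> 2 * b" if "(1/2) * a \<le> b" for a b :: real using that by simp
    show ?thesis
      unfolding A_def[abs_def] c_def Y_def
      by (rule half[OF cutoff_splitting[OF s[of n] M(1)[of n] M(2)[of n] r6(1)[of j] m eq_refl[OF mv] less_imp_le[OF neg]]])
  qed
  have limY: "(\<lambda>n. Y j n) \<longlonglongrightarrow> Y' j" for j
    unfolding Y_def Y'_def
  proof (intro tendsto_intros en)
    have eqI: "Gint (\<lambda>x. c j x * u x) = (LINT x|lborel. indicator (cball 0 (2 * real (j + 6))) x * Gp g (fchange (c j x * u x)))" for u :: "real^'n \<Rightarrow> real"
      unfolding Gint_def
    proof (intro Bochner_Integration.integral_cong refl)
      fix x :: "real^'n"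
      show "Gp g (fchange (c j x * u x)) = indicator (cball 0 (2 * real (j + 6))) x * Gp g (fchange (c j x * u x))"
      proof (cases "norm x \<le> 2 * real (j + 6)")
        case False
        then have "c j x = 0" unfolding c_def by (intro cutoff_outside r6) auto
        then show ?thesis by simp
      qed simp
    qed
    show "(\<lambda>n. Gint (\<lambda>x. c j x * v n x)) \<longlonglongrightarrow> Gint (\<lambda>x. c j x * V x)"
      unfolding eqI
    proof (rule Gint_local_limit[where P=P])
      show "AE x in lborel. (\<lambda>n. c j x * v n x) \<longlonglongrightarrow> c j x * V x"
        using AE by eventually_elim (intro tendsto_intros)
      show "(\<integral>\<^sup>+x. ennreal (\<bar>fchange (c j x * v n x)\<bar> powr p) \<partial>lborel) \<le> ennreal P" for n
        by (rule order_trans[OF nn_integral_mono P[of n]]) (intro ennreal_leI fchange_power_mono cle)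
    qed (use P0 finB in auto)
    show "(\<lambda>n. ?g j (v n)) \<longlonglongrightarrow> ?g j V"
      by (rule Gint_local_limit[where P=P]) (use AE P P0 fin_ann in auto)
    show "(\<lambda>n. ?m j (v n)) \<longlonglongrightarrow> ?m j V"
    proof (rule L2_limit_n2)
      show "L2 (\<lambda>x. indicator (?B j) x * fchange (v n x))" for n by (intro L2_indicator_mult L2_fchange Lv) simp
      show "L2 (\<lambda>x. indicator (?B j) x * fchange (V x))" by (intro L2_indicator_mult L2_fchange V) simp
      show "(\<lambda>n. n2 (\<lambda>x. indicator (?B j) x * fchange (v n x) - indicator (?B j) x * fchange (V x))) \<longlonglongrightarrow> 0"
      proof (rule null_sequence_squeeze[OF _ _ loc[of "real (j + 6)"]])
        fix n
        show "n2 (\<lambda>x. indicator (?B j) x * fchange (v n x) - indicator (?B j) x * fchange (V x)) \<le> n2 (\<lambda>x. indicator (?B j) x * (v n x - V x))"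
        proof (rule n2_mono)
          show "L2 (\<lambda>x. indicator (?B j) x * (v n x - V x))" by (intro L2_indicator_mult L2_diff Lv V) simp
          show "norm (indicator (?B j) x * fchange (v n x) - indicator (?B j) x * fchange (V x)) \<le> norm (indicator (?B j) x * (v n x - V x))" for x
            using fchange_lipschitz[of "v n x" "V x"] by (simp add: indicator_def)
          show "(\<lambda>x. indicator (?B j) x * fchange (v n x) - indicator (?B j) x * fchange (V x)) \<in> borel_measurable borel"
            by (rule L2_measurable, intro L2_diff L2_indicator_mult L2_fchange Lv V) simp_all
        qed
      qed simp
    qed
    show "m \<noteq> 0" using m by simp
  qed
  have step: "\<exists>B. sob (\<lambda>x. c j x * V x) B \<and> n2 B \<le> 2 * Y' j + \<epsilon>" if e: "0 < \<epsilon>" for j \<epsilon>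
  proof -
    have l: "(\<lambda>n. 2 * Y j n) \<longlonglongrightarrow> 2 * Y' j" by (intro tendsto_intros limY)
    have "\<forall>\<^sub>F n in sequentially. 2 * Y j n < 2 * Y' j + \<epsilon>" by (rule order_tendstoD(2)[OF l]) (use e in simp)
    then obtain N where N: "\<And>n. n \<ge> N \<Longrightarrow> 2 * Y j n < 2 * Y' j + \<epsilon>" by (auto simp: eventually_sequentially)
    show ?thesis
    proof (rule sob_lsc[of "\<lambda>n x. c j x * v (n + N) x" "\<lambda>n. A j (n + N)"])
      show "(\<lambda>n. n2 (\<lambda>x. c j x * v (n + N) x - c j x * V x)) \<longlonglongrightarrow> 0"
        by (rule LIMSEQ_ignore_initial_segment[OF limA])
      show "n2 (A j (n + N)) \<le> 2 * Y' j + \<epsilon>" for n using AY[of j "n + N"] N[of "n + N"] by simp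
    qed (rule sA LcV)+
  qed
  have limc: "(\<lambda>j. n2 (\<lambda>x. c j x * V x - V x)) \<longlonglongrightarrow> 0"
    unfolding c_def by (rule cutoff_tendsto_L2[OF V])
  have lower: "\<exists>W. sob V W \<and> n2 W \<le> c'" if bd: "\<forall>\<^sub>F j in sequentially. 2 * Y' j < c'" for c'
  proof -
    obtain J where J: "\<And>j. j \<ge> J \<Longrightarrow> 2 * Y' j < c'" using bd by (auto simp: eventually_sequentially)
    have "\<exists>B. sob (\<lambda>x. c (j + J) x * V x) B \<and> n2 B \<le> c'" for j
      using step[of "c' - 2 * Y' (j + J)" "j + J"] J[of "j + J"] by auto
    then obtain B where B: "\<And>j. sob (\<lambda>x. c (j + J) x * V x) (B j)" "\<And>j. n2 (B j) \<le> c'" by metis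
    show ?thesis
      by (rule sob_lsc[OF B(1) V _ B(2)]) (rule LIMSEQ_ignore_initial_segment[OF limc])
  qed
  \<comment> \<open>A gradient of V from a crude bound uniform in j. It must precede the sharp
    estimate, since integrability of G(f(V)) is derived from \<open>sob V W\<close>.\<close>
  obtain W where W: "sob V W"
  proof -
    have "\<exists>B. sob (\<lambda>x. c j x * V x) B \<and> n2 B \<le> 4 * M" for j
    proof (rule sob_lsc[OF sA LcV limA])
      fix n
      let ?d = "dcutoff (real (j + 6))"
      have m1: "L2 (\<lambda>x. c j x *\<^sub>R w n x)" "n2 (\<lambda>x. c j x *\<^sub>R w n x) \<le> 1\<^sup>2 * n2 (w n)"
      proof -
        have m: "(\<lambda>x. c j x *\<^sub>R w n x) \<in> borel_measurable borel" by measurable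
        have "norm (c j x *\<^sub>R w n x) \<le> 1 * norm (w n x)" for x
          using mult_right_mono[of "c j x" 1 "norm (w n x)"] c01[of j x] by simp
        from L2_bounded[OF sobD(2)[OF s[of n]] m this]
        show "L2 (\<lambda>x. c j x *\<^sub>R w n x)" "n2 (\<lambda>x. c j x *\<^sub>R w n x) \<le> 1\<^sup>2 * n2 (w n)" .
      qed
      have m2: "L2 (\<lambda>x. v n x *\<^sub>R ?d x)" "n2 (\<lambda>x. v n x *\<^sub>R ?d x) \<le> 1\<^sup>2 * n2 (v n)"
      proof -
        have m: "(\<lambda>x. v n x *\<^sub>R ?d x) \<in> borel_measurable borel" by measurable
        have "norm (v n x *\<^sub>R ?d x) \<le> 1 * norm (v n x)" for x
        proof -
          have "norm (?d x) \<le> 6 / real (j + 6)" by (rule dcutoff_bound[OF r6(2)])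
          also have "\<dots> \<le> 1" by simp
          finally show ?thesis using mult_left_mono[of "norm (?d x)" 1 "\<bar>v n x\<bar>"] by simp
        qed
        from L2_bounded[OF Lv[of n] m this]
        show "L2 (\<lambda>x. v n x *\<^sub>R ?d x)" "n2 (\<lambda>x. v n x *\<^sub>R ?d x) \<le> 1\<^sup>2 * n2 (v n)" .
      qed
      show "n2 (A j n) \<le> 4 * M"
        using n2_add_le[OF m1(1) m2(1)] m1(2) m2(2) M[of n] unfolding A_def[abs_def] by simp
    qed
    then obtain B where B: "\<And>j. sob (\<lambda>x. c j x * V x) (B j)" "\<And>j. n2 (B j) \<le> 4 * M" by metis
    from sob_lsc[OF B(1) V limc B(2)] show thesis using that by blast
  qed
  have iG: "integrable lborel (\<lambda>x. Gp g (fchange (V x)))" by (rule G_integrable[OF W])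
  have ev_in: "\<forall>\<^sub>F j in sequentially. x \<in> ?B j" for x :: "real^'n"
  proof -
    obtain J :: nat where "norm x \<le> real J" using real_arch_simple by blast
    then show ?thesis by (intro eventually_sequentiallyI[of J]) auto
  qed
  have gann: "(\<lambda>j. ?g j V) \<longlonglongrightarrow> 0"
  proof -
    have "(\<lambda>j. ?g j V) \<longlonglongrightarrow> (LINT x|(lborel::(real^'n) measure). 0)"
    proof (rule integral_dominated_convergence[where w="\<lambda>x. Gp g (fchange (V x))"])
      show "(\<lambda>x. indicator (?ann j) x * Gp g (fchange (V x))) \<in> borel_measurable lborel" for j
        using borel_measurable_integrable[OF integrable_mult_indicator[OF _ iG, of "?ann j"]] by simp
      show "AE x in lborel. (\<lambda>j. indicator (?ann j) x * Gp g (fchange (V x))) \<longlonglongrightarrow> 0"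
      proof (rule AE_I2, rule tendsto_eventually)
        fix x :: "real^'n"
        show "\<forall>\<^sub>F j in sequentially. indicator (?ann j) x * Gp g (fchange (V x)) = 0"
          using ev_in[of x] by eventually_elim simp
      qed
      show "AE x in lborel. norm (indicator (?ann j) x * Gp g (fchange (V x))) \<le> Gp g (fchange (V x))" for j
        using G_nonneg by (intro AE_I2) (auto simp: indicator_def)
    qed (simp_all add: iG)
    then show ?thesis by simp
  qed
  have mB: "(\<lambda>j. ?m j V) \<longlonglongrightarrow> mass V"
    unfolding mass_def
  proof (rule L2_limit_n2)
    show "L2 (\<lambda>x. indicator (?B j) x * fchange (V x))" for j by (intro L2_indicator_mult L2_fchange V) simp
    show "L2 (\<lambda>x. fchange (V x))" by (rule L2_fchange[OF V])
    show "(\<lambda>j. n2 (\<lambda>x. indicator (?B j) x * fchange (V x) - fchange (V x))) \<longlonglongrightarrow> 0"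
    proof (rule L2_dominated_convergence[OF _ _ L2_fchange[OF V]])
      show "AE x in lborel. (\<lambda>j. indicator (?B j) x * fchange (V x)) \<longlonglongrightarrow> fchange (V x)"
      proof (rule AE_I2, rule tendsto_eventually)
        fix x :: "real^'n"
        show "\<forall>\<^sub>F j in sequentially. indicator (?B j) x * fchange (V x) = fchange (V x)"
          using ev_in[of x] by eventually_elim simp
      qed
      show "AE x in lborel. norm (indicator (?B j) x * fchange (V x) - fchange (V x)) \<le> norm (fchange (V x))" for j
        by (intro AE_I2) (simp add: indicator_def)
      show "(\<lambda>x. indicator (?B j) x * fchange (V x)) \<in> borel_measurable borel" for j
        by (rule L2_measurable, intro L2_indicator_mult L2_fchange V) simp
      show "(\<lambda>x. fchange (V x)) \<in> borel_measurable borel" by (rule L2_measurable[OF L2_fchange[OF V]])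
    qed
  qed
  \<comment> \<open>The zeros are the limits of the annulus term and of the cutoff error. The
    expression simplifies to twice \<open>Gint V + mass V / m * e_inf m\<close>.\<close>
  define L where "L = 2 * (e_inf m + Gint V + 0 + 0 - (1 - mass V / m) * e_inf m)"
  have bound: "n2 W \<le> L + \<epsilon>" if e: "0 < \<epsilon>" for \<epsilon>
  proof -
    have "(\<lambda>j. 12 * M / real (j + 6)) \<longlonglongrightarrow> 0"
      by (rule LIMSEQ_ignore_initial_segment[where f="\<lambda>j. 12 * M / real j"]) (rule lim_const_over_n)
    then have l: "(\<lambda>j. 2 * (e_inf m + Gint V + ?g j V + 12 * M / real (j + 6) - (1 - ?m j V / m) * e_inf m)) \<longlonglongrightarrow> L"
      unfolding L_def using m by (intro tendsto_intros gann mB) auto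
    have "\<forall>\<^sub>F j in sequentially. 2 * (e_inf m + Gint V + ?g j V + 12 * M / real (j + 6) - (1 - ?m j V / m) * e_inf m) < L + \<epsilon>"
      by (rule order_tendstoD(2)[OF l]) (use e in simp)
    then have "\<forall>\<^sub>F j in sequentially. 2 * Y' j < L + \<epsilon>"
    proof eventually_elim
      case (elim j)
      obtain B where "sob (\<lambda>x. c j x * V x) B" using step[of 1 j] by auto
      from G_integrable[OF this] have "Gint (\<lambda>x. c j x * V x) \<le> Gint V"
        unfolding Gint_def by (rule integral_mono[OF _ iG]) (intro fchange_power_mono cle)
      then have "2 * Y' j \<le> 2 * (e_inf m + Gint V + ?g j V + 12 * M / real (j + 6) - (1 - ?m j V / m) * e_inf m)"
        unfolding Y'_def by (intro mult_left_mono diff_right_mono add_right_mono add_left_mono) auto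
      with elim show ?case by (rule le_less_trans[rotated])
    qed
    \<comment> \<open>The gradient obtained here depends on \<epsilon>; uniqueness of weak gradients
      transfers its bound to the fixed W.\<close>
    from lower[OF this] obtain W' where W': "sob V W'" "n2 W' \<le> L + \<epsilon>" by blast
    have "AE x in lborel. W' x = W x" by (rule sob_unique[OF W'(1) W]) simp
    from L2_cong_AE(2)[OF sobD(2)[OF W'(1)] L2_measurable[OF sobD(2)[OF W]] this] W'(2) show ?thesis by simp
  qed
  have "n2 W \<le> L" by (rule field_le_epsilon) (rule bound)
  then have "energy V W \<le> mass V / m * e_inf m"
    unfolding L_def energy_def by (simp add: algebra_simps)
  with W show thesis by (rule that)
qed

text \<open>The competitor of negative energy is required only to have mass at most m, which is what
  the endpoint of a path can offer: dilation raises the mass to m and keeps the energy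
  negative.\<close>

lemma minimizer_exists:
  assumes m: "0 < m" and s0: "sob v0 w0" and m0: "mass v0 \<le> m" and neg0: "energy v0 w0 < 0"
  shows "\<exists>v w. sob v w \<and> mass v = m \<and> (\<forall>v' w'. sob v' w' \<longrightarrow> mass v' = m \<longrightarrow> energy v w \<le> energy v' w')"
proof -
  have m0pos: "0 < mass v0"
  proof (rule ccontr)
    assume "\<not> ?thesis"
    then have "mass v0 = 0" using mass_nonneg[of v0] by linarith
    then show False using energy_ge[OF m s0 m0] neg0 by simp
  qed
  have neg: "e_inf m < 0"
    using e_inf_scaled_le[OF s0 m0pos m0] mult_pos_neg[of "m / mass v0" "energy v0 w0"] m m0pos neg0 by simp
  have ne: "{energy v w | v w. sob v w \<and> mass v = m} \<noteq> {}"
  proof -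
    obtain r where r: "1 \<le> r" "r ^ CARD('n) = m / mass v0" using e_inf_scaled[OF s0 m0pos m0] by blast
    have "mass (\<lambda>x. v0 (x /\<^sub>R r)) = m" using dilate_scaling(1)[OF s0, of r] r m0pos by simp
    with sob_dilate[OF s0, of r] r show ?thesis by force
  qed
  obtain v w M \<delta> r where s: "\<And>n. sob (v n) (w n)" and mv: "\<And>n. mass (v n) = m"
    and en: "\<And>n. energy (v n) (w n) < e_inf m + inverse (real (Suc n))"
    and M: "\<And>n. n2 (v n) \<le> M" "\<And>n. n2 (w n) \<le> M" "0 \<le> M" and d: "0 < \<delta>" "0 < r"
    and big: "\<And>n. ennreal (r ^ CARD('n) / 2) < emeasure lborel {h \<in> cbox 0 (r *\<^sub>R One). \<delta> / 2 \<le> \<bar>v n h\<bar>}"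
    by (rule minimizing_sequence[OF m neg ne]) blast
  obtain k V where k: "strict_mono (k::nat\<Rightarrow>nat)" and V: "L2 V" "n2 V \<le> M"
    and AE: "AE x in lborel. (\<lambda>n. v (k n) x) \<longlonglongrightarrow> V x"
    and loc: "\<And>R. (\<lambda>n. n2 (\<lambda>x. indicator (cball 0 R) x * (v (k n) x - V x))) \<longlonglongrightarrow> 0"
    by (rule sob_compactness[of v w M, OF s M(1,2)]) blast
  have mass_pos: "0 < mass V"
    by (rule local_mass_pos[OF sobD(1)[OF s] V(1) d big loc])
  have mass_le: "mass V \<le> m"
    unfolding mass_def
  proof (rule L2_Fatou(2)[where f="\<lambda>n x. fchange (v (k n) x)"])
    show "L2 (\<lambda>x. fchange (v (k n) x))" for n by (intro L2_fchange sobD(1)[OF s])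
    show "(\<lambda>x. fchange (V x)) \<in> borel_measurable borel" by (rule L2_measurable[OF L2_fchange[OF V(1)]])
    show "AE x in lborel. (\<lambda>n. fchange (v (k n) x)) \<longlonglongrightarrow> fchange (V x)"
      using AE
    proof eventually_elim
      case (elim x)
      have "isCont fchange (V x)" using fchange_continuous[of UNIV] by (simp add: continuous_on_eq_continuous_at)
      from isCont_tendsto_compose[OF this elim] show ?case .
    qed
    show "\<forall>\<^sub>F n in sequentially. n2 (\<lambda>x. fchange (v (k n) x)) \<le> m"
      using mv unfolding mass_def by simp
  qed (use m in simp)
  have enk: "(\<lambda>n. energy (v (k n)) (w (k n))) \<longlonglongrightarrow> e_inf m"
  proof -
    have "(\<lambda>n. energy (v n) (w n)) \<longlonglongrightarrow> e_inf m"
    proof (rule tendsto_sandwich)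
      show "\<forall>\<^sub>F n in sequentially. e_inf m \<le> energy (v n) (w n)"
        by (intro always_eventually allI e_inf_le s mv)
      show "\<forall>\<^sub>F n in sequentially. energy (v n) (w n) \<le> e_inf m + inverse (real (Suc n))"
        using en by (intro always_eventually allI less_imp_le)
      show "(\<lambda>n. e_inf m) \<longlonglongrightarrow> e_inf m" by simp
      have "(\<lambda>n. e_inf m + inverse (real (Suc n))) \<longlonglongrightarrow> e_inf m + 0"
        by (intro tendsto_intros LIMSEQ_inverse_real_of_nat)
      then show "(\<lambda>n. e_inf m + inverse (real (Suc n))) \<longlonglongrightarrow> e_inf m" by simp
    qed
    from LIMSEQ_subseq_LIMSEQ[OF this k] show ?thesis by (simp add: o_def)
  qed
  obtain W where W: "sob V W" "energy V W \<le> mass V / m * e_inf m"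
    by (rule limit_energy_le[OF m neg s mv enk M(1,2) V(1) AE loc])
  obtain r where r: "1 \<le> r" "r ^ CARD('n) = m / mass V"
    using e_inf_scaled[OF W(1) mass_pos mass_le] by blast
  then have r0: "0 < r" by simp
  let ?V = "\<lambda>x. V (x /\<^sub>R r)" and ?W = "\<lambda>x. W (x /\<^sub>R r) /\<^sub>R r"
  have "n2 W / (2 * r\<^sup>2) \<le> n2 W / (2 * 1)" using r(1) by (intro divide_left_mono) auto
  then have "energy ?V ?W \<le> r ^ CARD('n) * energy V W"
    unfolding dilate_scaling(2)[OF W(1) r0] using r0 by (intro mult_left_mono) (simp_all add: energy_def)
  also have "\<dots> \<le> m / mass V * (mass V / m * e_inf m)"
    unfolding r(2) using W(2) m mass_pos by (intro mult_left_mono) auto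
  also have "\<dots> = e_inf m" using m mass_pos by simp
  finally have "energy ?V ?W \<le> e_inf m" .
  moreover have "mass ?V = m" unfolding dilate_scaling(1)[OF W(1) r0] r(2) using mass_pos by simp
  ultimately show ?thesis using sob_dilate[OF W(1) r0] e_inf_le order_trans by blast
qed

end

section \<open>The mountain pass level\<close>

lemma H1_norm_diff:
  assumes "sob v1 w1" "AE x in lborel. u1 x = v1 x" and "sob v2 w2" "AE x in lborel. u2 x = v2 x"
  shows "H1_norm (\<lambda>x. u1 x - u2 x) = sqrt (n2 (\<lambda>x. v1 x - v2 x) + n2 (\<lambda>x. w1 x - w2 x))"
proof -
  note s = sob_diff[OF assms(1,3)]
  have [measurable]: "v1 \<in> borel_measurable borel" "v2 \<in> borel_measurable borel"
    "w1 \<in> borel_measurable borel" "w2 \<in> borel_measurable borel"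
    using sobD(1,2)[OF assms(1)] sobD(1,2)[OF assms(3)] by (auto simp: L2_def)
  have eq: "AE x in lborel. u1 x - u2 x = v1 x - v2 x" using assms(2,4) by eventually_elim simp
  have "AE x in lborel. (u1 x - u2 x)\<^sup>2 = (norm (v1 x - v2 x))\<^sup>2" using eq by eventually_elim simp
  from lebesgue_integral_AE(2)[OF _ this]
  have 1: "(LINT x|lebesgue. (u1 x - u2 x)\<^sup>2) = n2 (\<lambda>x. v1 x - v2 x)" by (simp add: n2_def)
  have "AE x in lborel. (norm (grad (\<lambda>x. u1 x - u2 x) x))\<^sup>2 = (norm (w1 x - w2 x))\<^sup>2"
    using grad_AE[OF s eq] by eventually_elim simp
  from lebesgue_integral_AE(2)[OF _ this]
  have 2: "(LINT x|lebesgue. (norm (grad (\<lambda>x. u1 x - u2 x) x))\<^sup>2) = n2 (\<lambda>x. w1 x - w2 x)" by (simp add: n2_def)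
  show ?thesis unfolding H1_norm_def 1 2 ..
qed

text \<open>It vanishes once the squared norm reaches 1 + 1/k, so it sharpens to the indicator of
  the closed unit ball as k grows.\<close>

definition plateau :: "real \<Rightarrow> 'a::euclidean_space \<Rightarrow> real" where
  "plateau k x = 1 - step (k * ((norm x)\<^sup>2 - 1))"

definition dplateau :: "real \<Rightarrow> 'a::euclidean_space \<Rightarrow> 'a" where
  "dplateau k x = (- (2 * k) * dstep (k * ((norm x)\<^sup>2 - 1))) *\<^sub>R x"

lemma plateau_bounds: "0 \<le> plateau k x" "plateau k x \<le> 1"
  using step_bounds by (auto simp: plateau_def)

lemma plateau_inside: "0 < k \<Longrightarrow> norm x \<le> 1 \<Longrightarrow> plateau k x = 1"
  by (simp add: plateau_def step_eq_0 mult_le_0_iff abs_square_le_1)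

lemma plateau_outside: "0 < k \<Longrightarrow> 1 + 1 / k \<le> (norm x)\<^sup>2 \<Longrightarrow> plateau k x = 0"
  by (simp add: plateau_def step_eq_1 field_simps)

lemma sob_plateau:
  assumes k: "1 \<le> k"
  shows "sob (plateau k) (dplateau k :: real^'n::finite \<Rightarrow> real^'n)"
proof (rule sob_C1_support)
  fix x :: "real^'n"
  have "((\<lambda>x. x \<bullet> x) has_derivative (\<lambda>v. 2 * (v \<bullet> x))) (at x)"
    by (auto intro!: derivative_eq_intros simp: inner_commute)
  then have "((\<lambda>x. k * ((x \<bullet> x) - 1)) has_derivative (\<lambda>v. k * (2 * (v \<bullet> x) - 0))) (at x)"
    by (intro has_derivative_diff has_derivative_mult_right has_derivative_const)
  moreover have "(step has_derivative (*) (dstep (k * ((x \<bullet> x) - 1)))) (at (k * ((x \<bullet> x) - 1)))"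
    using step_deriv by (simp add: has_field_derivative_def)
  ultimately have "((\<lambda>x. step (k * ((x \<bullet> x) - 1))) has_derivative
      (\<lambda>v. dstep (k * ((x \<bullet> x) - 1)) * (k * (2 * (v \<bullet> x) - 0)))) (at x)"
    by (rule has_derivative_compose)
  from has_derivative_diff[OF has_derivative_const[of 1] this]
  show "(plateau k has_derivative (\<lambda>v. v \<bullet> dplateau k x)) (at x)"
    by (simp add: plateau_def[abs_def] dplateau_def power2_norm_eq_inner mult_ac)
next
  have "continuous_on UNIV (\<lambda>x::real^'n. k * ((norm x)\<^sup>2 - 1))" by (intro continuous_intros)
  then have "continuous_on UNIV (\<lambda>x::real^'n. dstep (k * ((norm x)\<^sup>2 - 1)))"
    by (rule continuous_on_compose2[OF dstep_continuous]) auto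
  then show "continuous_on UNIV (dplateau k :: real^'n \<Rightarrow> real^'n)" unfolding dplateau_def by (intro continuous_intros)
next
  fix x :: "real^'n" assume "2 < norm x"
  then have "2\<^sup>2 \<le> (norm x)\<^sup>2" by (intro power_mono) auto
  then have "4 \<le> (norm x)\<^sup>2" by simp
  moreover have "1 / k \<le> 1" using k by simp
  ultimately have "1 + 1 / k \<le> (norm x)\<^sup>2" by linarith
  then show "plateau k x = 0" using k by (intro plateau_outside) auto
qed

section \<open>Returning to the original variable\<close>

context quasilinear
begin

text \<open>The slope of f is the inverse root of 1 + 2 f^2, so the weight in E cancels exactly and
  leaves |w|^2.\<close>

lemma sob_to_Sm:
  fixes v :: "real^'n \<Rightarrow> real"
  assumes s: "sob v w"
  shows "(\<lambda>x. fchange (v x)) \<in> Sm (mass v)" "Efun g (\<lambda>x. fchange (v x)) = energy v w"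
proof -
  have [measurable]: "v \<in> borel_measurable borel" "w \<in> borel_measurable borel"
    using sobD(1,2)[OF s] by (auto simp: L2_def)
  let ?u = "\<lambda>x. fchange (v x)"
  let ?w = "\<lambda>x. (1 / sqrt (1 + 2 * (?u x)\<^sup>2)) *\<^sub>R w x"
  note su = sob_fchange[OF s]
  have gr: "AE x in lborel. grad ?u x = ?w x" by (rule grad_AE[OF su]) simp
  have H: "?u \<in> H1" by (rule sob_weak_grad(2)[OF su, of ?u ?w]) simp_all
  have e1: "AE x in lborel. (1 + 2 * (?u x)\<^sup>2) * (norm (grad ?u x))\<^sup>2 = (norm (w x))\<^sup>2"
    using gr
  proof eventually_elim
    case (elim x)
    show ?case using one_plus_pos[of "?u x"] unfolding elim
      by (simp add: power_mult_distrib power_divide less_imp_le)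
  qed
  have e2: "AE x in lborel. (?u x)\<^sup>2 * (norm (grad ?u x))\<^sup>2 = (?u x)\<^sup>2 / (1 + 2 * (?u x)\<^sup>2) * (norm (w x))\<^sup>2"
    using gr
  proof eventually_elim
    case (elim x)
    show ?case using one_plus_pos[of "?u x"] unfolding elim
      by (simp add: power_mult_distrib power_divide less_imp_le)
  qed
  have le: "(?u x)\<^sup>2 / (1 + 2 * (?u x)\<^sup>2) * (norm (w x))\<^sup>2 \<le> (norm (w x))\<^sup>2" for x
    using mult_right_mono[of "(?u x)\<^sup>2 / (1 + 2 * (?u x)\<^sup>2)" 1 "(norm (w x))\<^sup>2"] one_plus_pos[of "?u x"]
    by (simp add: divide_le_eq_1)
  have "integrable lborel (\<lambda>x. (?u x)\<^sup>2 / (1 + 2 * (?u x)\<^sup>2) * (norm (w x))\<^sup>2)"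
    by (rule Bochner_Integration.integrable_bound[OF L2_integrable[OF sobD(2)[OF s]]])
      (measurable, use le one_plus_pos in \<open>auto simp: less_imp_le\<close>)
  then have "integrable lebesgue (\<lambda>x. (?u x)\<^sup>2 * (norm (grad ?u x))\<^sup>2)"
    using lebesgue_integral_AE(1)[OF _ e2] by simp
  moreover have "(LINT x|lebesgue. (?u x)\<^sup>2) = mass v"
    using lebesgue_integral_borel(2)[of "\<lambda>x. (?u x)\<^sup>2"] by (simp add: mass_def n2_def)
  ultimately show "?u \<in> Sm (mass v)" using H by (simp add: Sm_def)
  have "(LINT x|lebesgue. (1 + 2 * (?u x)\<^sup>2) * (norm (grad ?u x))\<^sup>2) = n2 w"
    using lebesgue_integral_AE(2)[OF _ e1] by (simp add: n2_def)
  moreover have "(LINT x|lebesgue. Gp g (?u x)) = Gint v"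
    using lebesgue_integral_borel(2)[of "\<lambda>x. Gp g (?u x)"] by (simp add: Gint_def)
  ultimately show "Efun g ?u = energy v w" by (simp add: Efun_def energy_def)
qed

text \<open>The nontrivial point is that Phi(u) is in L2: its square is at most u^2 + 2 u^4, and the
  fourth power is integrable by the critical inequality, which finiteness of the integral of u^2
  |grad u|^2 makes available.\<close>

lemma Sm_to_sob:
  fixes u :: "real^'n \<Rightarrow> real"
  assumes u: "u \<in> Sm m"
  obtains v w where "sob v w" "mass v = m" "energy v w = Efun g u"
proof -
  have "u \<in> H1" and ui: "integrable lebesgue (\<lambda>x. (u x)\<^sup>2 * (norm (grad u x))\<^sup>2)"
    and um: "(LINT x|lebesgue. (u x)\<^sup>2) = m" using u by (auto simp: Sm_def)
  then obtain u' w' where s: "sob u' w'" and u': "AE x in lborel. u x = u' x" and w': "AE x in lborel. grad u x = w' x"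
    by (auto elim: H1_sob)
  have [measurable]: "u' \<in> borel_measurable borel" "w' \<in> borel_measurable borel"
    using sobD(1,2)[OF s] by (auto simp: L2_def)
  have [measurable]: "Phi \<in> borel_measurable borel" by (intro borel_measurable_continuous_onI Phi_continuous)
  have "AE x in lborel. (u x)\<^sup>2 * (norm (grad u x))\<^sup>2 = (u' x)\<^sup>2 * (norm (w' x))\<^sup>2" using u' w' by eventually_elim simp
  from lebesgue_integral_AE(1)[OF _ this] ui have int: "integrable lborel (\<lambda>x. (u' x)\<^sup>2 * (norm (w' x))\<^sup>2)" by simp
  have "AE x in lborel. (u x)\<^sup>2 = (norm (u' x))\<^sup>2" using u' by eventually_elim simp
  from lebesgue_integral_AE(2)[OF _ this] um have n2u: "n2 u' = m" by (simp add: n2_def)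
  have "0 < max m 1" "n2 u' \<le> max m 1" using n2u by auto
  from sob_Gagliardo_Nirenberg(1)[OF s this p_eq int] have ip: "integrable lborel (\<lambda>x. \<bar>u' x\<bar> powr p)" .
  have LP: "L2 (\<lambda>x. Phi (u' x))"
    unfolding L2_def
  proof
    have i: "integrable lborel (\<lambda>x. 3 * (norm (u' x))\<^sup>2 + 2 * \<bar>u' x\<bar> powr p)"
      by (intro Bochner_Integration.integrable_add integrable_mult_right ip L2_integrable sobD(1)[OF s])
    have "(Phi t)\<^sup>2 \<le> 3 * t\<^sup>2 + 2 * \<bar>t\<bar> powr p" for t
    proof -
      have "\<bar>Phi t\<bar>\<^sup>2 \<le> (\<bar>t\<bar> * sqrt (1 + 2 * t\<^sup>2))\<^sup>2" by (intro power_mono Phi_abs_le) simp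
      also have "\<dots> = t\<^sup>2 * (1 + 2 * t\<^sup>2)" using one_plus_pos[of t] by (simp add: power_mult_distrib less_imp_le)
      also have "\<dots> = t\<^sup>2 + 2 * (t\<^sup>2 * t\<^sup>2)" by (simp add: distrib_left mult.left_commute)
      finally show ?thesis using fourth_power_le[of t] unfolding power2_abs by linarith
    qed
    then show "integrable lborel (\<lambda>x. (norm (Phi (u' x)))\<^sup>2)"
      by (intro Bochner_Integration.integrable_bound[OF i]) (auto intro!: AE_I2 order_trans[OF _ abs_ge_self])
  qed measurable
  let ?W = "\<lambda>x. sqrt (1 + 2 * (u' x)\<^sup>2) *\<^sub>R w' x"
  have sv: "sob (\<lambda>x. Phi (u' x)) ?W" by (rule sob_Phi[OF s LP int])
  have mv: "mass (\<lambda>x. Phi (u' x)) = m" using n2u by (simp add: mass_def fchange_Phi)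
  have "AE x in lborel. (1 + 2 * (u x)\<^sup>2) * (norm (grad u x))\<^sup>2 = (norm (?W x))\<^sup>2"
    using u' w'
  proof eventually_elim
    case (elim x)
    show ?case unfolding elim using one_plus_pos[of "u' x"] by (simp add: power_mult_distrib less_imp_le)
  qed
  from lebesgue_integral_AE(2)[OF _ this]
  have "(LINT x|lebesgue. (1 + 2 * (u x)\<^sup>2) * (norm (grad u x))\<^sup>2) = n2 ?W" by (simp add: n2_def)
  moreover have "AE x in lborel. Gp g (u x) = Gp g (fchange (Phi (u' x)))"
    using u' by eventually_elim (simp add: fchange_Phi)
  from lebesgue_integral_AE(2)[OF _ this]
  have "(LINT x|lebesgue. Gp g (u x)) = Gint (\<lambda>x. Phi (u' x))" by (simp add: Gint_def)
  ultimately have "energy (\<lambda>x. Phi (u' x)) ?W = Efun g u" by (simp add: energy_def Efun_def)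
  with sv mv show thesis by (rule that)
qed

lemma Sm_minimizer:
  assumes m: "0 < m" and s0: "sob v0 w0" "mass v0 \<le> m" "energy v0 w0 < 0"
  shows "\<exists>u :: real^'n \<Rightarrow> real. u \<in> Sm m \<and> Efun g u = e_level g TYPE('n) m \<and> is_minimizer g m u"
proof -
  obtain v w where s: "sob v w" and mv: "mass v = m"
    and min: "\<And>v' w'. sob v' w' \<Longrightarrow> mass v' = m \<Longrightarrow> energy v w \<le> energy v' w'"
    using minimizer_exists[OF m s0] by blast
  let ?u = "\<lambda>x. fchange (v x)"
  have u: "?u \<in> Sm m" using sob_to_Sm(1)[OF s] mv by simp
  have le: "Efun g ?u \<le> Efun g u'" if u': "u' \<in> Sm m" for u' :: "real^'n \<Rightarrow> real"
  proof -
    obtain v' w' where "sob v' w'" "mass v' = m" "energy v' w' = Efun g u'" by (rule Sm_to_sob[OF u'])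
    then show ?thesis using min[of v' w'] sob_to_Sm(2)[OF s] by simp
  qed
  have "e_level g TYPE('n) m = Efun g ?u"
    unfolding e_level_def by (rule cInf_eq_minimum) (use u le in auto)
  then show ?thesis using u le by (auto simp: is_minimizer_def)
qed

section \<open>Admissible paths and negative energy\<close>

lemma Jfun_sob:
  fixes v :: "real^'n \<Rightarrow> real"
  assumes s: "sob v w" and u: "AE x in lborel. u x = v x"
  shows "Jfun g lam u = energy v w + exp lam / 2 * mass v"
proof -
  have [measurable]: "v \<in> borel_measurable borel" "w \<in> borel_measurable borel"
    using sobD(1,2)[OF s] by (auto simp: L2_def)
  have "AE x in lborel. (norm (grad u x))\<^sup>2 = (norm (w x))\<^sup>2" using grad_AE[OF s u] by eventually_elim simp
  from lebesgue_integral_AE(2)[OF _ this] have 1: "(LINT x|lebesgue. (norm (grad u x))\<^sup>2) = n2 w" by (simp add: n2_def)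
  have "AE x in lborel. (fchange (u x))\<^sup>2 = (norm (fchange (v x)))\<^sup>2" using u by eventually_elim simp
  from lebesgue_integral_AE(2)[OF _ this] have 2: "(LINT x|lebesgue. (fchange (u x))\<^sup>2) = mass v" by (simp add: n2_def mass_def)
  have "AE x in lborel. Gp g (fchange (u x)) = Gp g (fchange (v x))" using u by eventually_elim simp
  from lebesgue_integral_AE(2)[OF _ this] have 3: "(LINT x|lebesgue. Gp g (fchange (u x))) = Gint v" by (simp add: Gint_def)
  show ?thesis unfolding Jfun_def 1 2 3 energy_def by simp
qed

text \<open>The root of the mass is Lipschitz for the L2 distance, the mass itself is not; hence
  continuity along paths is stated for roots.\<close>

lemma mass_sqrt_diff:
  fixes v v' :: "real^'n \<Rightarrow> real"
  assumes "L2 v" "L2 v'"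
  shows "\<bar>sqrt (mass v) - sqrt (mass v')\<bar> \<le> sqrt (n2 (\<lambda>x. v x - v' x))"
proof -
  have "\<bar>sqrt (mass v) - sqrt (mass v')\<bar> \<le> sqrt (n2 (\<lambda>x. fchange (v x) - fchange (v' x)))"
    unfolding mass_def by (intro L2_Minkowski_diff L2_fchange assms)
  also have "\<dots> \<le> sqrt (n2 (\<lambda>x. v x - v' x))"
    by (intro real_sqrt_le_mono n2_mono L2_diff assms L2_measurable[OF L2_diff[OF L2_fchange[OF assms(1)] L2_fchange[OF assms(2)]]])
      (simp add: fchange_lipschitz)
  finally show ?thesis .
qed

lemma mass_le_n2: "L2 v \<Longrightarrow> mass v \<le> n2 v"
  unfolding mass_def by (rule n2_mono) (auto intro: fchange_le L2_measurable[OF L2_fchange])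

text \<open>Borel representatives are chosen independently at each parameter. The
  \<open>H1_norm\<close> of a difference can be computed from any representatives, so continuity of
  the path becomes continuity of these numerical functions.\<close>

lemma Gamma1_representatives:
  fixes \<gamma> :: "real \<Rightarrow> real^'n \<Rightarrow> real"
  assumes \<gamma>: "\<gamma> \<in> Gamma1 g lam"
  obtains v w where "\<And>\<xi>. \<xi> \<in> {0..1} \<Longrightarrow> sob (v \<xi>) (w \<xi>)" "\<And>\<xi>. \<xi> \<in> {0..1} \<Longrightarrow> AE x in lborel. \<gamma> \<xi> x = v \<xi> x"
    "continuous_on {0..1} (\<lambda>\<xi>. sqrt (n2 (v \<xi>)))" "continuous_on {0..1} (\<lambda>\<xi>. sqrt (n2 (w \<xi>)))"
    "continuous_on {0..1} (\<lambda>\<xi>. sqrt (mass (v \<xi>)))"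
proof -
  have H: "\<gamma> \<xi> \<in> H1" if "\<xi> \<in> {0..1}" for \<xi> using \<gamma> that by (auto simp: Gamma1_def H1r_def)
  have "\<exists>v w. sob v w \<and> (AE x in lborel. \<gamma> \<xi> x = v x)" if "\<xi> \<in> {0..1}" for \<xi>
    using H1_sob[OF H[OF that]] by metis
  then obtain v w where s: "\<And>\<xi>. \<xi> \<in> {0..1} \<Longrightarrow> sob (v \<xi>) (w \<xi>)" and AE: "\<And>\<xi>. \<xi> \<in> {0..1} \<Longrightarrow> AE x in lborel. \<gamma> \<xi> x = v \<xi> x"
    by metis
  have dist: "\<exists>\<delta>>0. \<forall>\<eta>\<in>{0..1}. \<bar>\<eta> - \<xi>\<bar> < \<delta> \<longrightarrow>
      sqrt (n2 (\<lambda>x. v \<eta> x - v \<xi> x)) < \<epsilon> \<and> sqrt (n2 (\<lambda>x. w \<eta> x - w \<xi> x)) < \<epsilon>"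
    if \<xi>: "\<xi> \<in> {0..1}" and e: "0 < \<epsilon>" for \<xi> \<epsilon>
  proof -
    have "\<exists>\<delta>>0. \<forall>\<eta>\<in>{0..1}. \<bar>\<eta> - \<xi>\<bar> < \<delta> \<longrightarrow> H1_norm (\<lambda>x. \<gamma> \<eta> x - \<gamma> \<xi> x) < \<epsilon>"
      using \<gamma> \<xi> e by (simp add: Gamma1_def)
    then obtain \<delta> where d: "0 < \<delta>" "\<And>\<eta>. \<eta> \<in> {0..1} \<Longrightarrow> \<bar>\<eta> - \<xi>\<bar> < \<delta> \<Longrightarrow> H1_norm (\<lambda>x. \<gamma> \<eta> x - \<gamma> \<xi> x) < \<epsilon>" by blast
    have "sqrt (n2 (\<lambda>x. v \<eta> x - v \<xi> x)) < \<epsilon> \<and> sqrt (n2 (\<lambda>x. w \<eta> x - w \<xi> x)) < \<epsilon>"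
      if "\<eta> \<in> {0..1}" "\<bar>\<eta> - \<xi>\<bar> < \<delta>" for \<eta>
    proof -
      have lt: "sqrt (n2 (\<lambda>x. v \<eta> x - v \<xi> x) + n2 (\<lambda>x. w \<eta> x - w \<xi> x)) < \<epsilon>"
        using d(2)[OF that] H1_norm_diff[OF s[OF that(1)] AE[OF that(1)] s[OF \<xi>] AE[OF \<xi>]] by simp
      have "sqrt (n2 (\<lambda>x. v \<eta> x - v \<xi> x)) \<le> sqrt (n2 (\<lambda>x. v \<eta> x - v \<xi> x) + n2 (\<lambda>x. w \<eta> x - w \<xi> x))"
        "sqrt (n2 (\<lambda>x. w \<eta> x - w \<xi> x)) \<le> sqrt (n2 (\<lambda>x. v \<eta> x - v \<xi> x) + n2 (\<lambda>x. w \<eta> x - w \<xi> x))"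
        by (rule real_sqrt_le_mono, simp)+
      with lt show ?thesis by linarith
    qed
    with d(1) show ?thesis by blast
  qed
  have contI: "continuous_on {0..1} F"
    if F: "\<And>\<xi> \<eta>. \<xi> \<in> {0..1} \<Longrightarrow> \<eta> \<in> {0..1} \<Longrightarrow> \<bar>F \<eta> - F \<xi>\<bar> \<le> sqrt (n2 (\<lambda>x. v \<eta> x - v \<xi> x)) + sqrt (n2 (\<lambda>x. w \<eta> x - w \<xi> x))" for F :: "real \<Rightarrow> real"
    unfolding continuous_on_iff
  proof (intro ballI allI impI)
    fix \<xi> :: real and e :: real assume \<xi>: "\<xi> \<in> {0..1}" and e: "0 < e"
    then obtain \<delta> where d: "0 < \<delta>" "\<And>\<eta>. \<eta> \<in> {0..1} \<Longrightarrow> \<bar>\<eta> - \<xi>\<bar> < \<delta> \<Longrightarrow>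
      sqrt (n2 (\<lambda>x. v \<eta> x - v \<xi> x)) < e / 2 \<and> sqrt (n2 (\<lambda>x. w \<eta> x - w \<xi> x)) < e / 2"
      using dist[OF \<xi>, of "e / 2"] by auto
    have "dist (F \<eta>) (F \<xi>) < e" if "\<eta> \<in> {0..1}" "dist \<eta> \<xi> < \<delta>" for \<eta>
      using F[OF \<xi> that(1)] d(2)[OF that(1)] that(2) unfolding dist_real_def by linarith
    with d(1) show "\<exists>d>0. \<forall>x'\<in>{0..1}. dist x' \<xi> < d \<longrightarrow> dist (F x') (F \<xi>) < e" by blast
  qed
  have Lv: "L2 (v \<xi>)" and Lw: "L2 (w \<xi>)" if "\<xi> \<in> {0..1}" for \<xi> using sobD(1,2)[OF s[OF that]] .
  have cv: "continuous_on {0..1} (\<lambda>\<xi>. sqrt (n2 (v \<xi>)))"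
    by (rule contI) (use L2_Minkowski_diff[OF Lv Lv] in \<open>force intro: add_increasing2\<close>)
  have cw: "continuous_on {0..1} (\<lambda>\<xi>. sqrt (n2 (w \<xi>)))"
    by (rule contI) (use L2_Minkowski_diff[OF Lw Lw] in \<open>force intro: add_increasing\<close>)
  have cm: "continuous_on {0..1} (\<lambda>\<xi>. sqrt (mass (v \<xi>)))"
    by (rule contI) (use mass_sqrt_diff[OF Lv Lv] in \<open>force intro: add_increasing2\<close>)
  show thesis by (rule that[OF s AE cv cw cm])
qed

text \<open>The real supremum along a path bounds the values only if they are bounded above. As G >=
  0, J is at most a combination of squared norms that is continuous on the compact parameter
  interval.\<close>

lemma Gamma1_bdd_above:
  fixes \<gamma> :: "real \<Rightarrow> real^'n \<Rightarrow> real"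
  assumes \<gamma>: "\<gamma> \<in> Gamma1 g lam"
  shows "bdd_above ((\<lambda>\<xi>. Jfun g lam (\<gamma> \<xi>)) ` {0..1})"
proof -
  obtain v w where s: "\<And>\<xi>. \<xi> \<in> {0..1} \<Longrightarrow> sob (v \<xi>) (w \<xi>)" and AE: "\<And>\<xi>. \<xi> \<in> {0..1} \<Longrightarrow> AE x in lborel. \<gamma> \<xi> x = v \<xi> x"
    and cv: "continuous_on {0..1} (\<lambda>\<xi>. sqrt (n2 (v \<xi>)))" and cw: "continuous_on {0..1} (\<lambda>\<xi>. sqrt (n2 (w \<xi>)))"
    by (rule Gamma1_representatives[OF \<gamma>]) blast
  have J: "Jfun g lam (\<gamma> \<xi>) = energy (v \<xi>) (w \<xi>) + exp lam / 2 * mass (v \<xi>)" if "\<xi> \<in> {0..1}" for \<xi>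
    by (rule Jfun_sob[OF s[OF that] AE[OF that]])
  have Lv: "L2 (v \<xi>)" if "\<xi> \<in> {0..1}" for \<xi> using sobD(1)[OF s[OF that]] .
  show "bdd_above ((\<lambda>\<xi>. Jfun g lam (\<gamma> \<xi>)) ` {0..1})"
  proof -
    let ?h = "\<lambda>\<xi>. (1/2) * (sqrt (n2 (w \<xi>)))\<^sup>2 + exp lam / 2 * (sqrt (n2 (v \<xi>)))\<^sup>2"
    have "continuous_on {0..1} ?h" by (intro continuous_intros cv cw)
    then have "compact (?h ` {0..1})" by (rule compact_continuous_image) simp
    then have "bdd_above (?h ` {0..1})" by (intro bounded_imp_bdd_above compact_imp_bounded)
    then obtain B where "\<forall>y\<in>?h ` {0..1}. y \<le> B" unfolding bdd_above_def by (rule exE)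
    then have B: "?h \<xi> \<le> B" if "\<xi> \<in> {0..1}" for \<xi> using that by (rule bspec[OF _ imageI])
    have "Jfun g lam (\<gamma> \<xi>) \<le> B" if \<xi>: "\<xi> \<in> {0..1}" for \<xi>
    proof -
      have "exp lam / 2 * mass (v \<xi>) \<le> exp lam / 2 * n2 (v \<xi>)"
        by (intro mult_left_mono mass_le_n2 Lv \<xi>) simp
      then have "Jfun g lam (\<gamma> \<xi>) \<le> (1/2) * n2 (w \<xi>) + exp lam / 2 * n2 (v \<xi>)"
        unfolding J[OF \<xi>] energy_def using Gint_nonneg[of "v \<xi>"] by linarith
      then show ?thesis using B[OF \<xi>] by simp
    qed
    then show ?thesis by (rule bdd_aboveI2)
  qed
qed

text \<open>Along an admissible path the mass varies continuously from \<open>0\<close>; either it reaches \<open>m\<close>, where the bound on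
  \<open>J\<close> makes the energy negative, or it stays below \<open>m\<close> and the endpoint already has negative energy.\<close>

lemma path_negative_energy:
  fixes \<gamma> :: "real \<Rightarrow> real^'n \<Rightarrow> real"
  assumes m: "0 < m" and \<gamma>: "\<gamma> \<in> Gamma1 g lam" and sup: "2 * (Sup ((\<lambda>\<xi>. Jfun g lam (\<gamma> \<xi>)) ` {0..1}) / exp lam) < m"
  obtains v w where "sob v w" "mass v \<le> m" "energy v w < 0"
proof -
  obtain v w where s: "\<And>\<xi>. \<xi> \<in> {0..1} \<Longrightarrow> sob (v \<xi>) (w \<xi>)" and AE: "\<And>\<xi>. \<xi> \<in> {0..1} \<Longrightarrow> AE x in lborel. \<gamma> \<xi> x = v \<xi> x"
    and cm: "continuous_on {0..1} (\<lambda>\<xi>. sqrt (mass (v \<xi>)))"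
    by (rule Gamma1_representatives[OF \<gamma>]) blast
  have J: "Jfun g lam (\<gamma> \<xi>) = energy (v \<xi>) (w \<xi>) + exp lam / 2 * mass (v \<xi>)" if "\<xi> \<in> {0..1}" for \<xi>
    by (rule Jfun_sob[OF s[OF that] AE[OF that]])
  have Lv: "L2 (v \<xi>)" if "\<xi> \<in> {0..1}" for \<xi> using sobD(1)[OF s[OF that]] .
  note bdd = Gamma1_bdd_above[OF \<gamma>]
  have le: "Jfun g lam (\<gamma> \<xi>) < exp lam / 2 * m" if "\<xi> \<in> {0..1}" for \<xi>
  proof -
    have "Jfun g lam (\<gamma> \<xi>) \<le> Sup ((\<lambda>\<xi>. Jfun g lam (\<gamma> \<xi>)) ` {0..1})"
      using that by (intro cSup_upper bdd) auto
    also have "\<dots> < exp lam / 2 * m" using sup by (simp add: field_simps)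
    finally show ?thesis .
  qed
  have 01: "(0::real) \<in> {0..1}" "(1::real) \<in> {0..1}" by auto
  show thesis
  proof (cases "mass (v 1) \<le> m")
    case True
    have "Jfun g lam (\<gamma> 1) < 0" using \<gamma> by (simp add: Gamma1_def)
    moreover have "0 \<le> exp lam / 2 * mass (v 1)" using mass_nonneg by simp
    ultimately have "energy (v 1) (w 1) < 0" using J[OF 01(2)] by linarith
    with s[OF 01(2)] True show thesis by (rule that)
  next
    case False
    have "mass (v 0) = 0"
    proof -
      have g0: "\<gamma> 0 = (\<lambda>x. 0)" using \<gamma> by (simp add: Gamma1_def)
      have "AE x in lborel. 0 = fchange (v 0 x)" using AE[OF 01(1)]
        by eventually_elim (metis g0 fchange_0)
      from L2_cong_AE(2)[OF L2_zero L2_measurable[OF L2_fchange[OF Lv[OF 01(1)]]] this]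
      show ?thesis by (simp add: mass_def n2_def)
    qed
    then have "sqrt (mass (v 0)) \<le> sqrt m" "sqrt m \<le> sqrt (mass (v 1))" using m False by auto
    from IVT'[OF this _ cm] obtain \<xi> where \<xi>: "0 \<le> \<xi>" "\<xi> \<le> 1" "sqrt (mass (v \<xi>)) = sqrt m" by auto
    then have mm: "mass (v \<xi>) = m" by simp
    have \<xi>01: "\<xi> \<in> {0..1}" using \<xi> by simp
    have "energy (v \<xi>) (w \<xi>) < 0" using le[OF \<xi>01] J[OF \<xi>01] mm by simp
    with s[OF \<xi>01] mm show thesis by (intro that) auto
  qed
qed

text \<open>Admissibility restricts J only at the end of the path, so the straight segment to a
  radial function with negative J will do.\<close>

lemma ray_in_Gamma1:
  fixes v :: "real^'n \<Rightarrow> real"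
  assumes s: "sob v w" and rad: "radial v" and neg: "energy v w + exp lam / 2 * mass v < 0"
  shows "(\<lambda>\<xi> x. \<xi> * v x) \<in> Gamma1 g lam"
proof -
  have s\<xi>: "sob (\<lambda>x. \<xi> * v x) (\<lambda>x. \<xi> *\<^sub>R w x)" for \<xi> by (rule sob_cmult[OF s])
  have H: "(\<lambda>x. \<xi> * v x) \<in> H1r" for \<xi>
  proof -
    have "(\<lambda>x. \<xi> * v x) \<in> H1" by (rule sob_weak_grad(2)[OF s\<xi>[of \<xi>], of _ "\<lambda>x. \<xi> *\<^sub>R w x"]) simp_all
    moreover have "radial (\<lambda>x. \<xi> * v x)" using rad by (auto simp: radial_def)
    ultimately show ?thesis by (simp add: H1r_def)
  qed
  define c where "c = sqrt (n2 v + n2 w)"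
  have dist: "H1_norm (\<lambda>x. \<eta> * v x - \<xi> * v x) = \<bar>\<eta> - \<xi>\<bar> * c" for \<eta> \<xi>
  proof -
    have "H1_norm (\<lambda>x. \<eta> * v x - \<xi> * v x) = sqrt (n2 (\<lambda>x. (\<eta> - \<xi>) *\<^sub>R v x) + n2 (\<lambda>x. (\<eta> - \<xi>) *\<^sub>R w x))"
      using H1_norm_diff[OF s\<xi>[of \<eta>] _ s\<xi>[of \<xi>], of "\<lambda>x. \<eta> * v x" "\<lambda>x. \<xi> * v x"]
      by (simp add: left_diff_distrib scaleR_left_diff_distrib)
    also have "\<dots> = sqrt ((\<eta> - \<xi>)\<^sup>2 * (n2 v + n2 w))" by (simp only: n2_scaleR distrib_left)
    finally show ?thesis by (simp add: real_sqrt_mult c_def)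
  qed
  have "\<exists>\<delta>>0. \<forall>\<eta>\<in>{0..1}. \<bar>\<eta> - \<xi>\<bar> < \<delta> \<longrightarrow> H1_norm (\<lambda>x. \<eta> * v x - \<xi> * v x) < \<epsilon>" if e: "0 < \<epsilon>" for \<xi> \<epsilon>
  proof (intro exI conjI ballI impI)
    have c: "0 \<le> c" by (simp add: c_def)
    show "0 < \<epsilon> / (c + 1)" using e c by simp
    fix \<eta> assume "\<bar>\<eta> - \<xi>\<bar> < \<epsilon> / (c + 1)"
    then have "\<bar>\<eta> - \<xi>\<bar> * (c + 1) < \<epsilon>" using c by (simp add: pos_less_divide_eq)
    moreover have "\<bar>\<eta> - \<xi>\<bar> * c \<le> \<bar>\<eta> - \<xi>\<bar> * (c + 1)" by (intro mult_left_mono) auto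
    ultimately show "H1_norm (\<lambda>x. \<eta> * v x - \<xi> * v x) < \<epsilon>" unfolding dist by linarith
  qed
  moreover have "Jfun g lam (\<lambda>x. 1 * v x) < 0" using neg Jfun_sob[OF s, of "\<lambda>x. 1 * v x" lam] by simp
  ultimately show ?thesis using H by (simp add: Gamma1_def)
qed

text \<open>The height \<open>Phi s\<close> makes the original variable equal to s on the unit ball.
  Sharpening the plateau, the integral of \<open>d\<close> tends to its positive contribution from
  the ball, and a wide dilation then makes the gradient term negligible. Nonemptiness matters
  because the infimum over an empty set of reals is arbitrary.\<close>

lemma Gamma1_nonempty:
  assumes s: "s \<noteq> 0" "exp lam / 2 < Gp g s / s\<^sup>2"
  shows "(Gamma1 g lam :: (real \<Rightarrow> real^'n \<Rightarrow> real) set) \<noteq> {}"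
proof -
  define d where "d t = Gp g (fchange t) - exp lam / 2 * (fchange t)\<^sup>2" for t
  have cd: "continuous_on UNIV d"
    unfolding d_def by (intro continuous_intros continuous_on_compose2[OF G_continuous[of UNIV]] fchange_continuous) auto
  then have [measurable]: "d \<in> borel_measurable borel" by (rule borel_measurable_continuous_onI)
  have d0: "d 0 = 0" by (simp add: d_def)
  define V where "V n x = Phi s * plateau (real (Suc n)) x" for n and x :: "real^'n"
  define W where "W n x = Phi s *\<^sub>R dplateau (real (Suc n)) x" for n and x :: "real^'n"
  have sV: "sob (V n) (W n)" for n
    unfolding V_def W_def by (intro sob_cmult sob_plateau) simp
  have [measurable]: "V n \<in> borel_measurable borel" for n using sobD(1)[OF sV] by (simp add: L2_def)
  have dPhi: "0 < d (Phi s)"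
    using s by (simp add: d_def fchange_Phi field_simps)
  obtain C where C: "0 \<le> C" "\<And>t. \<bar>t\<bar> \<le> \<bar>Phi s\<bar> \<Longrightarrow> \<bar>d t\<bar> \<le> C"
  proof -
    have "compact (d ` {- \<bar>Phi s\<bar>..\<bar>Phi s\<bar>})" by (intro compact_continuous_image continuous_on_subset[OF cd]) auto
    then obtain B where B: "\<And>y. y \<in> d ` {- \<bar>Phi s\<bar>..\<bar>Phi s\<bar>} \<Longrightarrow> norm y \<le> B"
      using compact_imp_bounded bounded_iff by metis
    have "\<bar>d t\<bar> \<le> \<bar>B\<bar>" if "\<bar>t\<bar> \<le> \<bar>Phi s\<bar>" for t using B[of "d t"] that by (force simp: abs_le_iff)
    then show thesis by (intro that[of "\<bar>B\<bar>"]) auto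
  qed
  have Vle: "\<bar>V n x\<bar> \<le> \<bar>Phi s\<bar>" for n x
    using mult_left_mono[of "plateau (real (Suc n)) x" 1 "\<bar>Phi s\<bar>"] plateau_bounds[of "real (Suc n)" x] by (simp add: V_def abs_mult)
  have Im: "(\<lambda>x::real^'n. d (Phi s) * indicator (cball 0 1) x) \<in> borel_measurable borel"
    by (intro borel_measurable_times borel_measurable_const borel_measurable_indicator borel_closed closed_cball)
  let ?I = "LINT x|(lborel :: (real^'n) measure). d (Phi s) * indicator (cball 0 1) x"
  have "(\<lambda>n. LINT x|lborel. d (V n x)) \<longlonglongrightarrow> ?I"
  proof (rule integral_dominated_convergence[where w="\<lambda>x. C * indicator (cball 0 2) x"])
    show "integrable lborel (\<lambda>x::real^'n. C * indicator (cball 0 2) x)"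
      by (intro integrable_mult_right integrable_real_indicator emeasure_lborel_cball_finite) simp
    show "AE x in lborel. (\<lambda>n. d (V n x)) \<longlonglongrightarrow> d (Phi s) * indicator (cball 0 1) x"
    proof (rule AE_I2, rule tendsto_eventually)
      fix x :: "real^'n"
      show "\<forall>\<^sub>F n in sequentially. d (V n x) = d (Phi s) * indicator (cball 0 1) x"
      proof (cases "norm x \<le> 1")
        case True
        then show ?thesis by (simp add: V_def plateau_inside)
      next
        case False
        then have "0 < (norm x)\<^sup>2 - 1" by (simp add: one_less_power)
        then obtain J where J: "inverse (real (Suc J)) < (norm x)\<^sup>2 - 1" using reals_Archimedean by blast
        show ?thesis
        proof (rule eventually_sequentiallyI[of J])
          fix n assume "J \<le> n"
          then have "1 / real (Suc n) \<le> inverse (real (Suc J))" by (simp add: inverse_eq_divide frac_le)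
          then have "1 + 1 / real (Suc n) \<le> (norm x)\<^sup>2" using J by linarith
          then have "V n x = 0" unfolding V_def using plateau_outside[of "real (Suc n)" x] by simp
          then show "d (V n x) = d (Phi s) * indicator (cball 0 1) x" using False d0 by simp
        qed
      qed
    qed
    show "AE x in lborel. norm (d (V n x)) \<le> C * indicator (cball 0 2) x" for n
    proof (rule AE_I2)
      fix x
      show "norm (d (V n x)) \<le> C * indicator (cball 0 2) x"
      proof (cases "norm x \<le> 2")
        case True
        then show ?thesis using C(2)[OF Vle] by simp
      next
        case False
        then have "2\<^sup>2 \<le> (norm x)\<^sup>2" by (intro power_mono) auto
        then have "4 \<le> (norm x)\<^sup>2" by simp
        moreover have "1 / real (Suc n) \<le> 1" by simp
        ultimately have "1 + 1 / real (Suc n) \<le> (norm x)\<^sup>2" by linarith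
        then have "V n x = 0" unfolding V_def using plateau_outside[of "real (Suc n)" x] by simp
        then show ?thesis using False d0 C by simp
      qed
    qed
  qed (use Im in auto)
  moreover have "0 < ?I"
  proof -
    have "0 < measure lborel (cball (0::real^'n) 1)"
      using content_cball_pos[of 1 "0::real^'n"] by (simp add: measure_completion)
    then show ?thesis using dPhi by simp
  qed
  ultimately have "\<forall>\<^sub>F n in sequentially. 0 < (LINT x|lborel. d (V n x))" by (rule order_tendstoD)
  then obtain n where n: "0 < (LINT x|lborel. d (V n x))" by (meson eventually_sequentially le_refl)
  have dn: "(LINT x|lborel. d (V n x)) = Gint (V n) - exp lam / 2 * mass (V n)"
    using G_integrable[OF sV[of n]] L2_integrable[OF L2_fchange[OF sobD(1)[OF sV[of n]]]]
    by (simp add: d_def Gint_def mass_def n2_def)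
  define D where "D = Gint (V n) - exp lam / 2 * mass (V n)"
  have D: "0 < D" using n dn by (simp add: D_def)
  \<comment> \<open>Chosen so that \<open>D * r\<^sup>2\<close> exceeds \<open>n2 (W n)\<close> by
    1.\<close>
  define r where "r = sqrt ((n2 (W n) + 1) / D)"
  have r: "0 < r" using D by (simp add: r_def add_nonneg_pos)
  have r2: "n2 (W n) / (2 * r\<^sup>2) < D"
  proof -
    have "r\<^sup>2 = (n2 (W n) + 1) / D" using D by (simp add: r_def add_nonneg_nonneg)
    then have "D * r\<^sup>2 = n2 (W n) + 1" using D by simp
    then have "n2 (W n) < D * (2 * r\<^sup>2)" using n2_nonneg[of "W n"] by linarith
    then show ?thesis using r by (simp add: pos_divide_less_eq)
  qed
  let ?v = "\<lambda>x. V n (x /\<^sub>R r)" and ?w = "\<lambda>x. W n (x /\<^sub>R r) /\<^sub>R r"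
  have "energy ?v ?w + exp lam / 2 * mass ?v = r ^ CARD('n) * (n2 (W n) / (2 * r\<^sup>2) - D)"
    unfolding dilate_scaling(1,2)[OF sV r] D_def by (simp add: algebra_simps)
  also have "\<dots> < 0" using r r2 by (intro mult_pos_neg) auto
  finally have "energy ?v ?w + exp lam / 2 * mass ?v < 0" .
  moreover have "radial ?v"
    unfolding radial_def V_def plateau_def by (rule exI[of _ "\<lambda>t. Phi s * (1 - step (real (Suc n) * ((t / r)\<^sup>2 - 1)))"])
      (use r in \<open>simp add: divide_inverse mult.commute\<close>)
  ultimately show ?thesis using ray_in_Gamma1[OF sob_dilate[OF sV r]] by blast
qed

text \<open>Condition (g4) makes the supremum positive, so in the finite case the logarithm can be
  undone by \<open>exp\<close>. Being below the threshold then yields the s from which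
  \<open>Gamma1_nonempty\<close> builds a path.\<close>

lemma below_lambda0:
  assumes "s0 \<noteq> 0" "0 < Gp g s0"
  shows "\<exists>lam. ereal lam < lambda0 g"
    "ereal lam < lambda0 g \<Longrightarrow> \<exists>s. s \<noteq> 0 \<and> exp lam / 2 < Gp g s / s\<^sup>2"
proof -
  let ?S = "SUP s\<in>-{0}. ereal (Gp g s / s\<^sup>2)"
  have "ereal (Gp g s0 / s0\<^sup>2) \<le> ?S" using assms by (intro SUP_upper) auto
  moreover have "0 < Gp g s0 / s0\<^sup>2" using assms by simp
  ultimately have S: "0 < ?S" by (metis ereal_less(2) less_le_trans)
  show "\<exists>lam. ereal lam < lambda0 g"
  proof (cases "?S = \<infinity>")
    case True
    then show ?thesis by (auto simp: lambda0_def)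
  next
    case False
    then show ?thesis by (auto simp: lambda0_def Let_def intro: exI[of _ "ln (2 * real_of_ereal ?S) - 1"])
  qed
  assume lt: "ereal lam < lambda0 g"
  have "ereal (exp lam / 2) < ?S"
  proof (cases "?S")
    case (real r)
    then have "0 < r" using S by simp
    have "lam < ln (2 * r)" using lt real by (simp add: lambda0_def)
    then have "exp lam < 2 * r" using \<open>0 < r\<close> by (metis exp_less_mono exp_ln mult_pos_pos zero_less_numeral)
    then show ?thesis using real by simp
  qed (use S in auto)
  then show "\<exists>s. s \<noteq> 0 \<and> exp lam / 2 < Gp g s / s\<^sup>2" by (auto simp: less_SUP_iff)
qed

text \<open>Unwinds the nested infima: first a parameter \<open>lam\<close>, then a path with small
  maximum, to which \<open>path_negative_energy\<close> applies. Each step takes an element below an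
  infimum and so relies on nonemptiness.\<close>

lemma negative_energy_above_m1:
  assumes s0: "s0 \<noteq> 0" "0 < Gp g s0" and m: "0 < m" "m1 g TYPE('n) < m"
  obtains v :: "real^'n \<Rightarrow> real" and w where "sob v w" "mass v \<le> m" "energy v w < 0"
proof -
  let ?A = "{a1 g TYPE('n) lam / exp lam | lam. ereal lam < lambda0 g}"
  have "?A \<noteq> {}" using below_lambda0(1)[OF s0] by blast
  moreover have "Inf ?A < m / 2" using m(2) by (simp add: m1_def)
  ultimately obtain a where "a \<in> ?A" "a < m / 2" by (meson cInf_lessD)
  then obtain lam where lam: "ereal lam < lambda0 g" "a1 g TYPE('n) lam / exp lam < m / 2" by blast
  obtain s where s: "s \<noteq> 0" "exp lam / 2 < Gp g s / s\<^sup>2" using below_lambda0(2)[OF s0 lam(1)] by blast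
  let ?G = "Gamma1 g lam :: (real \<Rightarrow> real^'n \<Rightarrow> real) set"
  let ?F = "\<lambda>\<gamma> :: real \<Rightarrow> real^'n \<Rightarrow> real. Sup ((\<lambda>\<xi>. Jfun g lam (\<gamma> \<xi>)) ` {0..1})"
  have "?F ` ?G \<noteq> {}" using Gamma1_nonempty[OF s] by simp
  moreover have "Inf (?F ` ?G) < m / 2 * exp lam" using lam(2) by (simp add: a1_def pos_divide_less_eq)
  ultimately obtain y where "y \<in> ?F ` ?G" and y: "y < m / 2 * exp lam" by (meson cInf_lessD)
  then obtain \<gamma> where "y = ?F \<gamma>" and \<gamma>1: "\<gamma> \<in> ?G" by (rule_tac imageE)
  with y have \<gamma>: "\<gamma> \<in> ?G" "?F \<gamma> < m / 2 * exp lam" by simp_all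
  then have "2 * (?F \<gamma> / exp lam) < m" by (simp add: field_simps)
  from path_negative_energy[OF m(1) \<gamma>(1) this] show thesis using that by blast
qed

lemma sob_0: "sob (\<lambda>x. 0) (\<lambda>x. 0 :: real^'n)"
  using sob_cmult[OF sob_plateau[of 1], of 0] by simp

text \<open>Every path starts at 0, where J is 0, so its supremum is nonnegative. In the first claim
  this turns m > m1 into m > 0.\<close>

lemma m1_nonneg:
  assumes s0: "s0 \<noteq> 0" "0 < Gp g s0"
  shows "0 \<le> m1 g TYPE('n)"
proof -
  have a1: "0 \<le> a1 g TYPE('n) lam" if lam: "ereal lam < lambda0 g" for lam
    unfolding a1_def
  proof (rule cInf_greatest)
    obtain s where s: "s \<noteq> 0" "exp lam / 2 < Gp g s / s\<^sup>2" using below_lambda0(2)[OF s0 lam] by blast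
    show "(\<lambda>\<gamma>. Sup ((\<lambda>\<xi>. Jfun g lam (\<gamma> \<xi>)) ` {0..1})) ` (Gamma1 g lam :: (real \<Rightarrow> real^'n \<Rightarrow> real) set) \<noteq> {}"
      using Gamma1_nonempty[OF s] by simp
    fix y assume "y \<in> (\<lambda>\<gamma>. Sup ((\<lambda>\<xi>. Jfun g lam (\<gamma> \<xi>)) ` {0..1})) ` (Gamma1 g lam :: (real \<Rightarrow> real^'n \<Rightarrow> real) set)"
    then obtain \<gamma> :: "real \<Rightarrow> real^'n \<Rightarrow> real" where y: "y = Sup ((\<lambda>\<xi>. Jfun g lam (\<gamma> \<xi>)) ` {0..1})"
      and \<gamma>: "\<gamma> \<in> Gamma1 g lam" by (rule imageE)
    have "Jfun g lam (\<lambda>x::real^'n. 0) = 0"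
      using Jfun_sob[OF sob_0, of "\<lambda>x. 0" lam] by (simp add: energy_def Gint_def mass_def n2_def)
    moreover have "\<gamma> 0 = (\<lambda>x. 0)" using \<gamma> by (simp add: Gamma1_def)
    ultimately have "0 \<in> (\<lambda>\<xi>. Jfun g lam (\<gamma> \<xi>)) ` {0..1}" by (auto intro: image_eqI[of _ _ 0])
    then show "0 \<le> y" unfolding y by (rule cSup_upper[OF _ Gamma1_bdd_above[OF \<gamma>]])
  qed
  have "0 \<le> Inf {a1 g TYPE('n) lam / exp lam | lam. ereal lam < lambda0 g}"
    by (rule cInf_greatest) (use below_lambda0(1)[OF s0] a1 in auto)
  then show ?thesis by (simp add: m1_def)
qed


text \<open>The scaling \<open>a V(\<cdot>/t)\<close> with \<open>a \<rightarrow> 0\<close> and \<open>a\<^sup>2 t\<^sup>N\<close> fixed makes the gradient term of order \<open>t\<^sup>-\<^sup>2 \<sim> a\<^sup>4\<^sup>/\<^sup>N\<close>,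
  which a potential growing faster than \<open>s\<^sup>2\<^sup>+\<^sup>4\<^sup>/\<^sup>N\<close> at the origin beats.\<close>

lemma negative_energy_superlinear:
  assumes lim: "Liminf (at 0) (\<lambda>s. ereal (g s / (\<bar>s\<bar> powr (2 + 4 / real CARD('n) - 2) * s))) = \<infinity>" and m: "0 < m"
  obtains v :: "real^'n \<Rightarrow> real" and w where "sob v w" "mass v \<le> m" "energy v w < 0"
proof -
  define \<alpha> where "\<alpha> = 4 / real CARD('n)"
  let ?V = "cutoff 1 :: real^'n \<Rightarrow> real" and ?W = "dcutoff 1 :: real^'n \<Rightarrow> real^'n"
  have sV: "sob ?V ?W"
    by (rule sob_C1_support[of _ _ 2]) (simp_all add: cutoff_deriv dcutoff_continuous cutoff_outside)
  define \<beta> where "\<beta> = measure lborel (cball (0::real^'n) 1)"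
  have \<beta>: "0 < \<beta>" using content_cball_pos[of 1 "0::real^'n"] by (simp add: \<beta>_def measure_completion)
  \<comment> \<open>An upper bound for the squared norm of the profile that is visibly positive,
    since it is divided by.\<close>
  define c where "c = n2 ?V + 1"
  have c: "0 < c" unfolding c_def using n2_nonneg[of ?V] by linarith
  define D where "D = (m / c) powr (2 / real CARD('n))"
  have D: "0 < D" using m c by (simp add: D_def)
  \<comment> \<open>Solved from the final comparison: 8 * \<open>4 powr \<alpha>\<close> collects
    the factors (1/4)^\<alpha> and (1/4)^2 from the bound on G(a/2) and the 2 from the gradient
    term. The + 1 makes the comparison strict.\<close>
  define K where "K = (8 * 4 powr \<alpha> * n2 ?W + 1) / (\<beta> * D)"
  have K: "K * \<beta> * D = 8 * 4 powr \<alpha> * n2 ?W + 1" using \<beta> D by (simp add: K_def)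
  have "0 < K" unfolding K_def using \<beta> D by (intro divide_pos_pos add_nonneg_pos mult_nonneg_nonneg) auto
  have "\<forall>\<^sub>F s in at 0. ereal K < ereal (g s / (\<bar>s\<bar> powr (2 + 4 / real CARD('n) - 2) * s))"
    by (rule less_LiminfD, subst lim, simp)
  then obtain \<delta> where d: "0 < \<delta>" and gd: "\<And>s. s \<noteq> 0 \<Longrightarrow> \<bar>s\<bar> < \<delta> \<Longrightarrow> K < g s / (\<bar>s\<bar> powr \<alpha> * s)"
    unfolding eventually_at by (auto simp: \<alpha>_def dist_real_def)
  \<comment> \<open>At most \<delta> for the lower bound on g below a, and at most 1 for
    \<open>fchange_half_le\<close>.\<close>
  define a where "a = min 1 \<delta>"
  have a: "0 < a" "a \<le> 1" "a \<le> \<delta>" using d by (auto simp: a_def)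
  \<comment> \<open>The mean value theorem between a/4 and a/2 turns the lower bound on g into one
    on G at a/2; the value G(a/4) is simply nonnegative.\<close>
  have G: "K * (a / 4) powr \<alpha> * (a / 4)\<^sup>2 \<le> Gp g (a / 2)"
  proof -
    obtain z where z: "a / 4 < z" "z < a / 2" and e: "Gp g (a / 2) - Gp g (a / 4) = (a / 2 - a / 4) * g z"
      using MVT2[of "a / 4" "a / 2" "Gp g" g] G_deriv a by auto
    have z0: "0 < z" using z(1) a(1) by linarith
    have "K < g z / (\<bar>z\<bar> powr \<alpha> * z)" using z a z0 by (intro gd) auto
    then have "K * (z powr \<alpha> * z) < g z" using z0 by (simp add: pos_less_divide_eq)
    moreover have "K * ((a / 4) powr \<alpha> * (a / 4)) \<le> K * (z powr \<alpha> * z)"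
      using z z0 a \<open>0 < K\<close> by (intro mult_left_mono mult_mono powr_mono2) (auto simp: \<alpha>_def)
    ultimately have "(a / 4) * (K * ((a / 4) powr \<alpha> * (a / 4))) \<le> (a / 4) * g z" using a by (intro mult_left_mono) auto
    also have "\<dots> \<le> Gp g (a / 2)" using e G_nonneg[of "a / 4"] by simp
    finally show ?thesis by (simp add: power2_eq_square mult_ac)
  qed
  note saV = sob_cmult[OF sV, of a]
  let ?v = "\<lambda>x. a * ?V x" and ?w = "\<lambda>x. a *\<^sub>R ?W x"
  \<comment> \<open>On the unit ball the profile equals a, and f(a) is at least a/2 because a <= 1;
    elsewhere G is nonnegative.\<close>
  have Gi: "\<beta> * Gp g (a / 2) \<le> Gint ?v"
  proof -
    have "(LINT x|lborel. Gp g (a / 2) * indicator (cball (0::real^'n) 1) x) \<le> Gint ?v"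
      unfolding Gint_def
    proof (rule integral_mono[OF _ G_integrable[OF saV]])
      show "integrable lborel (\<lambda>x. Gp g (a / 2) * indicator (cball (0::real^'n) 1) x)"
        by (intro integrable_mult_right integrable_real_indicator emeasure_lborel_cball_finite) simp
      fix x :: "real^'n"
      show "Gp g (a / 2) * indicator (cball 0 1) x \<le> Gp g (fchange (a * cutoff 1 x))"
      proof (cases "norm x \<le> 1")
        case True
        have "\<bar>a / 2\<bar> \<le> \<bar>fchange a\<bar>" using fchange_half_le[of a] a by simp
        then show ?thesis using True G_mono by (simp add: cutoff_inside)
      qed (simp add: G_nonneg)
    qed
    then show ?thesis by (simp add: \<beta>_def mult.commute)
  qed
  \<comment> \<open>Fixes a^2 t^N = m / c, which keeps the mass below m. With \<alpha> = 4/N the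
    product t^2 a^\<alpha> then equals D, which is independent of a; this is why K could be chosen
    before a.\<close>
  define t where "t = (m / (a\<^sup>2 * c)) powr (1 / real CARD('n))"
  have t: "0 < t" using m a c by (simp add: t_def)
  have tN: "t ^ CARD('n) = m / (a\<^sup>2 * c)"
    using m a c by (simp add: t_def powr_power)
  have t2: "t\<^sup>2 * a powr \<alpha> = D"
  proof -
    have "a\<^sup>2 powr (2 / real CARD('n)) = a powr \<alpha>"
      using a by (simp add: \<alpha>_def powr_powr flip: powr_numeral)
    moreover have "t\<^sup>2 = (m / c / a\<^sup>2) powr (2 / real CARD('n))"
      using m a c by (simp add: t_def powr_power field_simps)
    moreover have "\<dots> = D / a\<^sup>2 powr (2 / real CARD('n))" unfolding D_def by (rule powr_divide)
    ultimately show ?thesis using a by simp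
  qed
  have "n2 ?w / (2 * t\<^sup>2) < \<beta> * Gp g (a / 2)"
  proof -
    have "8 * 4 powr \<alpha> * n2 ?W < K * \<beta> * (t\<^sup>2 * a powr \<alpha>)" unfolding t2 K by simp
    then have "a\<^sup>2 * (8 * 4 powr \<alpha> * n2 ?W) < a\<^sup>2 * (K * \<beta> * (t\<^sup>2 * a powr \<alpha>))" using a by (intro mult_strict_left_mono) auto
    then have "n2 ?w < \<beta> * (K * (a / 4) powr \<alpha> * (a / 4)\<^sup>2) * (2 * t\<^sup>2)"
      unfolding n2_scaleR powr_divide
      by (simp add: power_divide field_simps)
    also have "\<dots> \<le> \<beta> * Gp g (a / 2) * (2 * t\<^sup>2)" using G \<beta> by (intro mult_right_mono mult_left_mono) auto
    finally show ?thesis using t by (simp add: pos_divide_less_eq)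
  qed
  then have neg: "n2 ?w / (2 * t\<^sup>2) - Gint ?v < 0" using Gi by linarith
  show thesis
  proof (rule that[OF sob_dilate[OF saV t]])
    have "mass ?v \<le> a\<^sup>2 * n2 ?V" using mass_le_n2[OF sobD(1)[OF saV]] n2_scaleR[of a ?V] by simp
    also have "\<dots> \<le> a\<^sup>2 * c" unfolding c_def by (intro mult_left_mono) auto
    finally have "t ^ CARD('n) * mass ?v \<le> t ^ CARD('n) * (a\<^sup>2 * c)" using t by (intro mult_left_mono) auto
    also have "\<dots> = m" unfolding tN using a c by simp
    finally show "mass (\<lambda>x. ?v (x /\<^sub>R t)) \<le> m" unfolding dilate_scaling(1)[OF saV t] .
    show "energy (\<lambda>x. ?v (x /\<^sub>R t)) (\<lambda>x. ?w (x /\<^sub>R t) /\<^sub>R t) < 0"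
      unfolding dilate_scaling(2)[OF saV t] using t neg by (intro mult_pos_neg) auto
  qed
qed

end

theorem theorem1p6:
  fixes g :: "real \<Rightarrow> real"
  assumes N2: "CARD('n::finite) \<ge> 2"
    and g1: "continuous_on UNIV g"
    and g2: "((\<lambda>s. g s / s) \<longlongrightarrow> 0) (at 0)"
    and g3: "((\<lambda>s. \<bar>g s\<bar> / \<bar>s\<bar> powr (4 + 4 / real CARD('n) - 1)) \<longlongrightarrow> 0) at_infinity"
    and g4: "\<exists>s0>0. Gp g s0 > 0"
    and g5: "\<forall>s. g (- s) = - g s"
    and g7: "\<forall>s. g s * s \<ge> 0"
  shows "(\<forall>m > m1 g TYPE('n). \<exists>u :: (real^'n) \<Rightarrow> real.
            u \<in> Sm m \<and> Efun g u = e_level g TYPE('n) m \<and> is_minimizer g m u)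
       \<and> (Liminf (at 0) (\<lambda>s. ereal (g s / (\<bar>s\<bar> powr (2 + 4 / real CARD('n) - 2) * s))) = \<infinity> \<longrightarrow>
          (\<forall>m > 0. \<exists>u :: (real^'n) \<Rightarrow> real.
            u \<in> Sm m \<and> Efun g u = e_level g TYPE('n) m \<and> is_minimizer g m u))"
proof -
  interpret quasilinear g "TYPE('n)" "4 + 4 / real CARD('n)"
    by unfold_locales (rule refl g1 g2 g3 g5[rule_format] g7[rule_format])+
  obtain s0 where s0: "s0 \<noteq> 0" "0 < Gp g s0" using g4 less_irrefl by metis
  show ?thesis
  proof (intro conjI allI impI)
    fix m assume m: "m1 g TYPE('n) < m"
    then have m0: "0 < m" using m1_nonneg[OF s0] by simp
    obtain v :: "real^'n \<Rightarrow> real" and w where "sob v w" "mass v \<le> m" "energy v w < 0"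
      by (rule negative_energy_above_m1[OF s0 m0 m])
    with m0 show "\<exists>u :: (real^'n) \<Rightarrow> real. u \<in> Sm m \<and> Efun g u = e_level g TYPE('n) m \<and> is_minimizer g m u"
      by (rule Sm_minimizer)
  next
    fix m :: real
    assume lim: "Liminf (at 0) (\<lambda>s. ereal (g s / (\<bar>s\<bar> powr (2 + 4 / real CARD('n) - 2) * s))) = \<infinity>" and m0: "0 < m"
    obtain v :: "real^'n \<Rightarrow> real" and w where "sob v w" "mass v \<le> m" "energy v w < 0"
      by (rule negative_energy_superlinear[OF lim m0])
    with m0 show "\<exists>u :: (real^'n) \<Rightarrow> real. u \<in> Sm m \<and> Efun g u = e_level g TYPE('n) m \<and> is_minimizer g m u"
      by (rule Sm_minimizer)
  qed
qed

end
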